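(* $$\mathbb E|\mathrm{bd}\,\mathcal Q_d|=\sum_{\text{configs of size }d}\frac{s}{2^{d/2-1}\Gamma(\frac d2)}\prod_{l:k_l>0}\Big[\sqrt{i^{(l)}_1}\,\Delta_l^{-1/2}c_l\Big]\cdot J_{(-\infty,\infty)},$$ $$\mathbb E|\mathrm{bd}\,\mathcal Q^0_d|=\sum_{\text{configs of size }d}\frac{s}{2^{d/2-1}\Gamma(\frac d2)}\prod_{l:k_l>0}\Big[\sqrt{i^{(l)}_1}\,\Delta_l^{-1/2}c_l\Big]\cdot J_{(0,\infty)}+\sum_{\text{configs of size }d-1}\frac{\sqrt{2\pi}}{2^{d/2-1}\Gamma(\frac d2)}\prod_{l=1}^m e_l,$$ where $e_l=(i^{(l)}_1\Delta_l)^{-1/2}c_l$ if $k_l>0$ and $e_l=\frac{(2n_l-1)!!}{(2n_l)!!}$ if $k_l=0$, and $s,\Delta_l,c_l,J$ are computed for the configuration being summed. Moreover each summand equals the corresponding quantity $\mathbb E[|\mathrm{conv}\,\mathbf S_d|\mathbb 1_{\{\mathrm{conv}\,\mathbf S_d\in\mathcal F(\cdot)\}}]$, resp. $\mathbb E[|\mathrm{conv}\,\mathbf S^0_d|\mathbb 1_{\{\mathrm{conv}\,\mathbf S^0_d\in\mathcal F(\mathcal Q^0_d)\}}]$.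
   Context: Setting. Fix integers $d\ge 2$, $m\ge1$, $n_1,\dots,n_m\ge1$. Let $X^{(l)}_i$ ($1\le l\le m$, $1\le i\le n_l$) be independent standard Gaussian random vectors in $\mathbb{R}^d$ and $S^{(l)}_i=X^{(l)}_1+\dots+X^{(l)}_i$. Let $\mathcal Q_d=\mathrm{conv}\{S^{(l)}_i:1\le l\le m,1\le i\le n_l\}$ and $\mathcal Q^0_d=\mathrm{conv}(\{0\}\cup\{S^{(l)}_i\})$. $\mathcal F(\cdot)$ denotes the set of facets of a polytope; $|\mathrm{bd}\,K|$ is the $(d-1)$-dimensional surface area of the boundary of $K$, and $|\mathrm{conv}\,\cdot|$ of $d$ points is $(d-1)$-dimensional volume. An index configuration of size $k$ consists of nonnegative integers $k_1,\dots,k_m$ with $k_l\le n_l$ and $\sum_l k_l=k$, together with, for each $l$ with $k_l>0$, indices $1\le i^{(l)}_1<\dots<i^{(l)}_{k_l}\le n_l$. For a configuration of size $d$, $\mathbf S_d$ is the $d$-tuple of points $S^{(l)}_{i^{(l)}_j}$; for size $d-1$, $\mathbf S^0_d$ is $0$ followed by the $d-1$ points $S^{(l)}_{i^{(l)}_j}$. Persistence probabilities: with $N_1,N_2,\dots$ i.i.d. standard Gaussian real variables, $p_n(r)=\mathbb P[\sum_{i=1}^kN_i\le r,\ k=1,\dots,n]$ and $q_n(r)=\mathbb P[\sum_{i=1}^kN_i\le r,\ k=1,\dots,n\mid \sum_{i=1}^nN_i=r]$ (so $q_1\equiv1$). Notation: for $l$ with $k_l>0$, $\Delta_l=(i^{(l)}_2-i^{(l)}_1)\cdots(i^{(l)}_{k_l}-i^{(l)}_{k_l-1})$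 (empty product $=1$), $c_l=\frac{(2(n_l-i^{(l)}_{k_l})-1)!!}{(2(n_l-i^{(l)}_{k_l}))!!}$ with $(-1)!!=0!!=1$; $s=\sum_{l:k_l>0}1/i^{(l)}_1$; $J_{(a,b)}=\int_a^b e^{-sr^2/2}\prod_{l:k_l=0}p_{n_l}(r)\prod_{l:k_l>0}q_{i^{(l)}_1}(r)\,dr$.
   Formalization: The claims on Q_d are stated for n_1+...+n_m >= d+1 and those on Q^0_d for n_1+...+n_m >= d; with one step fewer the polytope is flat and the formulas give twice its area, and with fewer still all sums are empty. *)

theory Defs
  imports "HOL-Probability.Probability"
begin

definition hausdorff_pre :: "real \<Rightarrow> real \<Rightarrow> 'a::metric_space set \<Rightarrow> ennreal" where
  "hausdorff_pre s \<delta> A =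
     (INF C \<in> {C :: nat \<Rightarrow> 'a set. A \<subseteq> (\<Union>i. C i) \<and> (\<forall>i. bounded (C i) \<and> diameter (C i) \<le> \<delta>)}.
        (\<Sum>i. ennreal (unit_ball_vol s * (diameter (C i) / 2) powr s)))"

definition hausdorff_measure :: "real \<Rightarrow> 'a::metric_space set \<Rightarrow> ennreal" where
  "hausdorff_measure s A = (SUP \<delta> \<in> {0<..}. hausdorff_pre s \<delta> A)"

fun dfact :: "nat \<Rightarrow> nat" where
  "dfact 0 = 1"
| "dfact (Suc 0) = 1"
| "dfact (Suc (Suc k)) = Suc (Suc k) * dfact k"

text \<open>cfac N = (2N-1)!!/(2N)!!, with the convention (-1)!! = 0!! = 1\<close>
definition cfac :: "nat \<Rightarrow> real" where
  "cfac N = (if N = 0 then 1 else real (dfact (2 * N - 1)) / real (dfact (2 * N)))"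

definition std_normal_measure :: "real measure" where
  "std_normal_measure = density lborel (\<lambda>x. ennreal (std_normal_density x))"

definition persist_p :: "nat \<Rightarrow> real \<Rightarrow> real" where
  "persist_p k r = measure (PiM {1..k} (\<lambda>_. std_normal_measure))
      {N \<in> space (PiM {1..k} (\<lambda>_. std_normal_measure)). \<forall>j\<in>{1..k}. (\<Sum>i=1..j. N i) \<le> r}"

text \<open>q_n(r): the same probability conditioned on N_1+...+N_n = r, defined as the
  ratio of the joint density of (N_1,..,N_(n-1), N_1+..+N_n) restricted to the event
  and the N(0,n) density of the sum, evaluated at r.\<close>
definition persist_q :: "nat \<Rightarrow> real \<Rightarrow> real" where
  "persist_q k r =
     enn2real (\<integral>\<^sup>+ x. indicator {x. \<forall>j\<in>{1..k-1}. (\<Sum>i=1..j. x i) \<le> r} x *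
          ennreal ((\<Prod>i=1..k-1. std_normal_density (x i)) *
                   std_normal_density (r - (\<Sum>i=1..k-1. x i)))
        \<partial>(PiM {1..k-1} (\<lambda>_. lborel)))
     / normal_density 0 (sqrt (real k)) r"

definition std_gauss :: "(real ^ 'd::finite) measure" where
  "std_gauss = density lborel
     (\<lambda>x. ennreal ((2 * pi) powr (- real CARD('d) / 2) * exp (- (norm x)\<^sup>2 / 2)))"

definition walk_index :: "nat \<Rightarrow> (nat \<Rightarrow> nat) \<Rightarrow> (nat \<times> nat) set" where
  "walk_index m n = {(l, i). l \<in> {1..m} \<and> i \<in> {1..n l}}"

definition walk_space :: "nat \<Rightarrow> (nat \<Rightarrow> nat) \<Rightarrow> ((nat \<times> nat) \<Rightarrow> real ^ 'd::finite) measure" where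
  "walk_space m n = PiM (walk_index m n) (\<lambda>_. std_gauss)"

definition walk :: "((nat \<times> nat) \<Rightarrow> real ^ 'd::finite) \<Rightarrow> nat \<Rightarrow> nat \<Rightarrow> real ^ 'd" where
  "walk \<omega> l i = (\<Sum>j=1..i. \<omega> (l, j))"

definition Qpoly :: "nat \<Rightarrow> (nat \<Rightarrow> nat) \<Rightarrow> ((nat \<times> nat) \<Rightarrow> real ^ 'd::finite) \<Rightarrow> (real ^ 'd) set" where
  "Qpoly m n \<omega> = convex hull {walk \<omega> l i | l i. l \<in> {1..m} \<and> i \<in> {1..n l}}"

definition Qpoly0 :: "nat \<Rightarrow> (nat \<Rightarrow> nat) \<Rightarrow> ((nat \<times> nat) \<Rightarrow> real ^ 'd::finite) \<Rightarrow> (real ^ 'd) set" where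
  "Qpoly0 m n \<omega> = convex hull (insert 0 {walk \<omega> l i | l i. l \<in> {1..m} \<and> i \<in> {1..n l}})"

text \<open>A configuration of size k: for each l in 1..m a set A l of indices in 1..n_l
  (k_l = card (A l), the elements listed increasingly are the i^(l)_j), total size k.\<close>
definition configs :: "nat \<Rightarrow> (nat \<Rightarrow> nat) \<Rightarrow> nat \<Rightarrow> (nat \<Rightarrow> nat set) set" where
  "configs m n k = {A. (\<forall>l\<in>{1..m}. A l \<subseteq> {1..n l}) \<and> (\<forall>l. l \<notin> {1..m} \<longrightarrow> A l = {})
                        \<and> (\<Sum>l=1..m. card (A l)) = k}"

definition config_points :: "nat \<Rightarrow> ((nat \<times> nat) \<Rightarrow> real ^ 'd::finite) \<Rightarrow> (nat \<Rightarrow> nat set) \<Rightarrow> (real ^ 'd) set" where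
  "config_points m \<omega> A = {walk \<omega> l i | l i. l \<in> {1..m} \<and> i \<in> A l}"

definition active :: "nat \<Rightarrow> (nat \<Rightarrow> nat set) \<Rightarrow> nat set" where
  "active m A = {l \<in> {1..m}. A l \<noteq> {}}"

definition gapprod :: "nat set \<Rightarrow> real" where
  "gapprod B = (let xs = sorted_list_of_set B in
                 \<Prod>j\<in>{..<length xs - 1}. real (xs ! Suc j - xs ! j))"

definition sfac :: "nat \<Rightarrow> (nat \<Rightarrow> nat set) \<Rightarrow> real" where
  "sfac m A = (\<Sum>l\<in>active m A. 1 / real (Min (A l)))"

definition Jint_fun :: "nat \<Rightarrow> (nat \<Rightarrow> nat) \<Rightarrow> (nat \<Rightarrow> nat set) \<Rightarrow> real \<Rightarrow> real" where
  "Jint_fun m n A r = exp (- sfac m A * r\<^sup>2 / 2)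
      * (\<Prod>l\<in>{1..m} - active m A. persist_p (n l) r)
      * (\<Prod>l\<in>active m A. persist_q (Min (A l)) r)"

definition gcoef :: "nat \<Rightarrow> real" where
  "gcoef d = 1 / (2 powr (real d / 2 - 1) * Gamma (real d / 2))"

definition summand_facet :: "nat \<Rightarrow> nat \<Rightarrow> (nat \<Rightarrow> nat) \<Rightarrow> real set \<Rightarrow> (nat \<Rightarrow> nat set) \<Rightarrow> real" where
  "summand_facet d m n R A =
     sfac m A * gcoef d
     * (\<Prod>l\<in>active m A. sqrt (real (Min (A l))) / sqrt (gapprod (A l)) * cfac (n l - Max (A l)))
     * (LINT r:R|lborel. Jint_fun m n A r)"

definition elfac :: "(nat \<Rightarrow> nat) \<Rightarrow> (nat \<Rightarrow> nat set) \<Rightarrow> nat \<Rightarrow> real" where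
  "elfac n A l = (if A l \<noteq> {} then cfac (n l - Max (A l)) / sqrt (real (Min (A l)) * gapprod (A l))
                  else cfac (n l))"

text \<open>Summand for configurations of size d-1 (facets through 0).\<close>
definition summand_zero :: "nat \<Rightarrow> nat \<Rightarrow> (nat \<Rightarrow> nat) \<Rightarrow> (nat \<Rightarrow> nat set) \<Rightarrow> real" where
  "summand_zero d m n A = sqrt (2 * pi) * gcoef d * (\<Prod>l=1..m. elfac n A l)"

end

theory Submission
  imports Defs
begin

text \<open>A configuration spans a facet iff all points lie on one side of the hyperplane through its points,
  with normal vector c (a generalised cross product) and offset \<open>\<tau>\<close>; the facet has area
  \<open>norm c / (d - 1)!\<close>. A Householder reflection of the increments between consecutive configuration
  indices turns each of their sums into \<open>sqrt gap\<close> times one Gaussian vector and leaves the remaining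
  vectors independent of it. Given the configuration points, all other points lie below the hyperplane
  exactly if independent one-dimensional walks and bridges stay below r or 0, where \<open>r = \<tau> / norm c\<close>.
  This gives the factors \<open>p\<close> and \<open>q\<close>; at level 0 they are \<open>(2N-1)!!/(2N)!!\<close> (Sparre Andersen) and
  \<open>1/n\<close> (cyclic shifts). A second reflection, now of the d configuration vectors, decouples c from r and
  reduces the remaining expectation to that of a Gaussian determinant. Hausdorff measure is compared with
  Lebesgue measure through the isodiametric inequality, proved by Steiner symmetrisation.\<close>

subsection \<open>Gaussian product measures\<close>

text \<open>A normal vector is determined only up to sign, so a configuration contributes two
  one-sided events, one with c and offset r, one with -c and -r. Their sum does not depend on the
  orientation, so the second reflection need not track signs, and the two halves make up the
  integral over the whole line. Taking the origin as a further point only adds the condition r > 0;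
  hence the set \<open>R\<close>, which is \<open>UNIV\<close> or \<open>{0<..}\<close>. A facet
  through 0 has r = 0 on both sides, hence a doubled persistence factor. The powers of the gaps
  arise as follows: each gap multiplies the normal by its square root, and a bridge at level 0
  contributes the inverse gap. Only the first bridge of a walk starts at the origin instead of on
  the hyperplane; it keeps its level r and its square root, and s comes from these bridges alone.
  The (d - 1)! of the simplex volume cancels against the mean length of a Gaussian cross product.
  Facets overlap in lower faces and the covering sums at a fixed scale are only subadditive, so the
  boundary area is bounded below through shrunken, separated copies of the facets.\<close>

lemma nn_integral_lborel_affine:
  fixes f :: "'b::euclidean_space \<Rightarrow> ennreal" and c :: real
  assumes [measurable]: "f \<in> borel_measurable borel" and c: "c \<noteq> 0"
  shows "(\<integral>\<^sup>+x. f (t + c *\<^sub>R x) \<partial>lborel) = ennreal (1 / \<bar>c\<bar> ^ DIM('b)) * (\<integral>\<^sup>+x. f x \<partial>lborel)"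
proof -
  have "(\<integral>\<^sup>+x. f x \<partial>lborel) = \<bar>c\<bar> ^ DIM('b) * (\<integral>\<^sup>+x. f (t + c *\<^sub>R x) \<partial>lborel)"
    by (subst lborel_affine[OF c, of t])
       (auto simp: nn_integral_density nn_integral_distr nn_integral_cmult)
  then show ?thesis
    using c by (simp add: mult.assoc[symmetric] flip: ennreal_mult'')
qed

lemma nn_integral_PiM_translate:
  fixes f :: "('i \<Rightarrow> 'b::euclidean_space) \<Rightarrow> ennreal"
  assumes "finite I" "f \<in> borel_measurable (PiM I (\<lambda>_. lborel))"
  shows "(\<integral>\<^sup>+x. f (\<lambda>i\<in>I. x i + p i) \<partial>PiM I (\<lambda>_. lborel)) = (\<integral>\<^sup>+x. f x \<partial>PiM I (\<lambda>_. lborel))"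
  using assms
proof (induction I arbitrary: f rule: finite_induct)
  case empty
  interpret product_sigma_finite "\<lambda>_::'i. lborel :: 'b measure" ..
  show ?case by (subst (1 2) nn_integral_empty) (auto simp: restrict_def)
next
  case (insert i I)
  interpret product_sigma_finite "\<lambda>_::'i. lborel :: 'b measure" ..
  note [measurable] = insert.prems
  have sw: "(\<lambda>j\<in>insert i I. (x(i := y)) j + p j) = (\<lambda>j\<in>I. x j + p j)(i := p i + 1 *\<^sub>R y)" for x y
    using insert.hyps by (auto simp: fun_eq_iff)
  have m1: "(\<lambda>y. f (z(i := y))) \<in> borel_measurable borel" if "z \<in> extensional I" for z
  proof -
    have "(\<lambda>y. z(i := y)) \<in> borel \<rightarrow>\<^sub>M PiM (insert i I) (\<lambda>_. lborel)"
      using that by (intro measurable_PiM_single') (auto simp: space_PiM extensional_def split: if_splits)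
    then show ?thesis by measurable
  qed
  have "(\<integral>\<^sup>+x. f (\<lambda>i\<in>insert i I. x i + p i) \<partial>PiM (insert i I) (\<lambda>_. lborel)) =
     (\<integral>\<^sup>+x. (\<integral>\<^sup>+y. f ((\<lambda>j\<in>I. x j + p j)(i := p i + 1 *\<^sub>R y)) \<partial>lborel) \<partial>PiM I (\<lambda>_. lborel))"
    unfolding sw[symmetric] by (rule product_nn_integral_insert) (use insert.hyps in auto)
  also have "\<dots> = (\<integral>\<^sup>+x. (\<integral>\<^sup>+y. f ((\<lambda>j\<in>I. x j + p j)(i := y)) \<partial>lborel) \<partial>PiM I (\<lambda>_. lborel))"
  proof (rule nn_integral_cong)
    fix x :: "'i \<Rightarrow> 'b"
    show "(\<integral>\<^sup>+y. f ((\<lambda>j\<in>I. x j + p j)(i := p i + 1 *\<^sub>R y)) \<partial>lborel)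
      = (\<integral>\<^sup>+y. f ((\<lambda>j\<in>I. x j + p j)(i := y)) \<partial>lborel)"
      using nn_integral_lborel_affine[OF m1[of "\<lambda>j\<in>I. x j + p j"], of 1 "p i"] by simp
  qed
  also have "\<dots> = (\<integral>\<^sup>+x. (\<integral>\<^sup>+y. f (x(i := y)) \<partial>lborel) \<partial>PiM I (\<lambda>_. lborel))"
    by (rule insert.IH) measurable
  also have "\<dots> = (\<integral>\<^sup>+x. f x \<partial>PiM (insert i I) (\<lambda>_. lborel))"
    by (subst product_nn_integral_insert) (use insert.hyps in auto)
  finally show ?case .
qed

text \<open>The substitution inserts the new variable s, the linear form, in place of one coordinate;
  then only translations and a one-coordinate dilation are needed.\<close>
lemma nn_integral_PiM_rank_one:
  fixes f :: "('i \<Rightarrow> 'b::euclidean_space) \<Rightarrow> ennreal" and a b :: "'i \<Rightarrow> real"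
  assumes fin: "finite I" and f[measurable]: "f \<in> borel_measurable (PiM I (\<lambda>_. lborel))"
    and nz: "1 + (\<Sum>i\<in>I. a i * b i) \<noteq> 0"
  shows "(\<integral>\<^sup>+x. f (\<lambda>i\<in>I. x i + a i *\<^sub>R (\<Sum>k\<in>I. b k *\<^sub>R x k)) \<partial>PiM I (\<lambda>_. lborel)) =
    ennreal (1 / \<bar>1 + (\<Sum>i\<in>I. a i * b i)\<bar> ^ DIM('b)) * (\<integral>\<^sup>+x. f x \<partial>PiM I (\<lambda>_. lborel))"
proof (cases "\<forall>k\<in>I. b k = 0")
  case True
  have "(\<lambda>i\<in>I. x i + a i *\<^sub>R (\<Sum>k\<in>I. b k *\<^sub>R x k)) = x" if "x \<in> space (PiM I (\<lambda>_. lborel))" for x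
    using that True by (auto simp: space_PiM fun_eq_iff PiE_def extensional_def)
  then have "(\<integral>\<^sup>+x. f (\<lambda>i\<in>I. x i + a i *\<^sub>R (\<Sum>k\<in>I. b k *\<^sub>R x k)) \<partial>PiM I (\<lambda>_. lborel))
      = (\<integral>\<^sup>+x. f x \<partial>PiM I (\<lambda>_. lborel))"
    by (intro nn_integral_cong arg_cong[where f=f])
  moreover have "1 + (\<Sum>i\<in>I. a i * b i) = 1" using True by simp
  ultimately show ?thesis by (simp only:) simp
next
  case False
  then obtain i0 where i0: "i0 \<in> I" "b i0 \<noteq> 0" by auto
  define J where "J = I - {i0}"
  have IJ: "I = insert i0 J" "i0 \<notin> J" "finite J" using i0 fin by (auto simp: J_def)
  interpret product_sigma_finite "\<lambda>_::'i. lborel :: 'b measure" ..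
  interpret J: sigma_finite_measure "PiM J (\<lambda>_. lborel :: 'b measure)"
    using IJ by (intro sigma_finite)
  interpret P: pair_sigma_finite "PiM J (\<lambda>_. lborel :: 'b measure)" "lborel :: 'b measure" ..
  define S where "S x = (\<Sum>k\<in>J. b k *\<^sub>R x k)" for x :: "'i \<Rightarrow> 'b"
  define \<gamma> where "\<gamma> = 1 + (\<Sum>i\<in>I. a i * b i)"
  define \<alpha> where "\<alpha> = (\<Sum>i\<in>J. a i * b i)"
  have \<gamma>: "\<gamma> = 1 + a i0 * b i0 + \<alpha>" "\<gamma> \<noteq> 0" using IJ nz by (auto simp: \<gamma>_def \<alpha>_def)
  let ?L = "PiM J (\<lambda>_. lborel :: 'b measure)"
  have f'[measurable]: "f \<in> borel_measurable (PiM (insert i0 J) (\<lambda>_. lborel))" using f IJ by simp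
  have S[measurable]: "S \<in> borel_measurable ?L" unfolding S_def by measurable
  have sc: "(\<lambda>y. z(i0 := g y)) \<in> N \<rightarrow>\<^sub>M PiM (insert i0 J) (\<lambda>_. lborel)"
    if "z \<in> extensional J" "g \<in> borel_measurable N" for z :: "'i \<Rightarrow> 'b" and g N
    using that by (intro measurable_PiM_single')
      (auto simp: space_PiM extensional_def split: if_splits)
  \<comment> \<open>\<open>G x s\<close> is the transformed point in the new variables:
    \<open>s\<close> is the linear form, and \<open>(s - S x) / b i0\<close> recovers the coordinate
    \<open>i0\<close> that it replaces.\<close>
  define G where "G x s = (\<lambda>i\<in>J. x i + a i *\<^sub>R s)(i0 := (1 / b i0) *\<^sub>R (s - S x) + a i0 *\<^sub>R s)" for x s
  have G[measurable]: "(\<lambda>(x, s). G x s) \<in> ?L \<Otimes>\<^sub>M borel \<rightarrow>\<^sub>M PiM (insert i0 J) (\<lambda>_. lborel)"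
    unfolding G_def case_prod_beta by measurable
  have 1: "(\<lambda>i\<in>I. (x(i0 := y)) i + a i *\<^sub>R (\<Sum>k\<in>I. b k *\<^sub>R (x(i0 := y)) k))
      = G x (S x + b i0 *\<^sub>R y)" for x y
  proof -
    have "(\<Sum>k\<in>I. b k *\<^sub>R (x(i0 := y)) k) = S x + b i0 *\<^sub>R y"
      using IJ by (auto simp: S_def intro!: sum.cong)
    then show ?thesis using IJ i0 by (auto simp: fun_eq_iff G_def)
  qed
  have G1: "(\<lambda>s. f (G x s)) \<in> borel_measurable borel" if "x \<in> space ?L" for x
    using that by measurable
  have "(\<integral>\<^sup>+x. f (\<lambda>i\<in>I. x i + a i *\<^sub>R (\<Sum>k\<in>I. b k *\<^sub>R x k)) \<partial>PiM I (\<lambda>_. lborel))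
    = (\<integral>\<^sup>+x. (\<integral>\<^sup>+y. f (G x (S x + b i0 *\<^sub>R y)) \<partial>lborel) \<partial>?L)"
    unfolding 1[symmetric] IJ(1)[symmetric]
    using product_nn_integral_insert[OF IJ(3,2), of "\<lambda>x. f (\<lambda>i\<in>I. x i + a i *\<^sub>R (\<Sum>k\<in>I. b k *\<^sub>R x k))"]
    unfolding IJ(1)[symmetric] by measurable
  also have "\<dots> = (\<integral>\<^sup>+x. ennreal (1 / \<bar>b i0\<bar> ^ DIM('b)) * (\<integral>\<^sup>+s. f (G x s) \<partial>lborel) \<partial>?L)"
    using i0 G1 by (intro nn_integral_cong, subst nn_integral_lborel_affine) auto
  also have "\<dots> = ennreal (1 / \<bar>b i0\<bar> ^ DIM('b)) * (\<integral>\<^sup>+x. (\<integral>\<^sup>+s. f (G x s) \<partial>lborel) \<partial>?L)"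
    by (intro nn_integral_cmult) measurable
  also have "(\<integral>\<^sup>+x. (\<integral>\<^sup>+s. f (G x s) \<partial>lborel) \<partial>?L) = (\<integral>\<^sup>+s. (\<integral>\<^sup>+x. f (G x s) \<partial>?L) \<partial>lborel)"
    by (rule P.Fubini'[symmetric]) measurable
  \<comment> \<open>For fixed \<open>s\<close> the shift by \<open>a i *\<^sub>R s\<close> is a
    translation of the coordinates in \<open>J\<close> and is undone. Then \<open>s\<close> enters
    coordinate \<open>i0\<close> with slope \<open>\<gamma> / b i0\<close>, so the second dilation
    gives back the factor \<open>b i0\<close> and leaves the determinant
    \<open>\<gamma>\<close>.\<close>
  also have "\<dots> = (\<integral>\<^sup>+s. (\<integral>\<^sup>+x. f (x(i0 := (- 1 / b i0) *\<^sub>R S x + (\<gamma> / b i0) *\<^sub>R s)) \<partial>?L) \<partial>lborel)"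
  proof (rule nn_integral_cong)
    fix s :: 'b
    have "G x s = (\<lambda>i\<in>J. x i + a i *\<^sub>R s)(i0 := (- 1 / b i0) *\<^sub>R S (\<lambda>i\<in>J. x i + a i *\<^sub>R s) + (\<gamma> / b i0) *\<^sub>R s)" for x
    proof -
      have "S (\<lambda>i\<in>J. x i + a i *\<^sub>R s) = S x + \<alpha> *\<^sub>R s"
        by (simp add: S_def \<alpha>_def algebra_simps sum.distrib scaleR_sum_left)
      then have "(- 1 / b i0) *\<^sub>R S (\<lambda>i\<in>J. x i + a i *\<^sub>R s) + (\<gamma> / b i0) *\<^sub>R s
        = (- 1 / b i0) *\<^sub>R S x + ((\<gamma> - \<alpha>) / b i0) *\<^sub>R s"
        by (simp add: algebra_simps diff_divide_distrib)
      also have "(\<gamma> - \<alpha>) / b i0 = 1 / b i0 + a i0" using i0 by (simp add: \<gamma> field_simps)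
      finally have E: "(- 1 / b i0) *\<^sub>R S (\<lambda>i\<in>J. x i + a i *\<^sub>R s) + (\<gamma> / b i0) *\<^sub>R s
        = (- 1 / b i0) *\<^sub>R S x + (1 / b i0 + a i0) *\<^sub>R s" .
      show ?thesis unfolding E G_def by (simp add: algebra_simps)
    qed
    then show "(\<integral>\<^sup>+x. f (G x s) \<partial>?L) = (\<integral>\<^sup>+x. f (x(i0 := (- 1 / b i0) *\<^sub>R S x + (\<gamma> / b i0) *\<^sub>R s)) \<partial>?L)"
      using IJ by (simp only:) (subst nn_integral_PiM_translate[symmetric, of J _ "\<lambda>i. a i *\<^sub>R s"], auto)
  qed
  also have "\<dots> = (\<integral>\<^sup>+x. (\<integral>\<^sup>+s. f (x(i0 := (- 1 / b i0) *\<^sub>R S x + (\<gamma> / b i0) *\<^sub>R s)) \<partial>lborel) \<partial>?L)"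
    by (rule P.Fubini') measurable
  also have "\<dots> = (\<integral>\<^sup>+x. ennreal (1 / \<bar>\<gamma> / b i0\<bar> ^ DIM('b)) * (\<integral>\<^sup>+s. f (x(i0 := s)) \<partial>lborel) \<partial>?L)"
    using i0 \<gamma>(2)
    by (intro nn_integral_cong, subst nn_integral_lborel_affine[where f="\<lambda>s. f (_(i0 := s))"])
       (auto intro!: measurable_compose[OF sc f'] simp: space_PiM PiE_def)
  also have "\<dots> = ennreal (1 / \<bar>\<gamma> / b i0\<bar> ^ DIM('b)) * (\<integral>\<^sup>+x. (\<integral>\<^sup>+s. f (x(i0 := s)) \<partial>lborel) \<partial>?L)"
    by (intro nn_integral_cmult) measurable
  also have "(\<integral>\<^sup>+x. (\<integral>\<^sup>+s. f (x(i0 := s)) \<partial>lborel) \<partial>?L) = (\<integral>\<^sup>+x. f x \<partial>PiM I (\<lambda>_. lborel))"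
    using product_nn_integral_insert[OF IJ(3,2) f'] unfolding IJ(1)[symmetric] by simp
  also have "ennreal (1 / \<bar>b i0\<bar> ^ DIM('b)) * (ennreal (1 / \<bar>\<gamma> / b i0\<bar> ^ DIM('b)) * (\<integral>\<^sup>+x. f x \<partial>PiM I (\<lambda>_. lborel)))
    = ennreal (1 / \<bar>\<gamma>\<bar> ^ DIM('b)) * (\<integral>\<^sup>+x. f x \<partial>PiM I (\<lambda>_. lborel))"
    using i0 by (simp add: mult.assoc[symmetric] power_divide abs_divide flip: ennreal_mult'')
  finally show ?thesis unfolding \<gamma>_def .
qed

text \<open>Stated over any Euclidean space, so that the real steps and the vector steps of the
  statement are two instances and a projection maps one instance to another.\<close>

definition gauss :: "'b::euclidean_space measure" where
  "gauss = density lborel (\<lambda>x. ennreal ((2 * pi) powr (- real DIM('b) / 2) * exp (- (norm x)\<^sup>2 / 2)))"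

lemma std_gauss_eq: "std_gauss = (gauss :: (real^'d) measure)"
  by (simp add: std_gauss_def gauss_def)

lemma std_normal_measure_eq: "std_normal_measure = (gauss :: real measure)"
  unfolding std_normal_measure_def gauss_def std_normal_density_def
  by (simp add: powr_minus_divide powr_half_sqrt)

lemma sets_gauss[measurable_cong, simp]: "sets (gauss :: 'b::euclidean_space measure) = sets borel"
  by (simp add: gauss_def)

lemma space_gauss[simp]: "space (gauss :: 'b::euclidean_space measure) = UNIV"
  by (simp add: gauss_def)

lemma prob_space_gauss_real: "prob_space (gauss :: real measure)"
  using prob_space_normal_density[of 1 0]
  by (simp add: std_normal_measure_eq[symmetric] std_normal_measure_def)

lemma gauss_density_sum:
  fixes f :: "'b::euclidean_space \<Rightarrow> real"
  shows "(2 * pi) powr (- real DIM('b) / 2) * exp (- (norm (\<Sum>b\<in>Basis. f b *\<^sub>R b :: 'b))\<^sup>2 / 2)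
    = (\<Prod>b\<in>(Basis::'b set). (2 * pi) powr (- real DIM(real) / 2) * exp (- (norm (f b))\<^sup>2 / 2))"
proof -
  have "(norm (\<Sum>b\<in>Basis. f b *\<^sub>R b :: 'b))\<^sup>2 = (\<Sum>b\<in>Basis. (f b)\<^sup>2)"
    unfolding power2_norm_eq_inner
    by (subst euclidean_inner) (simp add: inner_sum_left_Basis power2_eq_square)
  moreover have "(2 * pi) powr (- real DIM('b) / 2) = ((2 * pi) powr (- 1 / 2)) ^ DIM('b)"
    by (simp add: powr_power)
  ultimately show ?thesis
    by (simp add: prod.distrib exp_sum sum_divide_distrib flip: sum_negf)
qed

lemma PiM_density_eq:
  fixes M :: "'a measure"
  assumes fin: "finite I" and "sigma_finite_measure M" "sigma_finite_measure (density M g)"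
    and [measurable]: "g \<in> borel_measurable M"
  shows "PiM I (\<lambda>_. density M g) = density (PiM I (\<lambda>_. M)) (\<lambda>x. \<Prod>i\<in>I. g (x i))"
proof -
  interpret D: product_sigma_finite "\<lambda>_::'b. density M g"
    using assms by (simp add: product_sigma_finite_def)
  interpret M: product_sigma_finite "\<lambda>_::'b. M"
    using assms by (simp add: product_sigma_finite_def)
  show ?thesis
  proof (rule D.PiM_eqI[OF fin, symmetric])
    show "sets (density (PiM I (\<lambda>_. M)) (\<lambda>x. \<Prod>i\<in>I. g (x i))) = sets (PiM I (\<lambda>_. density M g))"
      by (simp cong: sets_PiM_cong)
    fix A :: "'b \<Rightarrow> 'a set" assume A: "\<And>i. i \<in> I \<Longrightarrow> A i \<in> sets (density M g)"
    then have [measurable]: "\<And>i. i \<in> I \<Longrightarrow> A i \<in> sets M" by simp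
    have "emeasure (density (PiM I (\<lambda>_. M)) (\<lambda>x. \<Prod>i\<in>I. g (x i))) (Pi\<^sub>E I A) =
       (\<integral>\<^sup>+x. (\<Prod>i\<in>I. g (x i)) * indicator (Pi\<^sub>E I A) x \<partial>PiM I (\<lambda>_. M))"
      using fin by (subst emeasure_density) (auto intro!: sets_PiM_I_finite)
    also have "\<dots> = (\<integral>\<^sup>+x. (\<Prod>i\<in>I. g (x i) * indicator (A i) (x i)) \<partial>PiM I (\<lambda>_. M))"
    proof (intro nn_integral_cong)
      fix x assume x: "x \<in> space (PiM I (\<lambda>_. M))"
      have "indicator (Pi\<^sub>E I A) x = (\<Prod>i\<in>I. indicator (A i) (x i) :: ennreal)"
        using x fin by (auto simp: indicator_def PiE_iff space_PiM prod_zero_iff split: if_splits)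
      then show "(\<Prod>i\<in>I. g (x i)) * indicator (Pi\<^sub>E I A) x = (\<Prod>i\<in>I. g (x i) * indicator (A i) (x i))"
        by (simp add: prod.distrib)
    qed
    also have "\<dots> = (\<Prod>i\<in>I. \<integral>\<^sup>+x. g x * indicator (A i) x \<partial>M)"
      using fin by (subst M.product_nn_integral_prod) auto
    also have "\<dots> = (\<Prod>i\<in>I. emeasure (density M g) (A i))"
      by (intro prod.cong refl) (simp add: emeasure_density)
    finally show "emeasure (density (PiM I (\<lambda>_. M)) (\<lambda>x. \<Prod>i\<in>I. g (x i))) (Pi\<^sub>E I A) =
      (\<Prod>i\<in>I. emeasure (density M g) (A i))" .
  qed
qed

text \<open>Reduces a Gaussian vector to its independent coordinates, so that facts about products
  over an index set also serve in space.\<close>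

lemma gauss_eq_distr_PiM:
  "(gauss :: 'b::euclidean_space measure) = distr (PiM Basis (\<lambda>_. gauss)) borel (\<lambda>f. \<Sum>b\<in>Basis. f b *\<^sub>R b)"
proof -
  have "(PiM Basis (\<lambda>_. gauss) :: ('b \<Rightarrow> real) measure) = density (PiM Basis (\<lambda>_. lborel))
     (\<lambda>f. ennreal ((2 * pi) powr (- real DIM('b) / 2) * exp (- (norm (\<Sum>b\<in>Basis. f b *\<^sub>R b :: 'b))\<^sup>2 / 2)))"
    unfolding gauss_density_sum prod_ennreal[symmetric, OF mult_nonneg_nonneg[OF powr_ge_zero exp_ge_zero]] gauss_def
    by (rule PiM_density_eq[OF finite_Basis lborel.sigma_finite_measure_axioms
         prob_space_imp_sigma_finite[OF prob_space_gauss_real[unfolded gauss_def]]]) measurable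
  then show ?thesis
    unfolding gauss_def[where 'b='b]
    by (subst lborel_eq) (simp add: density_distr)
qed

lemma prob_space_gauss: "prob_space (gauss :: 'b::euclidean_space measure)"
  by (subst gauss_eq_distr_PiM, rule prob_space.prob_space_distr)
     (auto intro!: prob_space_PiM prob_space_gauss_real)

interpretation gauss: prob_space "gauss :: 'b::euclidean_space measure" by (rule prob_space_gauss)

abbreviation gaussians :: "'i set \<Rightarrow> ('i \<Rightarrow> 'b::euclidean_space) measure" where
  "gaussians I \<equiv> PiM I (\<lambda>_. gauss)"

lemma PiM_gauss_density:
  assumes fin: "finite I"
  shows "(gaussians I :: ('i \<Rightarrow> 'b::euclidean_space) measure) = density (PiM I (\<lambda>_. lborel))
     (\<lambda>x. ennreal (((2 * pi) powr (- real DIM('b) / 2)) ^ card I * exp (- (\<Sum>i\<in>I. (norm (x i))\<^sup>2) / 2)))"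
proof -
  have "((2 * pi) powr (- real DIM('b) / 2)) ^ card I * exp (- (\<Sum>i\<in>I. (norm (x i))\<^sup>2) / 2) =
    (\<Prod>i\<in>I. (2 * pi) powr (- real DIM('b) / 2) * exp (- (norm (x i))\<^sup>2 / 2))" for x :: "'i \<Rightarrow> 'b"
    using fin by (simp add: prod.distrib exp_sum sum_divide_distrib flip: sum_negf)
  then show ?thesis
    unfolding gauss_def
    by (simp only: prod_ennreal[symmetric, OF mult_nonneg_nonneg[OF powr_ge_zero exp_ge_zero]])
       (rule PiM_density_eq[OF fin lborel.sigma_finite_measure_axioms
          gauss.sigma_finite_measure_axioms[unfolded gauss_def]], measurable)
qed

text \<open>The map is the Householder reflection with unit normal \<open>a / sqrt 2\<close>, acting
  on the index side: all spatial coordinates of the vectors \<open>x i\<close> are mixed by the same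
  orthogonal matrix. The alternative of a vanishing \<open>a\<close> keeps the identity in the
  family; it occurs when the two vectors to be exchanged coincide.\<close>

lemma sum_norm_reflection:
  fixes x :: "'i \<Rightarrow> 'b::real_inner"
  assumes "finite I" "(\<Sum>i\<in>I. (a i)\<^sup>2) = 2 \<or> (\<forall>i\<in>I. a i = 0)"
  shows "(\<Sum>i\<in>I. (norm (x i - a i *\<^sub>R (\<Sum>k\<in>I. a k *\<^sub>R x k)))\<^sup>2) = (\<Sum>i\<in>I. (norm (x i))\<^sup>2)"
  using assms(2)
proof
  assume a: "(\<Sum>i\<in>I. (a i)\<^sup>2) = 2"
  define s where "s = (\<Sum>k\<in>I. a k *\<^sub>R x k)"
  have "(\<Sum>i\<in>I. (norm (x i - a i *\<^sub>R s))\<^sup>2) = (\<Sum>i\<in>I. (norm (x i))\<^sup>2) - 2 * (s \<bullet> s) + (\<Sum>i\<in>I. (a i)\<^sup>2) * (s \<bullet> s)"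
  proof -
    have "(norm (x i - a i *\<^sub>R s))\<^sup>2 = (norm (x i))\<^sup>2 - 2 * ((a i *\<^sub>R x i) \<bullet> s) + (a i)\<^sup>2 * (s \<bullet> s)" for i
      unfolding power2_norm_eq_inner by (simp add: algebra_simps power2_eq_square inner_commute)
    then have "(\<Sum>i\<in>I. (norm (x i - a i *\<^sub>R s))\<^sup>2)
      = (\<Sum>i\<in>I. (norm (x i))\<^sup>2) - 2 * (\<Sum>i\<in>I. (a i *\<^sub>R x i) \<bullet> s) + (\<Sum>i\<in>I. (a i)\<^sup>2) * (s \<bullet> s)"
      by (simp add: sum.distrib sum_subtractf sum_distrib_left sum_distrib_right)
    also have "(\<Sum>i\<in>I. (a i *\<^sub>R x i) \<bullet> s) = s \<bullet> s" by (simp only: s_def inner_sum_left)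
    finally show ?thesis .
  qed
  then show ?thesis by (simp add: a s_def)
qed simp

text \<open>The joint density depends on the sum of squared norms only, and the determinant of the
  rank-one change is \<open>1 - 2\<close> or \<open>1\<close>; so neither factor changes the
  measure.\<close>

lemma distr_PiM_gauss_reflection:
  assumes fin: "finite I" and a: "(\<Sum>i\<in>I. (a i)\<^sup>2) = 2 \<or> (\<forall>i\<in>I. a i = 0)"
  shows "distr (gaussians I) (gaussians I) (\<lambda>x. \<lambda>i\<in>I. x i - a i *\<^sub>R (\<Sum>k\<in>I. a k *\<^sub>R x k))
    = (gaussians I :: ('i \<Rightarrow> 'b::euclidean_space) measure)"
proof (rule measure_eqI)
  let ?T = "\<lambda>x::'i \<Rightarrow> 'b. \<lambda>i\<in>I. x i - a i *\<^sub>R (\<Sum>k\<in>I. a k *\<^sub>R x k)"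
  fix A assume "A \<in> sets (distr (gaussians I) (gaussians I) ?T)"
  then have A[measurable]: "A \<in> sets (PiM I (\<lambda>_. gauss :: 'b measure))" by simp
  have [measurable_cong]: "sets (PiM I (\<lambda>_. gauss :: 'b measure)) = sets (PiM I (\<lambda>_. lborel :: 'b measure))"
    by (simp cong: sets_PiM_cong)
  have A': "A \<in> sets (PiM I (\<lambda>_. lborel :: 'b measure))"
    using A by (simp cong: sets_PiM_cong)
  define g where "g x = ennreal (((2 * pi) powr (- real DIM('b) / 2)) ^ card I * exp (- (\<Sum>i\<in>I. (norm (x i))\<^sup>2) / 2))"
    for x :: "'i \<Rightarrow> 'b"
  have g[measurable]: "g \<in> borel_measurable (PiM I (\<lambda>_. lborel))" unfolding g_def by measurable
  have gT: "g (?T x) = g x" for x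
    using sum_norm_reflection[OF fin a, of x] by (simp add: g_def)
  have T: "?T x = (\<lambda>i\<in>I. x i + a i *\<^sub>R (\<Sum>k\<in>I. (- a k) *\<^sub>R x k))" for x
    by (auto simp: fun_eq_iff scaleR_right.sum sum_negf)
  have det: "\<bar>1 + (\<Sum>i\<in>I. a i * - a i)\<bar> = 1"
    using a by (auto simp: power2_eq_square sum_negf)
  have "emeasure (distr (gaussians I) (gaussians I) ?T) A
     = (\<integral>\<^sup>+x. indicator A (?T x) \<partial>gaussians I)"
    by (subst nn_integral_indicator[symmetric], simp, subst nn_integral_distr) measurable
  also have "\<dots> = (\<integral>\<^sup>+x. g (?T x) * indicator A (?T x) \<partial>PiM I (\<lambda>_. lborel))"
    unfolding gT unfolding g_def by (subst PiM_gauss_density[OF fin], subst nn_integral_density) measurable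
  also have "\<dots> = (\<integral>\<^sup>+x. g x * indicator A x \<partial>PiM I (\<lambda>_. lborel))"
    unfolding T using det by (subst nn_integral_PiM_rank_one[OF fin, where f="\<lambda>x. g x * indicator A x"]) auto
  also have "\<dots> = emeasure (gaussians I) A"
    using A' g by (subst PiM_gauss_density[OF fin], subst emeasure_density) (simp_all add: g_def[abs_def])
  finally show "emeasure (distr (gaussians I) (gaussians I) ?T) A = emeasure (gaussians I) A" .
qed simp

text \<open>The spatial version, obtained by taking the basis vectors as the index set.\<close>

lemma distr_gauss_reflection:
  fixes n :: "'b::euclidean_space"
  assumes n: "n \<bullet> n = 2 \<or> n = 0"
  shows "distr gauss borel (\<lambda>x. x - (n \<bullet> x) *\<^sub>R n) = gauss"
proof -
  let ?T = "\<lambda>x::'b \<Rightarrow> real. \<lambda>i\<in>Basis. x i - (n \<bullet> i) *\<^sub>R (\<Sum>k\<in>Basis. (n \<bullet> k) *\<^sub>R x k)"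
  let ?\<phi> = "\<lambda>f. (\<Sum>b\<in>Basis. f b *\<^sub>R b) :: 'b"
  have a: "(\<Sum>i\<in>Basis. (n \<bullet> i)\<^sup>2) = 2 \<or> (\<forall>i\<in>Basis. n \<bullet> i = 0)"
    using n euclidean_inner[of n n] by (auto simp: power2_eq_square)
  have eq: "?\<phi> f - (n \<bullet> ?\<phi> f) *\<^sub>R n = ?\<phi> (?T f)" for f
    by (rule euclidean_eqI) (simp add: inner_diff_left inner_sum_left_Basis inner_sum_right mult.commute)
  have "distr gauss borel (\<lambda>x. x - (n \<bullet> x) *\<^sub>R n)
    = distr (gaussians Basis) borel (\<lambda>f. ?\<phi> f - (n \<bullet> ?\<phi> f) *\<^sub>R n)"
    by (subst gauss_eq_distr_PiM, subst distr_distr) (auto simp: o_def)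
  also have "\<dots> = distr (distr (gaussians Basis) (gaussians Basis) ?T) borel ?\<phi>"
    unfolding eq by (subst distr_distr) (auto simp: o_def)
  also have "\<dots> = gauss"
    by (subst distr_PiM_gauss_reflection[OF finite_Basis a]) (rule gauss_eq_distr_PiM[symmetric])
  finally show ?thesis .
qed

text \<open>A reflection carries \<open>u\<close> to a basis vector, and the component along a basis
  vector is one factor of the product measure.\<close>

lemma distr_gauss_inner:
  fixes u :: "'b::euclidean_space"
  assumes u: "norm u = 1"
  shows "distr gauss borel (\<lambda>x. u \<bullet> x) = (gauss :: real measure)"
proof -
  obtain e :: 'b where e: "e \<in> Basis" using nonempty_Basis by blast
  have e1: "e \<bullet> e = 1" using e by simp
  have u1: "u \<bullet> u = 1" using u by (simp add: norm_eq_1)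
  \<comment> \<open>For \<open>u = e\<close> the division by zero gives \<open>n = 0\<close>, the
    degenerate case of the reflection.\<close>
  define n where "n = (sqrt 2 / norm (u - e)) *\<^sub>R (u - e)"
  have n: "n \<bullet> n = 2 \<or> n = 0"
    by (auto simp: n_def power2_norm_eq_inner[symmetric] power2_eq_square dot_square_norm)
  have refl: "u \<bullet> x = e \<bullet> (x - (n \<bullet> x) *\<^sub>R n)" for x
  proof (cases "u = e")
    case True then show ?thesis by (simp add: n_def)
  next
    case False
    let ?w = "u - e"
    have w: "?w \<bullet> ?w = 2 - 2 * (e \<bullet> u)" "?w \<bullet> ?w \<noteq> 0"
    proof -
      show "?w \<bullet> ?w = 2 - 2 * (e \<bullet> u)"
        using u1 e1 by (simp add: inner_diff_left inner_diff_right inner_commute)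
    qed (use False in simp)
    have "(n \<bullet> x) *\<^sub>R n = (2 * (?w \<bullet> x) / (?w \<bullet> ?w)) *\<^sub>R ?w"
      using w by (simp add: n_def dot_square_norm power2_eq_square)
    then have "e \<bullet> (x - (n \<bullet> x) *\<^sub>R n) = e \<bullet> x - 2 * (?w \<bullet> x) * ((e \<bullet> u) - 1) / (?w \<bullet> ?w)"
      by (simp only: inner_diff_right inner_scaleR_right) (simp add: e1)
    also have "\<dots> = e \<bullet> x + ?w \<bullet> x"
      using w(2) unfolding w(1) by (simp add: field_simps)
    finally show ?thesis by (simp add: inner_diff_left)
  qed
  have "distr (gauss :: 'b measure) borel (\<lambda>x. u \<bullet> x)
    = distr (distr gauss borel (\<lambda>x. x - (n \<bullet> x) *\<^sub>R n)) borel (\<lambda>x. e \<bullet> x)"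
    unfolding refl by (subst distr_distr) (auto simp: o_def)
  also have "\<dots> = distr (gauss :: 'b measure) borel (\<lambda>x. e \<bullet> x)"
    by (subst distr_gauss_reflection[OF n]) simp
  also have "\<dots> = distr (gaussians (Basis::'b set)) borel (\<lambda>f. f e)"
    using e by (subst gauss_eq_distr_PiM, subst distr_distr)
      (auto simp: o_def inner_commute[of e] inner_sum_left_Basis)
  also have "\<dots> = gauss"
    using distr_PiM_component[of "Basis::'b set" "\<lambda>_. gauss::real measure" e] e gauss.prob_space_axioms
    by (simp cong: distr_cong)
  finally show ?thesis .
qed

subsection \<open>The isodiametric inequality\<close>

definition flip :: "'i \<Rightarrow> ('i \<Rightarrow> real) \<Rightarrow> 'i \<Rightarrow> real" where
  "flip j z = z(j := - z j)"

text \<open>This interval replaces a section of length \<open>l\<close> in the Steiner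
  symmetrisation; written with a strict inequality it becomes the whole line when
  \<open>l = top\<close>.\<close>

lemma emeasure_symmetric_interval:
  "emeasure lborel {t::real. ennreal (2 * \<bar>t\<bar>) < l} = l"
proof (cases l)
  case (real r)
  have "{t::real. ennreal (2 * \<bar>t\<bar>) < l} = {- r / 2 <..< r / 2}"
    using real by (auto simp: ennreal_less_iff)
  then show ?thesis using real by simp
next
  case top
  then have "{t::real. ennreal (2 * \<bar>t\<bar>) < l} = UNIV" by auto
  then show ?thesis using top by simp
qed

text \<open>The differences \<open>Sup P - Inf Q\<close> and \<open>Sup Q - Inf P\<close> add up to
  the sum of the two spans, which exceeds \<open>2 * \<bar>s\<bar> + 2 * \<bar>t\<bar>\<close>; so
  one of them exceeds \<open>\<bar>s - t\<bar>\<close>. Hence centring two sections never increases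
  the largest distance between their points.\<close>

lemma far_points_of_long_sections:
  fixes P Q :: "real set"
  assumes [measurable]: "P \<in> sets borel" "Q \<in> sets borel"
    and s: "ennreal (2 * \<bar>s\<bar>) < emeasure lborel P" and t: "ennreal (2 * \<bar>t\<bar>) < emeasure lborel Q"
  shows "\<exists>p\<in>P. \<exists>q\<in>Q. \<bar>s - t\<bar> \<le> \<bar>p - q\<bar>"
proof (rule ccontr)
  assume "\<not> ?thesis"
  then have c: "\<And>p q. p \<in> P \<Longrightarrow> q \<in> Q \<Longrightarrow> \<bar>p - q\<bar> < \<bar>s - t\<bar>" by force
  have ne: "P \<noteq> {}" "Q \<noteq> {}" using s t by auto
  then obtain p0 q0 where p0: "p0 \<in> P" and q0: "q0 \<in> Q" by auto
  define \<delta> where "\<delta> = \<bar>s - t\<bar>"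
  have bdd: "bdd_above P" "bdd_below P" "bdd_above Q" "bdd_below Q"
  proof -
    show "bdd_above P" by (rule bdd_aboveI[of _ "q0 + \<delta>"]) (use c[OF _ q0] in \<open>force simp: \<delta>_def\<close>)
    show "bdd_below P" by (rule bdd_belowI[of _ "q0 - \<delta>"]) (use c[OF _ q0] in \<open>force simp: \<delta>_def\<close>)
    show "bdd_above Q" by (rule bdd_aboveI[of _ "p0 + \<delta>"]) (use c[OF p0] in \<open>force simp: \<delta>_def\<close>)
    show "bdd_below Q" by (rule bdd_belowI[of _ "p0 - \<delta>"]) (use c[OF p0] in \<open>force simp: \<delta>_def\<close>)
  qed
  have len: "emeasure lborel X \<le> ennreal (Sup X - Inf X)"
    if "bdd_above X" "bdd_below X" "X \<noteq> {}" for X :: "real set"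
  proof -
    have "emeasure lborel X \<le> emeasure lborel {Inf X..Sup X}"
      using that by (intro emeasure_mono) (auto intro: cInf_lower cSup_upper)
    also have "\<dots> = ennreal (Sup X - Inf X)"
      using that by (simp add: cInf_le_cSup)
    finally show ?thesis .
  qed
  have "ennreal (2 * \<bar>s\<bar>) < ennreal (Sup P - Inf P)" "ennreal (2 * \<bar>t\<bar>) < ennreal (Sup Q - Inf Q)"
    using s t len[of P] len[of Q] bdd ne by (auto intro: less_le_trans)
  then have "2 * \<bar>s\<bar> < Sup P - Inf P" "2 * \<bar>t\<bar> < Sup Q - Inf Q"
    by (auto simp: ennreal_less_iff)
  moreover have "Sup P - Inf Q \<le> \<delta>"
  proof -
    have "p - Inf Q \<le> \<delta>" if "p \<in> P" for p
    proof -
      have "p - \<delta> \<le> Inf Q"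
        using c[OF that] ne by (intro cInf_greatest) (force simp: \<delta>_def)+
      then show ?thesis by simp
    qed
    then have "Sup P \<le> Inf Q + \<delta>" using ne by (intro cSup_least) force+
    then show ?thesis by simp
  qed
  moreover have "Sup Q - Inf P \<le> \<delta>"
  proof -
    have "q - Inf P \<le> \<delta>" if "q \<in> Q" for q
    proof -
      have "q - \<delta> \<le> Inf P"
        using c[OF _ that] ne by (intro cInf_greatest) (force simp: \<delta>_def)+
      then show ?thesis by simp
    qed
    then have "Sup Q \<le> Inf P + \<delta>" using ne by (intro cSup_least) force+
    then show ?thesis by simp
  qed
  ultimately show False unfolding \<delta>_def by linarith
qed

text \<open>Every section in direction \<open>i\<close> is replaced by the centred interval of the
  same length. Fubini preserves the measure, \<open>far_points_of_long_sections\<close> controls the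
  diameter, and an earlier symmetry \<open>flip j\<close> survives because it maps sections to
  sections of equal length.\<close>

lemma steiner_step:
  fixes A :: "('i \<Rightarrow> real) set"
  assumes fin: "finite I0" "i \<notin> I0"
    and A[measurable]: "A \<in> sets (PiM (insert i I0) (\<lambda>_. lborel))"
    and diam: "\<And>x y. x \<in> A \<Longrightarrow> y \<in> A \<Longrightarrow> (\<Sum>k\<in>insert i I0. (x k - y k)\<^sup>2) \<le> D"
    and sym: "\<And>j x. j \<in> J \<Longrightarrow> x \<in> A \<Longrightarrow> flip j x \<in> A" and J: "J \<subseteq> I0"
  shows "\<exists>A' \<in> sets (PiM (insert i I0) (\<lambda>_. lborel)).
    emeasure (PiM (insert i I0) (\<lambda>_. lborel)) A' = emeasure (PiM (insert i I0) (\<lambda>_. lborel)) A \<and>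
    (\<forall>x\<in>A'. \<forall>y\<in>A'. (\<Sum>k\<in>insert i I0. (x k - y k)\<^sup>2) \<le> D) \<and> (\<forall>j\<in>insert i J. \<forall>x\<in>A'. flip j x \<in> A')"
proof -
  interpret product_sigma_finite "\<lambda>_::'i. lborel :: real measure" ..
  let ?L = "PiM (insert i I0) (\<lambda>_. lborel :: real measure)"
  let ?M = "PiM I0 (\<lambda>_. lborel :: real measure)"
  define l where "l x = (\<integral>\<^sup>+t. indicator A (x(i := t)) \<partial>lborel)" for x :: "'i \<Rightarrow> real"
  have l[measurable]: "l \<in> borel_measurable ?M" unfolding l_def by measurable
  define A' where "A' = {z \<in> space ?L. ennreal (2 * \<bar>z i\<bar>) < l (restrict z I0)}"
  have A'm[measurable]: "A' \<in> sets ?L" unfolding A'_def by measurable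
  have sec[measurable]: "{t. x(i := t) \<in> A} \<in> sets borel" if "x \<in> space ?M" for x
  proof -
    have "(\<lambda>t. x(i := t)) \<in> borel \<rightarrow>\<^sub>M ?L"
      using measurable_component_update[OF that fin(2)] by simp
    then show ?thesis using A by (simp add: measurable_def vimage_def)
  qed
  have l_eq: "l x = emeasure lborel {t. x(i := t) \<in> A}" if "x \<in> space ?M" for x
    using sec[OF that] unfolding l_def
    by (subst nn_integral_indicator[symmetric])
      (auto simp: indicator_def simp del: nn_integral_indicator intro!: nn_integral_cong)
  show ?thesis
  proof (intro bexI[of _ A'] conjI ballI)
    show "A' \<in> sets ?L" by fact
    have "emeasure ?L A' = (\<integral>\<^sup>+x. \<integral>\<^sup>+t. indicator A' (x(i := t)) \<partial>lborel \<partial>?M)"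
      by (subst nn_integral_indicator[symmetric, OF A'm], subst product_nn_integral_insert) (use fin in auto)
    also have "\<dots> = (\<integral>\<^sup>+x. l x \<partial>?M)"
    proof (rule nn_integral_cong)
      fix x assume x: "x \<in> space ?M"
      have "indicator A' (x(i := t)) = (indicator {t. ennreal (2 * \<bar>t\<bar>) < l x} t :: ennreal)" for t
      proof -
        have "restrict (x(i := t)) I0 = x"
          using x fin by (auto simp: space_PiM PiE_def extensional_def restrict_def fun_eq_iff)
        moreover have "x(i := t) \<in> space ?L"
          using x by (auto simp: space_PiM PiE_def extensional_def)
        ultimately show ?thesis by (auto simp: A'_def indicator_def)
      qed
      then show "(\<integral>\<^sup>+t. indicator A' (x(i := t)) \<partial>lborel) = l x"
        by (simp add: emeasure_symmetric_interval)
    qed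
    also have "\<dots> = emeasure ?L A"
      unfolding l_def
      by (subst nn_integral_indicator[symmetric, OF A], subst product_nn_integral_insert) (use fin in auto)
    finally show "emeasure ?L A' = emeasure ?L A" .
    have r0: "restrict z I0 \<in> space ?M" for z by (simp add: space_PiM)
    show "(\<Sum>k\<in>insert i I0. (x k - y k)\<^sup>2) \<le> D" if "x \<in> A'" "y \<in> A'" for x y
    proof -
      obtain p q where p: "(restrict x I0)(i := p) \<in> A" and q: "(restrict y I0)(i := q) \<in> A"
        and pq: "\<bar>x i - y i\<bar> \<le> \<bar>p - q\<bar>"
      proof -
        have "ennreal (2 * \<bar>z i\<bar>) < emeasure lborel {t. (restrict z I0)(i := t) \<in> A}" if "z \<in> A'" for z
          using that l_eq[OF r0, of z] by (simp add: A'_def)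
        from far_points_of_long_sections[OF sec[OF r0] sec[OF r0] this[OF \<open>x \<in> A'\<close>] this[OF \<open>y \<in> A'\<close>]]
        show ?thesis using that by blast
      qed
      have "(\<Sum>k\<in>insert i I0. (x k - y k)\<^sup>2) = (x i - y i)\<^sup>2 + (\<Sum>k\<in>I0. (x k - y k)\<^sup>2)"
        using fin by simp
      also have "\<dots> \<le> (p - q)\<^sup>2 + (\<Sum>k\<in>I0. (x k - y k)\<^sup>2)"
        using pq by (simp add: abs_le_square_iff)
      also have "\<dots> = (\<Sum>k\<in>insert i I0. (((restrict x I0)(i := p)) k - ((restrict y I0)(i := q)) k)\<^sup>2)"
        using fin by (auto intro!: sum.cong)
      also have "\<dots> \<le> D" by (rule diam[OF p q])
      finally show ?thesis .
    qed
    show "flip j x \<in> A'" if "j \<in> insert i J" "x \<in> A'" for j x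
    proof (cases "j = i")
      case True
      have "restrict (flip i x) I0 = restrict x I0" using fin by (auto simp: flip_def restrict_def fun_eq_iff)
      then show ?thesis using that True fin
        by (auto simp: A'_def flip_def space_PiM PiE_def extensional_def)
    next
      case False
      then have j: "j \<in> J" "j \<in> I0" using that J by auto
      have fl: "(restrict (flip j x) I0)(i := t) = flip j ((restrict x I0)(i := t))" for t x
        using j False by (auto simp: flip_def fun_eq_iff)
      have ff: "flip j (flip j z) = z" for z by (simp add: flip_def)
      have "(restrict (flip j x) I0)(i := t) \<in> A \<longleftrightarrow> (restrict x I0)(i := t) \<in> A" for t
        unfolding fl using sym[OF j(1)] ff by metis
      then have "l (restrict (flip j x) I0) = l (restrict x I0)"
        by (simp add: l_def indicator_def)
      then show ?thesis using that j False
        by (auto simp: A'_def flip_def space_PiM PiE_def extensional_def)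
    qed
  qed
qed

lemma steiner_symmetrization:
  fixes A :: "('i \<Rightarrow> real) set"
  assumes fin: "finite I" and A: "A \<in> sets (PiM I (\<lambda>_. lborel))"
    and diam: "\<And>x y. x \<in> A \<Longrightarrow> y \<in> A \<Longrightarrow> (\<Sum>k\<in>I. (x k - y k)\<^sup>2) \<le> D"
    and J: "J \<subseteq> I"
  shows "\<exists>A' \<in> sets (PiM I (\<lambda>_. lborel)). emeasure (PiM I (\<lambda>_. lborel)) A' = emeasure (PiM I (\<lambda>_. lborel)) A
    \<and> (\<forall>x\<in>A'. \<forall>y\<in>A'. (\<Sum>k\<in>I. (x k - y k)\<^sup>2) \<le> D) \<and> (\<forall>j\<in>J. \<forall>x\<in>A'. flip j x \<in> A')"
proof -
  have "finite J" using J fin finite_subset by auto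
  then show ?thesis using J
  proof (induction J rule: finite_induct)
    case empty then show ?case using A diam by blast
  next
    case (insert i J)
    then obtain B where B: "B \<in> sets (PiM I (\<lambda>_. lborel))" "emeasure (PiM I (\<lambda>_. lborel)) B = emeasure (PiM I (\<lambda>_. lborel)) A"
      "\<And>x y. x \<in> B \<Longrightarrow> y \<in> B \<Longrightarrow> (\<Sum>k\<in>I. (x k - y k)\<^sup>2) \<le> D" "\<And>j x. j \<in> J \<Longrightarrow> x \<in> B \<Longrightarrow> flip j x \<in> B"
      by auto
    have I: "I = insert i (I - {i})" using insert by auto
    have JI: "J \<subseteq> I - {i}" using insert by auto
    have f: "finite (I - {i})" "i \<notin> I - {i}" using fin by auto
    have dB: "\<And>x y. x \<in> B \<Longrightarrow> y \<in> B \<Longrightarrow> (\<Sum>k\<in>insert i (I - {i}). (x k - y k)\<^sup>2) \<le> D"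
      using B(3) I by simp
    from steiner_step[OF f _ dB B(4) JI] have "\<exists>A' \<in> sets (PiM I (\<lambda>_. lborel)).
      emeasure (PiM I (\<lambda>_. lborel)) A' = emeasure (PiM I (\<lambda>_. lborel)) B \<and>
      (\<forall>x\<in>A'. \<forall>y\<in>A'. (\<Sum>k\<in>I. (x k - y k)\<^sup>2) \<le> D) \<and> (\<forall>j\<in>insert i J. \<forall>x\<in>A'. flip j x \<in> A')"
      using B(1) unfolding I[symmetric] by blast
    then show ?case using B(2) by simp
  qed
qed

text \<open>Once the set is symmetric in every coordinate it contains \<open>- x\<close> with
  \<open>x\<close>, so twice the length of \<open>x\<close> is at most \<open>D\<close> and the set
  lies in the ball of radius \<open>D / 2\<close>.\<close>

lemma isodiametric_PiM:
  fixes A :: "('i \<Rightarrow> real) set"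
  assumes fin: "finite I" and A: "A \<in> sets (PiM I (\<lambda>_. lborel))" and D: "D > 0"
    and diam: "\<And>x y. x \<in> A \<Longrightarrow> y \<in> A \<Longrightarrow> sqrt (\<Sum>k\<in>I. (x k - y k)\<^sup>2) \<le> D"
  shows "emeasure (PiM I (\<lambda>_. lborel)) A \<le> ennreal (unit_ball_vol (real (card I)) * (D / 2) ^ card I)"
proof -
  have "(\<Sum>k\<in>I. (x k - y k)\<^sup>2) \<le> D\<^sup>2" if "x \<in> A" "y \<in> A" for x y
    using diam[OF that] D by (meson less_imp_le real_sqrt_le_iff' sum_nonneg zero_le_power2)
  then have "\<exists>B \<in> sets (PiM I (\<lambda>_. lborel)). emeasure (PiM I (\<lambda>_. lborel)) B = emeasure (PiM I (\<lambda>_. lborel)) A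
    \<and> (\<forall>x\<in>B. \<forall>y\<in>B. (\<Sum>k\<in>I. (x k - y k)\<^sup>2) \<le> D\<^sup>2) \<and> (\<forall>j\<in>I. \<forall>x\<in>B. flip j x \<in> B)"
    by (intro steiner_symmetrization fin A order_refl)
  then obtain B where B: "B \<in> sets (PiM I (\<lambda>_. lborel))" "emeasure (PiM I (\<lambda>_. lborel)) B = emeasure (PiM I (\<lambda>_. lborel)) A"
      "\<And>x y. x \<in> B \<Longrightarrow> y \<in> B \<Longrightarrow> (\<Sum>k\<in>I. (x k - y k)\<^sup>2) \<le> D\<^sup>2" "\<And>j x. j \<in> I \<Longrightarrow> x \<in> B \<Longrightarrow> flip j x \<in> B"
    by blast
  have "sqrt (\<Sum>k\<in>I. (x k)\<^sup>2) \<le> D / 2" if x: "x \<in> B" for x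
  proof -
    have neg: "(\<lambda>i. if i \<in> K then - x i else x i) \<in> B" if "K \<subseteq> I" for K
    proof -
      have "finite K" using that fin finite_subset by auto
      then show ?thesis using that
      proof (induction K rule: finite_induct)
        case empty then show ?case using x by simp
      next
        case (insert j K)
        have "flip j (\<lambda>i. if i \<in> K then - x i else x i) \<in> B" using insert by (intro B(4)) auto
        also have "flip j (\<lambda>i. if i \<in> K then - x i else x i) = (\<lambda>i. if i \<in> insert j K then - x i else x i)"
          using insert by (auto simp: flip_def fun_eq_iff)
        finally show ?case .
      qed
    qed
    have "(\<Sum>k\<in>I. (x k - (if k \<in> I then - x k else x k))\<^sup>2) \<le> D\<^sup>2"
      using B(3)[OF x neg[OF order_refl]] by simp
    also have "(\<Sum>k\<in>I. (x k - (if k \<in> I then - x k else x k))\<^sup>2) = 4 * (\<Sum>k\<in>I. (x k)\<^sup>2)"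
      by (simp add: sum_distrib_left power2_eq_square algebra_simps)
    finally have "(\<Sum>k\<in>I. (x k)\<^sup>2) \<le> (D / 2)\<^sup>2" by (simp add: power2_eq_square)
    then show ?thesis using D by (intro real_le_lsqrt) (auto intro: sum_nonneg)
  qed
  then have sub: "B \<subseteq> {f. sqrt (\<Sum>i\<in>I. (f i)\<^sup>2) \<le> D / 2} \<inter> space (PiM I (\<lambda>_. lborel))"
    using sets.sets_into_space[OF B(1)] by auto
  have "emeasure (PiM I (\<lambda>_. lborel)) A \<le> emeasure (PiM I (\<lambda>_. lborel)) ({f. sqrt (\<Sum>i\<in>I. (f i)\<^sup>2) \<le> D / 2} \<inter> space (PiM I (\<lambda>_. lborel)))"
    unfolding B(2)[symmetric]
  proof (rule emeasure_mono[OF sub])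
    have "{f \<in> space (PiM I (\<lambda>_. lborel)). sqrt (\<Sum>i\<in>I. (f i)\<^sup>2) \<le> D / 2} \<in> sets (PiM I (\<lambda>_. lborel :: real measure))"
      by measurable
    then show "{f. sqrt (\<Sum>i\<in>I. (f i)\<^sup>2) \<le> D / 2} \<inter> space (PiM I (\<lambda>_. lborel)) \<in> sets (PiM I (\<lambda>_. lborel :: real measure))"
      by (simp add: Collect_conj_eq Int_commute)
  qed
  also have "\<dots> = ennreal (unit_ball_vol (real (card I)) * (D / 2) ^ card I)"
    using fin D by (intro emeasure_cball_aux) auto
  finally show ?thesis .
qed

theorem isodiametric:
  fixes S :: "'a::euclidean_space set"
  assumes S[measurable]: "S \<in> sets borel" and bdd: "bounded S"
  shows "emeasure lborel S \<le> ennreal (unit_ball_vol (real DIM('a)) * (diameter S / 2) ^ DIM('a))"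
proof (cases "diameter S > 0")
  case True
  let ?\<phi> = "\<lambda>f. (\<Sum>b\<in>Basis. f b *\<^sub>R b) :: 'a"
  have "emeasure lborel S = emeasure (PiM Basis (\<lambda>_. lborel)) (?\<phi> -` S \<inter> space (PiM Basis (\<lambda>_. lborel)))"
    by (subst lborel_eq, subst emeasure_distr) auto
  also have "\<dots> \<le> ennreal (unit_ball_vol (real (card (Basis::'a set))) * (diameter S / 2) ^ card (Basis::'a set))"
  proof (rule isodiametric_PiM[OF finite_Basis _ True])
    have "?\<phi> \<in> borel_measurable (PiM Basis (\<lambda>_. lborel))" by measurable
    then show "?\<phi> -` S \<inter> space (PiM Basis (\<lambda>_. lborel)) \<in> sets (PiM Basis (\<lambda>_. lborel))"
      using S measurable_sets by blast
    fix x y assume "x \<in> ?\<phi> -` S \<inter> space (PiM Basis (\<lambda>_. lborel))" "y \<in> ?\<phi> -` S \<inter> space (PiM Basis (\<lambda>_. lborel))"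
    then have "dist (?\<phi> x) (?\<phi> y) \<le> diameter S" by (intro diameter_bounded_bound bdd) auto
    also have "dist (?\<phi> x) (?\<phi> y) = sqrt (\<Sum>k\<in>Basis. (x k - y k)\<^sup>2)"
      by (subst euclidean_dist_l2) (auto simp: L2_set_def dist_real_def inner_sum_left_Basis intro!: sum.cong)
    finally show "sqrt (\<Sum>k\<in>Basis. (x k - y k)\<^sup>2) \<le> diameter S" .
  qed
  finally show ?thesis by simp
next
  case False
  then have "diameter S = 0" using diameter_ge_0[OF bdd] by simp
  then have "x = y" if "x \<in> S" "y \<in> S" for x y
    using diameter_bounded_bound[OF bdd that] by simp
  then have "S = {} \<or> (\<exists>x. S = {x})" by blast
  then show ?thesis by auto
qed

section \<open>Covering premeasures and their comparison with Lebesgue measure\<close>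

abbreviation hcost :: "real \<Rightarrow> 'a::metric_space set \<Rightarrow> ennreal" where
  "hcost s C \<equiv> ennreal (unit_ball_vol s * (diameter C / 2) powr s)"

lemma hausdorff_pre_le:
  assumes "A \<subseteq> (\<Union>i. C i)" "\<And>i. bounded (C i)" "\<And>i. diameter (C i) \<le> \<delta>"
  shows "hausdorff_pre s \<delta> A \<le> (\<Sum>i. hcost s (C i))"
  unfolding hausdorff_pre_def using assms by (intro INF_lower) auto

lemma hausdorff_pre_greatest:
  assumes "\<And>C. A \<subseteq> (\<Union>i. C i) \<Longrightarrow> (\<And>i. bounded (C i)) \<Longrightarrow> (\<And>i. diameter (C i) \<le> \<delta>) \<Longrightarrow> x \<le> (\<Sum>i. hcost s (C i))"
  shows "x \<le> hausdorff_pre s \<delta> A"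
  unfolding hausdorff_pre_def using assms by (intro INF_greatest) auto


lemma hausdorff_pre_mono: "A \<subseteq> B \<Longrightarrow> hausdorff_pre s \<delta> A \<le> hausdorff_pre s \<delta> B"
  by (rule hausdorff_pre_greatest, rule hausdorff_pre_le) auto

text \<open>Vitali coverings come indexed by arbitrary countable sets; they are renumbered and
  padded with empty sets, which cost 0.\<close>

lemma hausdorff_pre_le_countable:
  assumes K: "countable K" and cov: "A \<subseteq> (\<Union>k\<in>K. C k)" and s: "s > 0" and \<delta>: "\<delta> \<ge> 0"
    and C: "\<And>k. k \<in> K \<Longrightarrow> bounded (C k)" "\<And>k. k \<in> K \<Longrightarrow> diameter (C k) \<le> \<delta>"
  shows "hausdorff_pre s \<delta> A \<le> (\<integral>\<^sup>+k. hcost s (C k) \<partial>count_space K)"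
proof -
  define f where "f = to_nat_on K"
  have inj: "inj_on f K" using K by (simp add: f_def inj_on_to_nat_on)
  define D where "D i = (if i \<in> f ` K then C (inv_into K f i) else {})" for i
  have Df: "D (f k) = C k" if "k \<in> K" for k using that inj by (simp add: D_def)
  have D: "bounded (D i) \<and> diameter (D i) \<le> \<delta>" for i
    using C inj \<delta> by (auto simp: D_def)
  have "A \<subseteq> (\<Union>i. D i)"
    using cov Df by blast
  then have "hausdorff_pre s \<delta> A \<le> (\<Sum>i. hcost s (D i))"
    using D by (intro hausdorff_pre_le) auto
  also have "\<dots> = (\<integral>\<^sup>+i. hcost s (D i) \<partial>count_space UNIV)"
    by (rule nn_integral_count_space_nat[symmetric])
  also have "\<dots> = (\<integral>\<^sup>+i. hcost s (D i) \<partial>count_space (f ` K))"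
    using s by (intro nn_integral_count_space_eq) (auto simp: D_def)
  also have "\<dots> = (\<integral>\<^sup>+k. hcost s (D (f k)) \<partial>count_space K)"
    using inj by (intro nn_integral_bij_count_space[symmetric]) (simp add: bij_betw_def)
  also have "\<dots> = (\<integral>\<^sup>+k. hcost s (C k) \<partial>count_space K)"
    by (intro nn_integral_cong) (simp add: Df)
  finally show ?thesis .
qed

lemma hausdorff_pre_Un_le:
  assumes s: "s > 0" and \<delta>: "\<delta> \<ge> 0"
  shows "hausdorff_pre s \<delta> (A \<union> B) \<le> hausdorff_pre s \<delta> A + hausdorff_pre s \<delta> B"
proof (rule ennreal_le_epsilon)
  fix e :: real assume fin: "hausdorff_pre s \<delta> A + hausdorff_pre s \<delta> B < top" and e: "0 < e"
  have "\<exists>C. X \<subseteq> (\<Union>i. C i) \<and> (\<forall>i. bounded (C i) \<and> diameter (C i) \<le> \<delta>) \<and>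
     (\<Sum>i. hcost s (C i)) \<le> hausdorff_pre s \<delta> X + ennreal (e / 2)" if "hausdorff_pre s \<delta> X < top" for X :: "'a set"
  proof -
    have "hausdorff_pre s \<delta> X < hausdorff_pre s \<delta> X + ennreal (e / 2)"
      using that e by simp
    then show ?thesis
      unfolding hausdorff_pre_def[of s \<delta> X] INF_less_iff by (auto simp: less_imp_le)
  qed
  from this[of A] this[of B] fin obtain C D where
    C: "A \<subseteq> (\<Union>i. C i)" "\<And>i. bounded (C i) \<and> diameter (C i) \<le> \<delta>" "(\<Sum>i. hcost s (C i)) \<le> hausdorff_pre s \<delta> A + ennreal (e / 2)" and
    D: "B \<subseteq> (\<Union>i. D i)" "\<And>i. bounded (D i) \<and> diameter (D i) \<le> \<delta>" "(\<Sum>i. hcost s (D i)) \<le> hausdorff_pre s \<delta> B + ennreal (e / 2)"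
    by (auto simp: less_top)
  define X where "X k = (case k of Inl i \<Rightarrow> C i | Inr i \<Rightarrow> D i)" for k :: "nat + nat"
  have "hausdorff_pre s \<delta> (A \<union> B) \<le> (\<integral>\<^sup>+k. hcost s (X k) \<partial>count_space UNIV)"
  proof (rule hausdorff_pre_le_countable[OF _ _ s \<delta>])
    show "A \<union> B \<subseteq> (\<Union>k\<in>UNIV. X k)"
    proof
      fix x assume "x \<in> A \<union> B"
      then have "(\<exists>i. x \<in> X (Inl i)) \<or> (\<exists>i. x \<in> X (Inr i))"
        using subsetD[OF C(1), of x] subsetD[OF D(1), of x] by (auto simp: X_def)
      then show "x \<in> (\<Union>k\<in>UNIV. X k)" by blast
    qed
  qed (use C(2) D(2) in \<open>auto simp: X_def split: sum.split\<close>)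
  also have "\<dots> = (\<integral>\<^sup>+k. hcost s (X k) \<partial>count_space (range Inl)) + (\<integral>\<^sup>+k. hcost s (X k) \<partial>count_space (range Inr))"
  proof -
    have "(\<integral>\<^sup>+k. hcost s (X k) \<partial>count_space UNIV) =
      (\<integral>\<^sup>+k. hcost s (X k) * indicator (range Inl) k + hcost s (X k) * indicator (range Inr) k \<partial>count_space UNIV)"
    proof (rule nn_integral_cong)
      fix k :: "nat + nat"
      show "hcost s (X k) = hcost s (X k) * indicator (range Inl) k + hcost s (X k) * indicator (range Inr) k"
        by (cases k) (auto simp: indicator_def)
    qed
    then show ?thesis
      by (simp add: nn_integral_add nn_integral_count_space_indicator)
  qed
  also have "(\<integral>\<^sup>+k. hcost s (X k) \<partial>count_space (range Inl)) = (\<Sum>i. hcost s (C i))"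
    by (subst nn_integral_bij_count_space[symmetric, of Inl UNIV])
       (auto simp: bij_betw_def X_def nn_integral_count_space_nat)
  also have "(\<integral>\<^sup>+k. hcost s (X k) \<partial>count_space (range Inr)) = (\<Sum>i. hcost s (D i))"
    by (subst nn_integral_bij_count_space[symmetric, of Inr UNIV])
       (auto simp: bij_betw_def X_def nn_integral_count_space_nat)
  also have "(\<Sum>i. hcost s (C i)) + (\<Sum>i. hcost s (D i)) \<le>
     (hausdorff_pre s \<delta> A + ennreal (e / 2)) + (hausdorff_pre s \<delta> B + ennreal (e / 2))"
    by (intro add_mono C D)
  also have "\<dots> = hausdorff_pre s \<delta> A + hausdorff_pre s \<delta> B + (ennreal (e / 2) + ennreal (e / 2))"
    by (simp add: ac_simps)
  also have "ennreal (e / 2) + ennreal (e / 2) = ennreal e"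
    using e by (simp flip: ennreal_plus)
  finally show "hausdorff_pre s \<delta> (A \<union> B) \<le> hausdorff_pre s \<delta> A + hausdorff_pre s \<delta> B + ennreal e" .
qed

lemma hausdorff_pre_empty: "s > 0 \<Longrightarrow> \<delta> \<ge> 0 \<Longrightarrow> hausdorff_pre s \<delta> {} = 0"
  using hausdorff_pre_le[of "{}" "\<lambda>_. {}" \<delta> s] by simp

lemma hausdorff_pre_UN_le:
  assumes "finite I" "s > 0" "\<delta> \<ge> 0"
  shows "hausdorff_pre s \<delta> (\<Union>i\<in>I. A i) \<le> (\<Sum>i\<in>I. hausdorff_pre s \<delta> (A i))"
  using assms(1)
proof (induction I rule: finite_induct)
  case (insert i I)
  have "hausdorff_pre s \<delta> (\<Union>i\<in>insert i I. A i) \<le> hausdorff_pre s \<delta> (A i) + hausdorff_pre s \<delta> (\<Union>i\<in>I. A i)"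
    using hausdorff_pre_Un_le[OF assms(2,3)] by simp
  also have "\<dots> \<le> hausdorff_pre s \<delta> (A i) + (\<Sum>i\<in>I. hausdorff_pre s \<delta> (A i))"
    by (intro add_left_mono insert)
  finally show ?case using insert by simp
qed (use assms in \<open>simp add: hausdorff_pre_empty\<close>)

text \<open>A covering set of diameter at most \<open>\<delta>\<close> meets at most one of the
  pieces, so a covering of the union splits into coverings of the pieces without using any set
  twice.\<close>

lemma sum_hausdorff_pre_le_separated:
  fixes A :: "'i \<Rightarrow> 'a::metric_space set"
  assumes I: "finite I" and s: "s > 0" and \<delta>: "\<delta> \<ge> 0"
    and sep: "\<And>i j x y. i \<in> I \<Longrightarrow> j \<in> I \<Longrightarrow> i \<noteq> j \<Longrightarrow> x \<in> A i \<Longrightarrow> y \<in> A j \<Longrightarrow> \<delta> < dist x y"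
  shows "(\<Sum>i\<in>I. hausdorff_pre s \<delta> (A i)) \<le> hausdorff_pre s \<delta> (\<Union>i\<in>I. A i)"
proof (rule hausdorff_pre_greatest)
  fix C :: "nat \<Rightarrow> 'a set"
  assume C: "(\<Union>i\<in>I. A i) \<subseteq> (\<Union>j. C j)" "\<And>j. bounded (C j)" "\<And>j. diameter (C j) \<le> \<delta>"
  define D where "D i j = (if C j \<inter> A i = {} then {} else C j)" for i j
  have "(\<Sum>i\<in>I. hausdorff_pre s \<delta> (A i)) \<le> (\<Sum>i\<in>I. \<Sum>j. hcost s (D i j))"
  proof (intro sum_mono hausdorff_pre_le)
    fix i assume i: "i \<in> I"
    show "A i \<subseteq> (\<Union>j. D i j)"
    proof
      fix x assume x: "x \<in> A i"
      then obtain j where "x \<in> C j" using C(1) i by blast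
      then have "x \<in> D i j" using x by (auto simp: D_def)
      then show "x \<in> (\<Union>j. D i j)" by blast
    qed
  qed (use C \<delta> in \<open>auto simp: D_def\<close>)
  also have "\<dots> = (\<Sum>j. \<Sum>i\<in>I. hcost s (D i j))"
    by (rule suminf_sum[symmetric]) simp
  also have "\<dots> \<le> (\<Sum>j. hcost s (C j))"
  proof (intro suminf_le summableI)
    fix j
    show "(\<Sum>i\<in>I. hcost s (D i j)) \<le> hcost s (C j)"
    proof (cases "\<exists>i\<in>I. C j \<inter> A i \<noteq> {}")
      case True
      then obtain i where i: "i \<in> I" "C j \<inter> A i \<noteq> {}" by auto
      have "D k j = {}" if "k \<in> I - {i}" for k
      proof (rule ccontr)
        assume "D k j \<noteq> {}"
        then obtain x y where "x \<in> C j" "x \<in> A i" "y \<in> C j" "y \<in> A k" using i by (auto simp: D_def split: if_splits)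
        then show False
          using sep[of i k x y] that i diameter_bounded_bound[OF C(2), of x j y] C(3)[of j] by (cases "i = k") simp_all
      qed
      then have "(\<Sum>i\<in>I. hcost s (D i j)) = hcost s (D i j)"
        using I i s by (subst sum.remove[OF I i(1)]) simp
      then show ?thesis using i by (simp add: D_def)
    qed (use s in \<open>simp add: D_def\<close>)
  qed
  finally show "(\<Sum>i\<in>I. hausdorff_pre s \<delta> (A i)) \<le> (\<Sum>j. hcost s (C j))" .
qed

lemma diameter_isometric_image:
  fixes f :: "'a::real_normed_vector \<Rightarrow> 'b::real_normed_vector"
  assumes "\<And>x y. dist (f x) (f y) = dist x y" "bounded S"
  shows "diameter (f ` S) = diameter S" "bounded (f ` S)"
proof -
  show b: "bounded (f ` S)"
    using assms(2) unfolding bounded_two_points by (simp add: assms(1))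
  show "diameter (f ` S) = diameter S"
  proof (rule antisym)
    show "diameter (f ` S) \<le> diameter S"
      using diameter_ge_0[OF assms(2)] diameter_bounded_bound[OF assms(2)] assms(1)
      by (intro diameter_le) (auto simp flip: dist_norm)
    have "dist x y \<le> diameter (f ` S)" if "x \<in> S" "y \<in> S" for x y
      using diameter_bounded_bound[OF b, of "f x" "f y"] that assms(1) by simp
    then show "diameter S \<le> diameter (f ` S)"
      using diameter_ge_0[OF b] by (intro diameter_le) (auto simp flip: dist_norm)
  qed
qed

lemma hausdorff_pre_isometric_image:
  fixes f :: "'a::real_normed_vector \<Rightarrow> 'b::real_normed_vector"
  assumes iso: "\<And>x y. dist (f x) (f y) = dist x y" and s: "s > 0"
  shows "hausdorff_pre s \<delta> (f ` A) = hausdorff_pre s \<delta> A"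
proof (rule antisym)
  show "hausdorff_pre s \<delta> (f ` A) \<le> hausdorff_pre s \<delta> A"
  proof (rule hausdorff_pre_greatest)
    fix C :: "nat \<Rightarrow> 'a set"
    assume C: "A \<subseteq> (\<Union>i. C i)" "\<And>i. bounded (C i)" "\<And>i. diameter (C i) \<le> \<delta>"
    have "f ` A \<subseteq> (\<Union>i. f ` C i)" using C(1) by blast
    then have "hausdorff_pre s \<delta> (f ` A) \<le> (\<Sum>i. hcost s (f ` C i))"
      using C by (intro hausdorff_pre_le) (auto simp: diameter_isometric_image iso)
    then show "hausdorff_pre s \<delta> (f ` A) \<le> (\<Sum>i. hcost s (C i))"
      using C by (simp add: diameter_isometric_image iso)
  qed
  show "hausdorff_pre s \<delta> A \<le> hausdorff_pre s \<delta> (f ` A)"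
  proof (rule hausdorff_pre_greatest)
    fix C :: "nat \<Rightarrow> 'b set"
    assume C: "f ` A \<subseteq> (\<Union>i. C i)" "\<And>i. bounded (C i)" "\<And>i. diameter (C i) \<le> \<delta>"
    have b: "bounded (f -` C i)" for i
      using C(2)[of i] unfolding bounded_two_points by (auto simp flip: iso)
    have d: "diameter (f -` C i) \<le> diameter (C i)" for i
      by (subst diameter_isometric_image(1)[OF iso b, symmetric], rule diameter_subset) (auto simp: C)
    have "hausdorff_pre s \<delta> A \<le> (\<Sum>i. hcost s (f -` C i))"
    proof (rule hausdorff_pre_le)
      show "A \<subseteq> (\<Union>i. f -` C i)" using C(1) by blast
      show "diameter (f -` C i) \<le> \<delta>" for i by (rule order_trans[OF d C(3)])
    qed (rule b)
    also have "\<dots> \<le> (\<Sum>i. hcost s (C i))"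
      using d s diameter_ge_0[OF b]
      by (intro suminf_le summableI ennreal_leI mult_left_mono powr_mono2) auto
    finally show "hausdorff_pre s \<delta> A \<le> (\<Sum>i. hcost s (C i))" .
  qed
qed

lemma hcost_DIM:
  fixes C :: "'a::euclidean_space set"
  assumes "bounded C"
  shows "hcost (real DIM('a)) C = ennreal (unit_ball_vol (real DIM('a)) * (diameter C / 2) ^ DIM('a))"
proof (cases "diameter C = 0")
  case False
  then have "diameter C > 0" using diameter_ge_0[OF assms] by simp
  then show ?thesis by (simp add: powr_realpow)
qed simp

text \<open>The isodiametric inequality bounds the volume of each covering set by its cost; it is
  applied to the closures, which are measurable and have the same diameter.\<close>

lemma emeasure_le_hausdorff_pre:
  fixes A :: "'a::euclidean_space set"
  shows "emeasure lborel A \<le> hausdorff_pre (real DIM('a)) \<delta> A"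
proof (rule hausdorff_pre_greatest)
  fix C :: "nat \<Rightarrow> 'a set"
  assume C: "A \<subseteq> (\<Union>i. C i)" "\<And>i. bounded (C i)"
  have "emeasure lborel A \<le> emeasure lborel (\<Union>i. closure (C i))"
    using C(1) closure_subset by (intro emeasure_mono) (auto, blast)
  also have "\<dots> \<le> (\<Sum>i. emeasure lborel (closure (C i)))"
    by (rule emeasure_subadditive_countably) auto
  also have "\<dots> \<le> (\<Sum>i. hcost (real DIM('a)) (C i))"
  proof (intro suminf_le summableI)
    fix i
    show "emeasure lborel (closure (C i)) \<le> hcost (real DIM('a)) (C i)"
      using isodiametric[of "closure (C i)"] C(2)[of i] bounded_closure[OF C(2), of i]
      by (simp add: hcost_DIM[OF C(2)] diameter_closure)
  qed
  finally show "emeasure lborel A \<le> (\<Sum>i. hcost (real DIM('a)) (C i))" .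
qed

lemma hcost_ball:
  fixes x :: "'a::euclidean_space"
  assumes "r > 0"
  shows "hcost (real DIM('a)) (ball x r) = emeasure lborel (ball x r)"
  using assms powr_realpow[OF assms, of "DIM('a)"] by (simp add: emeasure_ball)

lemma nn_integral_disjoint_balls_le:
  fixes a :: "'k \<Rightarrow> 'a::euclidean_space"
  assumes K: "countable K" "\<And>k. k \<in> K \<Longrightarrow> ball (a k) (r k) \<subseteq> U"
    and U: "U \<in> sets borel"
    and disj: "pairwise (\<lambda>i j. disjnt (ball (a i) (r i)) (ball (a j) (r j))) K"
  shows "(\<integral>\<^sup>+k. emeasure lborel (ball (a k) (r k)) \<partial>count_space K) \<le> emeasure lborel U"
proof -
  have "(\<integral>\<^sup>+k. emeasure lborel (ball (a k) (r k)) \<partial>count_space K) = emeasure lborel (\<Union>k\<in>K. ball (a k) (r k))"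
    using K disj by (intro emeasure_UN_countable[symmetric])
      (auto simp: disjoint_family_on_def pairwise_def disjnt_def)
  also have "\<dots> \<le> emeasure lborel U"
    using K U by (intro emeasure_mono) auto
  finally show ?thesis .
qed

text \<open>An open set of small volume around \<open>N\<close> contains disjoint balls whose
  fivefold enlargements cover \<open>N\<close>; their cost is at most \<open>5 ^ DIM('a)\<close>
  times that volume.\<close>

lemma hausdorff_pre_null:
  fixes N :: "'a::euclidean_space set"
  assumes N: "negligible N" and \<delta>: "\<delta> > 0"
  shows "hausdorff_pre (real DIM('a)) \<delta> N = 0"
proof -
  have "hausdorff_pre (real DIM('a)) \<delta> N \<le> 0 + ennreal e" if e: "e > 0" for e
  proof -
    have "N \<in> sets lebesgue" using N by (simp add: negligible_imp_sets)
    then obtain U where U: "open U" "N \<subseteq> U" "U - N \<in> lmeasurable" "emeasure lebesgue (U - N) < ennreal (e / 5 ^ DIM('a))"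
      using sets_lebesgue_outer_open[of N "e / 5 ^ DIM('a)"] e by auto
    have "emeasure lborel U = emeasure lebesgue U" using U(1) by (simp add: borel_open)
    also have "\<dots> \<le> emeasure lebesgue (U - N) + emeasure lebesgue N"
      using U N by (subst emeasure_subadditive[THEN order_trans[rotated]]) 
        (auto simp: negligible_imp_sets fmeasurableD Un_absorb2 intro!: emeasure_mono)
    also have "emeasure lebesgue N = 0"
      using N by (simp add: negligible_iff_null_sets null_sets_def)
    finally have Ue: "emeasure lborel U \<le> ennreal (e / 5 ^ DIM('a))"
      using U(4) by simp
    \<comment> \<open>Radius at most \<open>\<delta> / 10\<close>, so that the fivefold ball still
      has diameter at most \<open>\<delta>\<close>.\<close>
    define K where "K = {(x, r). 0 < r \<and> r \<le> \<delta> / 10 \<and> ball x r \<subseteq> (U :: 'a set)}"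
    have cov: "N \<subseteq> (\<Union>k\<in>K. ball (fst k) (snd k))"
    proof
      fix x assume "x \<in> N"
      then obtain r where r: "r > 0" "ball x r \<subseteq> U" using U openE by blast
      then have "(x, min r (\<delta> / 10)) \<in> K" using \<delta> by (auto simp: K_def)
      then show "x \<in> (\<Union>k\<in>K. ball (fst k) (snd k))"
        using r \<delta> by (intro UN_I[of "(x, min r (\<delta> / 10))"]) auto
    qed
    obtain C where C: "countable C" "C \<subseteq> K" "pairwise (\<lambda>i j. disjnt (ball (fst i) (snd i)) (ball (fst j) (snd j))) C"
      "N \<subseteq> (\<Union>i\<in>C. ball (fst i) (5 * snd i))"
    proof (rule Vitali_covering_lemma_balls[OF cov, of "\<delta> / 10"])
      show "0 < snd i \<and> snd i \<le> \<delta> / 10" if "i \<in> K" for i using that by (auto simp: K_def)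
    qed (rule that)
    have "hausdorff_pre (real DIM('a)) \<delta> N \<le> (\<integral>\<^sup>+k. hcost (real DIM('a)) (ball (fst k) (5 * snd k)) \<partial>count_space C)"
      using C \<delta> by (intro hausdorff_pre_le_countable) (auto simp: K_def split: if_splits)
    also have "\<dots> = (\<integral>\<^sup>+k. ennreal (5 ^ DIM('a)) * emeasure lborel (ball (fst k) (snd k)) \<partial>count_space C)"
    proof (rule nn_integral_cong)
      fix k assume "k \<in> space (count_space C)"
      then have k: "snd k > 0" using C(2) by (auto simp: K_def)
      show "hcost (real DIM('a)) (ball (fst k) (5 * snd k)) = ennreal (5 ^ DIM('a)) * emeasure lborel (ball (fst k) (snd k))"
        using k by (subst hcost_ball) (auto simp: emeasure_ball power_mult_distrib ac_simps simp flip: ennreal_mult')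
    qed
    also have "\<dots> = ennreal (5 ^ DIM('a)) * (\<integral>\<^sup>+k. emeasure lborel (ball (fst k) (snd k)) \<partial>count_space C)"
      by (rule nn_integral_cmult) simp
    also have "\<dots> \<le> ennreal (5 ^ DIM('a)) * ennreal (e / 5 ^ DIM('a))"
    proof (intro mult_left_mono order_trans[OF nn_integral_disjoint_balls_le Ue] C)
      show "ball (fst k) (snd k) \<subseteq> U" if "k \<in> C" for k
        using subsetD[OF C(2) that] by (simp add: K_def case_prod_beta)
    qed (use U in \<open>auto simp: borel_open\<close>)
    also have "\<dots> = ennreal e" by (simp flip: ennreal_mult')
    finally show ?thesis by simp
  qed
  note eps = this
  have "hausdorff_pre (real DIM('a)) \<delta> N \<le> 0"
  proof (rule ennreal_le_epsilon)
    show "hausdorff_pre (real DIM('a)) \<delta> N \<le> 0 + ennreal e" if "0 < e" for e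
      by (rule eps[OF that])
  qed
  then show ?thesis by simp
qed

text \<open>Vitali's covering theorem exhausts \<open>U\<close> by disjoint small balls up to a null
  set, and for a ball the cost is exactly its volume.\<close>

lemma hausdorff_pre_open_le:
  fixes U :: "'a::euclidean_space set"
  assumes U: "open U" and \<delta>: "\<delta> > 0"
  shows "hausdorff_pre (real DIM('a)) \<delta> U \<le> emeasure lborel U"
proof -
  define K where "K = {(x, r). 0 < r \<and> r \<le> \<delta> / 2 \<and> ball x r \<subseteq> (U :: 'a set)}"
  have cov: "\<exists>i. i \<in> K \<and> x \<in> ball (fst i) (snd i) \<and> snd i < d" if x: "x \<in> U" and d: "0 < d" for x d
  proof -
    obtain r where r: "r > 0" "ball x r \<subseteq> U" using U x openE by blast
    define t where "t = min (min r (\<delta> / 2)) (d / 2)"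
    have "0 < t" "t \<le> r" "t \<le> \<delta> / 2" "t < d" using r \<delta> d by (auto simp: t_def)
    then show ?thesis
      using r subset_ball[of t r x] by (intro exI[of _ "(x, t)"]) (auto simp: K_def)
  qed
  obtain C where C: "countable C" "C \<subseteq> K" "pairwise (\<lambda>i j. disjnt (ball (fst i) (snd i)) (ball (fst j) (snd j))) C"
      "negligible (U - (\<Union>i\<in>C. ball (fst i) (snd i)))"
  proof (rule Vitali_covering_theorem_balls[of U K fst snd])
    show "\<exists>i. i \<in> K \<and> x \<in> ball (fst i) (snd i) \<and> snd i < d" if "x \<in> U" "0 < d" for x d
      by (rule cov[OF that])
  qed (rule that)
  let ?B = "\<Union>i\<in>C. ball (fst i) (snd i)"
  have "hausdorff_pre (real DIM('a)) \<delta> U \<le> hausdorff_pre (real DIM('a)) \<delta> (?B \<union> (U - ?B))"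
    by (rule hausdorff_pre_mono) auto
  also have "\<dots> \<le> hausdorff_pre (real DIM('a)) \<delta> ?B + hausdorff_pre (real DIM('a)) \<delta> (U - ?B)"
    using \<delta> by (intro hausdorff_pre_Un_le) auto
  also have "hausdorff_pre (real DIM('a)) \<delta> (U - ?B) = 0"
    by (rule hausdorff_pre_null[OF C(4) \<delta>])
  also have "hausdorff_pre (real DIM('a)) \<delta> ?B \<le> (\<integral>\<^sup>+k. hcost (real DIM('a)) (ball (fst k) (snd k)) \<partial>count_space C)"
    using C \<delta> by (intro hausdorff_pre_le_countable) (auto simp: K_def split: if_splits)
  also have "\<dots> = (\<integral>\<^sup>+k. emeasure lborel (ball (fst k) (snd k)) \<partial>count_space C)"
    using C(2) by (intro nn_integral_cong hcost_ball) (auto simp: K_def)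
  also have "\<dots> \<le> emeasure lborel U"
  proof (intro nn_integral_disjoint_balls_le C)
    show "ball (fst k) (snd k) \<subseteq> U" if "k \<in> C" for k
      using subsetD[OF C(2) that] by (simp add: K_def case_prod_beta)
  qed (use U in \<open>auto simp: borel_open\<close>)
  finally show ?thesis by simp
qed

text \<open>Convexity makes the frontier negligible, which leaves the open interior. The value does
  not depend on \<open>\<delta>\<close>, so facets can later be compared at a scale adapted to their
  distances.\<close>

lemma hausdorff_pre_convex:
  fixes A :: "'a::euclidean_space set"
  assumes A: "convex A" "closed A" and \<delta>: "\<delta> > 0"
  shows "hausdorff_pre (real DIM('a)) \<delta> A = emeasure lborel A"
proof (rule antisym[OF _ emeasure_le_hausdorff_pre])
  have "hausdorff_pre (real DIM('a)) \<delta> A \<le> hausdorff_pre (real DIM('a)) \<delta> (interior A \<union> frontier A)"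
    by (rule hausdorff_pre_mono) (auto simp: frontier_def closure_subset[THEN subsetD])
  also have "\<dots> \<le> hausdorff_pre (real DIM('a)) \<delta> (interior A) + hausdorff_pre (real DIM('a)) \<delta> (frontier A)"
    using \<delta> by (intro hausdorff_pre_Un_le) auto
  also have "hausdorff_pre (real DIM('a)) \<delta> (frontier A) = 0"
    by (rule hausdorff_pre_null[OF negligible_convex_frontier[OF A(1)] \<delta>])
  also have "hausdorff_pre (real DIM('a)) \<delta> (interior A) \<le> emeasure lborel (interior A)"
    by (rule hausdorff_pre_open_le) (auto simp: \<delta>)
  also have "\<dots> \<le> emeasure lborel A"
    using A(2) by (intro emeasure_mono interior_subset) auto
  finally show "hausdorff_pre (real DIM('a)) \<delta> A \<le> emeasure lborel A" by simp
qed

lemma hausdorff_measure_const: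
  assumes "\<And>\<delta>. \<delta> > 0 \<Longrightarrow> hausdorff_pre s \<delta> A = v"
  shows "hausdorff_measure s A = v"
  unfolding hausdorff_measure_def using assms by (simp cong: SUP_cong_simp)

subsection \<open>Hausdorff measure of simplices\<close>

text \<open>An index type with CARD('d) - 1 elements, so that hyperplanes of real^'d can be
  parametrized by a Euclidean space (the maximum with 1 only serves nonemptiness).\<close>
typedef ('d::finite) facet_index = "{..<max 1 (CARD('d) - 1)}" by (rule exI[of _ 0]) simp

instantiation facet_index :: (finite) wellorder
begin
definition less_eq_facet_index :: "'a facet_index \<Rightarrow> 'a facet_index \<Rightarrow> bool" where
  "less_eq_facet_index x y \<longleftrightarrow> Rep_facet_index x \<le> Rep_facet_index y"
definition less_facet_index :: "'a facet_index \<Rightarrow> 'a facet_index \<Rightarrow> bool" where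
  "less_facet_index x y \<longleftrightarrow> Rep_facet_index x < Rep_facet_index y"
instance
proof
  fix P and a :: "'a facet_index"
  assume step: "\<And>x::'a facet_index. (\<And>y. y < x \<Longrightarrow> P y) \<Longrightarrow> P x"
  show "P a"
  proof (induction a rule: measure_induct_rule[of Rep_facet_index])
    case (less x)
    show ?case by (rule step, rule less) (simp add: less_facet_index_def)
  qed
next
  fix x y z :: "'a facet_index"
  show "x < y \<longleftrightarrow> x \<le> y \<and> \<not> y \<le> x" by (simp add: less_eq_facet_index_def less_facet_index_def less_le_not_le)
  show "x \<le> x" by (simp add: less_eq_facet_index_def)
  show "x \<le> y \<Longrightarrow> y \<le> z \<Longrightarrow> x \<le> z" by (simp add: less_eq_facet_index_def)
  show "x \<le> y \<Longrightarrow> y \<le> x \<Longrightarrow> x = y" by (simp add: less_eq_facet_index_def Rep_facet_index_inject[symmetric])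
  show "x \<le> y \<or> y \<le> x" by (simp add: less_eq_facet_index_def linear)
qed
end

lemma facet_index_UNIV: "(UNIV :: 'd::finite facet_index set) = Abs_facet_index ` {..<max 1 (CARD('d) - 1)}"
  using type_definition.Abs_image[OF type_definition_facet_index] by (rule sym)

instance facet_index :: (finite) finite
  by standard (simp add: facet_index_UNIV)

lemma CARD_facet_index: "CARD('d::finite) \<ge> 2 \<Longrightarrow> CARD('d facet_index) = CARD('d) - 1"
  using type_definition.card[OF type_definition_facet_index[where 'd='d]] by simp

text \<open>Permutations that move \<open>k0\<close> contribute 0 because row \<open>k0\<close> is a
  unit vector; the others correspond along \<open>\<beta>\<close> to permutations of the smaller
  index type, with the same sign.\<close>

lemma det_border:
  fixes w :: "'e::finite \<Rightarrow> real^'e" and \<beta> :: "'e \<Rightarrow> 'd::finite"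
  assumes \<beta>: "bij_betw \<beta> UNIV (UNIV - {k0})"
    and A: "A $ k0 = axis k0 1" "\<And>i. A $ \<beta> i $ k0 = 0" "\<And>i j. A $ \<beta> i $ \<beta> j = w i $ j"
  shows "det A = det (\<chi> i. w i)"
proof -
  have inj: "inj \<beta>" and rng: "range \<beta> = UNIV - {k0}" using \<beta> by (auto simp: bij_betw_def)
  let ?t = "\<lambda>p. of_int (sign p) * (\<Prod>i\<in>UNIV. A $ i $ p i)"
  have "det A = sum ?t {p. p permutes (UNIV::'d set)}" by (simp add: det_def)
  also have "\<dots> = sum ?t {p. p permutes range \<beta>}"
  proof (rule sum.mono_neutral_right)
    show "finite {p. p permutes (UNIV::'d set)}" by (simp add: finite_permutations)
    show "{p. p permutes range \<beta>} \<subseteq> {p. p permutes UNIV}" by (auto intro: permutes_subset)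
    show "\<forall>p\<in>{p. p permutes UNIV} - {p. p permutes range \<beta>}. ?t p = 0"
    proof
      fix p assume p: "p \<in> {p. p permutes (UNIV::'d set)} - {p. p permutes range \<beta>}"
      have "p k0 \<noteq> k0"
      proof
        assume "p k0 = k0"
        then have "p permutes range \<beta>" unfolding rng
          using p permutes_superset[of p UNIV "UNIV - {k0}"] by auto
        then show False using p by simp
      qed
      then have "A $ k0 $ p k0 = 0" by (simp add: A axis_def)
      then show "?t p = 0" by (auto intro!: prod_zero)
    qed
  qed
  also have "\<dots> = (\<Sum>q\<in>{q. q permutes (UNIV::'e set)}. ?t (map_permutation UNIV \<beta> q))"
  proof -
    have "bij_betw (map_permutation UNIV \<beta>) {q. q permutes UNIV} {p. p permutes range \<beta>}"
    proof (rule bij_betw_byWitness[where f'="map_permutation (range \<beta>) (inv \<beta>)"])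
      show "\<forall>q\<in>{q. q permutes UNIV}. map_permutation (range \<beta>) (inv \<beta>) (map_permutation UNIV \<beta> q) = q"
        using inj by (intro ballI map_permutation_compose_inv) (auto simp: bij_betw_def)
      show "\<forall>p\<in>{p. p permutes range \<beta>}. map_permutation UNIV \<beta> (map_permutation (range \<beta>) (inv \<beta>) p) = p"
        using inj by (intro ballI map_permutation_compose_inv)
          (auto simp: bij_betw_def inj_on_inv_into f_inv_into_f)
      show "map_permutation UNIV \<beta> ` {q. q permutes UNIV} \<subseteq> {p. p permutes range \<beta>}"
        using inj by (auto intro!: map_permutation_permutes simp: bij_betw_def)
      show "map_permutation (range \<beta>) (inv \<beta>) ` {p. p permutes range \<beta>} \<subseteq> {q. q permutes UNIV}"
        using inj by (auto intro!: map_permutation_permutes[of _ "range \<beta>"] simp: bij_betw_def inj_on_inv_into)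
    qed
    then show ?thesis by (rule sum.reindex_bij_betw[symmetric])
  qed
  also have "\<dots> = (\<Sum>q\<in>{q. q permutes (UNIV::'e set)}. of_int (sign q) * (\<Prod>i\<in>UNIV. (\<chi> i. w i) $ i $ q i))"
  proof (rule sum.cong[OF refl])
    fix q :: "'e \<Rightarrow> 'e" assume q: "q \<in> {q. q permutes UNIV}"
    let ?p = "map_permutation UNIV \<beta> q"
    have p: "?p permutes range \<beta>"
      using inj q by (auto intro!: map_permutation_permutes simp: bij_betw_def)
    have "?p k0 = k0" using p by (rule permutes_not_in) (simp add: rng)
    then have k0: "A $ k0 $ ?p k0 = 1" by (simp add: A axis_def)
    have "(\<Prod>i\<in>UNIV. A $ i $ ?p i) = (\<Prod>i\<in>insert k0 (range \<beta>). A $ i $ ?p i)"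
      unfolding rng by (rule prod.cong) auto
    also have "\<dots> = (\<Prod>i\<in>range \<beta>. A $ i $ ?p i)"
      using k0 by (subst prod.insert) (auto simp: rng)
    also have "\<dots> = (\<Prod>j\<in>UNIV. A $ \<beta> j $ ?p (\<beta> j))"
      using inj by (simp add: prod.reindex)
    also have "\<dots> = (\<Prod>j\<in>UNIV. w j $ q j)"
      using inj by (simp add: map_permutation_apply A)
    finally have "(\<Prod>i\<in>UNIV. A $ i $ ?p i) = (\<Prod>j\<in>UNIV. w j $ q j)" .
    moreover have "sign ?p = sign q"
      using inj q by (intro sign_map_permutation) auto
    ultimately show "?t ?p = of_int (sign q) * (\<Prod>i\<in>UNIV. (\<chi> i. w i) $ i $ q i)" by simp
  qed
  also have "\<dots> = det (\<chi> i. w i)" by (simp add: det_def)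
  finally show ?thesis .
qed

text \<open>The generalised cross product: the cofactors of row \<open>k0\<close> in the matrix
  whose other rows are the \<open>w k\<close>. Its length is the volume of the parallelotope spanned
  by these rows.\<close>

definition crossp :: "'d \<Rightarrow> ('d \<Rightarrow> real^'d) \<Rightarrow> real^'d::finite" where
  "crossp k0 w = (\<chi> i. det (\<chi> k. if k = k0 then axis i 1 else w k))"

lemma inner_crossp: "crossp k0 w \<bullet> x = det (\<chi> k. if k = k0 then x else w k)"
proof -
  have "det (\<chi> k. if k = k0 then x else w k) = det (\<chi> k. if k = k0 then (\<Sum>i\<in>UNIV. x $ i *s axis i 1) else w k)"
    by (simp only: basis_expansion)
  also have "\<dots> = (\<Sum>i\<in>UNIV. det (\<chi> k. if k = k0 then x $ i *s axis i 1 else w k))"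
    by (rule det_linear_row_sum) simp
  also have "\<dots> = (\<Sum>i\<in>UNIV. x $ i * det (\<chi> k. if k = k0 then axis i 1 else w k))"
    by (intro sum.cong refl det_row_mul)
  finally show ?thesis by (simp add: crossp_def inner_vec_def mult.commute)
qed

lemma inner_crossp_row: "k \<noteq> k0 \<Longrightarrow> crossp k0 w \<bullet> w k = 0"
  unfolding inner_crossp by (rule det_identical_rows[of k0 k]) (auto simp: row_def vec_eq_iff)

lemma det_rows_orthogonal_transformation:
  fixes g :: "real^'d \<Rightarrow> real^'d::finite"
  assumes g: "orthogonal_transformation g"
  shows "\<bar>det (\<chi> k. g (r k))\<bar> = \<bar>det (\<chi> k. r k)\<bar>"
proof -
  have lin: "linear g" using g by (simp add: orthogonal_transformation_linear)
  have "(\<chi> k. g (r k)) = (\<chi> k. r k) ** transpose (matrix g)"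
  proof -
    have "g (r k) $ j = (\<Sum>i\<in>UNIV. r k $ i * matrix g $ j $ i)" for k j
    proof -
      have "matrix g *v r k = g (r k)"
        using lin by (intro matrix_works) (simp add: linear_matrix_vector_mul_eq)
      then have "g (r k) $ j = (matrix g *v r k) $ j" by simp
      then show ?thesis by (simp add: matrix_vector_mult_def mult.commute)
    qed
    then show ?thesis by (simp add: vec_eq_iff matrix_matrix_mult_def transpose_def)
  qed
  moreover have "\<bar>det (matrix g)\<bar> = 1"
    using g det_orthogonal_matrix[of "matrix g"] by (auto simp: orthogonal_transformation_matrix)
  ultimately show ?thesis by (simp add: det_mul abs_mult)
qed

text \<open>A rotation takes the coordinate hyperplane \<open>x $ k0 = 0\<close>, a copy of
  \<open>real^'d facet_index\<close>, to the direction of the hyperplane through \<open>Y\<close>.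
  So the simplex is an isometric image of a full-dimensional one, for which the premeasure is
  Lebesgue measure. Its volume is a determinant of size d - 1; bordered by the unit normal
  \<open>u\<close> it becomes \<open>c \<bullet> u\<close>, the length of the cross product.\<close>

lemma hausdorff_pre_simplex:
  fixes Y :: "'d::finite \<Rightarrow> real^'d"
  assumes d2: "CARD('d) \<ge> 2" and c0: "crossp k0 (\<lambda>k. Y k - Y k0) \<noteq> 0" and \<delta>: "\<delta> > 0"
  shows "hausdorff_pre (real CARD('d) - 1) \<delta> (convex hull (range Y))
    = ennreal (norm (crossp k0 (\<lambda>k. Y k - Y k0)) / fact (CARD('d) - 1))"
proof -
  define w where "w k = Y k - Y k0" for k
  define c where "c = crossp k0 w"
  have c: "c \<noteq> 0" using c0 by (simp add: c_def w_def[abs_def])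
  define u where "u = c /\<^sub>R norm c"
  have u: "norm u = 1" "c \<bullet> u = norm c"
    using c by (auto simp: u_def dot_square_norm power2_eq_square)
  obtain f :: "real^'d \<Rightarrow> real^'d" where f: "orthogonal_transformation f" "f (axis k0 1) = u"
  proof (rule orthogonal_transformation_exists_1[of "axis k0 1" u])
    show "norm (axis k0 1 :: real^'d) = 1" by (simp add: norm_axis_1)
  qed (use u(1) that in auto)
  define g where "g = inv f"
  have g: "orthogonal_transformation g" unfolding g_def by (rule orthogonal_transformation_inv[OF f(1)])
  have fg: "f (g x) = x" for x
    unfolding g_def using f(1) by (simp add: orthogonal_transformation_surj surj_f_inv_f)
  have gf: "g (f x) = x" for x
    unfolding g_def using f(1) by (simp add: orthogonal_transformation_inj inv_f_f)
  have "card (UNIV - {k0}) = CARD('d facet_index)" by (simp add: CARD_facet_index[OF d2] card_Diff_singleton)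
  then obtain \<beta> :: "'d facet_index \<Rightarrow> 'd" where \<beta>: "bij_betw \<beta> UNIV (UNIV - {k0})"
    using finite_same_card_bij[of "UNIV :: 'd facet_index set" "UNIV - {k0}"] by auto
  have inj: "inj \<beta>" and rng: "range \<beta> = UNIV - {k0}" using \<beta> by (auto simp: bij_betw_def)
  have \<beta>k0: "\<beta> j \<noteq> k0" for j using rng by blast
  \<comment> \<open>\<open>\<iota>\<close> embeds the smaller space isometrically as the hyperplane
    with vanishing coordinate \<open>k0\<close>; \<open>\<pi>\<close> inverts it there.\<close>
  define \<iota> :: "real^'d facet_index \<Rightarrow> real^'d" where "\<iota> z = (\<chi> k. if k = k0 then 0 else z $ inv \<beta> k)" for z
  define \<pi> :: "real^'d \<Rightarrow> real^'d facet_index" where "\<pi> x = (\<chi> j. x $ \<beta> j)" for x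
  have \<iota>\<pi>: "\<iota> (\<pi> x) = x" if "x $ k0 = 0" for x
  proof -
    have "x $ \<beta> (inv \<beta> k) = x $ k" if "k \<noteq> k0" for k
      using that rng by (simp add: f_inv_into_f)
    then show ?thesis using that by (auto simp: \<iota>_def \<pi>_def vec_eq_iff)
  qed
  have lin\<iota>: "linear \<iota>"
    by (rule linearI) (auto simp: \<iota>_def vec_eq_iff)
  have norm\<iota>: "norm (\<iota> z) = norm z" for z
  proof -
    have "(\<Sum>k\<in>UNIV. (\<iota> z $ k)\<^sup>2) = (\<Sum>k\<in>insert k0 (range \<beta>). (\<iota> z $ k)\<^sup>2)"
      unfolding rng by (rule sum.cong) auto
    also have "\<dots> = (\<Sum>k\<in>range \<beta>. (\<iota> z $ k)\<^sup>2)"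
      by (subst sum.insert) (auto simp: rng \<iota>_def)
    also have "\<dots> = (\<Sum>j\<in>UNIV. (z $ j)\<^sup>2)"
      using inj by (simp add: sum.reindex \<iota>_def \<beta>k0)
    finally show ?thesis by (simp add: norm_vec_def L2_set_def)
  qed
  define v where "v j = \<pi> (g (w (\<beta> j)))" for j
  have gw0: "g (w k) $ k0 = 0" if "k \<noteq> k0" for k
  proof -
    have "g (w k) $ k0 = g (w k) \<bullet> g u"
      by (simp add: f(2)[symmetric] gf inner_axis)
    also have "\<dots> = w k \<bullet> u" using g by (simp add: orthogonal_transformation_def)
    also have "\<dots> = 0" using inner_crossp_row[OF that, of w] by (simp add: u_def c_def inner_commute)
    finally show ?thesis .
  qed
  have \<iota>v: "\<iota> (v j) = g (w (\<beta> j))" for j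
    unfolding v_def by (rule \<iota>\<pi>[OF gw0[OF \<beta>k0]])
  define F where "F z = Y k0 + f (\<iota> z)" for z
  have linf: "linear f" using f(1) by (simp add: orthogonal_transformation_linear)
  have lin: "linear (f \<circ> \<iota>)" by (rule linear_compose[OF lin\<iota> linf])
  have F_dist: "dist (F x) (F y) = dist x y" for x y
  proof -
    have "dist (F x) (F y) = norm ((f \<circ> \<iota>) (x - y))"
      unfolding linear_diff[OF lin] by (simp add: F_def dist_norm)
    also have "\<dots> = norm (x - y)" using f(1) by (simp add: orthogonal_transformation_norm norm\<iota>)
    finally show ?thesis by (simp add: dist_norm)
  qed
  let ?X = "insert 0 (range v)"
  have "F ` (convex hull ?X) = (+) (Y k0) ` ((f \<circ> \<iota>) ` (convex hull ?X))"
    by (auto simp: F_def image_image)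
  also have "\<dots> = convex hull ((+) (Y k0) ` ((f \<circ> \<iota>) ` ?X))"
    by (simp only: convex_hull_linear_image[OF lin] convex_hull_translation)
  also have "(+) (Y k0) ` ((f \<circ> \<iota>) ` ?X) = range Y"
  proof -
    have "(f \<circ> \<iota>) (v j) = w (\<beta> j)" for j by (simp add: \<iota>v fg)
    moreover have "(f \<circ> \<iota>) 0 = 0" using linear_0[OF lin] .
    ultimately have "(+) (Y k0) ` ((f \<circ> \<iota>) ` ?X) = insert (Y k0) (Y ` range \<beta>)"
      by (auto simp: w_def image_image)
    also have "\<dots> = range Y" unfolding rng by auto
    finally show ?thesis .
  qed
  finally have img: "F ` (convex hull ?X) = convex hull (range Y)" .
  have det: "\<bar>det (\<chi> j. v j)\<bar> = norm c"
  proof -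
    have "det (\<chi> k. g (if k = k0 then u else w k)) = det (\<chi> j. v j)"
    proof (rule det_border[OF \<beta>])
      show "(\<chi> k. g (if k = k0 then u else w k)) $ k0 = axis k0 1"
        by (simp add: f(2)[symmetric] gf)
    qed (auto simp: \<beta>k0 gw0 v_def \<pi>_def)
    then have "\<bar>det (\<chi> j. v j)\<bar> = \<bar>det (\<chi> k. if k = k0 then u else w k)\<bar>"
      using det_rows_orthogonal_transformation[OF g, of "\<lambda>k. if k = k0 then u else w k"] by simp
    also have "\<dots> = norm c" using u(2) by (simp add: inner_crossp[symmetric] c_def[symmetric])
    finally show ?thesis .
  qed
  have injv: "inj v"
  proof (rule injI, rule ccontr)
    fix i j assume "v i = v j" "i \<noteq> j"
    then have "det (\<chi> j. v j) = 0"
      by (intro det_identical_rows[of i j]) (auto simp: row_def vec_eq_iff)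
    then show False using det c by simp
  qed
  have v0: "v j \<noteq> 0" for j
  proof
    assume "v j = 0"
    then have "det (\<chi> j. v j) = 0"
      by (intro det_zero_row(1)[of j]) (auto simp: row_def vec_eq_iff)
    then show False using det c by simp
  qed
  have "measure lborel (convex hull ?X) = \<bar>det (\<chi> i j. v j $ i - 0 $ i)\<bar> / fact (CARD('d facet_index))"
  proof (rule content_simplex)
    have "0 \<notin> range v" using v0 by (metis rangeE)
    then show "card ?X = Suc CARD('d facet_index)" "bij_betw v UNIV (?X - {0})"
      using injv by (auto simp: card_image bij_betw_def)
  qed auto
  also have "(\<chi> i j. v j $ i - 0 $ i) = transpose (\<chi> j. v j)"
    by (simp add: transpose_def vec_eq_iff)
  finally have vol: "measure lborel (convex hull ?X) = norm c / fact (CARD('d) - 1)"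
    by (simp add: det det_transpose CARD_facet_index[OF d2])
  have cpt: "compact (convex hull ?X)" by (intro finite_imp_compact_convex_hull) auto
  have D: "real CARD('d) - 1 = real DIM(real^'d facet_index)"
    using d2 by (simp add: CARD_facet_index)
  have "hausdorff_pre (real CARD('d) - 1) \<delta> (convex hull (range Y)) = hausdorff_pre (real CARD('d) - 1) \<delta> (convex hull ?X)"
    unfolding img[symmetric] by (rule hausdorff_pre_isometric_image[OF F_dist]) (use d2 in simp)
  also have "\<dots> = emeasure lborel (convex hull ?X)"
    unfolding D using cpt \<delta> by (intro hausdorff_pre_convex) (auto simp: compact_imp_closed)
  also have "\<dots> = ennreal (measure lborel (convex hull ?X))"
    using emeasure_compact_finite[OF cpt] by (intro emeasure_eq_ennreal_measure) auto
  finally show ?thesis by (simp add: vol c_def w_def[abs_def])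
qed

subsection \<open>Facets of polytopes in general position\<close>

text \<open>The vectors \<open>w k\<close> with \<open>k \<noteq> k0\<close>, together with their
  cross product c, form an invertible matrix of determinant \<open>c \<bullet> c\<close>; it
  annihilates the part of \<open>a\<close> orthogonal to c.\<close>

lemma crossp_kernel:
  fixes w :: "'d::finite \<Rightarrow> real^'d"
  assumes c: "crossp k0 w \<noteq> 0" and a: "\<And>k. k \<noteq> k0 \<Longrightarrow> a \<bullet> w k = 0"
  shows "a = (a \<bullet> crossp k0 w / (crossp k0 w \<bullet> crossp k0 w)) *\<^sub>R crossp k0 w"
proof -
  define c where "c = crossp k0 w"
  define a' where "a' = a - (a \<bullet> c / (c \<bullet> c)) *\<^sub>R c"
  let ?A = "\<chi> k. if k = k0 then c else w k"
  have "det ?A \<noteq> 0" unfolding inner_crossp[symmetric] using c by (simp add: c_def)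
  then have inv: "invertible ?A" by (simp add: invertible_det_nz)
  have "?A *v a' = 0"
  proof -
    have "(if k = k0 then c else w k) \<bullet> a' = 0" for k
      using c a[of k] inner_crossp_row[of k k0 w]
      by (auto simp: a'_def inner_diff_right inner_commute c_def)
    then show ?thesis by (simp add: vec_eq_iff matrix_vector_mul_component)
  qed
  moreover obtain B where B: "B ** ?A = mat 1" using inv unfolding invertible_def by blast
  moreover have "a' = B *v (?A *v a')" unfolding matrix_vector_mul_assoc B by simp
  ultimately have "a' = 0" by simp
  then show ?thesis by (simp add: a'_def c_def)
qed

text \<open>If the differences spanned less than d - 1 dimensions, some nonzero vector would be
  orthogonal to all of them and to the cross product, against \<open>crossp_kernel\<close>.\<close>

lemma aff_dim_simplex:
  fixes Y :: "'d::finite \<Rightarrow> real^'d"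
  assumes c: "crossp k0 (\<lambda>k. Y k - Y k0) \<noteq> 0"
  shows "aff_dim (range Y) = int CARD('d) - 1"
proof -
  define w where "w k = Y k - Y k0" for k
  define c where "c = crossp k0 w"
  have c: "c \<noteq> 0" using assms by (simp add: c_def w_def[abs_def])
  have sub: "range w \<subseteq> {x. c \<bullet> x = 0}"
    using inner_crossp_row[of _ k0 w] by (auto simp: c_def w_def[of k0])
      (metis inner_zero_right diff_self w_def)
  have "dim (range w) \<le> CARD('d) - 1"
    using dim_subset[OF sub] dim_hyperplane[OF c] by simp
  moreover have "\<not> dim (range w) < CARD('d) - 1"
  proof
    assume less: "dim (range w) < CARD('d) - 1"
    have "dim (insert c (range w)) < DIM(real^'d)"
      using less by (auto simp: dim_insert)
    then obtain a where a: "a \<noteq> 0" "\<And>x. x \<in> span (insert c (range w)) \<Longrightarrow> orthogonal a x"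
      using orthogonal_to_subspace_exists[of "insert c (range w)"] by blast
    have "a \<bullet> w k = 0" "a \<bullet> c = 0" for k
      using a(2)[of "w k"] a(2)[of c] by (auto simp: orthogonal_def span_base)
    then show False using crossp_kernel[of k0 w a] c a(1) by (simp add: c_def)
  qed
  ultimately have "dim (range w) = CARD('d) - 1" by simp
  moreover have "aff_dim (range Y) = int (dim ((\<lambda>x. x - Y k0) ` range Y))"
    by (rule aff_dim_eq_dim_subtract) (auto intro: hull_inc)
  moreover have "(\<lambda>x. x - Y k0) ` range Y = range w" by (auto simp: w_def)
  ultimately show ?thesis by (simp add: of_nat_diff Suc_leI)
qed

text \<open>The face cut out by the hyperplane is spanned by the points of \<open>T\<close> on it,
  which are those of \<open>Y\<close>. It has dimension d - 1 by \<open>aff_dim_simplex\<close>, and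
  a point off the hyperplane raises the dimension of the hull to d.\<close>

lemma facet_of_simplex_if_le:
  fixes Y :: "'d::finite \<Rightarrow> real^'d"
  assumes T: "finite T" "range Y \<subseteq> T" and c: "crossp k0 (\<lambda>k. Y k - Y k0) \<noteq> 0"
    and a: "\<And>k. a \<bullet> Y k = b" and other: "\<And>x. x \<in> T - range Y \<Longrightarrow> a \<bullet> x < b" and ne: "T \<noteq> range Y"
  shows "convex hull (range Y) facet_of convex hull T"
proof -
  have le: "\<And>x. x \<in> T \<Longrightarrow> a \<bullet> x \<le> b" using a other by fastforce
  then have hull_le: "convex hull T \<subseteq> {x. a \<bullet> x \<le> b}"
    by (intro hull_minimal) (auto simp: convex_halfspace_le)
  define F where "F = convex hull T \<inter> {x. a \<bullet> x = b}"
  have F: "F face_of convex hull T"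
    unfolding F_def by (rule face_of_Int_supporting_hyperplane_le) (use hull_le in auto)
  then obtain T' where T': "T' \<subseteq> T" "F = convex hull T'"
    using face_of_convex_hull_subset[of T F] T finite_imp_compact by metis
  have "T' \<subseteq> range Y"
  proof
    fix x assume x: "x \<in> T'"
    then have "x \<in> F" "x \<in> T" using T' by (auto intro: hull_inc)
    then show "x \<in> range Y" using other[of x] by (auto simp: F_def)
  qed
  then have "F \<subseteq> convex hull (range Y)" unfolding T'(2) by (rule hull_mono)
  moreover have "convex hull (range Y) \<subseteq> F"
  proof -
    have "convex hull (range Y) \<subseteq> {x. a \<bullet> x = b}"
      by (rule hull_minimal) (auto simp: a convex_hyperplane)
    then show ?thesis unfolding F_def using hull_mono[OF T(2)] by blast
  qed
  ultimately have Fe: "F = convex hull (range Y)" by blast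
  obtain x where x: "x \<in> T" "x \<notin> range Y" using T(2) ne by blast
  have "x \<in> convex hull T" "x \<notin> F" using x other[of x] by (auto simp: F_def intro: hull_inc)
  then have "aff_dim F < aff_dim (convex hull T)"
    using face_of_aff_dim_lt[OF convex_convex_hull F] by auto
  moreover have "aff_dim (convex hull T) \<le> int CARD('d)"
    using aff_dim_le_DIM[of "convex hull T"] by simp
  moreover have "aff_dim F = int CARD('d) - 1"
    unfolding Fe aff_dim_convex_hull by (rule aff_dim_simplex[OF c])
  ultimately have "aff_dim F = aff_dim (convex hull T) - 1" by linarith
  then show ?thesis using F unfolding Fe by (simp add: facet_of_def)
qed

text \<open>For the direct implication, the normal of a hyperplane that cuts out the facet is a
  multiple \<open>\<mu>\<close> of \<open>c\<close> by \<open>crossp_kernel\<close>, and the sign of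
  \<open>\<mu>\<close> decides the side. Both sides occur because the orientation of
  \<open>c\<close> depends on the enumeration \<open>Y\<close>.\<close>

lemma facet_of_simplex_iff:
  fixes Y :: "'d::finite \<Rightarrow> real^'d" and k0 :: 'd
  defines "c \<equiv> crossp k0 (\<lambda>k. Y k - Y k0)"
  assumes T: "finite T" "range Y \<subseteq> T" and c: "c \<noteq> 0"
    and other: "\<And>x. x \<in> T - range Y \<Longrightarrow> c \<bullet> x \<noteq> c \<bullet> Y k0" and ne: "T \<noteq> range Y"
  shows "convex hull (range Y) facet_of convex hull T \<longleftrightarrow>
    (\<forall>x\<in>T. c \<bullet> x \<le> c \<bullet> Y k0) \<or> (\<forall>x\<in>T. c \<bullet> Y k0 \<le> c \<bullet> x)"
proof
  have cY: "c \<bullet> Y k = c \<bullet> Y k0" for k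
    using inner_crossp_row[of k k0 "\<lambda>k. Y k - Y k0"] by (cases "k = k0") (auto simp: c_def inner_diff_right)
  {
    assume "(\<forall>x\<in>T. c \<bullet> x \<le> c \<bullet> Y k0) \<or> (\<forall>x\<in>T. c \<bullet> Y k0 \<le> c \<bullet> x)"
    then show "convex hull (range Y) facet_of convex hull T"
    proof
      assume le: "\<forall>x\<in>T. c \<bullet> x \<le> c \<bullet> Y k0"
      show ?thesis
        by (rule facet_of_simplex_if_le[OF T c[unfolded c_def], of c "c \<bullet> Y k0"])
          (use le other cY ne in \<open>auto simp: less_le\<close>)
    next
      assume ge: "\<forall>x\<in>T. c \<bullet> Y k0 \<le> c \<bullet> x"
      have "- c \<bullet> x < - c \<bullet> Y k0" if "x \<in> T - range Y" for x
        using ge other[OF that] that by (auto simp: less_le)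
      then show ?thesis
        by (intro facet_of_simplex_if_le[OF T c[unfolded c_def], of "- c" "- c \<bullet> Y k0"]) (use cY ne in auto)
    qed
  }
  assume "convex hull (range Y) facet_of convex hull T"
  moreover have "polyhedron (convex hull T)" using T(1) by (rule polyhedron_convex_hull)
  ultimately obtain a b where ab: "a \<noteq> 0" "convex hull T \<subseteq> {x. a \<bullet> x \<le> b}"
      "convex hull (range Y) = convex hull T \<inter> {x. a \<bullet> x = b}"
    by (metis facet_of_polyhedron)
  have aY: "a \<bullet> Y k = b" for k
    using hull_inc[of "Y k" "range Y" convex] ab(3) by auto
  define \<mu> where "\<mu> = a \<bullet> c / (c \<bullet> c)"
  have "a = \<mu> *\<^sub>R c"
    unfolding \<mu>_def c_def by (rule crossp_kernel) (use c aY in \<open>auto simp: c_def inner_diff_right\<close>)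
  then have ax: "a \<bullet> x = \<mu> * (c \<bullet> x)" for x by simp
  have \<mu>: "\<mu> \<noteq> 0" using \<open>a = \<mu> *\<^sub>R c\<close> ab(1) by auto
  have le: "\<mu> * (c \<bullet> x) \<le> \<mu> * (c \<bullet> Y k0)" if "x \<in> T" for x
  proof -
    have "a \<bullet> x \<le> b" using that ab(2) hull_inc[of x T convex] by auto
    then show ?thesis using aY[of k0] by (simp add: ax)
  qed
  show "(\<forall>x\<in>T. c \<bullet> x \<le> c \<bullet> Y k0) \<or> (\<forall>x\<in>T. c \<bullet> Y k0 \<le> c \<bullet> x)"
  proof (cases "\<mu> > 0")
    case True then show ?thesis using le by simp
  next
    case False
    then have "\<mu> < 0" using \<mu> by simp
    then show ?thesis using le by simp
  qed
qed

text \<open>Any d distinct points of \<open>T\<close> span a hyperplane, and no further point of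
  \<open>T\<close> lies on it. The cross product form is the one that the facet criterion
  consumes.\<close>

definition general_position :: "'d \<Rightarrow> (real^'d::finite) set \<Rightarrow> bool" where
  "general_position k0 T \<longleftrightarrow> (\<forall>Y. inj Y \<and> range Y \<subseteq> T \<longrightarrow>
     crossp k0 (\<lambda>k. Y k - Y k0) \<noteq> 0 \<and>
     (\<forall>x\<in>T - range Y. crossp k0 (\<lambda>k. Y k - Y k0) \<bullet> x \<noteq> crossp k0 (\<lambda>k. Y k - Y k0) \<bullet> Y k0))"

lemma enumerate_subset:
  assumes "finite S" "CARD('d::finite) \<le> card S"
  obtains Y :: "'d::finite \<Rightarrow> 'a" where "inj Y" "range Y \<subseteq> S"
proof -
  obtain S' where S': "S' \<subseteq> S" "card S' = CARD('d)" "finite S'"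
    using obtain_subset_with_card_n[OF assms(2)] by metis
  then obtain Y :: "'d \<Rightarrow> 'a" where "bij_betw Y UNIV S'"
    using finite_same_card_bij[of "UNIV :: 'd set" S'] by auto
  then show ?thesis using that S' by (auto simp: bij_betw_def)
qed

lemma aff_dim_general_position:
  fixes T :: "(real^'d::finite) set"
  assumes T: "finite T" and gp: "general_position k0 T" and S: "S \<subseteq> T" "CARD('d) + 1 \<le> card S"
  shows "aff_dim S = int CARD('d)"
proof -
  have fS: "finite S" using S T finite_subset by blast
  then obtain Y :: "'d \<Rightarrow> real^'d" where Y: "inj Y" "range Y \<subseteq> S"
    using S by (metis add_leD1 enumerate_subset)
  have "card (range Y) = CARD('d)" using Y by (simp add: card_image)
  then have "range Y \<noteq> S" using S(2) by auto
  then obtain x where x: "x \<in> S" "x \<notin> range Y" using Y by blast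
  let ?c = "crossp k0 (\<lambda>k. Y k - Y k0)"
  have c: "?c \<noteq> 0" "?c \<bullet> x \<noteq> ?c \<bullet> Y k0"
    using gp x Y S unfolding general_position_def by (meson Diff_iff subset_iff subset_trans)+
  have cY: "?c \<bullet> Y k = ?c \<bullet> Y k0" for k
    using inner_crossp_row[of k k0 "\<lambda>k. Y k - Y k0"] by (cases "k = k0") (auto simp: inner_diff_right)
  have "x \<notin> affine hull (range Y)"
  proof
    assume "x \<in> affine hull (range Y)"
    moreover have "affine hull (range Y) \<subseteq> {x. ?c \<bullet> x = ?c \<bullet> Y k0}"
    proof (rule hull_minimal)
      show "range Y \<subseteq> {x. ?c \<bullet> x = ?c \<bullet> Y k0}" using cY by blast
    qed (rule affine_hyperplane)
    ultimately have "x \<in> {x. ?c \<bullet> x = ?c \<bullet> Y k0}" by (rule subsetD[rotated])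
    then show False using c(2) by blast
  qed
  then have "aff_dim (insert x (range Y)) = int CARD('d)"
    using aff_dim_simplex[OF c(1)] by (simp add: aff_dim_insert)
  moreover have "aff_dim (insert x (range Y)) \<le> aff_dim S"
    using x Y by (intro aff_dim_subset) auto
  moreover have "aff_dim S \<le> int CARD('d)" using aff_dim_le_DIM[of S] by simp
  ultimately show ?thesis by simp
qed

text \<open>A facet is the hull of a set of points of affine dimension d - 1; fewer than d points
  have smaller dimension, and more than d points in general position have dimension d.\<close>

lemma facet_of_general_position:
  fixes T :: "(real^'d::finite) set"
  assumes T: "finite T" "CARD('d) + 1 \<le> card T" and gp: "general_position k0 T"
    and F: "F facet_of convex hull T"
  obtains S where "S \<subseteq> T" "card S = CARD('d)" "F = convex hull S"
proof -
  note full = aff_dim_general_position[OF T(1) gp]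
  obtain S where S: "S \<subseteq> T" "F = convex hull S"
    using face_of_convex_hull_subset[of T F] T finite_imp_compact facet_of_imp_face_of[OF F] by metis
  have "aff_dim S = int CARD('d) - 1"
    using F full[OF order_refl T(2)] by (simp add: facet_of_def S(2) aff_dim_convex_hull)
  then have "\<not> CARD('d) + 1 \<le> card S" using full[OF S(1)] by auto
  moreover have "aff_dim S \<le> int (card S) - 1"
    using S T by (intro aff_dim_le_card) (auto intro: finite_subset)
  ultimately have "card S = CARD('d)" using \<open>aff_dim S = int CARD('d) - 1\<close> by simp
  then show ?thesis using that S by blast
qed

lemma frontier_general_position:
  fixes T :: "(real^'d::finite) set"
  assumes T: "finite T" "CARD('d) + 1 \<le> card T" and gp: "general_position k0 T"
  shows "frontier (convex hull T) = \<Union>{F. F facet_of convex hull T}"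
proof -
  have "aff_dim (convex hull T) = int DIM(real^'d)"
    using aff_dim_general_position[OF T(1) gp order_refl T(2)] by (simp add: aff_dim_convex_hull)
  then have "affine hull (convex hull T) = UNIV" by (simp only: aff_dim_eq_full)
  then have "rel_interior (convex hull T) = interior (convex hull T)" by (rule rel_interior_interior)
  then have "frontier (convex hull T) = rel_frontier (convex hull T)"
    by (simp add: frontier_def rel_frontier_def)
  also have "\<dots> = \<Union>{F. F facet_of convex hull T}"
    using T(1) by (intro rel_frontier_of_polyhedron polyhedron_convex_hull)
  finally show ?thesis .
qed

lemma crossp_scaleR: "crossp k0 (\<lambda>k. s *\<^sub>R w k) = s ^ (CARD('d) - 1) *\<^sub>R crossp k0 (w :: 'd::finite \<Rightarrow> real^'d)"
proof -
  have "det (\<chi> k. if k = k0 then axis i 1 else s *\<^sub>R w k)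
     = s ^ (CARD('d) - 1) * det (\<chi> k. if k = k0 then axis i 1 else w k)" for i
  proof -
    have "(\<chi> k. if k = k0 then axis i 1 else s *\<^sub>R w k) =
      (\<chi> k. (if k = k0 then 1 else s) *s (if k = k0 then axis i 1 else w k))"
      by (simp add: vec_eq_iff)
    then have "det (\<chi> k. if k = k0 then axis i 1 else s *\<^sub>R w k) =
      (\<Prod>k\<in>UNIV. if k = k0 then 1 else s) * det (\<chi> k. if k = k0 then axis i 1 else w k)"
      by (simp only: det_rows_mul)
    also have "(\<Prod>k\<in>UNIV. if k = k0 then 1 else s) = s ^ (CARD('d) - 1)"
      by (subst prod.remove[of _ k0]) (auto simp: card_Diff_singleton)
    finally show ?thesis .
  qed
  then show ?thesis by (simp add: crossp_def vec_eq_iff)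
qed

lemma hausdorff_measure_simplex:
  fixes Y :: "'d::finite \<Rightarrow> real^'d"
  assumes "CARD('d) \<ge> 2" "crossp k0 (\<lambda>k. Y k - Y k0) \<noteq> 0"
  shows "hausdorff_measure (real CARD('d) - 1) (convex hull (range Y))
    = ennreal (norm (crossp k0 (\<lambda>k. Y k - Y k0)) / fact (CARD('d) - 1))"
  by (intro hausdorff_measure_const hausdorff_pre_simplex assms)

lemma disjoint_compact_separated:
  fixes C :: "'i \<Rightarrow> 'a::euclidean_space set"
  assumes I: "finite I" and C: "\<And>i. i \<in> I \<Longrightarrow> compact (C i)"
    and disj: "\<And>i j. i \<in> I \<Longrightarrow> j \<in> I \<Longrightarrow> i \<noteq> j \<Longrightarrow> C i \<inter> C j = {}"
  obtains \<delta> where "\<delta> > 0" "\<And>i j x y. i \<in> I \<Longrightarrow> j \<in> I \<Longrightarrow> i \<noteq> j \<Longrightarrow> x \<in> C i \<Longrightarrow> y \<in> C j \<Longrightarrow> \<delta> < dist x y"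
proof -
  have "\<forall>p\<in>I \<times> I. \<exists>d>0. fst p \<noteq> snd p \<longrightarrow> (\<forall>x\<in>C (fst p). \<forall>y\<in>C (snd p). d \<le> dist x y)"
  proof
    fix p assume p: "p \<in> I \<times> I"
    show "\<exists>d>0. fst p \<noteq> snd p \<longrightarrow> (\<forall>x\<in>C (fst p). \<forall>y\<in>C (snd p). d \<le> dist x y)"
    proof (cases "fst p = snd p")
      case True then show ?thesis by (intro exI[of _ 1]) auto
    next
      case False
      then show ?thesis
        using separate_compact_closed[of "C (fst p)" "C (snd p)"] C p disj[of "fst p" "snd p"]
        by (auto simp: compact_imp_closed)
    qed
  qed
  then obtain d where d: "\<And>p. p \<in> I \<times> I \<Longrightarrow> d p > 0"
    "\<And>p x y. p \<in> I \<times> I \<Longrightarrow> fst p \<noteq> snd p \<Longrightarrow> x \<in> C (fst p) \<Longrightarrow> y \<in> C (snd p) \<Longrightarrow> d p \<le> dist x y"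
    by (metis (no_types, lifting) bchoice)
  \<comment> \<open>Half of the minimum gives the strict inequality; the inserted 1 keeps the set
    nonempty.\<close>
  define \<delta> where "\<delta> = Min (insert 1 (d ` (I \<times> I))) / 2"
  have fin: "finite (insert 1 (d ` (I \<times> I)))" using I by simp
  have pos: "0 < Min (insert 1 (d ` (I \<times> I)))"
    using fin d(1) by (subst Min_gr_iff) auto
  show ?thesis
  proof (rule that)
    show "\<delta> > 0" using pos by (simp add: \<delta>_def)
    fix i j x y assume ij: "i \<in> I" "j \<in> I" "i \<noteq> j" "x \<in> C i" "y \<in> C j"
    have "Min (insert 1 (d ` (I \<times> I))) \<le> d (i, j)" using fin ij by (intro Min_le) auto
    also have "\<dots> \<le> dist x y" using d(2)[of "(i, j)" x y] ij by simp
    finally show "\<delta> < dist x y" using pos by (simp add: \<delta>_def)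
  qed
qed

text \<open>The intersection of two different faces of equal dimension is a proper face of each and
  so misses the relative interiors.\<close>

lemma disjoint_rel_interior_faces:
  fixes Q :: "'a::euclidean_space set"
  assumes Q: "convex Q" and F: "F face_of Q" "G face_of Q" "F \<noteq> G" and dim: "aff_dim F = aff_dim G"
  shows "rel_interior F \<inter> rel_interior G = {}"
proof -
  have cG: "convex G" using F(2) by (rule face_of_imp_convex)
  have FG: "F \<inter> G face_of F"
    using face_of_subset[OF face_of_Int[OF F(1,2)], of F] F(1) by (auto dest: face_of_imp_subset)
  have "F \<inter> G \<noteq> F"
  proof
    assume "F \<inter> G = F"
    then have "F \<subseteq> G" by auto
    then have "F face_of G" using face_of_subset[OF F(1), of G] F(2) by (auto dest: face_of_imp_subset)
    then show False using face_of_aff_dim_lt[OF cG] F(3) dim by fastforce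
  qed
  then have "F \<inter> G \<inter> rel_interior F = {}" by (rule face_of_disjoint_rel_interior[OF FG])
  then show ?thesis using rel_interior_subset[of F] rel_interior_subset[of G] by blast
qed

text \<open>The bound from above is subadditivity. For the other one, each simplex is shrunk by the
  factor \<open>1 - t\<close> towards a relative interior point. The shrunken copies are compact and
  disjoint, hence separated at some scale, at which the premeasure is additive; letting
  \<open>t\<close> tend to 0 restores the full areas.\<close>

lemma hausdorff_measure_Un_simplices:
  fixes Y :: "'i \<Rightarrow> 'd::finite \<Rightarrow> real^'d"
  assumes d2: "CARD('d) \<ge> 2" and I: "finite I"
    and c: "\<And>i. i \<in> I \<Longrightarrow> crossp k0 (\<lambda>k. Y i k - Y i k0) \<noteq> 0"
    and Q: "convex Q" "\<And>i. i \<in> I \<Longrightarrow> convex hull (range (Y i)) face_of Q"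
    and inj: "inj_on (\<lambda>i. convex hull (range (Y i))) I"
  shows "hausdorff_measure (real CARD('d) - 1) (\<Union>i\<in>I. convex hull (range (Y i)))
     = (\<Sum>i\<in>I. hausdorff_measure (real CARD('d) - 1) (convex hull (range (Y i))))"
proof -
  define s where "s = real CARD('d) - 1"
  have s: "s > 0" using d2 by (simp add: s_def)
  define v where "v i = norm (crossp k0 (\<lambda>k. Y i k - Y i k0)) / fact (CARD('d) - 1)" for i
  have v0: "v i \<ge> 0" for i by (simp add: v_def)
  let ?F = "\<lambda>i. convex hull (range (Y i))"
  have F: "hausdorff_pre s \<delta> (?F i) = ennreal (v i)" if "i \<in> I" "\<delta> > 0" for i \<delta>
    unfolding s_def v_def by (rule hausdorff_pre_simplex[OF d2 c[OF that(1)] that(2)])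
  have Hm: "hausdorff_measure s (?F i) = ennreal (v i)" if "i \<in> I" for i
    by (rule hausdorff_measure_const) (rule F[OF that])
  have "hausdorff_measure s (\<Union>i\<in>I. ?F i) \<le> (\<Sum>i\<in>I. ennreal (v i))"
    unfolding hausdorff_measure_def
  proof (rule SUP_least)
    fix \<delta> :: real assume "\<delta> \<in> {0<..}"
    then have \<delta>: "\<delta> > 0" by simp
    have "hausdorff_pre s \<delta> (\<Union>i\<in>I. ?F i) \<le> (\<Sum>i\<in>I. hausdorff_pre s \<delta> (?F i))"
      using I s \<delta> by (intro hausdorff_pre_UN_le) auto
    also have "\<dots> = (\<Sum>i\<in>I. ennreal (v i))"
      by (rule sum.cong[OF refl]) (rule F[OF _ \<delta>])
    finally show "hausdorff_pre s \<delta> (\<Union>i\<in>I. ?F i) \<le> (\<Sum>i\<in>I. ennreal (v i))" .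
  qed
  moreover have "(\<Sum>i\<in>I. ennreal (v i)) \<le> hausdorff_measure s (\<Union>i\<in>I. ?F i)"
  proof -
    have ri: "\<exists>b. b \<in> rel_interior (?F i)" for i
      using rel_interior_eq_empty[of "?F i"] by auto
    then obtain b where b: "\<And>i. b i \<in> rel_interior (?F i)" by metis
    have shrink: "ennreal ((1 - t) ^ (CARD('d) - 1) * (\<Sum>i\<in>I. v i)) \<le> hausdorff_measure s (\<Union>i\<in>I. ?F i)"
      if t: "0 < t" "t < 1" for t
    proof -
      \<comment> \<open>Moving every vertex by the fraction \<open>t\<close> towards
        \<open>b i\<close> puts the whole simplex into its relative interior.\<close>
      define Z where "Z i k = Y i k - t *\<^sub>R (Y i k - b i)" for i k
      let ?G = "\<lambda>i. convex hull (range (Z i))"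
      have G: "?G i \<subseteq> rel_interior (?F i)" for i
      proof (rule hull_minimal)
        show "range (Z i) \<subseteq> rel_interior (?F i)"
          unfolding Z_def using t b by (auto intro!: rel_interior_convex_shrink hull_inc)
      qed (simp add: convex_rel_interior)
      have Zd: "Z i k - Z i k0 = (1 - t) *\<^sub>R (Y i k - Y i k0)" for i k
        by (simp add: Z_def algebra_simps)
      obtain \<delta> where \<delta>: "\<delta> > 0"
        "\<And>i j x y. i \<in> I \<Longrightarrow> j \<in> I \<Longrightarrow> i \<noteq> j \<Longrightarrow> x \<in> ?G i \<Longrightarrow> y \<in> ?G j \<Longrightarrow> \<delta> < dist x y"
      proof (rule disjoint_compact_separated[OF I, of ?G])
        show "compact (?G i)" for i by (intro finite_imp_compact_convex_hull) simp
        show "?G i \<inter> ?G j = {}" if ij: "i \<in> I" "j \<in> I" "i \<noteq> j" for i j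
        proof -
          have "rel_interior (?F i) \<inter> rel_interior (?F j) = {}"
          proof (rule disjoint_rel_interior_faces[OF Q(1) Q(2) Q(2)])
            show "?F i \<noteq> ?F j" using inj ij by (auto dest: inj_onD)
            show "aff_dim (?F i) = aff_dim (?F j)"
              using aff_dim_simplex[OF c[OF ij(1)]] aff_dim_simplex[OF c[OF ij(2)]]
              by (simp add: aff_dim_convex_hull)
          qed (use ij in auto)
          then show ?thesis using G[of i] G[of j] by blast
        qed
      qed (rule that)
      have Gv: "hausdorff_pre s \<delta> (?G i) = ennreal ((1 - t) ^ (CARD('d) - 1) * v i)" if "i \<in> I" for i
      proof -
        have "crossp k0 (\<lambda>k. Z i k - Z i k0) = (1 - t) ^ (CARD('d) - 1) *\<^sub>R crossp k0 (\<lambda>k. Y i k - Y i k0)"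
          unfolding Zd by (rule crossp_scaleR)
        then show ?thesis
          using hausdorff_pre_simplex[OF d2 _ \<delta>(1), of k0 "Z i"] c[OF that] t
          by (simp add: s_def v_def)
      qed
      have "ennreal ((1 - t) ^ (CARD('d) - 1) * (\<Sum>i\<in>I. v i)) = (\<Sum>i\<in>I. hausdorff_pre s \<delta> (?G i))"
        using t v0 by (simp add: Gv sum_distrib_left)
      also have "\<dots> \<le> hausdorff_pre s \<delta> (\<Union>i\<in>I. ?G i)"
        using \<delta>(1) by (intro sum_hausdorff_pre_le_separated[OF I s] \<delta>(2)) auto
      also have "\<dots> \<le> hausdorff_pre s \<delta> (\<Union>i\<in>I. ?F i)"
        using G rel_interior_subset by (intro hausdorff_pre_mono UN_mono) blast+
      also have "\<dots> \<le> hausdorff_measure s (\<Union>i\<in>I. ?F i)"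
        unfolding hausdorff_measure_def using \<delta>(1) by (intro SUP_upper) auto
      finally show ?thesis .
    qed
    have "ennreal (\<Sum>i\<in>I. v i) \<le> hausdorff_measure s (\<Union>i\<in>I. ?F i)"
    proof (rule tendsto_upperbound)
      show "((\<lambda>t. ennreal ((1 - t) ^ (CARD('d) - 1) * (\<Sum>i\<in>I. v i))) \<longlongrightarrow> ennreal (\<Sum>i\<in>I. v i)) (at_right 0)"
        by (rule tendsto_ennrealI) (auto intro!: tendsto_eq_intros)
      show "\<forall>\<^sub>F t in at_right 0. ennreal ((1 - t) ^ (CARD('d) - 1) * (\<Sum>i\<in>I. v i)) \<le> hausdorff_measure s (\<Union>i\<in>I. ?F i)"
      proof -
        have "\<forall>\<^sub>F t in at_right 0. t \<in> {0<..<1::real}" by (rule eventually_at_right_real) simp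
        then show ?thesis by (rule eventually_mono) (rule shrink, auto)
      qed
    qed simp
    then show ?thesis using v0 by simp
  qed
  ultimately have "hausdorff_measure s (\<Union>i\<in>I. ?F i) = (\<Sum>i\<in>I. ennreal (v i))" by (rule antisym)
  then show ?thesis using Hm by (simp add: s_def)
qed

abbreviation facet_area :: "(real^'d::finite) set \<Rightarrow> (real^'d) set \<Rightarrow> ennreal" where
  "facet_area S P \<equiv> if convex hull S facet_of P then hausdorff_measure (real CARD('d) - 1) (convex hull S) else 0"

text \<open>The sum runs over all candidate vertex sets, with 0 for those that span no facet. In
  this form the index set \<open>K\<close> can be the configurations, which do not depend on the
  random points.\<close>

lemma hausdorff_measure_frontier:
  fixes T :: "(real^'d::finite) set"
  assumes d2: "CARD('d) \<ge> 2" and T: "finite T" "CARD('d) + 1 \<le> card T" and gp: "general_position k0 T"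
    and K: "bij_betw S K {S. S \<subseteq> T \<and> card S = CARD('d)}"
  shows "hausdorff_measure (real CARD('d) - 1) (frontier (convex hull T))
    = (\<Sum>A\<in>K. facet_area (S A) (convex hull T))"
proof -
  have finK: "finite K" using K T bij_betw_finite[of S K] by simp
  define K' where "K' = {A\<in>K. convex hull (S A) facet_of convex hull T}"
  have "\<forall>A\<in>K. \<exists>Y :: 'd \<Rightarrow> real^'d. inj Y \<and> range Y = S A"
  proof
    fix A assume "A \<in> K"
    then have "S A \<subseteq> T" "card (S A) = CARD('d)" using K by (auto simp: bij_betw_def)
    then obtain Y :: "'d \<Rightarrow> real^'d" where "bij_betw Y UNIV (S A)"
      using finite_same_card_bij[of "UNIV :: 'd set" "S A"] T finite_subset[of "S A" T] by auto
    then show "\<exists>Y :: 'd \<Rightarrow> real^'d. inj Y \<and> range Y = S A" by (auto simp: bij_betw_def)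
  qed
  then obtain Y where Y: "\<And>A. A \<in> K \<Longrightarrow> inj (Y A)" "\<And>A. A \<in> K \<Longrightarrow> range (Y A :: 'd \<Rightarrow> real^'d) = S A"
    by metis
  have ST: "S A \<subseteq> T" if "A \<in> K" for A using K that by (auto simp: bij_betw_def)
  have gpY: "crossp k0 (\<lambda>k. Y A k - Y A k0) \<noteq> 0"
    "\<And>x. x \<in> T - S A \<Longrightarrow> crossp k0 (\<lambda>k. Y A k - Y A k0) \<bullet> x \<noteq> crossp k0 (\<lambda>k. Y A k - Y A k0) \<bullet> Y A k0"
    if "A \<in> K" for A
    using gp Y[OF that] ST[OF that] unfolding general_position_def by metis+
  \<comment> \<open>A candidate is recovered from its hull: the hyperplane through
    \<open>S A\<close> contains no other point of \<open>T\<close>.\<close>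
  have inj: "A = B" if AB: "A \<in> K" "B \<in> K" "convex hull (S A) = convex hull (S B)" for A B
  proof -
    have sub: "S B \<subseteq> S A" if AB: "A \<in> K" "B \<in> K" "convex hull (S A) = convex hull (S B)" for A B
    proof
      fix x assume x: "x \<in> S B"
      let ?c = "crossp k0 (\<lambda>k. Y A k - Y A k0)"
      have cY: "?c \<bullet> Y A k = ?c \<bullet> Y A k0" for k
        using inner_crossp_row[of k k0 "\<lambda>k. Y A k - Y A k0"] by (cases "k = k0") (auto simp: inner_diff_right)
      have "convex hull (range (Y A)) \<subseteq> {x. ?c \<bullet> x = ?c \<bullet> Y A k0}"
      proof (rule hull_minimal)
        show "range (Y A) \<subseteq> {x. ?c \<bullet> x = ?c \<bullet> Y A k0}" using cY by blast
      qed (rule convex_hyperplane)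
      moreover have "x \<in> convex hull (range (Y A))" unfolding Y(2)[OF AB(1)] AB(3) using x by (rule hull_inc)
      ultimately have "x \<in> {x. ?c \<bullet> x = ?c \<bullet> Y A k0}" by (rule subsetD)
      then show "x \<in> S A" using gpY(2)[OF AB(1), of x] ST[OF AB(2)] x by blast
    qed
    have "S A = S B" using sub[OF AB] sub[OF AB(2,1) AB(3)[symmetric]] by blast
    then show ?thesis using K AB by (auto simp: bij_betw_def dest: inj_onD)
  qed
  have "frontier (convex hull T) = (\<Union>A\<in>K'. convex hull (range (Y A)))"
  proof -
    have "F facet_of convex hull T \<longleftrightarrow> (\<exists>A\<in>K'. F = convex hull (range (Y A)))" for F
    proof
      assume F: "F facet_of convex hull T"
      obtain S' where S': "S' \<subseteq> T" "card S' = CARD('d)" "F = convex hull S'"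
        by (rule facet_of_general_position[OF T gp F])
      then have "S' \<in> S ` K" using K by (simp add: bij_betw_def)
      then obtain A where A: "A \<in> K" "S' = S A" by blast
      then have "A \<in> K'" using F S' by (simp add: K'_def)
      then show "\<exists>A\<in>K'. F = convex hull (range (Y A))" using S'(3) A(2) Y(2)[OF A(1)] by (intro bexI[of _ A]) simp_all
    qed (auto simp: K'_def Y(2))
    then show ?thesis unfolding frontier_general_position[OF T gp] by blast
  qed
  also have "hausdorff_measure (real CARD('d) - 1) \<dots> =
    (\<Sum>A\<in>K'. hausdorff_measure (real CARD('d) - 1) (convex hull (range (Y A))))"
  proof (rule hausdorff_measure_Un_simplices[OF d2 _ _ convex_convex_hull[of T], where ?k0.0=k0])
    show "finite K'" using finK by (simp add: K'_def)
    show "crossp k0 (\<lambda>k. Y i k - Y i k0) \<noteq> 0" if "i \<in> K'" for i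
      using gpY(1)[of i] that by (simp add: K'_def)
    show "convex hull (range (Y i)) face_of convex hull T" if "i \<in> K'" for i
      using that Y(2)[of i] by (auto simp: K'_def facet_of_imp_face_of)
    show "inj_on (\<lambda>i. convex hull (range (Y i))) K'"
      using inj Y(2) by (auto simp: inj_on_def K'_def)
  qed
  also have "\<dots> = (\<Sum>A\<in>K'. hausdorff_measure (real CARD('d) - 1) (convex hull (S A)))"
    by (rule sum.cong) (auto simp: Y(2) K'_def)
  also have "\<dots> = (\<Sum>A\<in>K. facet_area (S A) (convex hull T))"
    unfolding K'_def using finK by (simp add: sum.inter_filter)
  finally show ?thesis .
qed

subsection \<open>One-dimensional walks and bridges\<close>

lemma PiM_gauss_reindex:
  assumes "inj_on f J" "f ` J \<subseteq> I"
  shows "distr (PiM I (\<lambda>_. gauss :: 'b::euclidean_space measure)) (gaussians J) (\<lambda>x. \<lambda>j\<in>J. x (f j)) = gaussians J"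
  using distr_PiM_reindex[of I "\<lambda>_. gauss :: 'b measure" f J] assms gauss.prob_space_axioms by auto

lemma measurable_reindex:
  assumes "f ` J \<subseteq> I"
  shows "(\<lambda>x. \<lambda>j\<in>J. x (f j)) \<in> PiM I (\<lambda>_. M) \<rightarrow>\<^sub>M PiM J (\<lambda>_. M)"
  using assms by (intro measurable_restrict measurable_component_singleton) auto

lemma measure_PiM_gauss_reindex:
  assumes "inj_on f J" "f ` J \<subseteq> I" "E \<in> sets (PiM J (\<lambda>_. gauss :: 'b::euclidean_space measure))"
  shows "measure (gaussians I) {x \<in> space (gaussians I). (\<lambda>j\<in>J. x (f j)) \<in> E} = measure (gaussians J) E"
  by (subst PiM_gauss_reindex[OF assms(1,2), symmetric], subst measure_distr)
     (use assms in \<open>auto intro!: measurable_reindex arg_cong[where f="measure _"]\<close>)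

text \<open>Almost sure statements are proved by revealing one coordinate last, the others being
  fixed.\<close>

lemma AE_PiM_insert:
  fixes I :: "'i set" and M :: "'a measure"
  assumes M: "prob_space M" and I: "finite I" "i \<notin> I"
    and P: "{x \<in> space (PiM (insert i I) (\<lambda>_. M)). P x} \<in> sets (PiM (insert i I) (\<lambda>_. M))"
    and AE: "AE x in PiM I (\<lambda>_. M). AE y in M. P (x(i := y))"
  shows "AE x in PiM (insert i I) (\<lambda>_. M). P x"
proof -
  interpret M: prob_space M by fact
  interpret product_sigma_finite "\<lambda>_::'i. M" ..
  let ?N = "{x \<in> space (PiM (insert i I) (\<lambda>_. M)). \<not> P x}"
  have N: "?N \<in> sets (PiM (insert i I) (\<lambda>_. M))"
    using sets.compl_sets[OF P] by (auto simp: set_diff_eq elim!: back_subst[where P="\<lambda>X. X \<in> _"])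
  have "emeasure (PiM (insert i I) (\<lambda>_. M)) ?N = (\<integral>\<^sup>+x. \<integral>\<^sup>+y. indicator ?N (x(i := y)) \<partial>M \<partial>PiM I (\<lambda>_. M))"
    unfolding nn_integral_indicator[OF N, symmetric]
    by (rule product_nn_integral_insert[OF I]) (use N in simp)
  also have "\<dots> = (\<integral>\<^sup>+x. 0 \<partial>PiM I (\<lambda>_. M))"
  proof (rule nn_integral_cong_AE, use AE in eventually_elim)
    fix x assume "AE y in M. P (x(i := y))"
    then have "(\<integral>\<^sup>+y. indicator ?N (x(i := y)) \<partial>M) = (\<integral>\<^sup>+y. 0 \<partial>M)"
      by (intro nn_integral_cong_AE) (auto elim!: eventually_mono simp: indicator_def)
    then show "(\<integral>\<^sup>+y. indicator ?N (x(i := y)) \<partial>M) = 0" by simp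
  qed
  finally have "?N \<in> null_sets (PiM (insert i I) (\<lambda>_. M))" using N by (auto simp: null_sets_def)
  then show ?thesis by (rule AE_I') auto
qed

lemma AE_gauss_not_in_null:
  assumes "negligible N" "N \<in> sets borel"
  shows "AE x in (gauss :: 'b::euclidean_space measure). x \<notin> N"
proof -
  have "N \<in> null_sets lborel" using assms by (auto simp: negligible_iff_null_sets null_sets_completion_iff)
  then have "AE x in lborel. x \<notin> N" by (rule AE_not_in)
  then show ?thesis unfolding gauss_def by (subst AE_density) (auto elim!: eventually_mono)
qed

lemma AE_gauss_inner_neq:
  fixes c :: "'b::euclidean_space"
  assumes "c \<noteq> 0"
  shows "AE x in gauss. c \<bullet> x \<noteq> b"
  using AE_gauss_not_in_null[of "{x. c \<bullet> x = b}"] assms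
  by (simp add: negligible_hyperplane)

lemma AE_linear_neq:
  fixes c :: "'i \<Rightarrow> real"
  assumes I: "finite I" "i \<in> I" and c: "c i \<noteq> 0"
  shows "AE x in PiM I (\<lambda>_. gauss :: real measure). (\<Sum>k\<in>I. c k * x k) \<noteq> b"
proof -
  have I': "insert i (I - {i}) = I" using I by auto
  have "AE x in PiM (insert i (I - {i})) (\<lambda>_. gauss :: real measure). (\<Sum>k\<in>I. c k * x k) \<noteq> b"
  proof (rule AE_PiM_insert[OF gauss.prob_space_axioms])
    show "{x \<in> space (gaussians (insert i (I - {i}))). (\<Sum>k\<in>I. c k * x k) \<noteq> b} \<in> sets (PiM (insert i (I - {i})) (\<lambda>_. gauss :: real measure))"
      unfolding I' by measurable
    show "AE x in gaussians (I - {i}). AE y in gauss. (\<Sum>k\<in>I. c k * (x(i := y)) k) \<noteq> b"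
    proof (rule AE_I2)
      fix x
      have "(\<Sum>k\<in>I. c k * (x(i := y)) k) = c i \<bullet> y + (\<Sum>k\<in>I - {i}. c k * x k)" for y
        using I by (subst sum.remove[OF I]) auto
      then show "AE y in gauss. (\<Sum>k\<in>I. c k * (x(i := y)) k) \<noteq> b"
        using AE_gauss_inner_neq[OF c, of "b - (\<Sum>k\<in>I - {i}. c k * x k)"]
        by (auto elim!: eventually_mono)
    qed
  qed (use I in auto)
  then show ?thesis unfolding I' .
qed

lemma indep_vars_PiM_gauss:
  assumes "I \<noteq> {}"
  shows "prob_space.indep_vars (gaussians I) (\<lambda>_. gauss :: 'b::euclidean_space measure) (\<lambda>i x. x i) I"
proof -
  interpret P: prob_space "PiM I (\<lambda>_. gauss :: 'b measure)"
    by (intro prob_space_PiM gauss.prob_space_axioms)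
  have "distr (gaussians I) (gaussians I) (\<lambda>x. \<lambda>i\<in>I. x i) = PiM I (\<lambda>_. gauss :: 'b measure)"
    using PiM_gauss_reindex[of "\<lambda>x. x" I I] by simp
  also have "\<dots> = PiM I (\<lambda>i. distr (gaussians I) gauss (\<lambda>x. x i))"
    by (intro PiM_cong refl distr_PiM_component[symmetric] gauss.prob_space_axioms)
  finally show ?thesis
    by (subst P.indep_vars_iff_distr_eq_PiM'[OF assms]) auto
qed

lemma measure_PiM_gauss_blocks:
  fixes K :: "'k \<Rightarrow> 'i set"
  assumes B: "finite B" and K: "\<And>q. q \<in> B \<Longrightarrow> K q \<subseteq> I" and disj: "disjoint_family_on K B"
    and E: "\<And>q. q \<in> B \<Longrightarrow> E q \<in> sets (PiM (K q) (\<lambda>_. gauss :: 'b::euclidean_space measure))"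
  shows "measure (gaussians I) {x \<in> space (gaussians I). \<forall>q\<in>B. restrict x (K q) \<in> E q}
    = (\<Prod>q\<in>B. measure (gaussians (K q)) (E q))"
proof (cases "B = {}")
  case True
  interpret P: prob_space "PiM I (\<lambda>_. gauss :: 'b measure)"
    by (intro prob_space_PiM gauss.prob_space_axioms)
  show ?thesis using True P.prob_space by simp
next
  case False
  \<comment> \<open>\<open>indep_vars_PiM_gauss\<close> asks for a nonempty index set; a dummy index
    leaves the probability unchanged.\<close>
  define I' where "I' = insert undefined I"
  interpret P: prob_space "PiM I' (\<lambda>_. gauss :: 'b measure)"
    by (intro prob_space_PiM gauss.prob_space_axioms)
  have K': "\<And>q. q \<in> B \<Longrightarrow> K q \<subseteq> I'" using K by (auto simp: I'_def)
  have m: "(\<lambda>x. restrict x (K q)) \<in> PiM I (\<lambda>_. gauss :: 'b measure) \<rightarrow>\<^sub>M gaussians (K q)"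
    if "q \<in> B" for q
    using K[OF that] by (rule measurable_restrict_subset)
  have "{x \<in> space (gaussians I). restrict x (K q) \<in> E q} \<in> sets (PiM I (\<lambda>_. gauss :: 'b measure))"
    if "q \<in> B" for q
    using measurable_sets[OF m[OF that] E[OF that]] by (simp add: vimage_def Int_def conj_commute)
  then have S: "{x \<in> space (gaussians I). \<forall>q\<in>B. restrict x (K q) \<in> E q} \<in> sets (PiM I (\<lambda>_. gauss :: 'b measure))"
    using B by (intro sets.sets_Collect_finite_All')  (auto simp: False)
  have "measure (gaussians I) {x \<in> space (gaussians I). \<forall>q\<in>B. restrict x (K q) \<in> E q}
     = measure (gaussians I') {x \<in> space (gaussians I'). (\<lambda>j\<in>I. x j) \<in> {x \<in> space (gaussians I). \<forall>q\<in>B. restrict x (K q) \<in> E q}}"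
    by (rule measure_PiM_gauss_reindex[OF _ _ S, symmetric]) (auto simp: I'_def)
  also have "{x \<in> space (gaussians I'). (\<lambda>j\<in>I. x j) \<in> {x \<in> space (gaussians I). \<forall>q\<in>B. restrict x (K q) \<in> E q}}
     = (\<Inter>q\<in>B. (\<lambda>x. restrict (\<lambda>i. x i) (K q)) -` E q \<inter> space (PiM I' (\<lambda>_. gauss :: 'b measure)))"
  proof -
    have "restrict (restrict x I) (K q) = restrict x (K q)" if "q \<in> B" for q and x :: "'i \<Rightarrow> 'b"
      using K[OF that] by (simp add: Int_absorb1)
    moreover have "(\<lambda>j\<in>I. x j) \<in> space (PiM I (\<lambda>_. gauss :: 'b measure))" for x by (simp add: space_PiM)
    ultimately show ?thesis using False by auto
  qed
  also have "measure (gaussians I') \<dots> = (\<Prod>q\<in>B. measure (gaussians I') ((\<lambda>x. restrict (\<lambda>i. x i) (K q)) -` E q \<inter> space (gaussians I')))"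
    using P.indep_vars_restrict[OF indep_vars_PiM_gauss K' disj] False B E
    by (intro P.indep_varsD[where I=B and M'="\<lambda>q. gaussians (K q)"]) (auto simp: I'_def)
  also have "\<dots> = (\<Prod>q\<in>B. measure (gaussians (K q)) (E q))"
  proof (rule prod.cong[OF refl])
    fix q assume "q \<in> B"
    have "measure (gaussians I') {x \<in> space (gaussians I'). (\<lambda>j\<in>K q. x j) \<in> E q} = measure (gaussians (K q)) (E q)"
      by (rule measure_PiM_gauss_reindex) (use K' E \<open>q \<in> B\<close> in auto)
    then show "measure (gaussians I') ((\<lambda>x. restrict (\<lambda>i. x i) (K q)) -` E q \<inter> space (gaussians I')) = measure (gaussians (K q)) (E q)"
      by (simp add: vimage_def Int_def conj_commute)
  qed
  finally show ?thesis .
qed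

lemma distr_gauss_uminus: "distr gauss borel uminus = (gauss :: real measure)"
  using distr_gauss_inner[of "-1 :: real"] by simp

lemma distr_PiM_gauss_uminus:
  assumes "finite I"
  shows "distr (gaussians I) (gaussians I) (\<lambda>x. \<lambda>i\<in>I. - x i) = PiM I (\<lambda>_. gauss :: real measure)"
proof -
  have "distr (gaussians I) (gaussians I) (compose I uminus) = PiM I (\<lambda>_. distr gauss gauss (uminus :: real \<Rightarrow> real))"
    by (rule distr_PiM_finite_prob_space') (use assms gauss.prob_space_axioms in auto)
  moreover have "distr gauss gauss uminus = (gauss :: real measure)"
    using distr_gauss_uminus by (simp cong: distr_cong)
  ultimately show ?thesis by (simp add: compose_def[abs_def])
qed

section \<open>Persistence at level 0: the formula of Sparre Andersen\<close>

lemma cfac_0: "cfac 0 = 1" by (simp add: cfac_def)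

lemma dfact_pos: "dfact n > 0"
  by (induction n rule: dfact.induct) auto

lemma cfac_Suc: "cfac (Suc n) = cfac n * (2 * real n + 1) / (2 * real n + 2)"
proof (cases n)
  case 0 then show ?thesis by (simp add: cfac_def numeral_eq_Suc)
next
  case (Suc k)
  have "2 * Suc n = Suc (Suc (2 * n))" "2 * Suc n - 1 = Suc (Suc (2 * n - 1))" using Suc by auto
  then show ?thesis using dfact_pos[of "2 * n"] Suc
    by (simp add: cfac_def del: mult_Suc_right) (simp add: field_simps)
qed

text \<open>Identifies \<open>cfac n\<close> as the coefficient of \<open>x ^ n\<close> in the power
  series of \<open>(1 - x)\<close> to the power -1/2. The square of this series is the geometric
  series, which is the convolution identity below, obtained from Vandermonde's formula.\<close>

lemma cfac_gbinomial: "cfac n = (-1) ^ n * ((- 1 / 2 :: real) gchoose n)"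
proof (induction n)
  case (Suc n)
  have e: "(- 1 / 2 :: real) gchoose Suc n = (- 1 / 2 - real n) / (real n + 1) * ((- 1 / 2) gchoose n)"
    by (simp add: gbinomial_prod_rev field_simps)
  show ?case unfolding cfac_Suc Suc.IH e by (simp add: field_simps)
qed (simp add: cfac_0)

lemma cfac_convolution: "(\<Sum>k\<le>n. cfac k * cfac (n - k)) = 1"
proof -
  have "(\<Sum>k\<le>n. cfac k * cfac (n - k)) = (\<Sum>k\<in>{0..n}. (-1) ^ n * (((- 1 / 2 :: real) gchoose k) * ((- 1 / 2) gchoose (n - k))))"
  proof (rule sum.cong)
    fix k assume "k \<in> {0..n}"
    then have "(-1) ^ k * (-1 :: real) ^ (n - k) = (-1) ^ n" by (simp flip: power_add)
    then show "cfac k * cfac (n - k) = (-1) ^ n * (((- 1 / 2 :: real) gchoose k) * ((- 1 / 2) gchoose (n - k)))"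
      unfolding cfac_gbinomial by (simp add: mult_ac)
  qed auto
  also have "\<dots> = (-1) ^ n * ((-1 :: real) gchoose n)"
    by (simp add: sum_distrib_left[symmetric] gbinomial_Vandermonde)
  also have "\<dots> = 1"
    by (simp add: gbinomial_pochhammer pochhammer_fact[symmetric] flip: power_add)
  finally show ?thesis .
qed

text \<open>For positive \<open>n\<close> the terms \<open>k = 0\<close> and \<open>k = n\<close>
  give twice the value at \<open>n\<close> and the others involve earlier values only, so the
  identity is a recursion.\<close>

lemma convolution_unique:
  fixes f g :: "nat \<Rightarrow> real"
  assumes f: "f 0 = 1" "\<And>n. (\<Sum>k\<le>n. f k * f (n - k)) = 1" and g: "g 0 = 1" "\<And>n. (\<Sum>k\<le>n. g k * g (n - k)) = 1"
  shows "f n = g n"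
proof (induction n rule: less_induct)
  case (less n)
  show ?case
  proof (cases n)
    case 0 then show ?thesis using f g by simp
  next
    case (Suc m)
    have split: "(\<Sum>k\<le>n. h k * h (n - k)) = 2 * h n + (\<Sum>k\<in>{1..m}. h k * h (n - k))"
      if "h 0 = 1" for h :: "nat \<Rightarrow> real"
    proof -
      have "{..n} = insert 0 (insert n {1..m})" using Suc by auto
      then show ?thesis using that Suc by simp
    qed
    have "(\<Sum>k\<in>{1..m}. f k * f (n - k)) = (\<Sum>k\<in>{1..m}. g k * g (n - k))"
      using less Suc by (intro sum.cong) auto
    then show ?thesis using f(2)[of n] g(2)[of n] split[of f, OF f(1)] split[of g, OF g(1)] by simp
  qed
qed

text \<open>Almost surely exactly one index attains the maximum, so the indicators of these events
  add up to 1.\<close>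

lemma (in prob_space) sum_prob_argmax:
  fixes g :: "'k \<Rightarrow> 'a \<Rightarrow> real"
  assumes A: "finite A" "A \<noteq> {}" and g: "\<And>k. k \<in> A \<Longrightarrow> g k \<in> borel_measurable M"
    and inj: "AE x in M. inj_on (\<lambda>k. g k x) A"
  shows "(\<Sum>k\<in>A. prob {x \<in> space M. \<forall>j\<in>A. g j x \<le> g k x}) = 1"
proof -
  let ?F = "\<lambda>k. {x \<in> space M. \<forall>j\<in>A. g j x \<le> g k x}"
  have F[measurable]: "?F k \<in> events" if "k \<in> A" for k
    using A g that by (intro sets.sets_Collect_finite_All' borel_measurable_le) auto
  have "(\<Sum>k\<in>A. emeasure M (?F k)) = (\<Sum>k\<in>A. \<integral>\<^sup>+x. indicator (?F k) x \<partial>M)"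
    using F by (intro sum.cong) auto
  also have "\<dots> = (\<integral>\<^sup>+x. (\<Sum>k\<in>A. indicator (?F k) x) \<partial>M)"
    using F by (intro nn_integral_sum[symmetric]) auto
  also have "\<dots> = (\<integral>\<^sup>+x. 1 \<partial>M)"
  proof (rule nn_integral_cong_AE, use inj AE_space in eventually_elim)
    fix x assume inj: "inj_on (\<lambda>k. g k x) A" and x: "x \<in> space M"
    have "\<exists>k\<in>A. \<forall>j\<in>A. g j x \<le> g k x"
      using A Max_in[of "(\<lambda>k. g k x) ` A"] Max_ge[of "(\<lambda>k. g k x) ` A"] by fastforce
    then obtain k where k: "k \<in> A" "\<And>j. j \<in> A \<Longrightarrow> g j x \<le> g k x" by blast
    have "x \<in> ?F i \<longleftrightarrow> i = k" if "i \<in> A" for i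
    proof
      assume "x \<in> ?F i"
      then have "g k x \<le> g i x" using k(1) by simp
      then show "i = k" using k(2)[OF that] inj_onD[OF inj _ that k(1)] by simp
    qed (use k x in auto)
    then have "(\<Sum>i\<in>A. indicator (?F i) x) = (\<Sum>i\<in>A. if i = k then 1 else 0 :: ennreal)"
      by (intro sum.cong refl) (simp add: indicator_def)
    then show "(\<Sum>i\<in>A. indicator (?F i) x) = (1 :: ennreal)" using A k(1) by simp
  qed
  also have "\<dots> = 1" by (simp add: emeasure_space_1)
  finally have "ennreal (\<Sum>k\<in>A. prob (?F k)) = 1"
    by (simp add: emeasure_eq_measure)
  then show ?thesis by (simp add: ennreal_eq_1)
qed

lemma prob_space_PiM_gauss: "prob_space (PiM I (\<lambda>_. gauss :: 'b::euclidean_space measure))"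
  by (intro prob_space_PiM gauss.prob_space_axioms)

text \<open>Steps are renumbered from 0 and the trivial time 0 is included, so that time 0 can be a
  position of the maximum.\<close>

lemma persist_p_0_lessThan:
  "persist_p n 0 = measure (gaussians {..<n}) {x \<in> space (gaussians {..<n}). \<forall>j\<in>{..n}. (\<Sum>i<j. x i :: real) \<le> 0}"
proof -
  let ?S = "{x \<in> space (gaussians {..<n}). \<forall>j\<in>{..n}. (\<Sum>i<j. x i :: real) \<le> 0}"
  have S: "?S \<in> sets (gaussians {..<n})"
    by (intro sets.sets_Collect_finite_All' borel_measurable_le borel_measurable_sum) auto
  have *: "(\<lambda>k\<in>{..<n}. x (Suc k)) \<in> ?S \<longleftrightarrow>
    (\<forall>j\<in>{1..n}. (\<Sum>i=1..j. x i) \<le> 0)" for x :: "nat \<Rightarrow> real"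
  proof -
    have "(\<Sum>i<j. (\<lambda>k\<in>{..<n}. x (Suc k)) i) = (\<Sum>i=1..j. x i)" if "j \<le> n" for j
      using that by (simp add: sum.atLeast1_atMost_eq)
    moreover have "(\<forall>j\<in>{..n}. (\<Sum>i=1..j. x i) \<le> 0) \<longleftrightarrow> (\<forall>j\<in>{1..n}. (\<Sum>i=1..j. x i) \<le> 0)"
      by (auto simp: Ball_def) (metis One_nat_def Suc_leI atLeastatMost_empty_iff bot_nat_0.not_eq_extremum order_refl sum.empty)
    ultimately show ?thesis by (simp add: space_PiM)
  qed
  have "measure (gaussians {1..n}) {x \<in> space (gaussians {1..n}). (\<lambda>k\<in>{..<n}. x (Suc k)) \<in> ?S}
      = measure (gaussians {..<n}) ?S"
    by (rule measure_PiM_gauss_reindex[OF _ _ S]) auto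
  then show ?thesis unfolding persist_p_def std_normal_measure_eq * by simp
qed

text \<open>Seen from its position \<open>k\<close>, the maximum means that the later steps have
  nonpositive partial sums and that the earlier steps, read backwards from \<open>k\<close>, have
  nonnegative ones. The two groups of steps are independent; reversal and a change of sign turn the
  second event into one of the first kind.\<close>

lemma prob_argmax_walk:
  assumes k: "k \<le> n"
  shows "measure (gaussians {..<n}) {x \<in> space (gaussians {..<n}). \<forall>j\<in>{..n}. (\<Sum>i<j. x i) \<le> (\<Sum>i<k. x i :: real)}
    = persist_p k 0 * persist_p (n - k) 0"
proof -
  let ?P = "\<lambda>I. PiM I (\<lambda>_. gauss :: real measure) :: (nat \<Rightarrow> real) measure"
  define K where "K b = (if b then {k..<n} else {..<k})" for b
  define E where "E b = (if b then {y \<in> space (?P {k..<n}). \<forall>j\<in>{..n - k}. (\<Sum>i\<in>{k..<k + j}. y i) \<le> 0}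
    else {y \<in> space (?P {..<k}). \<forall>j\<in>{..k}. 0 \<le> (\<Sum>i\<in>{k - j..<k}. y i)})" for b
  have E1: "{y \<in> space (?P {k..<n}). \<forall>j\<in>{..n - k}. (\<Sum>i\<in>{k..<k + j}. y i) \<le> 0} \<in> sets (?P {k..<n})"
    by (intro sets.sets_Collect_finite_All' borel_measurable_le borel_measurable_sum) auto
  have E0: "{y \<in> space (?P {..<k}). \<forall>j\<in>{..k}. 0 \<le> (\<Sum>i\<in>{k - j..<k}. y i)} \<in> sets (?P {..<k})"
    by (intro sets.sets_Collect_finite_All' borel_measurable_le borel_measurable_sum) auto
  have EK: "E b \<in> sets (?P (K b))" for b using E0 E1 by (simp add: E_def K_def)
  have "{x \<in> space (?P {..<n}). \<forall>j\<in>{..n}. (\<Sum>i<j. x i) \<le> (\<Sum>i<k. x i)} =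
    {x \<in> space (?P {..<n}). \<forall>b\<in>{True, False}. restrict x (K b) \<in> E b}"
  proof -
    have "(\<forall>j\<in>{..n}. (\<Sum>i<j. x i) \<le> (\<Sum>i<k. x i)) \<longleftrightarrow> (\<forall>b\<in>{True, False}. restrict x (K b) \<in> E b)" for x :: "nat \<Rightarrow> real"
    proof -
      have l: "(\<Sum>i<k. x i) = (\<Sum>i<k - j. x i) + (\<Sum>i\<in>{k - j..<k}. x i)" for j
        by (subst sum.atLeastLessThan_concat[symmetric, of 0 "k - j" k, folded atLeast0LessThan, simplified lessThan_atLeast0[symmetric]]) auto
      have u: "(\<Sum>i<k + j. x i) = (\<Sum>i<k. x i) + (\<Sum>i\<in>{k..<k + j}. x i)" for j
        using sum.atLeastLessThan_concat[of 0 k "k + j" x] by (simp add: lessThan_atLeast0)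
      have "(\<forall>j\<in>{..n}. (\<Sum>i<j. x i) \<le> (\<Sum>i<k. x i)) \<longleftrightarrow>
        (\<forall>j\<in>{..k}. (\<Sum>i<k - j. x i) \<le> (\<Sum>i<k. x i)) \<and> (\<forall>j\<in>{..n - k}. (\<Sum>i<k + j. x i) \<le> (\<Sum>i<k. x i))"
      proof safe
        fix j assume h: "\<forall>j\<in>{..k}. (\<Sum>i<k - j. x i) \<le> (\<Sum>i<k. x i)" "\<forall>j\<in>{..n - k}. (\<Sum>i<k + j. x i) \<le> (\<Sum>i<k. x i)" "j \<le> n"
        show "(\<Sum>i<j. x i) \<le> (\<Sum>i<k. x i)"
        proof (cases "j \<le> k")
          case True then show ?thesis using bspec[OF h(1), of "k - j"] by simp
        next
          case False then show ?thesis using bspec[OF h(2), of "j - k"] h(3) by simp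
        qed
      qed (use k in auto)
      also have "\<dots> \<longleftrightarrow> (\<forall>j\<in>{..k}. 0 \<le> (\<Sum>i\<in>{k - j..<k}. x i)) \<and> (\<forall>j\<in>{..n - k}. (\<Sum>i\<in>{k..<k + j}. x i) \<le> 0)"
        using l u by (metis (no_types, lifting) add_le_same_cancel1 le_add_same_cancel1)
      also have "\<dots> \<longleftrightarrow> restrict x (K False) \<in> E False \<and> restrict x (K True) \<in> E True"
      proof -
        have "(\<Sum>i\<in>{k - j..<k}. restrict x {..<k} i) = (\<Sum>i\<in>{k - j..<k}. x i)" for j by (intro sum.cong) auto
        moreover have "(\<Sum>i\<in>{k..<k + j}. restrict x {k..<n} i) = (\<Sum>i\<in>{k..<k + j}. x i)" if "j \<le> n - k" for j
          using that by (intro sum.cong) auto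
        ultimately show ?thesis by (simp add: K_def E_def space_PiM)
      qed
      finally show ?thesis by auto
    qed
    then show ?thesis by blast
  qed
  also have "measure (?P {..<n}) \<dots> = (\<Prod>b\<in>{True, False}. measure (?P (K b)) (E b))"
    using k EK by (intro measure_PiM_gauss_blocks) (auto simp: K_def disjoint_family_on_def)
  also have "\<dots> = measure (?P {..<k}) (E False) * measure (?P {k..<n}) (E True)"
    by (simp add: K_def)
  also have "measure (?P {k..<n}) (E True) = persist_p (n - k) 0"
  proof -
    let ?S = "{x \<in> space (?P {..<n - k}). \<forall>j\<in>{..n - k}. (\<Sum>i<j. x i) \<le> 0}"
    have S: "?S \<in> sets (?P {..<n - k})"
      by (intro sets.sets_Collect_finite_All' borel_measurable_le borel_measurable_sum) auto
    have "(\<lambda>i\<in>{..<n - k}. x (i + k)) \<in> ?S \<longleftrightarrow> (\<forall>j\<in>{..n - k}. (\<Sum>i\<in>{k..<k + j}. x i) \<le> 0)" for x :: "nat \<Rightarrow> real"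
    proof -
      have "(\<Sum>i<j. (\<lambda>i\<in>{..<n - k}. x (i + k)) i) = (\<Sum>i\<in>{k..<k + j}. x i)" if "j \<le> n - k" for j
        using that sum.shift_bounds_nat_ivl[of x 0 k j] by (simp add: lessThan_atLeast0 add.commute)
      then show ?thesis by (simp add: space_PiM)
    qed
    then have "measure (?P {k..<n}) (E True) = measure (?P {k..<n}) {x \<in> space (?P {k..<n}). (\<lambda>i\<in>{..<n - k}. x (i + k)) \<in> ?S}"
      by (simp add: E_def)
    also have "\<dots> = measure (?P {..<n - k}) ?S"
      by (rule measure_PiM_gauss_reindex[OF _ _ S]) auto
    finally show ?thesis by (simp add: persist_p_0_lessThan)
  qed
  also have "measure (?P {..<k}) (E False) = persist_p k 0"
  proof -
    let ?S = "{x \<in> space (?P {..<k}). \<forall>j\<in>{..k}. (\<Sum>i<j. x i) \<le> 0}"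
    let ?S' = "{x \<in> space (?P {..<k}). \<forall>j\<in>{..k}. 0 \<le> (\<Sum>i<j. x i)}"
    have S: "?S \<in> sets (?P {..<k})" "?S' \<in> sets (?P {..<k})"
      by (intro sets.sets_Collect_finite_All' borel_measurable_le borel_measurable_sum; auto)+
    have "(\<lambda>i\<in>{..<k}. x (k - Suc i)) \<in> ?S' \<longleftrightarrow> (\<forall>j\<in>{..k}. 0 \<le> (\<Sum>i\<in>{k - j..<k}. x i))" for x :: "nat \<Rightarrow> real"
    proof -
      have "(\<Sum>i<j. (\<lambda>i\<in>{..<k}. x (k - Suc i)) i) = (\<Sum>i\<in>{k - j..<k}. x i)" if "j \<le> k" for j
        using that by (intro sum.reindex_bij_witness[of _ "\<lambda>i. k - Suc i" "\<lambda>i. k - Suc i"]) auto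
      then show ?thesis by (simp add: space_PiM)
    qed
    then have "measure (?P {..<k}) (E False) = measure (?P {..<k}) {x \<in> space (?P {..<k}). (\<lambda>i\<in>{..<k}. x (k - Suc i)) \<in> ?S'}"
      by (simp add: E_def)
    also have "\<dots> = measure (?P {..<k}) ?S'"
      by (rule measure_PiM_gauss_reindex[OF _ _ S(2)]) (auto intro!: inj_onI)
    also have "\<dots> = measure (distr (?P {..<k}) (?P {..<k}) (\<lambda>x. \<lambda>i\<in>{..<k}. - x i)) ?S"
      using S by (subst measure_distr)
        (auto simp: space_PiM sum_negf intro!: arg_cong[where f="measure _"])
    also have "\<dots> = measure (?P {..<k}) ?S" by (simp add: distr_PiM_gauss_uminus)
    finally show ?thesis by (simp add: persist_p_0_lessThan)
  qed
  finally show ?thesis .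
qed

text \<open>The walk has an a.s. unique maximum; splitting at its position gives a convolution identity
  which determines the sequence.\<close>
theorem persist_p_0: "persist_p n 0 = cfac n"
proof (rule convolution_unique[OF _ _ cfac_0 cfac_convolution])
  show "persist_p 0 0 = 1"
    using prob_space.prob_space[OF prob_space_PiM_gauss[where 'b=real, of "{..<0::nat}"]]
    by (simp add: persist_p_0_lessThan)
  fix n :: nat
  interpret P: prob_space "PiM {..<n} (\<lambda>_. gauss :: real measure)" by (rule prob_space_PiM_gauss)
  have "(\<Sum>k\<le>n. persist_p k 0 * persist_p (n - k) 0) =
    (\<Sum>k\<in>{..n}. P.prob {x \<in> space (gaussians {..<n}). \<forall>j\<in>{..n}. (\<Sum>i<j. x i) \<le> (\<Sum>i<k. x i)})"
    by (intro sum.cong refl) (simp add: prob_argmax_walk)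
  also have "\<dots> = 1"
  proof (rule P.sum_prob_argmax)
    \<comment> \<open>The difference of two partial sums is a nontrivial linear form in the steps,
      so ties have probability 0.\<close>
    have neq: "AE x in gaussians {..<n}. s < t \<longrightarrow> (\<Sum>i<s. x i) \<noteq> (\<Sum>i<t. x i :: real)" if "t \<le> n" for s t :: nat
    proof (cases "s < t")
      case True
      have "AE x in gaussians {..<n}. (\<Sum>i<n. indicator {s..<t} i * x i) \<noteq> (0::real)"
        by (rule AE_linear_neq[of _ s]) (use True that in auto)
      then show ?thesis
      proof (rule eventually_mono)
        fix x :: "nat \<Rightarrow> real" assume "(\<Sum>i<n. indicator {s..<t} i * x i) \<noteq> (0::real)"
        moreover have "(\<Sum>i<n. indicator {s..<t} i * x i) = (\<Sum>i\<in>{s..<t}. x i)"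
        proof -
          have "(\<Sum>i<n. indicator {s..<t} i * x i) = (\<Sum>i\<in>{..<n}. if i \<in> {s..<t} then x i else 0)"
            by (intro sum.cong) (auto simp: indicator_def)
          also have "\<dots> = (\<Sum>i\<in>{..<n} \<inter> {s..<t}. x i)" by (rule sum.inter_restrict[symmetric]) simp
          also have "{..<n} \<inter> {s..<t} = {s..<t}" using that by auto
          finally show ?thesis .
        qed
        moreover have "(\<Sum>i<t. x i) = (\<Sum>i<s. x i) + (\<Sum>i\<in>{s..<t}. x i)"
          using sum.atLeastLessThan_concat[of 0 s t x] True by (simp add: lessThan_atLeast0)
        ultimately show "s < t \<longrightarrow> (\<Sum>i<s. x i) \<noteq> (\<Sum>i<t. x i)" by simp
      qed
    qed simp
    have "AE x in gaussians {..<n}. \<forall>t\<in>{..n}. \<forall>s\<in>{..n}. s < t \<longrightarrow> (\<Sum>i<s. x i) \<noteq> (\<Sum>i<t. x i :: real)"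
      by (intro AE_finite_allI neq) auto
    then show "AE x in gaussians {..<n}. inj_on (\<lambda>k. \<Sum>i<k. x i :: real) {..n}"
      by (rule eventually_mono) (rule linorder_inj_onI', auto)
    show "(\<lambda>x. \<Sum>i<k. x i) \<in> borel_measurable (PiM {..<n} (\<lambda>_. gauss :: real measure))" if "k \<in> {..n}" for k
      using that by (intro borel_measurable_sum) auto
  qed auto
  finally show "(\<Sum>k\<le>n. persist_p k 0 * persist_p (n - k) 0) = 1" .
qed

text \<open>The orthogonal reflection of the coordinates 1,...,n that exchanges the last unit vector
  with the constant unit vector: afterwards the last input is the normalized sum of the outputs.\<close>
definition bridge :: "nat \<Rightarrow> (nat \<Rightarrow> 'b::real_vector) \<Rightarrow> nat \<Rightarrow> 'b" where
  "bridge n x i = (if i = n then (\<Sum>k=1..n. x k) /\<^sub>R sqrt n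
     else x i + (1 / (sqrt n - 1)) *\<^sub>R (x n - (\<Sum>k=1..n. x k) /\<^sub>R sqrt n))"

lemma bridge_cong: "(\<And>k. k \<in> {1..n} \<Longrightarrow> x k = y k) \<Longrightarrow> i \<in> {1..n} \<Longrightarrow> bridge n x i = bridge n y i"
  by (auto simp: bridge_def intro!: sum.cong arg_cong2[where f="(+)"] arg_cong2[where f="(-)"] arg_cong2[where f=scaleR])

lemma borel_measurable_bridge:
  fixes f :: "nat \<Rightarrow> 'a \<Rightarrow> 'b::euclidean_space"
  assumes f: "\<And>k. k \<in> {1..n} \<Longrightarrow> f k \<in> borel_measurable M" and i: "i \<in> {1..n}"
  shows "(\<lambda>z. bridge n (\<lambda>k. f k z) i) \<in> borel_measurable M"
proof -
  have S: "(\<lambda>z. \<Sum>k=1..n. f k z) \<in> borel_measurable M" using f by (rule borel_measurable_sum)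
  have "f n \<in> borel_measurable M" "f i \<in> borel_measurable M" using i by (auto intro!: f)
  then show ?thesis using S unfolding bridge_def by (cases "i = n") (simp_all, measurable)
qed

lemma inner_bridge: "u \<bullet> bridge n x i = bridge n (\<lambda>k. u \<bullet> x k) i"
  by (simp add: bridge_def inner_sum_right inner_add_right inner_diff_right)

lemma sum_bridge:
  assumes "n \<ge> 1"
  shows "(\<Sum>i=1..n. bridge n x i) = sqrt n *\<^sub>R x n"
proof (cases "n = 1")
  case False
  with assms have n: "sqrt n > 1" by simp
  define S where "S = (\<Sum>k=1..n. x k)"
  define S' where "S' = (\<Sum>k\<in>{1..<n}. x k)"
  have ivl: "{Suc 0..n} = insert n {Suc 0..<n}" using assms by auto
  have S: "S = x n + S'" by (simp add: S_def S'_def ivl)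
  define y where "y = (1 / (sqrt n - 1)) *\<^sub>R (x n - S /\<^sub>R sqrt n)"
  have "(\<Sum>i=1..n. bridge n x i) = S /\<^sub>R sqrt n + (\<Sum>i\<in>{1..<n}. x i + y)"
  proof -
    have "bridge n x n = S /\<^sub>R sqrt n" by (simp add: bridge_def S_def)
    moreover have "(\<Sum>i\<in>{1..<n}. bridge n x i) = (\<Sum>i\<in>{1..<n}. x i + y)"
      by (intro sum.cong) (auto simp: bridge_def S_def y_def)
    ultimately show ?thesis by (simp add: ivl)
  qed
  also have "\<dots> = S /\<^sub>R sqrt n + S' + (real n - 1) *\<^sub>R y"
    using assms by (simp add: sum.distrib S'_def of_nat_diff sum_constant_scaleR)
  also have "(real n - 1) *\<^sub>R y = (sqrt n + 1) *\<^sub>R (x n - S /\<^sub>R sqrt n)"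
  proof -
    have "(real n - 1) * (1 / (sqrt n - 1)) = sqrt n + 1"
      using n by (simp add: field_simps)
    then show ?thesis by (simp add: y_def)
  qed
  also have "S /\<^sub>R sqrt n + S' + (sqrt n + 1) *\<^sub>R (x n - S /\<^sub>R sqrt n) = sqrt n *\<^sub>R x n + (x n + S' - S)"
    using n by (simp add: algebra_simps)
  finally show ?thesis by (simp add: S)
qed (simp add: bridge_def)

lemma bridge_reflection:
  assumes "n \<ge> 1"
  obtains a :: "nat \<Rightarrow> real" where "(\<Sum>i=1..n. (a i)\<^sup>2) = 2 \<or> (\<forall>i\<in>{1..n}. a i = 0)"
    "\<And>(x :: nat \<Rightarrow> 'b::real_vector) i. i \<in> {1..n} \<Longrightarrow> bridge n x i = x i - a i *\<^sub>R (\<Sum>k=1..n. a k *\<^sub>R x k)"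
proof (cases "n = 1")
  case True
  show ?thesis
    by (rule that[of "\<lambda>_. 0"]) (use True in \<open>auto simp: bridge_def\<close>)
next
  case False
  with assms have n: "sqrt n > 1" by simp
  define q where "q = sqrt n"
  have q: "q > 1" "q * q = real n" using n by (auto simp: q_def)
  \<comment> \<open>The mirror vector is \<open>m\<close> times the difference of the n-th unit
    vector and \<open>(1, ..., 1) / q\<close>. That difference has squared length
    \<open>2 * (q - 1) / q\<close>, and \<open>m\<close> normalises it to 2.\<close>
  define m where "m = sqrt (q / (q - 1))"
  have m: "m * m = q / (q - 1)" using q by (simp add: m_def)
  define a where "a i = (if i = n then m * (1 - 1 / q) else - m / q)" for i
  have ivl: "{Suc 0..n} = insert n {Suc 0..<n}" using assms by auto
  show ?thesis
  proof (rule that)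
    have "(\<Sum>i=1..n. (a i)\<^sup>2) = (m * (1 - 1 / q))\<^sup>2 + (real n - 1) * (m / q)\<^sup>2"
      using assms by (simp add: ivl a_def of_nat_diff)
    also have "\<dots> = (m * m) * ((1 - 1 / q)\<^sup>2 + (q * q - 1) / q\<^sup>2)"
      using q by (simp add: field_simps power2_eq_square)
    also have "\<dots> = 2"
    proof -
      have "(1 - 1 / q)\<^sup>2 + (q * q - 1) / q\<^sup>2 = 2 * (q - 1) / q"
        using q(1) by (simp add: field_simps power2_eq_square)
      then show ?thesis unfolding m using q by (simp add: field_simps)
    qed
    finally show "(\<Sum>i=1..n. (a i)\<^sup>2) = 2 \<or> (\<forall>i\<in>{1..n}. a i = 0)" ..
    fix x :: "nat \<Rightarrow> 'b" and i assume i: "i \<in> {1..n}"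
    define S where "S = (\<Sum>k=1..n. x k)"
    define S' where "S' = (\<Sum>k\<in>{1..<n}. x k)"
    have S: "S = x n + S'" by (simp add: S_def S'_def ivl)
    have "(\<Sum>k=1..n. a k *\<^sub>R x k) = (m * (1 - 1 / q)) *\<^sub>R x n + (\<Sum>k\<in>{1..<n}. (- m / q) *\<^sub>R x k)"
      by (simp add: ivl a_def)
    also have "\<dots> = (m * (1 - 1 / q)) *\<^sub>R x n - (m / q) *\<^sub>R S'"
      by (simp add: S'_def scaleR_sum_right sum_negf)
    also have "\<dots> = m *\<^sub>R (x n - (1 / q) *\<^sub>R S)"
      by (simp add: S algebra_simps)
    finally have sum: "(\<Sum>k=1..n. a k *\<^sub>R x k) = m *\<^sub>R (x n - (1 / q) *\<^sub>R S)" .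
    show "bridge n x i = x i - a i *\<^sub>R (\<Sum>k=1..n. a k *\<^sub>R x k)"
    proof (cases "i = n")
      case True
      have "m * (1 - 1 / q) * m = 1"
        using m q by (simp add: field_simps)
      then have "x i - a i *\<^sub>R (\<Sum>k=1..n. a k *\<^sub>R x k) = (1 / q) *\<^sub>R S"
        unfolding sum by (simp add: a_def True)
      then show ?thesis using True by (simp add: bridge_def S_def q_def divide_inverse)
    next
      case False
      have "- m / q * m = - (1 / (q - 1))"
        using m q by (simp add: field_simps)
      then have "x i - a i *\<^sub>R (\<Sum>k=1..n. a k *\<^sub>R x k) = x i + (1 / (q - 1)) *\<^sub>R (x n - (1 / q) *\<^sub>R S)"
        unfolding sum using False by (simp add: a_def)
      then show ?thesis using False by (simp add: bridge_def S_def q_def divide_inverse)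
    qed
  qed
qed

lemma distr_bridge:
  assumes "n \<ge> 1"
  shows "distr (gaussians {1..n}) (gaussians {1..n}) (\<lambda>x. \<lambda>i\<in>{1..n}. bridge n x i)
    = PiM {1..n} (\<lambda>_. gauss :: 'b::euclidean_space measure)"
proof (rule bridge_reflection[OF assms, where 'b='b])
  fix a :: "nat \<Rightarrow> real"
  assume a: "(\<Sum>i=1..n. (a i)\<^sup>2) = 2 \<or> (\<forall>i\<in>{1..n}. a i = 0)"
    "\<And>(x :: nat \<Rightarrow> 'b) i. i \<in> {1..n} \<Longrightarrow> bridge n x i = x i - a i *\<^sub>R (\<Sum>k=1..n. a k *\<^sub>R x k)"
  have "(\<lambda>i\<in>{1..n}. bridge n x i) = (\<lambda>i\<in>{1..n}. x i - a i *\<^sub>R (\<Sum>k=1..n. a k *\<^sub>R x k))" for x :: "nat \<Rightarrow> 'b"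
    by (rule restrict_ext) (rule a(2))
  then show ?thesis using distr_PiM_gauss_reflection[OF _ a(1)] by simp
qed

text \<open>The definition integrates over the first \<open>n - 1\<close> steps, the last one being
  what is missing to \<open>r\<close>. Substituting the bridge with last input
  \<open>r / sqrt n\<close> makes the other inputs independent standard normal, by isometry; the
  constant left over, together with the Jacobian, is the density of the sum by which the definition
  divides.\<close>

lemma persist_q_bridge:
  assumes n: "n \<ge> 1"
  shows "persist_q n r = measure (PiM {1..n-1} (\<lambda>_. gauss :: real measure))
    {z \<in> space (gaussians {1..n-1}). \<forall>j\<in>{1..n-1}. (\<Sum>i=1..j. bridge n (z(n := r / sqrt n)) i) \<le> r}"
proof -
  let ?K = "{1..n-1}"
  let ?L = "PiM ?K (\<lambda>_. lborel :: real measure)"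
  define q where "q = sqrt n"
  have q: "q \<ge> 1" "q * q = real n" using n by (auto simp: q_def)
  have cardK: "real (card ?K) = q * q - 1" using n q by (simp add: of_nat_diff)
  define E :: "(nat \<Rightarrow> real) set" where "E = {x. \<forall>j\<in>?K. (\<Sum>i=1..j. x i) \<le> r}"
  define h where "h x = indicator E x * ennreal ((\<Prod>i=1..n-1. std_normal_density (x i)) *
                   std_normal_density (r - (\<Sum>i=1..n-1. x i)))" for x
  have E: "{x \<in> space ?L. x \<in> E} \<in> sets ?L"
    unfolding E_def mem_Collect_eq by measurable
  have E_ind[measurable]: "(\<lambda>x. indicator E x :: ennreal) \<in> borel_measurable ?L"
  proof -
    have "E \<inter> space ?L = {x \<in> space ?L. x \<in> E}" by auto
    then show ?thesis using E borel_measurable_indicator_iff[of E ?L] by simp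
  qed
  have h[measurable]: "h \<in> borel_measurable ?L" unfolding h_def by measurable
  define \<beta> where "\<beta> z = (\<lambda>i\<in>?K. z i + (- 1 / (q * (q - 1))) *\<^sub>R (\<Sum>k\<in>?K. 1 *\<^sub>R z k) + r / (q * q))" for z :: "nat \<Rightarrow> real"
  \<comment> \<open>The Jacobian of the substitution. For \<open>n = 1\<close> the quotient has the
    denominator 0, but the sum is empty and \<open>\<gamma> = 1\<close>.\<close>
  define \<gamma> where "\<gamma> = 1 + (\<Sum>i\<in>?K. (- 1 / (q * (q - 1))) * 1)"
  have \<gamma>: "\<gamma> = (if n = 1 then 1 else - 1 / q)"
  proof (cases "n = 1")
    case False
    then have "q > 1" using n by (simp add: q_def)
    then show ?thesis unfolding \<gamma>_def sum_constant cardK using False by (simp add: field_simps)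
  qed (simp add: \<gamma>_def)
  have \<gamma>_abs: "\<bar>\<gamma>\<bar> = 1 / q" using \<gamma> q by (auto simp: q_def)
  have \<beta>_bridge: "\<beta> z i = bridge n (z(n := r / sqrt n)) i" if "i \<in> ?K" for z i
  proof -
    have "n > 1" using that by auto
    then have q1: "q > 1" by (simp add: q_def)
    have sum: "(\<Sum>k=1..n. (z(n := r / sqrt n)) k) = (\<Sum>k\<in>?K. z k) + r / q"
    proof -
      have "{1..n} = insert n ?K" using n by auto
      moreover have "(\<Sum>k\<in>?K. (z(n := r / sqrt n)) k) = (\<Sum>k\<in>?K. z k)"
        by (intro sum.cong) (use n in auto)
      moreover have "n \<notin> ?K" using n by auto
      ultimately show ?thesis by (simp add: q_def)
    qed
    have "i \<noteq> n" using that n by auto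
    then have "bridge n (z(n := r / sqrt n)) i = z i + (1 / (q - 1)) * (r / q - ((\<Sum>k\<in>?K. z k) + r / q) / q)"
      unfolding bridge_def sum by (simp add: q_def divide_inverse mult.commute)
    also have "\<dots> = z i + (- 1 / (q * (q - 1))) * (\<Sum>k\<in>?K. z k) + r / (q * q)"
      using q1 by (simp add: divide_simps) (simp add: algebra_simps)
    finally show ?thesis using that by (simp add: \<beta>_def)
  qed
  \<comment> \<open>The missing step is the last component of the bridge, so the sum of all squares
    equals that of the inputs.\<close>
  have dens: "(\<Prod>i=1..n-1. std_normal_density (\<beta> z i)) * std_normal_density (r - (\<Sum>i=1..n-1. \<beta> z i))
    = (\<Prod>i=1..n-1. std_normal_density (z i)) * std_normal_density (r / q)" for z
  proof (cases "n = 1")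
    case True then show ?thesis using q by (simp add: q_def)
  next
    case False
    then have q1: "q > 1" using n by (simp add: q_def)
    define s where "s = (\<Sum>k\<in>?K. z k)"
    define e where "e = r / (q * q) - s / (q * (q - 1))"
    have \<beta>z: "\<beta> z i = z i + e" if "i \<in> ?K" for i
      using that by (simp add: \<beta>_def s_def e_def)
    have sum1: "(\<Sum>i=1..n-1. \<beta> z i) = s + (q * q - 1) * e"
      by (simp add: \<beta>z sum.distrib s_def cardK[simplified])
    have sum2: "(\<Sum>i=1..n-1. (\<beta> z i)\<^sup>2) = (\<Sum>i=1..n-1. (z i)\<^sup>2) + 2 * e * s + (q * q - 1) * e\<^sup>2"
      by (simp add: \<beta>z power2_sum sum.distrib s_def cardK[simplified] sum_distrib_left mult_ac)
    have "2 * e * s + (q * q - 1) * e\<^sup>2 + (r - (s + (q * q - 1) * e))\<^sup>2 = (r / q)\<^sup>2"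
    proof -
      have s_eq: "s = (q - 1) * (r - q * q * e) / q" 
        using q1 by (simp add: e_def field_simps)
      show ?thesis unfolding s_eq using q1 by (simp add: field_simps power2_eq_square)
    qed
    then have sq: "(\<Sum>i=1..n-1. (\<beta> z i)\<^sup>2) + (r - (\<Sum>i=1..n-1. \<beta> z i))\<^sup>2 = (\<Sum>i=1..n-1. (z i)\<^sup>2) + (r / q)\<^sup>2"
      unfolding sum1 sum2 by simp
    have pd: "(\<Prod>i=1..n-1. std_normal_density (x i)) * std_normal_density y =
      (1 / sqrt (2 * pi)) ^ n * exp (- ((\<Sum>i=1..n-1. (x i)\<^sup>2) + y\<^sup>2) / 2)" for x y
    proof -
      have "(\<Prod>i=1..n-1. std_normal_density (x i)) = (1 / sqrt (2 * pi)) ^ (n - 1) * exp (- (\<Sum>i=1..n-1. (x i)\<^sup>2) / 2)"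
        by (simp add: std_normal_density_def prod_dividef prod.distrib exp_sum[symmetric] sum_divide_distrib[symmetric] sum_negf power_divide power_one_over)
      moreover have "(1 / sqrt (2 * pi)) ^ n = (1 / sqrt (2 * pi)) ^ (n - 1) * (1 / sqrt (2 * pi))"
        using n by (metis One_nat_def Suc_pred less_eq_Suc_le power_Suc2)
      ultimately show ?thesis
        by (simp add: std_normal_density_def exp_add[symmetric] add_divide_distrib)
    qed
    show ?thesis unfolding pd sq by simp
  qed
  have bm: "\<beta> \<in> ?L \<rightarrow>\<^sub>M ?L" unfolding \<beta>_def by measurable
  have "(\<integral>\<^sup>+z. h (\<beta> z) \<partial>?L) = (\<integral>\<^sup>+z. h (\<lambda>i\<in>?K. z i + r / (q * q)) \<partial>?L) * ennreal (1 / \<bar>\<gamma>\<bar>)"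
  proof -
    have "(\<integral>\<^sup>+z. h (\<beta> z) \<partial>?L) = (\<integral>\<^sup>+z. (\<lambda>x. h (\<lambda>i\<in>?K. x i + r / (q * q))) (\<lambda>i\<in>?K. z i + (- 1 / (q * (q - 1))) *\<^sub>R (\<Sum>k\<in>?K. 1 *\<^sub>R z k)) \<partial>?L)"
      by (intro nn_integral_cong arg_cong[where f=h]) (auto simp: \<beta>_def)
    also have "\<dots> = ennreal (1 / \<bar>\<gamma>\<bar> ^ DIM(real)) * (\<integral>\<^sup>+z. h (\<lambda>i\<in>?K. z i + r / (q * q)) \<partial>?L)"
      unfolding \<gamma>_def
    proof (rule nn_integral_PiM_rank_one)
      show "(\<lambda>x. h (\<lambda>i\<in>?K. x i + r / (q * q))) \<in> borel_measurable ?L" by measurable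
      show "1 + (\<Sum>i\<in>?K. - 1 / (q * (q - 1)) * 1) \<noteq> 0" using \<gamma> q unfolding \<gamma>_def by (auto split: if_splits)
    qed simp
    finally show ?thesis by (simp add: mult.commute)
  qed
  also have "(\<integral>\<^sup>+z. h (\<lambda>i\<in>?K. z i + r / (q * q)) \<partial>?L) = (\<integral>\<^sup>+z. h z \<partial>?L)"
    by (rule nn_integral_PiM_translate[OF _ h]) simp
  finally have subst: "(\<integral>\<^sup>+z. h z \<partial>?L) * ennreal q = (\<integral>\<^sup>+z. h (\<beta> z) \<partial>?L)"
    using \<gamma>_abs q by simp
  define g where "g z = (indicator E (\<beta> z) :: ennreal)" for z
  have g[measurable]: "g \<in> borel_measurable ?L"
    unfolding g_def by (rule measurable_compose[OF bm E_ind])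
  have "(\<integral>\<^sup>+z. h (\<beta> z) \<partial>?L) = (\<integral>\<^sup>+z. ennreal (std_normal_density (r / q)) * (ennreal (\<Prod>i\<in>?K. std_normal_density (z i)) * g z) \<partial>?L)"
    unfolding h_def dens g_def by (intro nn_integral_cong) (simp add: ennreal_mult' prod_nonneg mult_ac)
  also have "\<dots> = ennreal (std_normal_density (r / q)) * (\<integral>\<^sup>+z. ennreal (\<Prod>i\<in>?K. std_normal_density (z i)) * g z \<partial>?L)"
    by (intro nn_integral_cmult) measurable
  also have "(\<integral>\<^sup>+z. ennreal (\<Prod>i\<in>?K. std_normal_density (z i)) * g z \<partial>?L)
     = (\<integral>\<^sup>+z. g z \<partial>gaussians ?K)"
  proof -
    have "PiM ?K (\<lambda>_. gauss :: real measure) = density ?L (\<lambda>x. \<Prod>i\<in>?K. ennreal (std_normal_density (x i)))"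
      unfolding std_normal_measure_eq[symmetric] std_normal_measure_def
      by (rule PiM_density_eq[OF _ lborel.sigma_finite_measure_axioms
         gauss.sigma_finite_measure_axioms[where 'b=real, unfolded std_normal_measure_eq[symmetric] std_normal_measure_def]]) auto
    then show ?thesis
      by (subst \<open>gaussians ?K = _\<close>, subst nn_integral_density)
        (auto simp: prod_ennreal simp del: One_nat_def)
  qed
  also have "\<dots> = emeasure (gaussians ?K) {z \<in> space (gaussians ?K). \<beta> z \<in> E}"
  proof -
    have sp: "space (PiM ?K (\<lambda>_. gauss :: real measure)) = space ?L" by (simp add: space_PiM)
    have st: "sets (PiM ?K (\<lambda>_. gauss :: real measure)) = sets ?L" by (simp cong: sets_PiM_cong)
    have "{z \<in> space ?L. \<beta> z \<in> {x \<in> space ?L. x \<in> E}} \<in> sets ?L"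
      using measurable_sets[OF bm E] by (simp add: vimage_def Int_def conj_commute)
    moreover have "{z \<in> space ?L. \<beta> z \<in> {x \<in> space ?L. x \<in> E}} = {z \<in> space ?L. \<beta> z \<in> E}"
      using measurable_space[OF bm] by auto
    ultimately have "{z \<in> space (PiM ?K (\<lambda>_. gauss :: real measure)). \<beta> z \<in> E} \<in> sets (gaussians ?K)"
      unfolding sp st by simp
    then show ?thesis
      by (subst nn_integral_indicator[symmetric]) (auto intro!: nn_integral_cong simp: g_def indicator_def simp del: nn_integral_indicator)
  qed
  also have "{z \<in> space (gaussians ?K). \<beta> z \<in> E} =
    {z \<in> space (gaussians ?K). \<forall>j\<in>?K. (\<Sum>i=1..j. bridge n (z(n := r / sqrt n)) i) \<le> r}" (is "_ = ?Z")
  proof -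
    have "(\<Sum>i=1..j. \<beta> z i) = (\<Sum>i=1..j. bridge n (z(n := r / sqrt n)) i)" if "j \<in> ?K" for z j
      using that by (intro sum.cong refl \<beta>_bridge) (auto simp: Suc_le_eq)
    then show ?thesis by (simp add: E_def)
  qed
  finally have "(\<integral>\<^sup>+z. h z \<partial>?L) * ennreal q = ennreal (std_normal_density (r / q)) * emeasure (gaussians ?K) ?Z"
    unfolding subst .
  also have "\<dots> = ennreal (std_normal_density (r / q) * measure (gaussians ?K) ?Z)"
    using prob_space_PiM_gauss[where 'b=real, of ?K]
    by (simp add: finite_measure.emeasure_eq_measure prob_space.finite_measure ennreal_mult')
  finally have "enn2real ((\<integral>\<^sup>+z. h z \<partial>?L) * ennreal q) = std_normal_density (r / q) * measure (gaussians ?K) ?Z"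
    by simp
  then have "enn2real (\<integral>\<^sup>+z. h z \<partial>?L) * q = std_normal_density (r / q) * measure (gaussians ?K) ?Z"
    using q by (simp add: enn2real_mult)
  moreover have "normal_density 0 (sqrt (real n)) r = std_normal_density (r / q) / q"
    using q by (simp add: normal_density_def std_normal_density_def q_def real_sqrt_mult power_divide)
  moreover have "std_normal_density (r / q) > 0" by (simp add: std_normal_density_def)
  moreover have "persist_q n r = enn2real (\<integral>\<^sup>+z. h z \<partial>?L) / normal_density 0 (sqrt (real n)) r"
    unfolding persist_q_def h_def E_def ..
  moreover have "a / (c / q) = b" if "a * q = c * b" "c > 0" for a b c :: real
    using that q by (simp add: field_simps)
  ultimately show ?thesis by simp
qed

text \<open>By \<open>sum_bridge\<close>, \<open>x n /\<^sub>R sqrt n\<close> is the mean of the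
  outputs; so setting the last input to 0 centres the other outputs.\<close>

lemma bridge_shift:
  assumes "i \<in> {1..n}" "i \<noteq> n"
  shows "bridge n (x(n := 0)) i = bridge n x i - x n /\<^sub>R sqrt n"
proof -
  have n: "n > 1" using assms by auto
  then have q: "sqrt n > 1" by simp
  have ivl: "{1..n} = insert n {1..<n}" using n by auto
  have "(\<Sum>k\<in>{1..<n}. (x(n := 0)) k) = (\<Sum>k\<in>{1..<n}. x k)" by (intro sum.cong) auto
  then have S: "(\<Sum>k=1..n. (x(n := 0)) k) = (\<Sum>k=1..n. x k) - x n"
    unfolding ivl by simp
  have e: "1 / (sqrt n - 1) * (1 - 1 / sqrt n) = 1 / sqrt n" using q by (simp add: field_simps)
  have "bridge n x i - bridge n (x(n := 0)) i = (1 / (sqrt n - 1) * (1 - 1 / sqrt n)) *\<^sub>R x n"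
    unfolding bridge_def S using assms(2) by (simp add: algebra_simps divide_inverse)
  then show ?thesis unfolding e by (simp add: algebra_simps divide_inverse)
qed

text \<open>\<open>B\<close> is the walk with its mean drift removed, so it returns to 0 at time
  \<open>n\<close>. A cyclic shift of the steps preserves their law and shifts the path
  \<open>B\<close> in time, up to a constant; hence the maximum moves from \<open>Suc s\<close> to
  \<open>s\<close>.\<close>

lemma prob_cyclic_shift_step:
  fixes n s :: nat
  defines "B \<equiv> \<lambda>j x. (\<Sum>i<j. x i) - real j * ((\<Sum>i<n. x i :: real) / real n)"
  assumes s: "Suc s < n"
  shows "measure (gaussians {..<n}) {x \<in> space (gaussians {..<n}). \<forall>j\<in>{..<n}. B j x \<le> B (Suc s) x}
    = measure (gaussians {..<n}) {x \<in> space (gaussians {..<n}). \<forall>j\<in>{..<n}. B j x \<le> B s x}"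
proof -
  let ?P = "PiM {..<n} (\<lambda>_. gauss :: real measure)"
  let ?f = "\<lambda>i. Suc i mod n"
  let ?E = "{x \<in> space ?P. \<forall>j\<in>{..<n}. B j x \<le> B s x}"
  have n: "n > 0" using s by simp
  have E: "?E \<in> sets ?P"
    unfolding B_def using s
    by (intro sets.sets_Collect_finite_All' borel_measurable_le borel_measurable_diff
        borel_measurable_sum borel_measurable_times borel_measurable_divide) auto
  have inj: "inj_on ?f {..<n}"
  proof (rule inj_onI)
    fix i j assume "i \<in> {..<n}" "j \<in> {..<n}" "Suc i mod n = Suc j mod n"
    then show "i = j" by (cases "Suc i = n"; cases "Suc j = n") auto
  qed
  have sub: "?f ` {..<n} \<subseteq> {..<n}" using n by auto
  then have bij: "bij_betw ?f {..<n} {..<n}"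
    using inj by (simp add: bij_betw_def endo_inj_surj)
  have Bf: "B j (\<lambda>i\<in>{..<n}. x (?f i)) = B (Suc j) x - B 1 x" if j: "j < n" for j x
  proof -
    have tot: "(\<Sum>i<n. (\<lambda>i\<in>{..<n}. x (?f i)) i) = (\<Sum>i<n. x i)"
      using sum.reindex_bij_betw[OF bij, of x] by simp
    have "(\<Sum>i<j. (\<lambda>i\<in>{..<n}. x (?f i)) i) = (\<Sum>i<j. x (Suc i))"
      using j by (intro sum.cong) auto
    also have "\<dots> = (\<Sum>i<Suc j. x i) - x 0" by (subst sum.lessThan_Suc_shift) simp
    finally have part: "(\<Sum>i<j. (\<lambda>i\<in>{..<n}. x (?f i)) i) = (\<Sum>i<Suc j. x i) - x 0" .
    show ?thesis unfolding B_def tot part by (simp add: algebra_simps add_divide_distrib)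
  qed
  have B0: "B 0 x = 0" "B n x = 0" for x using n by (auto simp: B_def)
  have ev: "(\<lambda>i\<in>{..<n}. x (?f i)) \<in> ?E \<longleftrightarrow> (\<forall>j\<in>{..<n}. B j x \<le> B (Suc s) x)" for x
  proof -
    have "(\<lambda>i\<in>{..<n}. x (?f i)) \<in> ?E \<longleftrightarrow> (\<forall>j\<in>{..<n}. B (Suc j) x \<le> B (Suc s) x)"
      using s by (simp add: Bf space_PiM)
    also have "\<dots> \<longleftrightarrow> (\<forall>j\<in>{..<n}. B j x \<le> B (Suc s) x)"
    proof safe
      fix j assume h: "\<forall>j\<in>{..<n}. B (Suc j) x \<le> B (Suc s) x" and j: "j < n"
      show "B j x \<le> B (Suc s) x"
      proof (cases j)
        case 0
        then show ?thesis using bspec[OF h, of "n - 1"] n B0 by simp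
      qed (use h j in auto)
    next
      fix j assume h: "\<forall>j\<in>{..<n}. B j x \<le> B (Suc s) x" and j: "j < n"
      show "B (Suc j) x \<le> B (Suc s) x"
      proof (cases "Suc j = n")
        case True
        then show ?thesis using bspec[OF h, of 0] n B0 by simp
      qed (use h j in auto)
    qed
    finally show ?thesis .
  qed
  have "measure ?P {x \<in> space ?P. (\<lambda>i\<in>{..<n}. x (?f i)) \<in> ?E} = measure ?P ?E"
    by (rule measure_PiM_gauss_reindex[OF inj sub E])
  then show ?thesis unfolding ev .
qed

text \<open>Among the cyclic shifts of the centred walk exactly one stays nonpositive.\<close>
lemma prob_centred_walk_nonpos:
  fixes n :: nat
  assumes n: "n \<ge> 1"
  shows "measure (gaussians {1..n}) {x \<in> space (gaussians {1..n}).
     \<forall>j\<in>{1..n-1}. (\<Sum>i=1..j. x i - (\<Sum>k=1..n. x k :: real) / real n) \<le> 0} = 1 / real n"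
proof -
  let ?P = "PiM {..<n} (\<lambda>_. gauss :: real measure)"
  interpret P: prob_space ?P by (rule prob_space_PiM_gauss)
  define B where "B = (\<lambda>j x. (\<Sum>i<j. x i) - real j * ((\<Sum>i<n. x i :: real) / real n))"
  define M where "M s = P.prob {x \<in> space ?P. \<forall>j\<in>{..<n}. B j x \<le> B s x}" for s
  have Bm: "B k \<in> borel_measurable ?P" if "k \<in> {..<n}" for k
    unfolding B_def using that
    by (intro borel_measurable_diff borel_measurable_sum borel_measurable_times borel_measurable_divide) auto
  have M0: "M s = M 0" if "s < n" for s
    using that
  proof (induction s)
    case (Suc s)
    then show ?case using prob_cyclic_shift_step[of s n] by (simp add: M_def B_def)
  qed simp
  have "(\<Sum>s\<in>{..<n}. M s) = 1"
    unfolding M_def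
  proof (rule P.sum_prob_argmax[OF _ _ Bm])
    have neq: "AE x in ?P. s < t \<longrightarrow> B s x \<noteq> B t x" if t: "t < n" for s t :: nat
    proof (cases "s < t")
      case True
      \<comment> \<open>These are the coefficients of the steps in \<open>B t x - B s x\<close>;
        \<open>c s\<close> does not vanish because \<open>t - s < n\<close>.\<close>
      define c where "c i = indicator {s..<t} i - (real t - real s) / real n" for i
      have "c s \<noteq> 0" using True t by (auto simp: c_def field_simps)
      then have "AE x in ?P. (\<Sum>i<n. c i * x i) \<noteq> 0"
        by (intro AE_linear_neq[of _ s]) (use True t in auto)
      then show ?thesis
      proof (rule eventually_mono)
        fix x :: "nat \<Rightarrow> real" assume ne: "(\<Sum>i<n. c i * x i) \<noteq> 0"
        have "(\<Sum>i<n. indicator {s..<t} i * x i) = (\<Sum>i\<in>{..<n}. if i \<in> {s..<t} then x i else 0)"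
          by (intro sum.cong) (auto simp: indicator_def)
        also have "\<dots> = (\<Sum>i\<in>{..<n} \<inter> {s..<t}. x i)" by (rule sum.inter_restrict[symmetric]) simp
        also have "{..<n} \<inter> {s..<t} = {s..<t}" using t by auto
        finally have ind: "(\<Sum>i<n. indicator {s..<t} i * x i) = (\<Sum>i\<in>{s..<t}. x i)" .
        have "(\<Sum>i<n. c i * x i) = (\<Sum>i\<in>{s..<t}. x i) - (\<Sum>i<n. (real t - real s) / real n * x i)"
          unfolding c_def left_diff_distrib sum_subtractf ind ..
        then have "(\<Sum>i<n. c i * x i) = (\<Sum>i\<in>{s..<t}. x i) - (real t - real s) * ((\<Sum>i<n. x i) / real n)"
          unfolding sum_distrib_left[symmetric] by simp
        moreover have "(\<Sum>i<t. x i) = (\<Sum>i<s. x i) + (\<Sum>i\<in>{s..<t}. x i)"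
          using sum.atLeastLessThan_concat[of 0 s t x] True by (simp add: lessThan_atLeast0)
        ultimately have "(\<Sum>i<n. c i * x i) = B t x - B s x"
          by (simp add: B_def algebra_simps diff_divide_distrib add_divide_distrib)
        then show "s < t \<longrightarrow> B s x \<noteq> B t x" using ne by auto
      qed
    qed simp
    have "AE x in ?P. \<forall>t\<in>{..<n}. \<forall>s\<in>{..<n}. s < t \<longrightarrow> B s x \<noteq> B t x"
      by (intro AE_finite_allI neq) auto
    then show "AE x in ?P. inj_on (\<lambda>k. B k x) {..<n}"
      by (rule eventually_mono) (rule linorder_inj_onI', auto)
    have "0 \<in> {..<n}" using n by simp
    then show "{..<n} \<noteq> {}" by blast
  qed auto
  moreover have "(\<Sum>s\<in>{..<n}. M s) = (\<Sum>s\<in>{..<n}. M 0)"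
    by (rule sum.cong[OF refl]) (rule M0, simp)
  ultimately have "real n * M 0 = 1" by simp
  then have M1: "M 0 = 1 / real n" using n by (simp add: field_simps)
  let ?E = "{x \<in> space ?P. \<forall>j\<in>{..<n}. B j x \<le> B 0 x}"
  have E: "?E \<in> sets ?P"
    using Bm n by (intro sets.sets_Collect_finite_All borel_measurable_le) auto
  have ev: "(\<lambda>k\<in>{..<n}. x (Suc k)) \<in> ?E \<longleftrightarrow>
     (\<forall>j\<in>{1..n-1}. (\<Sum>i=1..j. x i - (\<Sum>k=1..n. x k) / real n) \<le> 0)" for x :: "nat \<Rightarrow> real"
  proof -
    have "B j (\<lambda>k\<in>{..<n}. x (Suc k)) = (\<Sum>i=1..j. x i - (\<Sum>k=1..n. x k) / real n)" if "j < n" for j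
    proof -
      have "(\<Sum>i<l. (\<lambda>k\<in>{..<n}. x (Suc k)) i) = (\<Sum>i=1..l. x i)" if "l \<le> n" for l
        using that by (simp add: sum.atLeast1_atMost_eq)
      then show ?thesis using that by (simp add: B_def sum_subtractf)
    qed
    moreover have "B 0 y = 0" for y by (simp add: B_def)
    moreover have "(\<forall>j\<in>{..<n}. (\<Sum>i=1..j. x i - (\<Sum>k=1..n. x k) / real n) \<le> 0) \<longleftrightarrow>
       (\<forall>j\<in>{1..n-1}. (\<Sum>i=1..j. x i - (\<Sum>k=1..n. x k) / real n) \<le> 0)"
    proof -
      have "{..<n} = insert 0 {1..n-1}" using n by auto
      then show ?thesis by simp
    qed
    ultimately show ?thesis by (simp add: space_PiM)
  qed
  have "measure (gaussians {1..n}) {x \<in> space (gaussians {1..n}). (\<lambda>k\<in>{..<n}. x (Suc k)) \<in> ?E} = P.prob ?E"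
    by (rule measure_PiM_gauss_reindex[OF _ _ E]) auto
  then show ?thesis using M1 unfolding ev by (simp add: M_def)
qed

text \<open>At level 0 the pinned input in \<open>persist_q_bridge\<close> is 0, so the event
  concerns the centred outputs of the bridge. These outputs are again independent standard normal,
  and the cyclic symmetry applies to them.\<close>

theorem persist_q_0:
  assumes n: "n \<ge> 1"
  shows "persist_q n 0 = 1 / real n"
proof -
  let ?K = "{1..n-1}" and ?N = "{1..n}"
  let ?P = "PiM ?N (\<lambda>_. gauss :: real measure)"
  let ?Z = "{z \<in> space (gaussians ?K). \<forall>j\<in>?K. (\<Sum>i=1..j. bridge n (z(n := 0 :: real)) i) \<le> 0}"
  let ?C = "{x \<in> space ?P. \<forall>j\<in>?K. (\<Sum>i=1..j. x i - (\<Sum>k=1..n. x k) / real n) \<le> 0}"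
  have Z: "?Z \<in> sets (gaussians ?K)"
  proof (intro sets.sets_Collect_finite_All borel_measurable_le borel_measurable_sum)
    fix j i assume ji: "j \<in> ?K" "i \<in> {1..j}"
    show "(\<lambda>z. bridge n (z(n := 0)) i) \<in> borel_measurable (PiM ?K (\<lambda>_. gauss :: real measure))"
    proof (rule borel_measurable_bridge)
      show "(\<lambda>z. (z(n := 0)) k) \<in> borel_measurable (PiM ?K (\<lambda>_. gauss :: real measure))" if "k \<in> ?N" for k
        using that by (cases "k = n") auto
    qed (use ji in auto)
  qed auto
  have C: "?C \<in> sets ?P"
    by (intro sets.sets_Collect_finite_All borel_measurable_le borel_measurable_sum
        borel_measurable_diff borel_measurable_divide) auto
  have bm: "(\<lambda>x. \<lambda>i\<in>?N. bridge n x i) \<in> ?P \<rightarrow>\<^sub>M ?P"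
  proof (rule measurable_restrict)
    show "(\<lambda>x. bridge n x i) \<in> ?P \<rightarrow>\<^sub>M gauss" if "i \<in> ?N" for i
      using borel_measurable_bridge[of n "\<lambda>k x. x k" ?P i] that by simp
  qed
  have "persist_q n 0 = measure (gaussians ?K) ?Z"
    using persist_q_bridge[OF n, of 0] by simp
  also have "\<dots> = measure ?P {x \<in> space ?P. (\<lambda>k\<in>?K. x k) \<in> ?Z}"
    by (rule measure_PiM_gauss_reindex[OF _ _ Z, symmetric]) auto
  also have "{x \<in> space ?P. (\<lambda>k\<in>?K. x k) \<in> ?Z} = (\<lambda>x. \<lambda>i\<in>?N. bridge n x i) -` ?C \<inter> space ?P"
  proof -
    have "(\<lambda>k\<in>?K. x k) \<in> ?Z \<longleftrightarrow> (\<lambda>i\<in>?N. bridge n x i) \<in> ?C" for x :: "nat \<Rightarrow> real"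
    proof -
      have "(\<Sum>i=1..j. bridge n ((\<lambda>k\<in>?K. x k)(n := 0)) i) =
        (\<Sum>i=1..j. (\<lambda>i\<in>?N. bridge n x i) i - (\<Sum>k=1..n. (\<lambda>i\<in>?N. bridge n x i) k) / real n)" if j: "j \<in> ?K" for j
      proof (rule sum.cong[OF refl])
        fix i assume i: "i \<in> {1..j}"
        then have iN: "i \<in> ?N" "i \<noteq> n" using j n by auto
        have "bridge n ((\<lambda>k\<in>?K. x k)(n := 0)) i = bridge n (x(n := 0)) i"
          using iN by (intro bridge_cong) auto
        also have "\<dots> = bridge n x i - x n / sqrt n" using bridge_shift[OF iN, of x] by (simp add: divide_inverse mult.commute)
        also have "x n / sqrt n = (\<Sum>k=1..n. bridge n x k) / real n"
          unfolding sum_bridge[OF n] using n by (simp add: field_simps)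
        finally have eq: "bridge n ((\<lambda>k\<in>?K. x k)(n := 0)) i = bridge n x i - (\<Sum>k=1..n. bridge n x k) / real n" .
        have r1: "(\<lambda>i\<in>?N. bridge n x i) i = bridge n x i" using iN by simp
        have r2: "(\<Sum>k=1..n. (\<lambda>i\<in>?N. bridge n x i) k) = (\<Sum>k=1..n. bridge n x k)"
          by (intro sum.cong) auto
        show "bridge n ((\<lambda>k\<in>?K. x k)(n := 0)) i =
          (\<lambda>i\<in>?N. bridge n x i) i - (\<Sum>k=1..n. (\<lambda>i\<in>?N. bridge n x i) k) / real n"
          unfolding r1 r2 by (rule eq)
      qed
      then show ?thesis by (simp add: space_PiM del: One_nat_def)
    qed
    then show ?thesis by blast
  qed
  also have "measure ?P \<dots> = measure (distr ?P ?P (\<lambda>x. \<lambda>i\<in>?N. bridge n x i)) ?C"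
    by (rule measure_distr[OF bm C, symmetric])
  also have "\<dots> = measure ?P ?C" by (simp only: distr_bridge[OF n])
  also have "\<dots> = 1 / real n" by (rule prob_centred_walk_nonpos[OF n])
  finally show ?thesis .
qed

subsection \<open>Gaussian determinants\<close>

lemma borel_measurable_vec_nth:
  fixes f :: "'a \<Rightarrow> real^'d::finite"
  assumes "f \<in> borel_measurable M"
  shows "(\<lambda>x. f x $ j) \<in> borel_measurable M"
proof -
  have "(\<lambda>x. f x \<bullet> axis j 1) \<in> borel_measurable M" using assms by measurable
  then show ?thesis by (simp add: inner_axis)
qed

lemma borel_measurable_vec_lambda:
  fixes f :: "'d::finite \<Rightarrow> 'a \<Rightarrow> real"
  assumes "\<And>i. f i \<in> borel_measurable M"
  shows "(\<lambda>x. \<chi> i. f i x) \<in> borel_measurable M"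
  using assms by (subst borel_measurable_euclidean_space) (auto simp: Basis_vec_def inner_axis)

lemma borel_measurable_det:
  fixes f :: "'d::finite \<Rightarrow> 'a \<Rightarrow> real^'d"
  assumes "\<And>k. f k \<in> borel_measurable M"
  shows "(\<lambda>x. det (\<chi> k. f k x)) \<in> borel_measurable M"
  unfolding det_def using borel_measurable_vec_nth[OF assms] by simp

lemma borel_measurable_crossp:
  fixes f :: "'d::finite \<Rightarrow> 'a \<Rightarrow> real^'d"
  assumes "\<And>k. k \<noteq> k0 \<Longrightarrow> f k \<in> borel_measurable M"
  shows "(\<lambda>x. crossp k0 (\<lambda>k. f k x)) \<in> borel_measurable M"
  unfolding crossp_def
proof (intro borel_measurable_vec_lambda borel_measurable_det)
  show "(\<lambda>x. if k = k0 then axis i 1 else f k x) \<in> borel_measurable M" for i k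
    using assms[of k] by (cases "k = k0") auto
qed

text \<open>Row \<open>k\<close> contains a variable \<open>priv k\<close> that no row of smaller
  rank contains. When the rows are revealed in the order of rank, each new row therefore almost
  surely avoids the hyperplane on which the determinant vanishes.\<close>

lemma AE_det_nonzero:
  fixes \<alpha> :: "'d::finite \<Rightarrow> 'i \<Rightarrow> real" and rank :: "'d \<Rightarrow> nat"
  assumes inj: "inj rank"
    and diag: "\<And>k. \<alpha> k (priv k) \<noteq> 0"
    and tri: "\<And>k k'. rank k' < rank k \<Longrightarrow> \<alpha> k' (priv k) = 0"
    and I: "finite I" "\<And>k. priv k \<in> I"
  shows "AE \<omega> in PiM I (\<lambda>_. gauss :: (real^'d) measure). det (\<chi> k. \<Sum>i\<in>I. \<alpha> k i *\<^sub>R \<omega> i) \<noteq> 0"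
proof -
  \<comment> \<open>Rows not yet revealed are unit vectors, so the induction starts at the identity
    matrix.\<close>
  define row where "row n I \<omega> k = (if rank k < n then (\<Sum>i\<in>I. \<alpha> k i *\<^sub>R \<omega> i) else axis k 1)" for n I and \<omega> :: "'i \<Rightarrow> real^'d" and k
  have "AE \<omega> in PiM I (\<lambda>_. gauss :: (real^'d) measure). det (\<chi> k. row n I \<omega> k) \<noteq> 0"
    if "finite I" "\<And>k. rank k < n \<Longrightarrow> priv k \<in> I" for n I
    using that
  proof (induction n arbitrary: I)
    case 0
    have "(\<chi> k. axis k 1) = (mat 1 :: real^'d^'d)" by (simp add: vec_eq_iff mat_def axis_def)
    then show ?case by (simp add: row_def)
  next
    case (Suc n)
    show ?case
    proof (cases "\<exists>k. rank k = n")
      case False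
      then have "row (Suc n) I \<omega> k = row n I \<omega> k" for \<omega> k
        by (auto simp: row_def less_Suc_eq)
      then show ?thesis using Suc by simp
    next
      case True
      then obtain k1 where k1: "rank k1 = n" by blast
      define i where "i = priv k1"
      define J where "J = I - {i}"
      have IJ: "I = insert i J" "i \<notin> J" "finite J"
        using Suc.prems k1 by (auto simp: J_def i_def)
      have ai: "\<alpha> k i = 0" if "rank k < n" for k
        using tri[of k k1] that k1 by (simp add: i_def)
      have privJ: "priv k \<in> J" if "rank k < n" for k
      proof -
        have "priv k \<noteq> i" using ai[OF that] diag[of k] by auto
        then show ?thesis using Suc.prems(2)[of k] that by (simp add: J_def)
      qed
      have IH: "AE \<omega> in PiM J (\<lambda>_. gauss :: (real^'d) measure). det (\<chi> k. row n J \<omega> k) \<noteq> 0"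
        by (rule Suc.IH[OF IJ(3)]) (rule privJ)
      define row' where "row' \<omega> y k = (if k = k1 then \<alpha> k1 i *\<^sub>R y + (\<Sum>j\<in>J. \<alpha> k1 j *\<^sub>R \<omega> j) else row n J \<omega> k)"
        for \<omega> y and k :: 'd
      have row_upd: "row (Suc n) I (fun_upd \<omega> i y) k = row' \<omega> y k" for \<omega> y k
      proof -
        have s: "(\<Sum>j\<in>I. \<alpha> k j *\<^sub>R (fun_upd \<omega> i y) j) = \<alpha> k i *\<^sub>R y + (\<Sum>j\<in>J. \<alpha> k j *\<^sub>R \<omega> j)"
          using IJ by (auto intro!: sum.cong)
        have "rank k = n \<longleftrightarrow> k = k1" using inj k1 by (auto dest: injD)
        then show ?thesis using s ai[of k] by (auto simp: row_def row'_def less_Suc_eq k1)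
      qed
      have "AE \<omega> in PiM (insert i J) (\<lambda>_. gauss :: (real^'d) measure). det (\<chi> k. row (Suc n) I \<omega> k) \<noteq> 0"
      proof (rule AE_PiM_insert[OF gauss.prob_space_axioms IJ(3,2)])
        have "(\<lambda>\<omega>. row (Suc n) I \<omega> k) \<in> borel_measurable (PiM (insert i J) (\<lambda>_. gauss :: (real^'d) measure))" for k
          unfolding row_def IJ(1)[symmetric] by (cases "rank k < Suc n") (simp_all, measurable)
        then have "(\<lambda>\<omega>. det (\<chi> k. row (Suc n) I \<omega> k)) \<in> borel_measurable (PiM (insert i J) (\<lambda>_. gauss :: (real^'d) measure))"
          by (rule borel_measurable_det)
        then show "{x \<in> space (gaussians (insert i J)). det (\<chi> k. row (Suc n) I x k) \<noteq> 0} \<in> sets (PiM (insert i J) (\<lambda>_. gauss :: (real^'d) measure))"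
          by measurable
        show "AE \<omega> in gaussians J. AE y in gauss. det (\<chi> k. row (Suc n) I (fun_upd \<omega> i y) k) \<noteq> 0"
          using IH
        proof (rule eventually_mono)
          fix \<omega> :: "'i \<Rightarrow> real^'d" assume d: "det (\<chi> k. row n J \<omega> k) \<noteq> 0"
          define c where "c = crossp k1 (row n J \<omega>)"
          have "(if k = k1 then axis k1 1 else row n J \<omega> k) = row n J \<omega> k" for k
            by (simp add: row_def k1)
          then have "c \<bullet> axis k1 1 \<noteq> 0" using d by (simp add: c_def inner_crossp)
          then have "\<alpha> k1 i *\<^sub>R c \<noteq> 0" using diag[of k1] by (auto simp: i_def)
          from AE_gauss_inner_neq[OF this, of "- (c \<bullet> (\<Sum>j\<in>J. \<alpha> k1 j *\<^sub>R \<omega> j))"]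
          show "AE y in gauss. det (\<chi> k. row (Suc n) I (fun_upd \<omega> i y) k) \<noteq> 0"
          proof (rule eventually_mono)
            fix y assume "\<alpha> k1 i *\<^sub>R c \<bullet> y \<noteq> - (c \<bullet> (\<Sum>j\<in>J. \<alpha> k1 j *\<^sub>R \<omega> j))"
            moreover have "det (\<chi> k. row (Suc n) I (fun_upd \<omega> i y) k) = c \<bullet> (\<alpha> k1 i *\<^sub>R y + (\<Sum>j\<in>J. \<alpha> k1 j *\<^sub>R \<omega> j))"
              unfolding c_def inner_crossp row_upd row'_def ..
            ultimately show "det (\<chi> k. row (Suc n) I (fun_upd \<omega> i y) k) \<noteq> 0"
              by (simp add: inner_add_right)
          qed
        qed
      qed
      then show ?thesis unfolding IJ(1)[symmetric] .
    qed
  qed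
  from this[of I "Suc (Max (range rank))"] I
  have "AE \<omega> in PiM I (\<lambda>_. gauss :: (real^'d) measure). det (\<chi> k. row (Suc (Max (range rank))) I \<omega> k) \<noteq> 0" by simp
  moreover have "rank k < Suc (Max (range rank))" for k by (simp add: less_Suc_eq_le)
  ultimately show ?thesis by (simp add: row_def)
qed

lemma reflection_exists:
  fixes u e :: "'b::euclidean_space"
  assumes u: "norm u = 1" and e: "norm e = 1"
  obtains \<mu> where "(\<mu> *\<^sub>R (u - e)) \<bullet> (\<mu> *\<^sub>R (u - e)) = 2 \<or> \<mu> *\<^sub>R (u - e) = 0"
    "u - ((\<mu> *\<^sub>R (u - e)) \<bullet> u) *\<^sub>R (\<mu> *\<^sub>R (u - e)) = e"
proof (cases "u = e")
  case True then show ?thesis by (intro that[of 0]) auto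
next
  case False
  define w where "w = u - e"
  have ww: "w \<bullet> w \<noteq> 0" using False by (simp add: w_def)
  have wu: "w \<bullet> u = (w \<bullet> w) / 2"
    using u e by (simp add: w_def inner_diff_left inner_diff_right inner_commute norm_eq_1)
  have pos: "w \<bullet> w > 0" using ww by simp
  define \<mu> where "\<mu> = sqrt (2 / (w \<bullet> w))"
  have \<mu>: "\<mu> * \<mu> = 2 / (w \<bullet> w)" using pos by (simp add: \<mu>_def)
  show ?thesis
  proof (rule that[of \<mu>], unfold w_def[symmetric])
    have "(\<mu> *\<^sub>R w) \<bullet> (\<mu> *\<^sub>R w) = \<mu> * \<mu> * (w \<bullet> w)" by simp
    then show "(\<mu> *\<^sub>R w) \<bullet> (\<mu> *\<^sub>R w) = 2 \<or> \<mu> *\<^sub>R w = 0" using \<mu> pos by simp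
    have "((\<mu> *\<^sub>R w) \<bullet> u) *\<^sub>R (\<mu> *\<^sub>R w) = (\<mu> * \<mu> * (w \<bullet> u)) *\<^sub>R w" by (simp add: mult_ac)
    also have "\<mu> * \<mu> * (w \<bullet> u) = 1" unfolding \<mu> wu using pos by simp
    finally show "u - ((\<mu> *\<^sub>R w) \<bullet> u) *\<^sub>R (\<mu> *\<^sub>R w) = e" by (simp add: w_def)
  qed
qed

lemma orthogonal_transformation_reflection:
  fixes n :: "'b::euclidean_space"
  assumes "n \<bullet> n = 2 \<or> n = 0"
  shows "orthogonal_transformation (\<lambda>x. x - (n \<bullet> x) *\<^sub>R n)"
proof -
  have "linear (\<lambda>x. x - (n \<bullet> x) *\<^sub>R n)"
    by (rule linearI) (simp_all add: inner_add_right algebra_simps)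
  moreover have "(x - (n \<bullet> x) *\<^sub>R n) \<bullet> (y - (n \<bullet> y) *\<^sub>R n) = x \<bullet> y" for x y
    using assms by (auto simp: inner_diff_left inner_diff_right inner_commute algebra_simps)
  ultimately show ?thesis by (simp add: orthogonal_transformation_def)
qed

lemma distr_PiM_gauss_map:
  fixes f :: "'b::euclidean_space \<Rightarrow> 'c::euclidean_space"
  assumes I: "finite I" and f: "f \<in> borel_measurable borel" "distr gauss borel f = gauss"
  shows "distr (gaussians I) (gaussians I) (\<lambda>x. \<lambda>i\<in>I. f (x i)) = PiM I (\<lambda>_. gauss :: 'c measure)"
proof -
  have "distr (gaussians I) (gaussians I) (compose I f) = PiM I (\<lambda>_. distr (gauss :: 'b measure) (gauss :: 'c measure) f)"
    by (rule distr_PiM_finite_prob_space') (use I f(1) gauss.prob_space_axioms in auto)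
  moreover have "distr gauss gauss f = (gauss :: 'c measure)"
    using f(2) by (simp cong: distr_cong)
  ultimately show ?thesis by (simp add: compose_def[abs_def])
qed

text \<open>The mean of the chi distribution with \<open>n\<close> degrees of freedom, i.e. of the
  length of a standard Gaussian vector in dimension \<open>n\<close>.\<close>

definition chi_mean :: "nat \<Rightarrow> real" where
  "chi_mean n = sqrt 2 * Gamma ((real n + 1) / 2) / Gamma (real n / 2)"

lemma Gamma_real_Suc_half: "Gamma (real k + 1 / 2) = sqrt pi * fact (2 * k) / (4 ^ k * fact k)"
proof (induction k)
  case (Suc k)
  have "Gamma (real (Suc k) + 1 / 2) = Gamma ((real k + 1 / 2) + 1)" by (simp add: add_ac)
  also have "\<dots> = (real k + 1 / 2) * Gamma (real k + 1 / 2)"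
    by (rule Gamma_plus1) (auto dest!: nonpos_Ints_nonpos)
  also have "\<dots> = sqrt pi * fact (2 * Suc k) / (4 ^ Suc k * fact (Suc k))"
  proof -
    have f1: "fact (2 * Suc k) = (2 * real k + 2) * (2 * real k + 1) * fact (2 * k)" by (simp add: algebra_simps)
    have f2: "fact (Suc k) = (real k + 1) * fact k" by (simp add: algebra_simps)
    have "(y + 1 / 2) * (p * f / (q * g)) = p * ((2 * y + 2) * (2 * y + 1) * f) / (4 * q * ((y + 1) * g))"
      if "y \<ge> 0" "q > 0" "g > 0" for y p f q g :: real
      using that by (simp add: divide_simps) (simp add: algebra_simps)
    then show ?thesis unfolding Suc.IH f1 f2 by simp
  qed
  finally show ?case .
qed (simp add: Gamma_one_half_real)

lemma nn_integral_std_normal_abs_moment: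
  "(\<integral>\<^sup>+x. ennreal (std_normal_density x * \<bar>x\<bar> ^ n) \<partial>lborel) = ennreal (2 powr (real n / 2) * Gamma ((real n + 1) / 2) / sqrt pi)"
proof (cases "even n")
  case True
  then obtain k where k: "n = 2 * k" by blast
  have "(\<integral>\<^sup>+x. ennreal (std_normal_density x * \<bar>x\<bar> ^ n) \<partial>lborel) = ennreal (fact (2 * k) / (2 ^ k * fact k))"
    using std_normal_moment_even[of k]
    by (simp add: k has_bochner_integral_iff nn_integral_eq_integral power_mult)
  moreover have "2 powr (real n / 2) * Gamma ((real n + 1) / 2) / sqrt pi = fact (2 * k) / (2 ^ k * fact k)"
  proof -
    have e: "(real n + 1) / 2 = real k + 1 / 2" "real n / 2 = real k" by (simp_all add: k)
    have p: "(4::real) ^ k = 2 ^ k * 2 ^ k" by (simp flip: power_mult_distrib)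
    show ?thesis unfolding e Gamma_real_Suc_half p by (simp add: powr_realpow)
  qed
  ultimately show ?thesis by simp
next
  case False
  then obtain k where k: "n = 2 * k + 1" by (blast elim: oddE)
  have "(\<integral>\<^sup>+x. ennreal (std_normal_density x * \<bar>x\<bar> ^ n) \<partial>lborel) = ennreal (sqrt (2 / pi) * 2 ^ k * fact k)"
    using std_normal_moment_abs_odd[of k]
    by (simp add: k has_bochner_integral_iff nn_integral_eq_integral)
  moreover have "2 powr (real n / 2) * Gamma ((real n + 1) / 2) / sqrt pi = sqrt (2 / pi) * 2 ^ k * fact k"
  proof -
    have e: "(real n + 1) / 2 = 1 + real k" "real n / 2 = real k + 1 / 2" by (simp_all add: k)
    show ?thesis unfolding e
      by (simp add: Gamma_fact powr_add powr_realpow powr_half_sqrt real_sqrt_divide)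
  qed
  ultimately show ?thesis by simp
qed

text \<open>Polar coordinates for radial functions: the two measures are compared on the half-lines
  \<open>{..a}\<close>, where volumes of balls suffice. Radius 0 is obtained as a limit of positive
  radii.\<close>

lemma distr_L2_lborel:
  assumes I: "finite I" "I \<noteq> {}"
  shows "distr (PiM I (\<lambda>_. lborel)) borel (\<lambda>x. sqrt (\<Sum>i\<in>I. (x i)\<^sup>2))
    = density lborel (\<lambda>r. ennreal (real (card I) * unit_ball_vol (card I) * r ^ (card I - 1) * indicator {0..} r))"
proof (rule measure_eqI_generator_eq[where E="range (\<lambda>a::real. {..a})" and \<Omega>=UNIV and A="\<lambda>n::nat. {..real n}"])
  let ?n = "card I" and ?N = "\<lambda>x::_ \<Rightarrow> real. sqrt (\<Sum>i\<in>I. (x i)\<^sup>2)"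
  have n: "?n > 0" using I by (simp add: card_gt_0_iff)
  show "Int_stable (range (\<lambda>a::real. {..a}))"
    by (auto simp: Int_stable_def)
  have Nm: "?N \<in> borel_measurable (PiM I (\<lambda>_. lborel))" by measurable
  have D: "emeasure (distr (PiM I (\<lambda>_. lborel)) borel ?N) {..r} = ennreal (unit_ball_vol ?n * r ^ ?n)" if "r \<ge> 0" for r
  proof (cases "r = 0")
    case False
    then have "r > 0" using that by simp
    have "?N -` {..r} \<inter> space (PiM I (\<lambda>_. lborel)) = {f. sqrt (\<Sum>i\<in>I. (f i)\<^sup>2) \<le> r} \<inter> space (PiM I (\<lambda>_. lborel))" by auto
    then show ?thesis using emeasure_cball_aux[OF I(1) \<open>r > 0\<close>]
      by (subst emeasure_distr) (auto intro: Nm)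
  next
    case True
    have "emeasure (distr (PiM I (\<lambda>_. lborel)) borel ?N) {..0} \<le> 0"
    proof (rule ennreal_le_epsilon)
      fix e :: real assume e: "0 < e"
      define V where "V = unit_ball_vol (real ?n)"
      have V: "V > 0" by (simp add: V_def)
      define t where "t = min 1 (e / V)"
      have t: "0 < t" "t \<le> 1" "V * t \<le> e" using e V by (auto simp: t_def min_def field_simps)
      have "emeasure (distr (PiM I (\<lambda>_. lborel)) borel ?N) {..0} \<le> emeasure (distr (PiM I (\<lambda>_. lborel)) borel ?N) {..t}"
        using t by (intro emeasure_mono) auto
      also have "\<dots> = ennreal (V * t ^ ?n)"
      proof -
        have "?N -` {..t} \<inter> space (PiM I (\<lambda>_. lborel)) = {f. sqrt (\<Sum>i\<in>I. (f i)\<^sup>2) \<le> t} \<inter> space (PiM I (\<lambda>_. lborel))" by auto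
        then show ?thesis using emeasure_cball_aux[OF I(1) t(1)]
          by (subst emeasure_distr) (auto intro: Nm simp: V_def)
      qed
      also have "\<dots> \<le> ennreal e"
      proof (rule ennreal_leI)
        have "t ^ ?n \<le> t ^ 1" using t n by (intro power_decreasing) auto
        then have "V * t ^ ?n \<le> V * t" using V by simp
        then show "V * t ^ ?n \<le> e" using t by simp
      qed
      finally show "emeasure (distr (PiM I (\<lambda>_. lborel)) borel ?N) {..0} \<le> 0 + ennreal e" by simp
    qed
    then show ?thesis using True n by simp
  qed
  let ?g = "\<lambda>r. ennreal (real ?n * unit_ball_vol ?n * r ^ (?n - 1) * indicator {0..} r)"
  have D': "emeasure (density lborel ?g) {..r} = ennreal (unit_ball_vol ?n * r ^ ?n)" if "r \<ge> 0" for r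
  proof -
    have "emeasure (density lborel ?g) {..r} = (\<integral>\<^sup>+x. ennreal (real ?n * unit_ball_vol ?n * x ^ (?n - 1)) * indicator {0..r} x \<partial>lborel)"
      by (subst emeasure_density) (auto intro!: nn_integral_cong simp: indicator_def)
    also have "\<dots> = ennreal (unit_ball_vol ?n * r ^ ?n - unit_ball_vol ?n * 0 ^ ?n)"
    proof (rule nn_integral_FTC_Icc[OF _ _ _ that])
      show "(\<lambda>x. real ?n * unit_ball_vol ?n * x ^ (?n - 1)) \<in> borel_measurable borel" by measurable
      show "((\<lambda>x. unit_ball_vol ?n * x ^ ?n) has_real_derivative real ?n * unit_ball_vol ?n * x ^ (?n - 1)) (at x)"
        if "x \<in> {0..r}" for x
        by (auto intro!: derivative_eq_intros)
      show "0 \<le> real ?n * unit_ball_vol ?n * x ^ (?n - 1)" if "x \<in> {0..r}" for x using that by simp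
    qed
    finally show ?thesis using n by (simp add: zero_power)
  qed
  show "emeasure (distr (PiM I (\<lambda>_. lborel)) borel ?N) X = emeasure (density lborel ?g) X"
    if X': "X \<in> range (\<lambda>a::real. {..a})" for X
  proof -
    obtain r where X: "X = {..r}" using X' by blast
    show ?thesis
    proof (cases "r \<ge> 0")
      case False
      have "?N -` {..r} \<inter> space (PiM I (\<lambda>_. lborel)) = {}"
      proof -
        have "\<not> ?N x \<le> r" for x
        proof -
          have "0 \<le> ?N x" by (intro real_sqrt_ge_zero sum_nonneg) simp
          then show ?thesis using False by linarith
        qed
        then show ?thesis by auto
      qed
      then have 1: "emeasure (distr (PiM I (\<lambda>_. lborel)) borel ?N) X = 0"
        unfolding X by (subst emeasure_distr) (auto intro: Nm)
      have z: "?g x * indicator {..r} x = 0" for x using False by (auto simp: indicator_def)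
      have "emeasure (density lborel ?g) X = (\<integral>\<^sup>+x. ?g x * indicator {..r} x \<partial>lborel)"
        unfolding X by (subst emeasure_density) auto
      also have "\<dots> = 0" unfolding z by simp
      finally have "emeasure (density lborel ?g) X = 0" .
      then show ?thesis using 1 by simp
    qed (simp only: X D D')
  qed
  show "sets (distr (PiM I (\<lambda>_. lborel)) borel ?N) = sigma_sets UNIV (range (\<lambda>a::real. {..a}))"
    "sets (density lborel ?g) = sigma_sets UNIV (range (\<lambda>a::real. {..a}))"
    by (simp_all add: borel_eq_atMost)
  show "range (\<lambda>n::nat. {..real n}) \<subseteq> range (\<lambda>a::real. {..a})" by auto
  show "(\<Union>n::nat. {..real n}) = UNIV" by (auto intro: real_arch_simple)
  show "emeasure (distr (PiM I (\<lambda>_. lborel)) borel ?N) {..real n} \<noteq> \<infinity>" for n by (simp add: D)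
qed auto

text \<open>In radial form the integral is, up to constants, half of the absolute moment of order
  \<open>card I\<close> of a real normal variable.\<close>

lemma nn_integral_L2_gauss:
  assumes I: "finite I" "I \<noteq> {}"
  shows "(\<integral>\<^sup>+x. ennreal (sqrt (\<Sum>i\<in>I. (x i)\<^sup>2)) \<partial>PiM I (\<lambda>_. gauss :: real measure)) = ennreal (chi_mean (card I))"
proof -
  define n where "n = card I"
  have n: "n > 0" using I by (simp add: card_gt_0_iff n_def)
  define C where "C = ((2 * pi) powr (- 1 / 2)) ^ n"
  define V where "V = unit_ball_vol (real n)"
  have CV: "C > 0" "V > 0" by (simp_all add: C_def V_def)
  define f where "f t = ennreal (C * exp (- t\<^sup>2 / 2)) * ennreal t" for t :: real
  have f[measurable]: "f \<in> borel_measurable borel" unfolding f_def by measurable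
  have "(\<integral>\<^sup>+x. ennreal (sqrt (\<Sum>i\<in>I. (x i)\<^sup>2)) \<partial>PiM I (\<lambda>_. gauss :: real measure))
     = (\<integral>\<^sup>+x. f (sqrt (\<Sum>i\<in>I. (x i)\<^sup>2)) \<partial>PiM I (\<lambda>_. lborel))"
    by (subst PiM_gauss_density[OF I(1)], subst nn_integral_density)
       (auto simp: f_def C_def n_def sum_nonneg)
  also have "\<dots> = (\<integral>\<^sup>+t. f t \<partial>distr (PiM I (\<lambda>_. lborel)) borel (\<lambda>x. sqrt (\<Sum>i\<in>I. (x i)\<^sup>2)))"
    by (subst nn_integral_distr) auto
  also have "\<dots> = (\<integral>\<^sup>+t. ennreal (real n * V * t ^ (n - 1) * indicator {0..} t) * f t \<partial>lborel)"
    unfolding distr_L2_lborel[OF I] n_def[symmetric] V_def[symmetric]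
    by (subst nn_integral_density) auto
  also have "\<dots> = (\<integral>\<^sup>+t. ennreal (real n * V * C * sqrt (2 * pi)) * (ennreal (std_normal_density t * \<bar>t\<bar> ^ n) * indicator {0..} t) \<partial>lborel)"
  proof (rule nn_integral_cong)
    fix t :: real
    show "ennreal (real n * V * t ^ (n - 1) * indicator {0..} t) * f t =
      ennreal (real n * V * C * sqrt (2 * pi)) * (ennreal (std_normal_density t * \<bar>t\<bar> ^ n) * indicator {0..} t)"
    proof (cases "t \<ge> 0")
      case True
      have "t ^ n = t ^ (n - 1) * t" using n by (metis Suc_diff_1 power_Suc2)
      then have "real n * V * t ^ (n - 1) * (C * exp (- t\<^sup>2 / 2) * t) = real n * V * C * sqrt (2 * pi) * (std_normal_density t * \<bar>t\<bar> ^ n)"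
        using True by (simp add: std_normal_density_def)
      then show ?thesis using True CV by (simp add: f_def flip: ennreal_mult)
    qed simp
  qed
  also have "\<dots> = ennreal (real n * V * C * sqrt (2 * pi)) * (\<integral>\<^sup>+t. ennreal (std_normal_density t * \<bar>t\<bar> ^ n) * indicator {0..} t \<partial>lborel)"
    by (rule nn_integral_cmult) measurable
  also have "(\<integral>\<^sup>+t. ennreal (std_normal_density t * \<bar>t\<bar> ^ n) * indicator {0..} t \<partial>lborel)
     = ennreal (2 powr (real n / 2) * Gamma ((real n + 1) / 2) / sqrt pi / 2)"
  proof -
    let ?h = "\<lambda>t. ennreal (std_normal_density t * \<bar>t\<bar> ^ n)"
    have sym: "(\<integral>\<^sup>+t. ?h t * indicator {..0} t \<partial>lborel) = (\<integral>\<^sup>+t. ?h t * indicator {0..} t \<partial>lborel)"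
      by (subst nn_integral_real_affine[where c="-1" and t=0])
         (auto intro!: nn_integral_cong simp: std_normal_density_def indicator_def)
    have "(\<integral>\<^sup>+t. ?h t \<partial>lborel) = (\<integral>\<^sup>+t. ?h t * indicator {..0} t + ?h t * indicator {0..} t \<partial>lborel)"
      using n by (intro nn_integral_cong) (auto simp: indicator_def)
    also have "\<dots> = 2 * (\<integral>\<^sup>+t. ?h t * indicator {0..} t \<partial>lborel)"
      by (subst nn_integral_add) (auto simp: sym mult_2)
    finally have "2 * (\<integral>\<^sup>+t. ?h t * indicator {0..} t \<partial>lborel) = 2 * ennreal (2 powr (real n / 2) * Gamma ((real n + 1) / 2) / sqrt pi / 2)"
      unfolding nn_integral_std_normal_abs_moment
      by (simp add: Gamma_real_pos ennreal_mult'[symmetric] flip: ennreal_numeral)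
    then show ?thesis by (simp add: ennreal_mult_cancel_left)
  qed
  also have "ennreal (real n * V * C * sqrt (2 * pi)) * ennreal (2 powr (real n / 2) * Gamma ((real n + 1) / 2) / sqrt pi / 2)
    = ennreal (chi_mean n)"
  proof -
    have Gp: "Gamma (real n / 2 + 1) = real n / 2 * Gamma (real n / 2)"
      using n by (intro Gamma_plus1) (auto dest!: nonpos_Ints_nonpos)
    have G0: "Gamma (real n / 2) > 0" using n by (simp add: Gamma_real_pos)
    have C: "C = 1 / (2 powr (real n / 2) * pi powr (real n / 2))"
    proof -
      have "C = (2 * pi) powr (- real n / 2)" by (simp add: C_def powr_power)
      then show ?thesis by (simp add: powr_mult powr_minus_divide)
    qed
    have "real n * V * C * sqrt (2 * pi) * (2 powr (real n / 2) * Gamma ((real n + 1) / 2) / sqrt pi / 2) = chi_mean n"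
      unfolding V_def unit_ball_vol_def chi_mean_def C Gp using n G0
      by (simp add: field_simps real_sqrt_mult)
    then show ?thesis using CV by (subst ennreal_mult[symmetric]) (auto simp: Gamma_real_pos less_imp_le)
  qed
  finally show ?thesis by (simp add: n_def)
qed

lemma distr_gauss_components:
  fixes B :: "'d::finite set"
  shows "distr (gauss :: (real^'d) measure) (gaussians B) (\<lambda>x. \<lambda>k\<in>B. x $ k) = PiM B (\<lambda>_. gauss :: real measure)"
proof -
  let ?Basis = "Basis :: (real^'d) set"
  have ax: "axis k 1 \<in> ?Basis" for k by (simp add: axis_in_Basis_iff)
  have "distr (gauss :: (real^'d) measure) (gaussians B) (\<lambda>x. \<lambda>k\<in>B. x $ k)
    = distr (gaussians ?Basis) (gaussians B) (\<lambda>f. \<lambda>k\<in>B. (\<Sum>b\<in>?Basis. f b *\<^sub>R b) $ k)"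
  proof (subst gauss_eq_distr_PiM, subst distr_distr)
    show "(\<lambda>x::real^'d. \<lambda>k\<in>B. x $ k) \<in> borel \<rightarrow>\<^sub>M gaussians B"
      by (rule measurable_restrict) (simp add: borel_measurable_vec_nth)
  qed (auto simp: o_def)
  also have "(\<lambda>f. \<lambda>k\<in>B. (\<Sum>b\<in>?Basis. f b *\<^sub>R b) $ k) = (\<lambda>f. \<lambda>k\<in>B. f (axis k 1) :: real)"
  proof -
    have "(\<Sum>b\<in>?Basis. f b *\<^sub>R b) $ k = f (axis k 1)" for f k
    proof -
      have "(\<Sum>b\<in>?Basis. f b *\<^sub>R b) $ k = (\<Sum>b\<in>?Basis. f b *\<^sub>R b) \<bullet> axis k 1" by (simp add: inner_axis)
      also have "\<dots> = f (axis k 1)" by (rule inner_sum_left_Basis[OF ax])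
      finally show ?thesis .
    qed
    then show ?thesis by simp
  qed
  also have "distr (gaussians ?Basis) (gaussians B) (\<lambda>f. \<lambda>k\<in>B. f (axis k 1) :: real) = gaussians B"
    by (rule PiM_gauss_reindex) (auto simp: inj_on_def axis_eq_axis ax)
  finally show ?thesis .
qed

lemma nn_integral_partial_norm_gauss:
  fixes B :: "'d::finite set"
  assumes "B \<noteq> {}"
  shows "(\<integral>\<^sup>+x. ennreal (sqrt (\<Sum>k\<in>B. (x $ k)\<^sup>2)) \<partial>(gauss :: (real^'d) measure)) = ennreal (chi_mean (card B))"
proof -
  have m: "(\<lambda>x::real^'d. \<lambda>k\<in>B. x $ k) \<in> gauss \<rightarrow>\<^sub>M gaussians B"
    by (rule measurable_restrict) (simp add: borel_measurable_vec_nth)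
  have "ennreal (chi_mean (card B)) = (\<integral>\<^sup>+x. ennreal (sqrt (\<Sum>k\<in>B. (x k)\<^sup>2)) \<partial>PiM B (\<lambda>_. gauss :: real measure))"
    using assms by (simp add: nn_integral_L2_gauss)
  also have "\<dots> = (\<integral>\<^sup>+x. ennreal (sqrt (\<Sum>k\<in>B. (x $ k)\<^sup>2)) \<partial>(gauss :: (real^'d) measure))"
    by (subst distr_gauss_components[symmetric], subst nn_integral_distr[OF m]) (auto cong: sum.cong)
  finally show ?thesis ..
qed

text \<open>Given the new row x, the determinant depends on its projection p to the coordinates in
  \<open>insert k0 B\<close>, the rows outside being unit vectors. A spatial reflection takes p to
  its length times \<open>axis k0 1\<close>, fixes those unit vectors and preserves the law of the
  other Gaussian rows. So x contributes the factor \<open>norm p\<close> in front of the smaller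
  determinant.\<close>

lemma nn_integral_abs_det_insert:
  fixes B :: "'d::finite set"
  assumes k0: "k0 \<notin> B"
  shows "(\<integral>\<^sup>+g. ennreal \<bar>det (\<chi> k. if k \<in> insert k0 B then g k else axis k 1)\<bar> \<partial>PiM (insert k0 B) (\<lambda>_. gauss :: (real^'d) measure))
    = ennreal (chi_mean (card (insert k0 B))) * (\<integral>\<^sup>+g. ennreal \<bar>det (\<chi> k. if k \<in> B then g k else axis k 1)\<bar> \<partial>PiM B (\<lambda>_. gauss :: (real^'d) measure))"
proof -
  let ?B = "insert k0 B"
  let ?P = "\<lambda>B. PiM B (\<lambda>_. gauss :: (real^'d) measure)"
  let ?row = "\<lambda>B g k. if k \<in> B then g k else axis k 1 :: real^'d"
  interpret product_sigma_finite "\<lambda>_::'d. gauss :: (real^'d) measure" ..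
  define D where "D = (\<integral>\<^sup>+g. ennreal \<bar>det (\<chi> k. ?row B g k)\<bar> \<partial>?P B)"
  have dm: "(\<lambda>g. ennreal \<bar>det (\<chi> k. ?row B g k)\<bar>) \<in> borel_measurable (?P B)" for B
  proof -
    have "(\<lambda>g. ?row B g k) \<in> borel_measurable (?P B)" for k by (cases "k \<in> B") auto
    then have "(\<lambda>g. det (\<chi> k. ?row B g k)) \<in> borel_measurable (?P B)" by (rule borel_measurable_det)
    then show ?thesis by measurable
  qed
  have inner: "(\<integral>\<^sup>+g. ennreal \<bar>det (\<chi> k. if k = k0 then x else ?row B g k)\<bar> \<partial>?P B) = ennreal (sqrt (\<Sum>k\<in>?B. (x $ k)\<^sup>2)) * D" for x
  proof -
    define p where "p = (\<chi> k. if k \<in> ?B then x $ k else 0)"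
    define \<rho> where "\<rho> = sqrt (\<Sum>k\<in>?B. (x $ k)\<^sup>2)"
    have norm_p: "norm p = \<rho>"
    proof -
      have "(\<Sum>k\<in>UNIV. (p $ k)\<^sup>2) = (\<Sum>k\<in>?B. (x $ k)\<^sup>2)"
        by (rule sum.mono_neutral_cong_right) (auto simp: p_def)
      then show ?thesis by (simp add: norm_vec_def L2_set_def \<rho>_def)
    qed
    have det_p: "det (\<chi> k. if k = k0 then x else ?row B g k) = det (\<chi> k. if k = k0 then p else ?row B g k)" for g
    proof -
      let ?A = "\<chi> k. if k = k0 then p else ?row B g k"
      have xp: "x - p = (\<Sum>k\<in>- ?B. x $ k *s axis k 1)"
      proof -
        have "x = (\<Sum>k\<in>UNIV. x $ k *s axis k 1)" by (simp add: basis_expansion)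
        also have "\<dots> = (\<Sum>k\<in>?B. x $ k *s axis k 1) + (\<Sum>k\<in>- ?B. x $ k *s axis k 1)"
          by (subst sum.union_disjoint[symmetric]) (auto simp: Un_def intro!: sum.cong)
        also have "(\<Sum>k\<in>?B. x $ k *s axis k 1) = (\<Sum>k\<in>UNIV. p $ k *s axis k 1)"
          by (rule sum.mono_neutral_cong_left) (auto simp: p_def)
        finally have "x = p + (\<Sum>k\<in>- ?B. x $ k *s axis k 1)" by (simp add: basis_expansion)
        then show ?thesis by (metis add_diff_cancel_left')
      qed
      have "x - p \<in> vec.span {row j ?A |j. j \<noteq> k0}"
        unfolding xp
      proof (intro vec.span_sum vec.span_scale vec.span_base)
        fix k assume "k \<in> - ?B"
        then have "k \<noteq> k0" "axis k 1 = row k ?A" by (auto simp: row_def vec_eq_iff)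
        then show "axis k 1 \<in> {row j ?A |j. j \<noteq> k0}" by blast
      qed
      then have "det (\<chi> k. if k = k0 then row k0 ?A + (x - p) else row k ?A) = det ?A" by (rule det_row_span)
      moreover have "(\<chi> k. if k = k0 then row k0 ?A + (x - p) else row k ?A) = (\<chi> k. if k = k0 then x else ?row B g k)"
        by (auto simp: row_def vec_eq_iff)
      ultimately show ?thesis by simp
    qed
    show ?thesis
    proof (cases "p = 0")
      case True
      then have "det (\<chi> k. if k = k0 then p else ?row B g k) = 0" for g
        by (intro det_zero_row(1)[of k0]) (simp add: row_def vec_eq_iff)
      then show ?thesis using True norm_p by (simp add: det_p \<rho>_def[symmetric])
    next
      case False
      then have \<rho>: "\<rho> > 0" using norm_p by auto
      define w where "w = p /\<^sub>R \<rho>"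
      have pw: "p = \<rho> *\<^sub>R w" using \<rho> by (simp add: w_def)
      have nw: "norm w = 1" using \<rho> norm_p by (simp add: w_def)
      obtain \<mu> where \<mu>: "(\<mu> *\<^sub>R (w - axis k0 1)) \<bullet> (\<mu> *\<^sub>R (w - axis k0 1)) = 2 \<or> \<mu> *\<^sub>R (w - axis k0 1) = 0"
        "w - ((\<mu> *\<^sub>R (w - axis k0 1)) \<bullet> w) *\<^sub>R (\<mu> *\<^sub>R (w - axis k0 1)) = axis k0 1"
        by (rule reflection_exists[OF nw norm_axis_1[of k0]])
      define n where "n = \<mu> *\<^sub>R (w - axis k0 1)"
      define R where "R y = y - (n \<bullet> y) *\<^sub>R n" for y
      have n: "n \<bullet> n = 2 \<or> n = 0" using \<mu>(1) by (simp add: n_def)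
      have R: "orthogonal_transformation R" unfolding R_def[abs_def] by (rule orthogonal_transformation_reflection[OF n])
      have Rm: "R \<in> borel_measurable borel" unfolding R_def[abs_def] by measurable
      have Rw: "R w = axis k0 1" using \<mu>(2) by (simp add: R_def n_def)
      have Rp: "R p = \<rho> *\<^sub>R axis k0 1"
        unfolding pw using linear_scale[OF orthogonal_transformation_linear[OF R]] Rw by simp
      have Rax: "R (axis k 1) = axis k 1" if "k \<notin> ?B" for k
      proof -
        have "n $ k = 0" using that by (simp add: n_def w_def p_def axis_def)
        then have "n \<bullet> axis k 1 = 0" by (simp add: inner_axis)
        then show ?thesis by (simp add: R_def)
      qed
      have "R \<in> gauss \<rightarrow>\<^sub>M gauss" using Rm by simp
      then have Rm': "(\<lambda>g. \<lambda>k\<in>B. R (g k)) \<in> ?P B \<rightarrow>\<^sub>M ?P B"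
        by (intro measurable_restrict measurable_compose[OF measurable_component_singleton])
      have Dm': "(\<lambda>g. ennreal \<rho> * ennreal \<bar>det (\<chi> k. ?row B g k)\<bar>) \<in> borel_measurable (?P B)"
        by (intro borel_measurable_times_ennreal dm) simp
      have "\<bar>det (\<chi> k. if k = k0 then p else ?row B g k)\<bar> = \<rho> * \<bar>det (\<chi> k. ?row B (\<lambda>k\<in>B. R (g k)) k)\<bar>" for g
      proof -
        have "\<bar>det (\<chi> k. if k = k0 then p else ?row B g k)\<bar> = \<bar>det (\<chi> k. R (if k = k0 then p else ?row B g k))\<bar>"
          by (rule det_rows_orthogonal_transformation[OF R, symmetric])
        also have "(\<chi> k. R (if k = k0 then p else ?row B g k)) = (\<chi> k. if k = k0 then \<rho> *s axis k0 1 else ?row B (\<lambda>k\<in>B. R (g k)) k)"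
          by (auto simp: vec_eq_iff Rp Rax)
        also have "det \<dots> = \<rho> * det (\<chi> k. if k = k0 then axis k0 1 else ?row B (\<lambda>k\<in>B. R (g k)) k)"
          by (rule det_row_mul)
        also have "(\<chi> k. if k = k0 then axis k0 1 else ?row B (\<lambda>k\<in>B. R (g k)) k) = (\<chi> k. ?row B (\<lambda>k\<in>B. R (g k)) k)"
          using k0 by (auto simp: vec_eq_iff)
        finally show ?thesis using \<rho> by (simp add: abs_mult)
      qed
      then have "(\<integral>\<^sup>+g. ennreal \<bar>det (\<chi> k. if k = k0 then x else ?row B g k)\<bar> \<partial>?P B)
        = (\<integral>\<^sup>+g. ennreal \<rho> * ennreal \<bar>det (\<chi> k. ?row B (\<lambda>k\<in>B. R (g k)) k)\<bar> \<partial>?P B)"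
        using \<rho> by (simp add: det_p ennreal_mult)
      also have "\<dots> = (\<integral>\<^sup>+g. ennreal \<rho> * ennreal \<bar>det (\<chi> k. ?row B g k)\<bar> \<partial>distr (?P B) (?P B) (\<lambda>g. \<lambda>k\<in>B. R (g k)))"
        by (rule nn_integral_distr[OF Rm', symmetric]) (simp only: measurable_distr_eq1 Dm')
      also have "distr (?P B) (?P B) (\<lambda>g. \<lambda>k\<in>B. R (g k)) = ?P B"
        using distr_gauss_reflection[OF n] Rm by (intro distr_PiM_gauss_map) (auto simp: R_def[abs_def])
      also have "(\<integral>\<^sup>+g. ennreal \<rho> * ennreal \<bar>det (\<chi> k. ?row B g k)\<bar> \<partial>?P B) = ennreal \<rho> * D"
        unfolding D_def by (rule nn_integral_cmult[OF dm])
      finally show ?thesis by (simp add: \<rho>_def)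
    qed
  qed
  have "(\<integral>\<^sup>+g. ennreal \<bar>det (\<chi> k. ?row ?B g k)\<bar> \<partial>?P ?B) = (\<integral>\<^sup>+x. \<integral>\<^sup>+g. ennreal \<bar>det (\<chi> k. ?row ?B (fun_upd g k0 x) k)\<bar> \<partial>?P B \<partial>gauss)"
    by (rule product_nn_integral_insert_rev[OF _ k0 dm]) simp
  also have "\<dots> = (\<integral>\<^sup>+x. ennreal (sqrt (\<Sum>k\<in>?B. (x $ k)\<^sup>2)) * D \<partial>(gauss :: (real^'d) measure))"
  proof (rule nn_integral_cong)
    fix x :: "real^'d"
    have "(\<chi> k. ?row ?B (fun_upd g k0 x) k) = (\<chi> k. if k = k0 then x else ?row B g k)" for g
      by (auto simp: vec_eq_iff)
    then show "(\<integral>\<^sup>+g. ennreal \<bar>det (\<chi> k. ?row ?B (fun_upd g k0 x) k)\<bar> \<partial>?P B) = ennreal (sqrt (\<Sum>k\<in>?B. (x $ k)\<^sup>2)) * D"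
      using inner[of x] by simp
  qed
  also have "\<dots> = (\<integral>\<^sup>+x. ennreal (sqrt (\<Sum>k\<in>?B. (x $ k)\<^sup>2)) \<partial>(gauss :: (real^'d) measure)) * D"
  proof (rule nn_integral_multc)
    have "(\<lambda>x::real^'d. x $ k) \<in> borel_measurable gauss" for k by (rule borel_measurable_vec_nth) simp
    then show "(\<lambda>x. ennreal (sqrt (\<Sum>k\<in>?B. (x $ k)\<^sup>2))) \<in> borel_measurable (gauss :: (real^'d) measure)" by measurable
  qed
  finally show ?thesis by (simp only: nn_integral_partial_norm_gauss[OF insert_not_empty] D_def)
qed

lemma nn_integral_abs_det_gauss:
  "(\<integral>\<^sup>+g. ennreal \<bar>det (\<chi> k. g k)\<bar> \<partial>PiM UNIV (\<lambda>_. gauss :: (real^'d::finite) measure)) = ennreal (\<Prod>j=1..CARD('d). chi_mean j)"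
proof -
  have chi0: "chi_mean j \<ge> 0" for j
    by (cases "j = 0") (auto simp: chi_mean_def Gamma_real_pos less_imp_le)
  have "(\<integral>\<^sup>+g. ennreal \<bar>det (\<chi> k. if k \<in> B then g k else axis k 1)\<bar> \<partial>PiM B (\<lambda>_. gauss :: (real^'d) measure)) = ennreal (\<Prod>j=1..card B. chi_mean j)"
    if "finite B" for B :: "'d set"
    using that
  proof (induction B rule: finite_induct)
    case empty
    interpret P: prob_space "PiM ({}::'d set) (\<lambda>_. gauss :: (real^'d) measure)" by (rule prob_space_PiM_gauss)
    have "(\<chi> k. axis k 1) = (mat 1 :: real^'d^'d)" by (simp add: vec_eq_iff mat_def axis_def)
    then show ?case by (simp add: P.emeasure_space_1)
  next
    case (insert k0 B)
    have "ennreal (chi_mean (Suc (card B))) * ennreal (\<Prod>j=1..card B. chi_mean j) = ennreal (\<Prod>j=1..Suc (card B). chi_mean j)"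
      using chi0 by (simp add: prod_nonneg ennreal_mult[symmetric] mult.commute)
    then show ?case using insert by (simp only: nn_integral_abs_det_insert[OF insert(2)] card_insert_disjoint[OF insert(1,2)])
  qed
  from this[of UNIV] show ?thesis by simp
qed

text \<open>The quotients of Gamma values telescope.\<close>

lemma prod_chi_mean: "(\<Prod>j=1..n. chi_mean j) = 2 powr (real n / 2) * Gamma ((real n + 1) / 2) / sqrt pi"
proof (induction n)
  case 0 then show ?case by (simp add: Gamma_one_half_real)
next
  case (Suc n)
  have G: "Gamma ((real n + 1) / 2) > 0" by (simp add: Gamma_real_pos)
  have "(\<Prod>j=1..Suc n. chi_mean j) = 2 powr (real n / 2) * Gamma ((real n + 1) / 2) / sqrt pi * chi_mean (Suc n)"
    using Suc.IH by simp
  also have "\<dots> = 2 powr (real n / 2) * sqrt 2 * Gamma ((real (Suc n) + 1) / 2) / sqrt pi"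
  proof -
    have e: "real (Suc n) / 2 = (real n + 1) / 2" by simp
    have "Gamma ((real n + 1) / 2) \<noteq> 0" using G by linarith
    then show ?thesis unfolding chi_mean_def e by (simp add: field_simps)
  qed
  also have "2 powr (real n / 2) * sqrt 2 = 2 powr (real (Suc n) / 2)"
    by (simp add: powr_half_sqrt[symmetric] powr_add[symmetric] add_divide_distrib add.commute)
  finally show ?case .
qed

text \<open>Legendre's duplication formula at half-integers. Raising \<open>n\<close> by 1 moves
  both arguments by 1/2, so one factor stays and the other is rewritten by
  \<open>Gamma_plus1\<close>.\<close>

lemma Gamma_half_duplication:
  "Gamma (real (Suc n) / 2) * Gamma (real (Suc n) / 2 + 1 / 2) = 2 powr (- real n) * sqrt pi * fact n"
proof (induction n)
  case 0 then show ?case by (simp add: Gamma_one_half_real)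
next
  case (Suc n)
  have e: "real (Suc (Suc n)) / 2 = real (Suc n) / 2 + 1 / 2" "real (Suc n) / 2 + 1 / 2 + 1 / 2 = real (Suc n) / 2 + 1"
    by simp_all
  have "Gamma (real (Suc n) / 2 + 1) = real (Suc n) / 2 * Gamma (real (Suc n) / 2)"
    by (intro Gamma_plus1) (auto dest!: nonpos_Ints_nonpos)
  then have "Gamma (real (Suc (Suc n)) / 2) * Gamma (real (Suc (Suc n)) / 2 + 1 / 2) =
    real (Suc n) / 2 * (Gamma (real (Suc n) / 2) * Gamma (real (Suc n) / 2 + 1 / 2))"
    unfolding e by simp
  also have "\<dots> = real (Suc n) * (2 powr (- real n) / 2) * sqrt pi * fact n" unfolding Suc.IH by simp
  also have "2 powr (- real n) / 2 = 2 powr (- real (Suc n))"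
  proof -
    have "- real (Suc n) = - real n - 1" by simp
    then show ?thesis by (simp only: powr_diff) simp
  qed
  finally show ?case by simp
qed

lemma abs_inner_gauss:
  fixes c :: "'b::euclidean_space"
  shows "(\<integral>\<^sup>+x. ennreal \<bar>c \<bullet> x\<bar> \<partial>gauss) = ennreal (norm c * sqrt (2 / pi))"
proof (cases "c = 0")
  case False
  define u where "u = c /\<^sub>R norm c"
  have u: "norm u = 1" and cu: "c = norm c *\<^sub>R u" using False by (auto simp: u_def)
  have "(\<integral>\<^sup>+x. ennreal \<bar>c \<bullet> x\<bar> \<partial>gauss) = (\<integral>\<^sup>+x. ennreal (norm c) * ennreal \<bar>u \<bullet> x\<bar> \<partial>gauss)"
    by (subst cu) (simp add: abs_mult ennreal_mult)
  also have "\<dots> = ennreal (norm c) * (\<integral>\<^sup>+x. ennreal \<bar>u \<bullet> x\<bar> \<partial>gauss)"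
    by (rule nn_integral_cmult) measurable
  also have "(\<integral>\<^sup>+x. ennreal \<bar>u \<bullet> x\<bar> \<partial>gauss) = (\<integral>\<^sup>+t. ennreal \<bar>t\<bar> \<partial>(gauss :: real measure))"
    by (subst distr_gauss_inner[OF u, symmetric], subst nn_integral_distr) auto
  also have "\<dots> = (\<integral>\<^sup>+x. ennreal (std_normal_density x * \<bar>x\<bar> ^ 1) \<partial>lborel)"
    unfolding std_normal_measure_eq[symmetric] std_normal_measure_def
    by (subst nn_integral_density) (auto simp: ennreal_mult[symmetric] std_normal_density_def)
  also have "\<dots> = ennreal (sqrt (2 / pi))"
    unfolding nn_integral_std_normal_abs_moment by (simp add: powr_half_sqrt real_sqrt_divide)
  finally show ?thesis by (simp add: ennreal_mult)
qed simp

lemma crossp_cong: "(\<And>k. k \<noteq> k0 \<Longrightarrow> v k = w k) \<Longrightarrow> crossp k0 v = crossp k0 w"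
  unfolding crossp_def by (intro arg_cong[where f=vec_lambda] ext arg_cong[where f=det]) (auto simp: vec_eq_iff)

text \<open>Expanding a Gaussian determinant along row \<open>k0\<close> gives the inner product of
  the cross product with an independent Gaussian vector, whose absolute value has, given the cross
  product, the mean \<open>sqrt (2 / pi)\<close> times its length. So the expected length is the
  expected absolute determinant divided by \<open>sqrt (2 / pi)\<close>; the duplication formula
  rewrites the quotient through \<open>Gamma (d / 2)\<close>, which is where \<open>gcoef\<close>
  comes from.\<close>

lemma nn_integral_norm_crossp:
  fixes k0 :: "'d::finite"
  assumes d2: "CARD('d) \<ge> 2"
  shows "(\<integral>\<^sup>+g. ennreal (norm (crossp k0 g)) \<partial>PiM (UNIV - {k0}) (\<lambda>_. gauss :: (real^'d) measure))
    = ennreal (fact (CARD('d) - 1) * sqrt (pi / 2) * gcoef CARD('d))"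
proof -
  let ?P = "\<lambda>B. PiM B (\<lambda>_. gauss :: (real^'d) measure)"
  let ?J = "UNIV - {k0} :: 'd set"
  interpret product_sigma_finite "\<lambda>_::'d. gauss :: (real^'d) measure" ..
  define E where "E = (\<integral>\<^sup>+g. ennreal (norm (crossp k0 g)) \<partial>?P ?J)"
  have U: "insert k0 ?J = UNIV" by auto
  have cm: "(\<lambda>g. crossp k0 g) \<in> borel_measurable (?P ?J)"
    by (rule borel_measurable_crossp) auto
  have "(\<lambda>g. det (\<chi> k. g k)) \<in> borel_measurable (?P UNIV)" by (rule borel_measurable_det) auto
  then have dm: "(\<lambda>g. ennreal \<bar>det (\<chi> k. g k)\<bar>) \<in> borel_measurable (?P (insert k0 ?J))" unfolding U by measurable
  have "ennreal (\<Prod>j=1..CARD('d). chi_mean j) = (\<integral>\<^sup>+g. ennreal \<bar>det (\<chi> k. g k)\<bar> \<partial>?P (insert k0 ?J))"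
    unfolding U nn_integral_abs_det_gauss ..
  also have "\<dots> = (\<integral>\<^sup>+g. \<integral>\<^sup>+x. ennreal \<bar>det (\<chi> k. (fun_upd g k0 x) k)\<bar> \<partial>gauss \<partial>?P ?J)"
    by (rule product_nn_integral_insert[OF _ _ dm]) auto
  also have "\<dots> = (\<integral>\<^sup>+g. \<integral>\<^sup>+x. ennreal \<bar>crossp k0 g \<bullet> x\<bar> \<partial>gauss \<partial>?P ?J)"
    unfolding inner_crossp by (simp add: fun_upd_def)
  also have "\<dots> = (\<integral>\<^sup>+g. ennreal (norm (crossp k0 g)) * ennreal (sqrt (2 / pi)) \<partial>?P ?J)"
    by (simp add: abs_inner_gauss ennreal_mult)
  also have "\<dots> = E * ennreal (sqrt (2 / pi))"
    unfolding E_def using measurable_compose[OF cm, of "\<lambda>x. ennreal (norm x)" borel]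
    by (intro nn_integral_multc) simp
  finally have "E * ennreal (sqrt (2 / pi)) = ennreal (\<Prod>j=1..CARD('d). chi_mean j)" by simp
  also have "(\<Prod>j=1..CARD('d). chi_mean j) = fact (CARD('d) - 1) * sqrt (pi / 2) * gcoef CARD('d) * sqrt (2 / pi)"
  proof -
    let ?n = "CARD('d)"
    define G where "G = Gamma (real ?n / 2)"
    define G' where "G' = Gamma (real ?n / 2 + 1 / 2)"
    have n: "real ?n > 0" using d2 by simp
    have G: "G > 0" unfolding G_def using n by (simp add: Gamma_real_pos)
    have "Suc (?n - 1) = ?n" using d2 by simp
    then have "G * G' = 2 powr (1 - real ?n) * sqrt pi * fact (?n - 1)"
      using Gamma_half_duplication[of "?n - 1"] d2 by (simp add: G_def G'_def of_nat_diff)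
    then have G': "G' = 2 powr (1 - real ?n) * sqrt pi * fact (?n - 1) / G" using G by (simp add: field_simps)
    have "(\<Prod>j=1..?n. chi_mean j) = 2 powr (real ?n / 2) * G' / sqrt pi"
      unfolding prod_chi_mean G'_def by (simp add: add_divide_distrib)
    also have "\<dots> = 2 powr (real ?n / 2) * 2 powr (1 - real ?n) * fact (?n - 1) / G"
      unfolding G' by simp
    also have "2 powr (real ?n / 2) * 2 powr (1 - real ?n) = 1 / 2 powr (real ?n / 2 - 1)"
      by (simp add: powr_add[symmetric] powr_minus_divide[symmetric])
    also have "1 / 2 powr (real ?n / 2 - 1) * fact (?n - 1) / G = fact (?n - 1) * (sqrt (pi / 2) * sqrt (2 / pi)) * gcoef ?n"
      by (simp add: gcoef_def G_def real_sqrt_mult[symmetric])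
    finally show ?thesis by simp
  qed
  finally have "E * ennreal (sqrt (2 / pi)) = ennreal (fact (CARD('d) - 1) * sqrt (pi / 2) * gcoef CARD('d)) * ennreal (sqrt (2 / pi))"
    by (subst ennreal_mult''[symmetric]) auto
  then have "E = ennreal (fact (CARD('d) - 1) * sqrt (pi / 2) * gcoef CARD('d))"
    using ennreal_mult_cancel_left[of "ennreal (sqrt (2 / pi))" E "ennreal (fact (CARD('d) - 1) * sqrt (pi / 2) * gcoef CARD('d))"]
    by (simp add: mult.commute)
  then show ?thesis by (simp add: E_def)
qed

text \<open>Reflecting the rows is multiplication from the left by the orthogonal matrix
  \<open>Q\<close>.\<close>

lemma abs_det_reflect_rows:
  fixes n :: "'d::finite \<Rightarrow> real" and g :: "'d \<Rightarrow> real^'d"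
  assumes n: "(\<Sum>k\<in>UNIV. (n k)\<^sup>2) = 2"
  shows "\<bar>det (\<chi> k. g k - n k *\<^sub>R (\<Sum>j\<in>UNIV. n j *\<^sub>R g j))\<bar> = \<bar>det (\<chi> k. g k)\<bar>"
proof -
  define Q :: "real^'d^'d" where "Q = (\<chi> k j. of_bool (k = j) - n k * n j)"
  have "orthogonal_matrix Q"
  proof -
    have "(\<Sum>k\<in>UNIV. (of_bool (k = i) - n k * n i) * (of_bool (k = j) - n k * n j)) = of_bool (i = j)" for i j
    proof -
      have "(\<Sum>k\<in>UNIV. (of_bool (k = i) - n k * n i) * (of_bool (k = j) - n k * n j)) =
        (\<Sum>k\<in>UNIV. of_bool (k = i) * of_bool (k = j)) - (\<Sum>k\<in>UNIV. of_bool (k = i) * (n k * n j))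
        - (\<Sum>k\<in>UNIV. of_bool (k = j) * (n k * n i)) + (\<Sum>k\<in>UNIV. (n k)\<^sup>2) * (n i * n j)"
        by (simp add: algebra_simps sum.distrib sum_subtractf sum_distrib_left power2_eq_square)
      also have "(\<Sum>k\<in>UNIV. of_bool (k = i) * of_bool (k = j)) = (of_bool (i = j) :: real)"
        by (subst sum.remove[of _ i]) auto
      also have "(\<Sum>k\<in>UNIV. of_bool (k = i) * (n k * n j)) = n i * n j"
        by (subst sum.remove[of _ i]) auto
      also have "(\<Sum>k\<in>UNIV. of_bool (k = j) * (n k * n i)) = n j * n i"
        by (subst sum.remove[of _ j]) auto
      finally show ?thesis using n by simp
    qed
    then show ?thesis
      by (simp add: orthogonal_matrix Q_def matrix_matrix_mult_def transpose_def mat_def vec_eq_iff)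
  qed
  then have "\<bar>det Q\<bar> = 1" using det_orthogonal_matrix[of Q] by auto
  moreover have "(\<chi> k. g k - n k *\<^sub>R (\<Sum>j\<in>UNIV. n j *\<^sub>R g j)) = Q ** (\<chi> k. g k)"
  proof -
    have "g k $ i - n k * (\<Sum>j\<in>UNIV. n j * g j $ i) = (\<Sum>j\<in>UNIV. (of_bool (k = j) - n k * n j) * g j $ i)" for k i
    proof -
      have "(\<Sum>j\<in>UNIV. of_bool (k = j) * g j $ i) = g k $ i"
        by (subst sum.remove[of _ k]) auto
      then show ?thesis by (simp add: left_diff_distrib sum_subtractf sum_distrib_left mult.assoc)
    qed
    then show ?thesis by (simp add: Q_def matrix_matrix_mult_def vec_eq_iff)
  qed
  ultimately show ?thesis by (simp add: det_mul abs_mult)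
qed

lemma AE_gauss_det_nonzero: "AE g in PiM UNIV (\<lambda>_. gauss :: (real^'d::finite) measure). det (\<chi> k. g k) \<noteq> 0"
proof -
  obtain rank :: "'d \<Rightarrow> nat" where "inj rank"
    using finite_imp_inj_to_nat_seg[of "UNIV :: 'd set"] by auto
  then have "AE g in PiM UNIV (\<lambda>_. gauss :: (real^'d) measure). det (\<chi> k. \<Sum>i\<in>UNIV. of_bool (k = i) *\<^sub>R g i) \<noteq> 0"
    by (intro AE_det_nonzero[where priv="\<lambda>k. k" and rank=rank]) auto
  moreover have "(\<Sum>i\<in>UNIV. of_bool (k = i) *\<^sub>R g i) = g k" for k and g :: "'d \<Rightarrow> real^'d"
    by (subst sum.remove[of _ k]) auto
  ultimately show ?thesis by simp
qed

text \<open>The cross product does not involve \<open>g k0\<close>; given the other rows, the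
  projection of \<open>g k0\<close> on its direction is standard normal, whatever the
  length.\<close>

lemma nn_integral_gauss_crossp_direction:
  fixes k0 :: "'d::finite" and H :: "real \<Rightarrow> ennreal"
  assumes d2: "CARD('d) \<ge> 2" and H[measurable]: "H \<in> borel_measurable borel"
  shows "(\<integral>\<^sup>+g. ennreal (norm (crossp k0 g)) * H ((crossp k0 g \<bullet> g k0) / norm (crossp k0 g)) \<partial>PiM UNIV (\<lambda>_. gauss :: (real^'d) measure))
    = ennreal (fact (CARD('d) - 1) * sqrt (pi / 2) * gcoef CARD('d)) * (\<integral>\<^sup>+t. H t \<partial>(gauss :: real measure))"
proof -
  let ?P = "\<lambda>B. PiM B (\<lambda>_. gauss :: (real^'d) measure)"
  let ?J = "UNIV - {k0} :: 'd set"
  interpret product_sigma_finite "\<lambda>_::'d. gauss :: (real^'d) measure" ..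
  have U: "insert k0 ?J = UNIV" by auto
  let ?F = "\<lambda>g. ennreal (norm (crossp k0 g)) * H ((crossp k0 g \<bullet> g k0) / norm (crossp k0 g))"
  have cm[measurable]: "(\<lambda>g. crossp k0 g) \<in> borel_measurable (?P UNIV)"
    by (rule borel_measurable_crossp) auto
  have cmJ: "(\<lambda>g. crossp k0 g) \<in> borel_measurable (?P ?J)"
    by (rule borel_measurable_crossp) auto
  have Fm: "?F \<in> borel_measurable (?P (insert k0 ?J))" unfolding U by measurable
  have "(\<integral>\<^sup>+g. ?F g \<partial>?P UNIV) = (\<integral>\<^sup>+g. \<integral>\<^sup>+x. ?F (fun_upd g k0 x) \<partial>gauss \<partial>?P ?J)"
    using product_nn_integral_insert[OF _ _ Fm] unfolding U by simp
  also have "\<dots> = (\<integral>\<^sup>+g. ennreal (norm (crossp k0 g)) * (\<integral>\<^sup>+t. H t \<partial>(gauss :: real measure)) \<partial>?P ?J)"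
  proof (rule nn_integral_cong)
    fix g :: "'d \<Rightarrow> real^'d"
    define c where "c = crossp k0 g"
    have c: "crossp k0 (fun_upd g k0 x) = c" for x
      unfolding c_def by (rule crossp_cong) simp
    show "(\<integral>\<^sup>+x. ?F (fun_upd g k0 x) \<partial>gauss) = ennreal (norm (crossp k0 g)) * (\<integral>\<^sup>+t. H t \<partial>(gauss :: real measure))"
    proof (cases "c = 0")
      case False
      define u where "u = c /\<^sub>R norm c"
      have u: "norm u = 1" using False by (simp add: u_def)
      have "(\<integral>\<^sup>+x. ?F (fun_upd g k0 x) \<partial>gauss) = (\<integral>\<^sup>+x. ennreal (norm c) * H (u \<bullet> x) \<partial>gauss)"
        unfolding c by (simp add: u_def divide_inverse mult.commute)
      also have "\<dots> = ennreal (norm c) * (\<integral>\<^sup>+x. H (u \<bullet> x) \<partial>gauss)"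
        by (rule nn_integral_cmult) measurable
      also have "(\<integral>\<^sup>+x. H (u \<bullet> x) \<partial>gauss) = (\<integral>\<^sup>+t. H t \<partial>(gauss :: real measure))"
        by (subst distr_gauss_inner[OF u, symmetric], subst nn_integral_distr) auto
      finally show ?thesis unfolding c_def .
    qed (simp add: c, simp add: c_def)
  qed
  also have "\<dots> = (\<integral>\<^sup>+g. ennreal (norm (crossp k0 g)) \<partial>?P ?J) * (\<integral>\<^sup>+t. H t \<partial>(gauss :: real measure))"
    using measurable_compose[OF cmJ, of "\<lambda>x. ennreal (norm x)" borel] by (intro nn_integral_multc) simp
  finally show ?thesis by (simp only: nn_integral_norm_crossp[OF d2])
qed

text \<open>Reflecting the rows so that the vector b is mapped to a multiple of a unit vector turns the
  normal vector c into a multiple of the cross product of all rows but one; the offset then becomes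
  the projection of the remaining, independent row.\<close>
lemma nn_integral_hyperplane:
  fixes c :: "('d::finite \<Rightarrow> real^'d) \<Rightarrow> real^'d" and b :: "'d \<Rightarrow> real" and h :: "real \<Rightarrow> ennreal"
  assumes d2: "CARD('d) \<ge> 2"
    and cm[measurable]: "c \<in> borel_measurable (gaussians UNIV)"
    and \<tau>m[measurable]: "\<tau> \<in> borel_measurable (gaussians UNIV)"
    and cg: "\<And>g k. c g \<bullet> g k = \<tau> g * b k"
    and \<tau>: "\<And>g. \<bar>\<tau> g\<bar> = a * \<bar>det (\<chi> k. g k)\<bar>" and a: "a > 0"
    and b: "\<And>k. b k \<ge> 0" and s: "s = (\<Sum>k\<in>UNIV. (b k)\<^sup>2)" "s > 0"
    and h[measurable]: "h \<in> borel_measurable borel"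
  shows "(\<integral>\<^sup>+g. ennreal (norm (c g)) * (h (\<tau> g / norm (c g)) + h (- (\<tau> g / norm (c g)))) \<partial>gaussians UNIV)
    = ennreal (a * s * fact (CARD('d) - 1) * gcoef CARD('d)) * (\<integral>\<^sup>+r. ennreal (exp (- s * r\<^sup>2 / 2)) * h r \<partial>lborel)"
proof -
  let ?P = "PiM UNIV (\<lambda>_. gauss :: (real^'d) measure)"
  define H where "H t = h t + h (- t)" for t
  have H[measurable]: "H \<in> borel_measurable borel" unfolding H_def by measurable
  \<comment> \<open>\<open>H\<close> is even, so the signs of the offset and of
    \<open>\<kappa>\<close> below need not be followed.\<close>
  have H_abs: "H x = H y" if "\<bar>x\<bar> = \<bar>y\<bar>" for x y
    using that by (auto simp: H_def abs_eq_iff add.commute)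
  define \<Phi> where "\<Phi> g = ennreal (norm (c g)) * H (\<tau> g / norm (c g))" for g
  have \<Phi>[measurable]: "\<Phi> \<in> borel_measurable ?P" unfolding \<Phi>_def by measurable
  define z where "z = sqrt s"
  have z: "z > 0" "z * z = s" using s by (auto simp: z_def)
  obtain k0 :: 'd where True by blast
  \<comment> \<open>Squared length of the sum of the unit vector \<open>b / z\<close> and the
    coordinate vector of \<open>k0\<close>; the plus sign keeps it positive since \<open>b\<close>
    is nonnegative. The mirror vector \<open>n\<close> is this sum scaled to squared length 2, so
    the reflection takes \<open>b / z\<close> to minus the coordinate vector.\<close>
  define q where "q = 2 * (z + b k0) / z"
  have q: "q > 0" using z(1) b[of k0] by (simp add: q_def)
  define \<mu> where "\<mu> = sqrt (2 / q)"
  have \<mu>: "\<mu> * \<mu> = 2 / q" using q by (simp add: \<mu>_def)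
  define n where "n k = \<mu> * (b k / z + of_bool (k = k0))" for k
  have sum_of: "(\<Sum>k\<in>UNIV. f k * of_bool (k = k0)) = (f k0 :: real)" for f
    by (subst sum.remove[of _ k0]) auto
  have nn: "(\<Sum>k\<in>UNIV. (n k)\<^sup>2) = 2"
  proof -
    have "(n k)\<^sup>2 = \<mu> * \<mu> * ((b k)\<^sup>2 / s + (2 * b k / z + 1) * of_bool (k = k0))" for k
      using z by (auto simp: n_def power2_eq_square algebra_simps)
    then have "(\<Sum>k\<in>UNIV. (n k)\<^sup>2) = \<mu> * \<mu> * (s / s + (2 * b k0 / z + 1))"
      by (simp only: sum_distrib_left[symmetric] sum.distrib sum_of sum_divide_distrib[symmetric] s(1)[symmetric])
    also have "s / s + (2 * b k0 / z + 1) = q" using s(2) z(1) by (simp add: q_def field_simps)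
    finally show ?thesis using q by (simp add: \<mu>)
  qed
  define T where "T g = (\<lambda>k\<in>UNIV. g k - n k *\<^sub>R (\<Sum>j\<in>UNIV. n j *\<^sub>R g j))" for g :: "'d \<Rightarrow> real^'d"
  have "(\<integral>\<^sup>+g. \<Phi> g \<partial>?P) = (\<integral>\<^sup>+g. \<Phi> g \<partial>distr ?P ?P T)"
    unfolding T_def[abs_def] by (subst distr_PiM_gauss_reflection) (use nn in auto)
  also have "\<dots> = (\<integral>\<^sup>+g. \<Phi> (T g) \<partial>?P)"
    by (rule nn_integral_distr) (unfold T_def, measurable)
  also have "\<dots> = (\<integral>\<^sup>+g. ennreal (a * z) * (ennreal (norm (crossp k0 g)) * H ((crossp k0 g \<bullet> g k0) / norm (crossp k0 g) / z)) \<partial>?P)"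
  proof (rule nn_integral_cong_AE, use AE_gauss_det_nonzero in eventually_elim)
    fix g :: "'d \<Rightarrow> real^'d" assume det: "det (\<chi> k. g k) \<noteq> 0"
    define r where "r = crossp k0 g"
    define c' where "c' = c (T g)"
    define \<tau>' where "\<tau>' = \<tau> (T g)"
    have r_g: "r \<bullet> g k0 = det (\<chi> k. g k)"
      unfolding r_def inner_crossp by (rule arg_cong[where f=det]) (simp add: vec_eq_iff)
    have r0: "r \<noteq> 0" using det r_g by auto
    define x where "x k = c' \<bullet> g k" for k
    define \<sigma> where "\<sigma> = (\<Sum>k\<in>UNIV. n k * x k)"
    have x1: "x k - n k * \<sigma> = \<tau>' * b k" for k
    proof -
      have "c' \<bullet> T g k = x k - n k * \<sigma>"
        by (simp add: T_def x_def \<sigma>_def inner_diff_right inner_sum_right)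
      then show ?thesis using cg[of "T g" k] by (simp add: c'_def \<tau>'_def)
    qed
    define \<nu> where "\<nu> = (\<Sum>k\<in>UNIV. n k * b k)"
    have "\<sigma> - 2 * \<sigma> = \<tau>' * \<nu>"
    proof -
      have "(\<Sum>k\<in>UNIV. n k * (x k - n k * \<sigma>)) = \<sigma> - (\<Sum>k\<in>UNIV. (n k)\<^sup>2) * \<sigma>"
        by (simp add: \<sigma>_def right_diff_distrib sum_subtractf sum_distrib_right power2_eq_square mult.assoc)
      also have "\<dots> = \<sigma> - 2 * \<sigma>" by (simp add: nn)
      finally show ?thesis unfolding x1 by (simp add: \<nu>_def sum_distrib_left mult_ac)
    qed
    then have \<sigma>: "\<sigma> = - (\<tau>' * \<nu>)" by simp
    have "\<nu> = \<mu> * (z + b k0)"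
    proof -
      have "n k * b k = \<mu> * ((b k)\<^sup>2 / z + b k * of_bool (k = k0))" for k
        by (simp add: n_def power2_eq_square algebra_simps)
      then have "\<nu> = \<mu> * (s / z + b k0)"
        unfolding \<nu>_def by (simp only: sum_distrib_left[symmetric] sum.distrib sum_of sum_divide_distrib[symmetric] s(1)[symmetric])
      also have "s / z = z" using z by (simp add: field_simps)
      finally show ?thesis .
    qed
    then have n\<nu>: "n k * \<nu> = b k + z * of_bool (k = k0)" for k
    proof -
      have "n k * \<nu> = (\<mu> * \<mu>) * (z + b k0) * (b k / z + of_bool (k = k0))"
        using \<open>\<nu> = \<mu> * (z + b k0)\<close> by (simp add: n_def)
      also have "(\<mu> * \<mu>) * (z + b k0) = z"
        unfolding \<mu> q_def using z(1) b[of k0] by (simp add: field_simps)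
      finally show ?thesis using z(1) by (simp add: distrib_left)
    qed
    \<comment> \<open>The normal at the reflected rows is orthogonal to all original rows but
      \<open>g k0\<close>, hence a multiple \<open>\<kappa>\<close> of their cross product.\<close>
    have x2: "x k = - (\<tau>' * z) * of_bool (k = k0)" for k
    proof -
      have "x k = \<tau>' * b k - \<tau>' * (n k * \<nu>)" using x1[of k] by (simp add: \<sigma> algebra_simps)
      then show ?thesis unfolding n\<nu> by (simp add: algebra_simps)
    qed
    define \<kappa> where "\<kappa> = c' \<bullet> r / (r \<bullet> r)"
    have c'r: "c' = \<kappa> *\<^sub>R r"
      unfolding \<kappa>_def r_def
    proof (rule crossp_kernel)
      show "crossp k0 g \<noteq> 0" using r0 by (simp add: r_def)
      show "c' \<bullet> g k = 0" if "k \<noteq> k0" for k using x2[of k] that by (simp add: x_def)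
    qed
    have \<kappa>1: "\<kappa> * det (\<chi> k. g k) = - (\<tau>' * z)"
      using x2[of k0] r_g by (simp add: x_def c'r)
    have "\<bar>det (\<chi> k. T g k)\<bar> = \<bar>det (\<chi> k. g k)\<bar>"
      using abs_det_reflect_rows[OF nn, of g] by (simp add: T_def)
    then have \<tau>'a: "\<bar>\<tau>'\<bar> = a * \<bar>det (\<chi> k. g k)\<bar>" by (simp add: \<tau>'_def \<tau>)
    have "\<bar>\<kappa>\<bar> * \<bar>det (\<chi> k. g k)\<bar> = \<bar>\<tau>'\<bar> * z"
      using \<kappa>1 z(1) by (simp flip: abs_mult) (simp add: abs_mult)
    then have \<kappa>: "\<bar>\<kappa>\<bar> = a * z" using det by (simp add: \<tau>'a)
    have nc': "norm c' = a * z * norm r" by (simp add: c'r \<kappa>)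
    have "\<bar>\<tau>' / norm c'\<bar> = \<bar>(r \<bullet> g k0) / norm r / z\<bar>"
      unfolding nc' r_g using a z(1) r0 by (simp add: abs_mult \<tau>'a field_simps)
    then show "\<Phi> (T g) = ennreal (a * z) * (ennreal (norm (crossp k0 g)) * H ((crossp k0 g \<bullet> g k0) / norm (crossp k0 g) / z))"
      unfolding \<Phi>_def c'_def[symmetric] \<tau>'_def[symmetric] r_def[symmetric]
      using a z(1) H_abs[of "\<tau>' / norm c'" "(r \<bullet> g k0) / norm r / z"]
      by (simp add: nc' ennreal_mult mult.assoc)
  qed
  also have "\<dots> = ennreal (a * z) * (\<integral>\<^sup>+g. ennreal (norm (crossp k0 g)) * H ((crossp k0 g \<bullet> g k0) / norm (crossp k0 g) / z) \<partial>?P)"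
  proof (rule nn_integral_cmult)
    have [measurable]: "(\<lambda>g. crossp k0 g) \<in> borel_measurable ?P" by (rule borel_measurable_crossp) auto
    show "(\<lambda>g. ennreal (norm (crossp k0 g)) * H ((crossp k0 g \<bullet> g k0) / norm (crossp k0 g) / z)) \<in> borel_measurable ?P"
      by measurable
  qed
  also have "(\<integral>\<^sup>+g. ennreal (norm (crossp k0 g)) * H ((crossp k0 g \<bullet> g k0) / norm (crossp k0 g) / z) \<partial>?P)
    = ennreal (fact (CARD('d) - 1) * sqrt (pi / 2) * gcoef CARD('d)) * (\<integral>\<^sup>+t. H (t / z) \<partial>(gauss :: real measure))"
    using nn_integral_gauss_crossp_direction[OF d2, of "\<lambda>t. H (t / z)" k0] by simp
  also have "(\<integral>\<^sup>+t. H (t / z) \<partial>(gauss :: real measure)) = ennreal (2 * z / sqrt (2 * pi)) * (\<integral>\<^sup>+r. ennreal (exp (- s * r\<^sup>2 / 2)) * h r \<partial>lborel)"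
  proof -
    have "(\<integral>\<^sup>+t. h (- (t / z)) \<partial>(gauss :: real measure)) = (\<integral>\<^sup>+t. h (t / z) \<partial>(gauss :: real measure))"
      by (subst (2) distr_gauss_uminus[symmetric], subst nn_integral_distr) auto
    then have "(\<integral>\<^sup>+t. H (t / z) \<partial>(gauss :: real measure)) = 2 * (\<integral>\<^sup>+t. h (t / z) \<partial>(gauss :: real measure))"
      unfolding H_def by (subst nn_integral_add) (auto simp: mult_2)
    also have "(\<integral>\<^sup>+t. h (t / z) \<partial>(gauss :: real measure)) = (\<integral>\<^sup>+t. ennreal (std_normal_density t) * h (t / z) \<partial>lborel)"
      unfolding std_normal_measure_eq[symmetric] std_normal_measure_def
      by (subst nn_integral_density) auto
    also have "\<dots> = ennreal z * (\<integral>\<^sup>+r. ennreal (std_normal_density (z * r)) * h r \<partial>lborel)"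
      using z(1) by (subst nn_integral_real_affine[where c=z and t=0]) auto
    also have "(\<integral>\<^sup>+r. ennreal (std_normal_density (z * r)) * h r \<partial>lborel)
      = (\<integral>\<^sup>+r. ennreal (1 / sqrt (2 * pi)) * (ennreal (exp (- s * r\<^sup>2 / 2)) * h r) \<partial>lborel)"
    proof (rule nn_integral_cong)
      fix r :: real
      have "std_normal_density (z * r) = 1 / sqrt (2 * pi) * exp (- s * r\<^sup>2 / 2)"
        using z(2) by (simp add: std_normal_density_def power_mult_distrib power2_eq_square)
      then show "ennreal (std_normal_density (z * r)) * h r = ennreal (1 / sqrt (2 * pi)) * (ennreal (exp (- s * r\<^sup>2 / 2)) * h r)"
        by (simp only: mult.assoc[symmetric]) (simp flip: ennreal_mult'')
    qed
    also have "\<dots> = ennreal (1 / sqrt (2 * pi)) * (\<integral>\<^sup>+r. ennreal (exp (- s * r\<^sup>2 / 2)) * h r \<partial>lborel)"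
      by (rule nn_integral_cmult) measurable
    also have "2 * (ennreal z * (ennreal (1 / sqrt (2 * pi)) * (\<integral>\<^sup>+r. ennreal (exp (- s * r\<^sup>2 / 2)) * h r \<partial>lborel)))
      = ennreal (2 * z / sqrt (2 * pi)) * (\<integral>\<^sup>+r. ennreal (exp (- s * r\<^sup>2 / 2)) * h r \<partial>lborel)"
    proof -
      have "ennreal (2 * z / sqrt (2 * pi)) = ennreal 2 * ennreal z * ennreal (1 / sqrt (2 * pi))"
        using z(1) by (simp only: ennreal_mult[symmetric]) (simp add: ennreal_mult''[symmetric])
      then show ?thesis by (simp add: mult.assoc)
    qed
    finally show ?thesis .
  qed
  also have "ennreal (a * z) * (ennreal (fact (CARD('d) - 1) * sqrt (pi / 2) * gcoef CARD('d)) *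
      (ennreal (2 * z / sqrt (2 * pi)) * (\<integral>\<^sup>+r. ennreal (exp (- s * r\<^sup>2 / 2)) * h r \<partial>lborel)))
    = ennreal (a * s * fact (CARD('d) - 1) * gcoef CARD('d)) * (\<integral>\<^sup>+r. ennreal (exp (- s * r\<^sup>2 / 2)) * h r \<partial>lborel)"
  proof -
    have g0: "gcoef CARD('d) \<ge> 0" using d2 by (simp add: gcoef_def Gamma_real_pos less_imp_le)
    have nn: "a * z \<ge> 0" "fact (CARD('d) - 1) * sqrt (pi / 2) * gcoef CARD('d) \<ge> 0" "2 * z / sqrt (2 * pi) \<ge> 0"
      using a z(1) g0 by simp_all
    have sq: "sqrt (pi / 2) * (2 / sqrt (2 * pi)) = 1"
      by (simp add: real_sqrt_divide real_sqrt_mult field_simps)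
    have "(a * z) * ((fact (CARD('d) - 1) * sqrt (pi / 2) * gcoef CARD('d)) * (2 * z / sqrt (2 * pi)))
      = a * (z * z) * fact (CARD('d) - 1) * gcoef CARD('d) * (sqrt (pi / 2) * (2 / sqrt (2 * pi)))" by simp
    also have "\<dots> = a * s * fact (CARD('d) - 1) * gcoef CARD('d)" unfolding sq z(2) by simp
    finally have "ennreal (a * s * fact (CARD('d) - 1) * gcoef CARD('d)) =
      ennreal (a * z) * (ennreal (fact (CARD('d) - 1) * sqrt (pi / 2) * gcoef CARD('d)) * ennreal (2 * z / sqrt (2 * pi)))"
      by (simp only: ennreal_mult[symmetric] mult_nonneg_nonneg nn)
    then show ?thesis by (simp only: mult.assoc)
  qed
  finally show ?thesis by (simp add: \<Phi>_def H_def)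
qed

subsection \<open>Conditioning on the points of a configuration\<close>

text \<open>The mirror vectors have disjoint supports, so each reflection leaves the linear forms of
  the others unchanged, and subtracting all corrections at once is the composition of the
  reflections.\<close>

lemma distr_PiM_gauss_reflections:
  fixes a :: "'k \<Rightarrow> 'i \<Rightarrow> real"
  assumes I: "finite I" and F: "finite F"
    and a: "\<And>q. q \<in> F \<Longrightarrow> (\<Sum>i\<in>I. (a q i)\<^sup>2) = 2 \<or> (\<forall>i\<in>I. a q i = 0)"
    and disj: "\<And>q \<gamma> i. q \<in> F \<Longrightarrow> \<gamma> \<in> F \<Longrightarrow> q \<noteq> \<gamma> \<Longrightarrow> i \<in> I \<Longrightarrow> a q i * a \<gamma> i = 0"
  shows "distr (gaussians I) (gaussians I)
      (\<lambda>x. \<lambda>i\<in>I. x i - (\<Sum>q\<in>F. a q i *\<^sub>R (\<Sum>k\<in>I. a q k *\<^sub>R x k)))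
    = (gaussians I :: ('i \<Rightarrow> 'b::euclidean_space) measure)"
  using F a disj
proof (induction F rule: finite_induct)
  case empty
  show ?case by (simp only: sum.empty diff_zero) (rule PiM_gauss_reindex[of "\<lambda>i. i" I I]; simp)
next
  case (insert q F)
  let ?P = "gaussians I :: ('i \<Rightarrow> 'b) measure"
  define T where "T x = (\<lambda>i\<in>I. x i - (\<Sum>q\<in>F. a q i *\<^sub>R (\<Sum>k\<in>I. a q k *\<^sub>R x k)))" for x :: "'i \<Rightarrow> 'b"
  define R where "R x = (\<lambda>i\<in>I. x i - a q i *\<^sub>R (\<Sum>k\<in>I. a q k *\<^sub>R x k))" for x :: "'i \<Rightarrow> 'b"
  have Tm: "T \<in> ?P \<rightarrow>\<^sub>M ?P" unfolding T_def by measurable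
  have Rm: "R \<in> ?P \<rightarrow>\<^sub>M ?P" unfolding R_def by measurable
  have T: "distr ?P ?P T = ?P" unfolding T_def[abs_def] by (rule insert.IH) (use insert.prems in auto)
  have R: "distr ?P ?P R = ?P"
    unfolding R_def[abs_def] by (rule distr_PiM_gauss_reflection[OF I insert.prems(1)]) simp
  have "R (T x) = (\<lambda>i\<in>I. x i - (\<Sum>q\<in>insert q F. a q i *\<^sub>R (\<Sum>k\<in>I. a q k *\<^sub>R x k)))" for x
  proof -
    have "(\<Sum>k\<in>I. a q k *\<^sub>R T x k) = (\<Sum>k\<in>I. a q k *\<^sub>R x k)"
    proof (rule sum.cong[OF refl])
      fix k assume k: "k \<in> I"
      have "a q k *\<^sub>R (\<Sum>\<gamma>\<in>F. a \<gamma> k *\<^sub>R (\<Sum>k\<in>I. a \<gamma> k *\<^sub>R x k)) = (\<Sum>\<gamma>\<in>F. (a q k * a \<gamma> k) *\<^sub>R (\<Sum>k\<in>I. a \<gamma> k *\<^sub>R x k))"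
        by (simp only: scaleR_sum_right[of "a q k"] scaleR_scaleR)
      also have "\<dots> = 0"
      proof (rule sum.neutral, rule ballI)
        fix \<gamma> assume "\<gamma> \<in> F"
        then have "a q k * a \<gamma> k = 0" using insert.hyps k by (intro insert.prems(2)) auto
        then show "(a q k * a \<gamma> k) *\<^sub>R (\<Sum>k\<in>I. a \<gamma> k *\<^sub>R x k) = 0" by (simp only: scaleR_zero_left)
      qed
      finally show "a q k *\<^sub>R T x k = a q k *\<^sub>R x k" using k by (simp add: T_def scaleR_diff_right)
    qed
    then show ?thesis using insert.hyps by (auto simp: R_def T_def fun_eq_iff algebra_simps)
  qed
  then have "distr ?P ?P (\<lambda>x. \<lambda>i\<in>I. x i - (\<Sum>q\<in>insert q F. a q i *\<^sub>R (\<Sum>k\<in>I. a q k *\<^sub>R x k))) = distr ?P ?P (R \<circ> T)"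
    by (simp add: o_def)
  also have "\<dots> = distr (distr ?P ?P T) ?P R" by (rule distr_distr[OF Rm Tm, symmetric])
  finally show ?case unfolding T R .
qed

text \<open>Applies \<open>bridge\<close> to all blocks at once. The map is handed on only through
  its invariance and its values on and off the blocks, so that later proofs need not know the mirror
  vectors.\<close>

lemma PiM_gauss_bridge_blocks:
  fixes e :: "'k \<Rightarrow> nat \<Rightarrow> 'i" and D :: "'k \<Rightarrow> nat"
  assumes I: "finite I" and F: "finite F" and D: "\<And>q. q \<in> F \<Longrightarrow> D q \<ge> 1"
    and inj: "\<And>q. q \<in> F \<Longrightarrow> inj_on (e q) {1..D q}"
    and sub: "\<And>q. q \<in> F \<Longrightarrow> e q ` {1..D q} \<subseteq> I"
    and disj: "disjoint_family_on (\<lambda>q. e q ` {1..D q}) F"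
  obtains T :: "('i \<Rightarrow> 'b::euclidean_space) \<Rightarrow> ('i \<Rightarrow> 'b)" where
    "T \<in> gaussians I \<rightarrow>\<^sub>M gaussians I"
    "distr (gaussians I) (gaussians I) T = gaussians I"
    "\<And>x q t. q \<in> F \<Longrightarrow> t \<in> {1..D q} \<Longrightarrow> T x (e q t) = bridge (D q) (\<lambda>t. x (e q t)) t"
    "\<And>x i. i \<in> I \<Longrightarrow> i \<notin> (\<Union>q\<in>F. e q ` {1..D q}) \<Longrightarrow> T x i = x i"
proof -
  let ?P = "gaussians I :: ('i \<Rightarrow> 'b) measure"
  let ?K = "\<lambda>q. e q ` {1..D q}"
  have "\<exists>a. \<forall>q\<in>F. ((\<Sum>i=1..D q. (a q i)\<^sup>2) = 2 \<or> (\<forall>i\<in>{1..D q}. a q i = 0)) \<and>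
     (\<forall>(x :: nat \<Rightarrow> 'b) i. i \<in> {1..D q} \<longrightarrow> bridge (D q) x i = x i - (a q i :: real) *\<^sub>R (\<Sum>k=1..D q. a q k *\<^sub>R x k))"
  proof (rule bchoice, rule ballI)
    fix q assume "q \<in> F"
    show "\<exists>a. ((\<Sum>i=1..D q. (a i)\<^sup>2) = 2 \<or> (\<forall>i\<in>{1..D q}. a i = 0)) \<and>
     (\<forall>(x :: nat \<Rightarrow> 'b) i. i \<in> {1..D q} \<longrightarrow> bridge (D q) x i = x i - (a i :: real) *\<^sub>R (\<Sum>k=1..D q. a k *\<^sub>R x k))"
    proof (rule bridge_reflection[OF D[OF \<open>q \<in> F\<close>], where 'b='b])
      fix a :: "nat \<Rightarrow> real"
      assume "(\<Sum>i=1..D q. (a i)\<^sup>2) = 2 \<or> (\<forall>i\<in>{1..D q}. a i = 0)"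
        "\<And>(x :: nat \<Rightarrow> 'b) i. i \<in> {1..D q} \<Longrightarrow> bridge (D q) x i = x i - a i *\<^sub>R (\<Sum>k=1..D q. a k *\<^sub>R x k)"
      then show ?thesis by (intro exI[of _ a] conjI allI impI)
    qed
  qed
  then obtain a :: "'k \<Rightarrow> nat \<Rightarrow> real" where
    a: "\<And>q. q \<in> F \<Longrightarrow> (\<Sum>i=1..D q. (a q i)\<^sup>2) = 2 \<or> (\<forall>i\<in>{1..D q}. a q i = 0)"
    and br: "\<And>q (x :: nat \<Rightarrow> 'b) i. q \<in> F \<Longrightarrow> i \<in> {1..D q} \<Longrightarrow> bridge (D q) x i = x i - a q i *\<^sub>R (\<Sum>k=1..D q. a q k *\<^sub>R x k)"
    by (elim exE) (simp only: Ball_def, blast)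
  \<comment> \<open>The mirror vector of block \<open>q\<close>, transported by \<open>e q\<close>
    and extended by 0 to all indices.\<close>
  define b where "b q i = (if i \<in> ?K q then a q (the_inv_into {1..D q} (e q) i) else 0)" for q i
  have b_e: "b q (e q t) = a q t" if "q \<in> F" "t \<in> {1..D q}" for q t
    unfolding b_def using that the_inv_into_f_f[OF inj[OF that(1)] that(2)] by simp
  have b_sum: "(\<Sum>i\<in>I. g i (b q i)) = (\<Sum>t=1..D q. g (e q t) (a q t))"
    if q: "q \<in> F" and g: "\<And>i. g i 0 = 0" for q and g :: "'i \<Rightarrow> real \<Rightarrow> 'z::comm_monoid_add"
  proof -
    have "(\<Sum>i\<in>I. g i (b q i)) = (\<Sum>i\<in>?K q. g i (b q i))"
      by (rule sum.mono_neutral_right[OF I sub[OF q]]) (auto simp: b_def g)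
    also have "\<dots> = (\<Sum>t=1..D q. g (e q t) (b q (e q t)))" by (simp only: sum.reindex[OF inj[OF q]] o_def)
    also have "\<dots> = (\<Sum>t=1..D q. g (e q t) (a q t))" by (rule sum.cong) (use b_e[OF q] in auto)
    finally show ?thesis .
  qed
  have b0: "b \<gamma> i = 0" if "q \<in> F" "\<gamma> \<in> F" "q \<noteq> \<gamma>" "i \<in> ?K q" for q \<gamma> i
    using disjoint_family_onD[OF disj that(1-3)] that(4) by (auto simp: b_def)
  define T where "T x = (\<lambda>i\<in>I. x i - (\<Sum>q\<in>F. b q i *\<^sub>R (\<Sum>k\<in>I. b q k *\<^sub>R x k)))" for x :: "'i \<Rightarrow> 'b"
  show ?thesis
  proof (rule that)
    show "T \<in> ?P \<rightarrow>\<^sub>M ?P" unfolding T_def by measurable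
    show "distr ?P ?P T = ?P"
      unfolding T_def[abs_def]
    proof (rule distr_PiM_gauss_reflections[OF I F])
      fix q assume q: "q \<in> F"
      show "(\<Sum>i\<in>I. (b q i)\<^sup>2) = 2 \<or> (\<forall>i\<in>I. b q i = 0)"
      proof (rule disjE[OF a[OF q]])
        assume "(\<Sum>i=1..D q. (a q i)\<^sup>2) = 2"
        then show ?thesis using b_sum[OF q, of "\<lambda>_ y. y\<^sup>2"] by simp
      next
        assume "\<forall>i\<in>{1..D q}. a q i = 0"
        then have "\<forall>i\<in>I. b q i = 0" using b_e[OF q] by (auto simp: b_def[of q] simp del: One_nat_def)
        then show ?thesis ..
      qed
    next
      fix q \<gamma> i assume "q \<in> F" "\<gamma> \<in> F" "q \<noteq> \<gamma>"
      then show "b q i * b \<gamma> i = 0" using b0[of q \<gamma> i] by (cases "i \<in> ?K q") (auto simp: b_def[of q])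
    qed
    show "T x (e q t) = bridge (D q) (\<lambda>t. x (e q t)) t" if q: "q \<in> F" and t: "t \<in> {1..D q}" for x q t
    proof -
      have eI: "e q t \<in> I" using sub[OF q] t by auto
      have "(\<Sum>\<gamma>\<in>F. b \<gamma> (e q t) *\<^sub>R (\<Sum>k\<in>I. b \<gamma> k *\<^sub>R x k)) = b q (e q t) *\<^sub>R (\<Sum>k\<in>I. b q k *\<^sub>R x k)"
        using b0[OF q, of _ "e q t"] t by (subst sum.remove[OF F q]) (auto intro!: sum.neutral)
      also have "(\<Sum>k\<in>I. b q k *\<^sub>R x k) = (\<Sum>t=1..D q. a q t *\<^sub>R x (e q t))"
        by (rule b_sum[OF q]) simp
      finally show ?thesis using eI by (simp only: T_def restrict_apply' br[OF q t] b_e[OF q t])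
    qed
    show "T x i = x i" if "i \<in> I" "i \<notin> (\<Union>q\<in>F. ?K q)" for x i
    proof -
      have "b q i = 0" if "q \<in> F" for q using that \<open>i \<notin> (\<Union>q\<in>F. ?K q)\<close> by (auto simp: b_def)
      then show ?thesis using \<open>i \<in> I\<close> by (simp add: T_def)
    qed
  qed
qed

text \<open>Projection to the line of a unit vector turns the vectors into independent standard
  normal variables, and the event splits over disjoint blocks of them.\<close>

lemma measure_PiM_gauss_inner_blocks:
  fixes e :: "'k \<Rightarrow> nat \<Rightarrow> 'i" and N :: "'k \<Rightarrow> nat" and u :: "'b::euclidean_space"
  assumes I: "finite I" and B: "finite B" and u: "norm u = 1"
    and inj: "\<And>q. q \<in> B \<Longrightarrow> inj_on (e q) {1..N q}"
    and sub: "\<And>q. q \<in> B \<Longrightarrow> e q ` {1..N q} \<subseteq> I"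
    and disj: "disjoint_family_on (\<lambda>q. e q ` {1..N q}) B"
    and E: "\<And>q. q \<in> B \<Longrightarrow> E q \<in> sets (PiM {1..N q} (\<lambda>_. gauss :: real measure))"
  shows "measure (gaussians I) {z \<in> space (gaussians I). \<forall>q\<in>B. (\<lambda>t\<in>{1..N q}. u \<bullet> z (e q t)) \<in> E q}
    = (\<Prod>q\<in>B. measure (gaussians {1..N q}) (E q))"
proof -
  let ?P = "PiM I (\<lambda>_. gauss :: real measure)"
  let ?Q = "PiM I (\<lambda>_. gauss :: 'b measure)"
  define K where "K q = e q ` {1..N q}" for q
  define E' where "E' q = {y \<in> space (gaussians (K q)). (\<lambda>t\<in>{1..N q}. y (e q t)) \<in> E q}" for q
  have E': "E' q \<in> sets (gaussians (K q))" if "q \<in> B" for q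
  proof -
    have m: "(\<lambda>y. \<lambda>t\<in>{1..N q}. y (e q t)) \<in> gaussians (K q) \<rightarrow>\<^sub>M PiM {1..N q} (\<lambda>_. gauss :: real measure)"
      by (rule measurable_reindex) (simp add: K_def)
    have "E' q = (\<lambda>y. \<lambda>t\<in>{1..N q}. y (e q t)) -` E q \<inter> space (gaussians (K q))" by (auto simp: E'_def)
    then show ?thesis using measurable_sets[OF m E[OF that]] by simp
  qed
  let ?S = "{x \<in> space ?P. \<forall>q\<in>B. restrict x (K q) \<in> E' q}"
  have S: "?S \<in> sets ?P"
  proof (rule sets.sets_Collect_finite_All[OF _ B])
    fix q assume q: "q \<in> B"
    have m: "(\<lambda>x. restrict x (K q)) \<in> ?P \<rightarrow>\<^sub>M gaussians (K q)"
      using sub[OF q] by (intro measurable_restrict_subset) (simp add: K_def)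
    have "{x \<in> space ?P. restrict x (K q) \<in> E' q} = (\<lambda>x. restrict x (K q)) -` E' q \<inter> space ?P" by auto
    then show "{x \<in> space ?P. restrict x (K q) \<in> E' q} \<in> sets ?P" using measurable_sets[OF m E'[OF q]] by simp
  qed
  have mem: "restrict x (K q) \<in> E' q \<longleftrightarrow> (\<lambda>t\<in>{1..N q}. x (e q t)) \<in> E q" for x q
  proof -
    have "(\<lambda>t\<in>{1..N q}. restrict x (K q) (e q t)) = (\<lambda>t\<in>{1..N q}. x (e q t))" by (auto simp: K_def fun_eq_iff)
    moreover have "restrict x (K q) \<in> space (gaussians (K q))" by (simp add: space_PiM)
    ultimately show ?thesis unfolding E'_def by (simp only: mem_Collect_eq simp_thms)
  qed
  have fm: "(\<lambda>z. \<lambda>i\<in>I. u \<bullet> z i) \<in> ?Q \<rightarrow>\<^sub>M ?P" by measurable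
  have d: "distr ?Q ?P (\<lambda>z. \<lambda>i\<in>I. u \<bullet> z i) = ?P"
    by (rule distr_PiM_gauss_map[OF I _ distr_gauss_inner[OF u]]) simp
  have "measure ?P ?S = measure ?Q ((\<lambda>z. \<lambda>i\<in>I. u \<bullet> z i) -` ?S \<inter> space ?Q)"
    by (subst d[symmetric], rule measure_distr[OF fm]) (use S in simp)
  also have "(\<lambda>z. \<lambda>i\<in>I. u \<bullet> z i) -` ?S \<inter> space ?Q = {z \<in> space ?Q. \<forall>q\<in>B. (\<lambda>t\<in>{1..N q}. u \<bullet> z (e q t)) \<in> E q}"
  proof -
    have "(\<lambda>t\<in>{1..N q}. (\<lambda>i\<in>I. u \<bullet> z i) (e q t)) = (\<lambda>t\<in>{1..N q}. u \<bullet> z (e q t))" if "q \<in> B" for z q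
      using sub[OF that] by (auto simp: fun_eq_iff image_subset_iff simp del: One_nat_def)
    then show ?thesis unfolding mem by (auto simp: space_PiM simp del: One_nat_def)
  qed
  also have "measure ?P ?S = (\<Prod>q\<in>B. measure (gaussians (K q)) (E' q))"
    by (rule measure_PiM_gauss_blocks[OF B _ _ E']) (use sub disj in \<open>simp_all add: K_def\<close>)
  also have "\<dots> = (\<Prod>q\<in>B. measure (gaussians {1..N q}) (E q))"
    unfolding E'_def by (rule prod.cong[OF refl], rule measure_PiM_gauss_reindex) (use inj E in \<open>simp_all add: K_def\<close>)
  finally show ?thesis by (rule sym)
qed

section \<open>Blocks of steps between consecutive configuration indices\<close>

lemma finite_walk_index: "finite (walk_index m n)"
proof -
  have "walk_index m n = Sigma {1..m} (\<lambda>l. {1..n l})" by (auto simp: walk_index_def)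
  then show ?thesis by simp
qed

lemma walk_0: "walk \<omega> l 0 = 0" by (simp add: walk_def)

lemma walk_add: "walk \<omega> l (p + t) = walk \<omega> l p + (\<Sum>s=1..t. \<omega> (l, p + s))"
  by (induction t) (simp_all add: walk_def add.assoc)

lemma borel_measurable_walk:
  assumes "l \<in> {1..m}" "i \<le> n l"
  shows "(\<lambda>\<omega>. walk \<omega> l i) \<in> borel_measurable (PiM (walk_index m n) (\<lambda>_. gauss :: (real^'d::finite) measure))"
  unfolding walk_def using assms
  by (intro borel_measurable_sum) (auto simp: walk_index_def intro!: measurable_component_singleton[where M="\<lambda>_. gauss", simplified])

locale config =
  fixes m :: nat and n :: "nat \<Rightarrow> nat" and A :: "nat \<Rightarrow> nat set"
  assumes A_sub: "l \<in> {1..m} \<Longrightarrow> A l \<subseteq> {1..n l}"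
begin

definition J :: "(nat \<times> nat) set" where "J = {(l, i). l \<in> {1..m} \<and> i \<in> A l}"

text \<open>The time 0 stands for the start of the walk, so that the first configuration index has a
  predecessor too.\<close>

definition prev :: "nat \<Rightarrow> nat \<Rightarrow> nat" where "prev l i = Max (insert 0 {j \<in> A l. j < i})"

definition final :: "nat \<Rightarrow> nat" where "final l = Max (insert 0 (A l))"

definition gap :: "nat \<times> nat \<Rightarrow> nat" where "gap = (\<lambda>(l, i). i - prev l i)"

definition block :: "nat \<times> nat \<Rightarrow> nat \<Rightarrow> nat \<times> nat" where "block = (\<lambda>(l, i) t. (l, prev l i + t))"

text \<open>The points of the configuration after the substitution that turns each increment between
  consecutive configuration indices into \<open>sqrt gap\<close> times a single Gaussian vector.\<close>
definition point :: "(nat \<times> nat \<Rightarrow> 'b::real_vector) \<Rightarrow> nat \<Rightarrow> nat \<Rightarrow> 'b" where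
  "point W l i = (\<Sum>j | j \<in> A l \<and> j \<le> i. sqrt (real (gap (l, j))) *\<^sub>R W (l, j))"

text \<open>The room left below the hyperplane at the start of a block: the first block of a walk
  starts at the origin, a later one at a configuration point, which lies on the hyperplane.\<close>

definition level :: "real \<Rightarrow> nat \<times> nat \<Rightarrow> real" where
  "level r = (\<lambda>(l, i). if prev l i = 0 then r else 0)"

text \<open>The conditional probability, given the configuration points, that all points stay below
  the hyperplane at signed distance \<open>r\<close> from the origin: one bridge per block and one
  free walk per tail after the last configuration index, which is the whole walk if there is
  none.\<close>

definition persist :: "real \<Rightarrow> real" where
  "persist r = (\<Prod>q\<in>J. persist_q (gap q) (level r q)) *
     (\<Prod>l=1..m. persist_p (n l - final l) (if A l = {} then r else 0))"

lemma finite_A: "l \<in> {1..m} \<Longrightarrow> finite (A l)" using A_sub finite_subset by blast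

lemma A_pos: "l \<in> {1..m} \<Longrightarrow> i \<in> A l \<Longrightarrow> 1 \<le> i \<and> i \<le> n l" using A_sub by fastforce

lemma J_sub: "J \<subseteq> walk_index m n" using A_pos by (auto simp: J_def walk_index_def)

lemma finite_J: "finite J" using J_sub finite_walk_index finite_subset by blast

lemma prev_cases:
  assumes l: "l \<in> {1..m}"
  shows "prev l i = 0 \<or> prev l i \<in> A l \<and> prev l i < i"
proof -
  have "prev l i \<in> insert 0 {j \<in> A l. j < i}"
    unfolding prev_def using finite_A[OF l] by (intro Max_in) auto
  then show ?thesis by auto
qed

lemma prev_ge: "l \<in> {1..m} \<Longrightarrow> j \<in> A l \<Longrightarrow> j < i \<Longrightarrow> j \<le> prev l i"
  unfolding prev_def using finite_A by (intro Max_ge) auto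

lemma prev_less: "(l, i) \<in> J \<Longrightarrow> prev l i < i"
  using prev_cases[of l i] A_pos[of l i] by (auto simp: J_def)

lemma gap_pos: "q \<in> J \<Longrightarrow> gap q \<ge> 1"
  using prev_less by (cases q) (auto simp: gap_def Suc_le_eq)

lemma prev_plus_gap: "(l, i) \<in> J \<Longrightarrow> prev l i + gap (l, i) = i"
  using prev_less[of l i] by (simp add: gap_def)

lemma block_gap: "q \<in> J \<Longrightarrow> block q (gap q) = q"
  by (cases q) (simp add: block_def prev_plus_gap)

lemma inj_block: "inj_on (block q) X"
  by (cases q) (auto simp: inj_on_def block_def)

lemma final_cases: "l \<in> {1..m} \<Longrightarrow> final l = 0 \<and> A l = {} \<or> final l \<in> A l"
proof -
  assume l: "l \<in> {1..m}"
  have "final l \<in> insert 0 (A l)" unfolding final_def using finite_A[OF l] by (intro Max_in) auto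
  moreover have "A l = {}" if "final l = 0" "final l \<notin> A l"
  proof (rule ccontr)
    assume "A l \<noteq> {}"
    then obtain i where i: "i \<in> A l" by auto
    then have "i \<le> final l" unfolding final_def using finite_A[OF l] by (intro Max_ge) auto
    then show False using A_pos[OF l i] that by simp
  qed
  ultimately show ?thesis by auto
qed

lemma le_final: "l \<in> {1..m} \<Longrightarrow> i \<in> A l \<Longrightarrow> i \<le> final l"
  unfolding final_def using finite_A by (intro Max_ge) auto


lemma index_cases:
  assumes l: "l \<in> {1..m}" and i: "i \<in> {1..n l}"
  obtains (tail) t where "t \<in> {1..n l - final l}" "i = final l + t"
    | (block) j t where "(l, j) \<in> J" "t \<in> {1..gap (l, j)}" "i = prev l j + t"
proof (cases "i \<le> final l")
  case False
  then show ?thesis using i by (intro tail[of "i - final l"]) auto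
next
  case True
  then have "final l \<in> A l" using final_cases[OF l] i by auto
  then have ne: "{j \<in> A l. i \<le> j} \<noteq> {}" using True by auto
  \<comment> \<open>The block of \<open>i\<close> ends at the first configuration index not before
    \<open>i\<close>.\<close>
  define j where "j = Min {j \<in> A l. i \<le> j}"
  have fin: "finite {j \<in> A l. i \<le> j}" using finite_A[OF l] by simp
  have j: "j \<in> A l" "i \<le> j" using Min_in[OF fin ne] by (auto simp: j_def)
  have "prev l j < i"
  proof (rule ccontr)
    assume "\<not> prev l j < i"
    then have "prev l j \<in> A l" "i \<le> prev l j" "prev l j < j" using prev_cases[OF l, of j] i by auto
    then show False using Min_le[OF fin, of "prev l j"] by (auto simp: j_def)
  qed
  then show ?thesis using j l by (intro block[of j "i - prev l j"]) (auto simp: J_def gap_def)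
qed

lemma block_sub:
  assumes "q \<in> J"
  shows "block q ` {1..gap q} \<subseteq> walk_index m n"
proof -
  obtain l i where q: "q = (l, i)" by (cases q)
  then have "prev l i + gap q = i" "l \<in> {1..m}" "i \<in> A l" using assms prev_plus_gap by (auto simp: J_def)
  then show ?thesis using A_pos[of l i] by (auto simp: block_def walk_index_def q)
qed

lemma block_disjoint:
  assumes "(l, i) \<in> J" "(l, j) \<in> J" "i < j" "s \<le> gap (l, i)" "t \<ge> 1"
  shows "prev l i + s \<noteq> prev l j + t"
proof -
  have "prev l i + s \<le> i" using prev_plus_gap[OF assms(1)] assms(4) by simp
  also have "i \<le> prev l j" using assms prev_ge[of l i j] by (auto simp: J_def)
  finally show ?thesis using assms(5) by simp
qed

lemma disjoint_blocks: "disjoint_family_on (\<lambda>q. block q ` {1..gap q}) J"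
proof -
  have "prev l i + s \<noteq> prev l j + t"
    if "(l, i) \<in> J" "(l, j) \<in> J" "i \<noteq> j" "s \<in> {1..gap (l, i)}" "t \<in> {1..gap (l, j)}" for l i j s t
    using block_disjoint[of l i j s t] block_disjoint[of l j i t s] that by (cases "i < j") auto
  then show ?thesis unfolding disjoint_family_on_def by (fastforce simp: block_def)
qed

text \<open>Only the last position of a block is a configuration index: another one would end a
  block of its own and lie in two blocks.\<close>

lemma block_notin_J:
  assumes q: "q \<in> J" and t: "t \<in> {1..gap q - 1}"
  shows "block q t \<in> walk_index m n - J"
proof -
  have t': "t \<in> {1..gap q}" "t \<noteq> gap q" using t by auto
  have "block q t \<notin> J"
  proof
    assume J: "block q t \<in> J"
    have eq: "block (block q t) (gap (block q t)) = block q t" by (rule block_gap[OF J])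
    have "gap (block q t) \<in> {1..gap (block q t)}" using gap_pos[OF J] by simp
    then have "block q t \<in> block (block q t) ` {1..gap (block q t)}" using eq by force
    moreover have "block q t \<in> block q ` {1..gap q}" using t' by blast
    ultimately have "block q t = q" using disjoint_family_onD[OF disjoint_blocks J q] by blast
    then have "block q t = block q (gap q)" using block_gap[OF q] by simp
    then show False using t'(2) by (cases q) (simp add: block_def)
  qed
  then show ?thesis using block_sub[OF q] t'(1) by blast
qed

lemma tail_notin_block:
  assumes l: "l \<in> {1..m}" and t: "t \<ge> 1"
  shows "(l, final l + t) \<notin> (\<Union>q\<in>J. block q ` {1..gap q})"
proof
  assume "(l, final l + t) \<in> (\<Union>q\<in>J. block q ` {1..gap q})"
  then obtain j s where j: "(l, j) \<in> J" "s \<le> gap (l, j)" "final l + t = prev l j + s"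
    by (auto simp: block_def)
  then have "final l + t \<le> j" using prev_plus_gap[OF j(1)] by simp
  moreover have "j \<le> final l" using j(1) le_final[OF l] by (simp add: J_def)
  ultimately show False using t by simp
qed

lemma tail_notin_J:
  assumes l: "l \<in> {1..m}" and t: "t \<in> {1..n l - final l}"
  shows "(l, final l + t) \<in> walk_index m n - J"
  using le_final[OF l, of "final l + t"] l t by (auto simp: J_def walk_index_def)

lemma point_0: "l \<in> {1..m} \<Longrightarrow> point W l 0 = 0"
  using A_pos[of l] by (auto simp: point_def intro!: sum.neutral)

lemma point_prev:
  assumes "(l, i) \<in> J"
  shows "point W l i = point W l (prev l i) + sqrt (real (gap (l, i))) *\<^sub>R W (l, i)"
proof -
  have l: "l \<in> {1..m}" and i: "i \<in> A l" using assms by (auto simp: J_def)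
  have "{j. j \<in> A l \<and> j \<le> i} = insert i {j. j \<in> A l \<and> j \<le> prev l i}"
    using prev_less[OF assms] prev_ge[OF l, of _ i] i by fastforce
  then show ?thesis
    using prev_less[OF assms] finite_A[OF l] by (simp add: point_def)
qed

lemma point_cong: "l \<in> {1..m} \<Longrightarrow> (\<And>q. q \<in> J \<Longrightarrow> W q = W' q) \<Longrightarrow> point W l i = point W' l i"
  unfolding point_def by (intro sum.cong) (auto simp: J_def)

text \<open>A block or tail starts either at the origin or on the hyperplane, and the level makes up
  the difference to \<open>r\<close>.\<close>

lemma point_level:
  assumes l: "l \<in> {1..m}" and u: "\<And>l i. (l, i) \<in> J \<Longrightarrow> u \<bullet> point W l i = (r :: real)"
  shows "u \<bullet> point W l (prev l i) + level r (l, i) = r"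
    "u \<bullet> point W l (final l) + (if A l = {} then r else 0) = r"
proof -
  show "u \<bullet> point W l (prev l i) + level r (l, i) = r"
    using prev_cases[OF l, of i] u[of l "prev l i"] point_0[OF l, of W] A_pos[OF l, of "prev l i"] l
    by (auto simp: level_def J_def)
  show "u \<bullet> point W l (final l) + (if A l = {} then r else 0) = r"
    using final_cases[OF l] u[of l "final l"] point_0[OF l, of W] l by (auto simp: J_def)
qed

text \<open>By \<open>sum_bridge\<close> the steps of a block add up to the root of the gap times
  its last input, which is stored at the configuration index itself.\<close>

lemma walk_eq_point:
  assumes T: "\<And>q t. q \<in> J \<Longrightarrow> t \<in> {1..gap q} \<Longrightarrow> Tx (block q t) = bridge (gap q) (\<lambda>t. x (block q t)) t"
    and l: "l \<in> {1..m}" and i: "i \<in> insert 0 (A l)"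
  shows "walk Tx l i = point x l i"
  using i
proof (induction i rule: less_induct)
  case (less i)
  show ?case
  proof (cases "i = 0")
    case False
    then have J: "(l, i) \<in> J" using less.prems l by (simp add: J_def)
    have "walk Tx l i = walk Tx l (prev l i) + (\<Sum>s=1..gap (l, i). Tx (block (l, i) s))"
      unfolding block_def by (subst prev_plus_gap[OF J, symmetric]) (simp add: walk_add)
    also have "(\<Sum>s=1..gap (l, i). Tx (block (l, i) s)) = (\<Sum>s=1..gap (l, i). bridge (gap (l, i)) (\<lambda>t. x (block (l, i) t)) s)"
      by (intro sum.cong T[OF J]) simp_all
    also have "\<dots> = sqrt (real (gap (l, i))) *\<^sub>R x (block (l, i) (gap (l, i)))" by (rule sum_bridge[OF gap_pos[OF J]])
    also have "block (l, i) (gap (l, i)) = (l, i)" by (rule block_gap[OF J])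
    also have "walk Tx l (prev l i) = point x l (prev l i)"
      using prev_cases[OF l, of i] prev_less[OF J] by (intro less.IH) auto
    finally show ?thesis by (simp only: point_prev[OF J])
  qed (simp add: walk_0 point_0[OF l])
qed

text \<open>Heights inside a block are the starting height plus partial sums of a scalar bridge,
  heights in a tail the starting height plus free partial sums. At the end of a block the height is
  exactly \<open>r\<close>, so only the times up to \<open>gap q - 1\<close> impose a
  condition.\<close>

lemma walk_bound_iff:
  fixes x :: "nat \<times> nat \<Rightarrow> real^'d::finite" and u :: "real^'d"
  assumes T: "\<And>q t. q \<in> J \<Longrightarrow> t \<in> {1..gap q} \<Longrightarrow> Tx (block q t) = bridge (gap q) (\<lambda>t. x (block q t)) t"
    and T': "\<And>i. i \<in> walk_index m n \<Longrightarrow> i \<notin> (\<Union>q\<in>J. block q ` {1..gap q}) \<Longrightarrow> Tx i = x i"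
    and u: "\<And>l i. (l, i) \<in> J \<Longrightarrow> u \<bullet> point x l i = r"
  shows "(\<forall>(l, i)\<in>walk_index m n. u \<bullet> walk Tx l i \<le> r) \<longleftrightarrow>
    (\<forall>q\<in>J. \<forall>j\<in>{1..gap q - 1}. (\<Sum>s=1..j. bridge (gap q) (\<lambda>t. u \<bullet> x (block q t)) s) \<le> level r q) \<and>
    (\<forall>l\<in>{1..m}. \<forall>j\<in>{1..n l - final l}. (\<Sum>s=1..j. u \<bullet> x (l, final l + s)) \<le> (if A l = {} then r else 0))"
    (is "?L \<longleftrightarrow> ?B \<and> ?R")
proof -
  have blk: "u \<bullet> walk Tx l (prev l i + t) = r - level r (l, i) + (\<Sum>s=1..t. bridge (gap (l, i)) (\<lambda>t. u \<bullet> x (block (l, i) t)) s)"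
    if J: "(l, i) \<in> J" and t: "t \<le> gap (l, i)" for l i t
  proof -
    have l: "l \<in> {1..m}" using J by (simp add: J_def)
    have "u \<bullet> walk Tx l (prev l i) = r - level r (l, i)"
      using point_level(1)[OF l u, of i] walk_eq_point[OF T l, of "prev l i"] prev_cases[OF l, of i] by auto
    moreover have "(\<Sum>s=1..t. Tx (l, prev l i + s)) = (\<Sum>s=1..t. bridge (gap (l, i)) (\<lambda>t. x (block (l, i) t)) s)"
    proof (rule sum.cong[OF refl])
      fix s assume "s \<in> {1..t}"
      then show "Tx (l, prev l i + s) = bridge (gap (l, i)) (\<lambda>t. x (block (l, i) t)) s"
        using T[OF J, of s] t by (simp add: block_def)
    qed
    ultimately show ?thesis unfolding walk_add inner_add_right inner_bridge[symmetric] inner_sum_right[symmetric]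
      by (simp only:)
  qed
  have tl: "u \<bullet> walk Tx l (final l + t) = r - (if A l = {} then r else 0) + (\<Sum>s=1..t. u \<bullet> x (l, final l + s))"
    if l: "l \<in> {1..m}" and t: "t \<le> n l - final l" for l t
  proof -
    have "u \<bullet> walk Tx l (final l) = r - (if A l = {} then r else 0)"
    proof -
      have "walk Tx l (final l) = point x l (final l)"
        using final_cases[OF l] by (intro walk_eq_point[OF T l]) auto
      moreover have "u \<bullet> point x l (final l) + (if A l = {} then r else 0) = r"
        by (rule point_level(2)[OF l]) (rule u)
      ultimately show ?thesis by (simp only: eq_diff_eq)
    qed
    moreover have "(\<Sum>s=1..t. Tx (l, final l + s)) = (\<Sum>s=1..t. x (l, final l + s))"
    proof (rule sum.cong[OF refl])
      fix s assume s: "s \<in> {1..t}"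
      show "Tx (l, final l + s) = x (l, final l + s)"
        by (rule T'[OF _ tail_notin_block[OF l]]) (use l s t in \<open>auto simp: walk_index_def\<close>)
    qed
    ultimately show ?thesis unfolding walk_add inner_add_right inner_sum_right[symmetric] by (simp only:)
  qed
  show ?thesis
  proof (intro iffI conjI ballI)
    fix q j assume L: ?L and q: "q \<in> J" and j: "j \<in> {1..gap q - 1}"
    obtain l i where li: "q = (l, i)" by (cases q)
    have "(l, prev l i + j) \<in> walk_index m n" using block_notin_J[OF q j] by (simp add: block_def li)
    then have "u \<bullet> walk Tx l (prev l i + j) \<le> r" using L by auto
    moreover have "j \<le> gap (l, i)" using j li by auto
    ultimately show "(\<Sum>s=1..j. bridge (gap q) (\<lambda>t. u \<bullet> x (block q t)) s) \<le> level r q"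
      using blk[of l i j] q li by simp
  next
    fix l j assume L: ?L and l: "l \<in> {1..m}" and j: "j \<in> {1..n l - final l}"
    have "u \<bullet> walk Tx l (final l + j) \<le> r" using L tail_notin_J[OF l j] by auto
    moreover have "j \<le> n l - final l" using j by auto
    ultimately show "(\<Sum>s=1..j. u \<bullet> x (l, final l + s)) \<le> (if A l = {} then r else 0)"
      using tl[OF l, of j] by linarith
  next
    assume R: "?B \<and> ?R"
    fix li assume "li \<in> walk_index m n"
    then show "case li of (l, i) \<Rightarrow> u \<bullet> walk Tx l i \<le> r"
    proof (intro case_prodI2)
      fix l i assume "li \<in> walk_index m n" "li = (l, i)"
      then have l: "l \<in> {1..m}" and i: "i \<in> {1..n l}" by (auto simp: walk_index_def)
      show "u \<bullet> walk Tx l i \<le> r"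
      proof (rule index_cases[OF l i])
        fix t assume tail: "t \<in> {1..n l - final l}" "i = final l + t"
        have "(\<Sum>s=1..t. u \<bullet> x (l, final l + s)) \<le> (if A l = {} then r else 0)" using R l tail(1) by blast
        moreover have "t \<le> n l - final l" using tail by auto
        ultimately show ?thesis using tl[OF l, of t] tail(2) by (cases "A l = {}") simp_all
      next
        fix j t assume block: "(l, j) \<in> J" "t \<in> {1..gap (l, j)}" "i = prev l j + t"
        show ?thesis
        proof (cases "t = gap (l, j)")
          case True
          then have "i = j" using block prev_plus_gap by simp
          then show ?thesis using u[OF block(1)] walk_eq_point[OF T l, of j] block(1) by (auto simp: J_def)
        next
          case False
          then have t: "t \<in> {1..gap (l, j) - 1}" using block(2) by auto
          have "(\<Sum>s=1..t. bridge (gap (l, j)) (\<lambda>t. u \<bullet> x (block (l, j) t)) s) \<le> level r (l, j)"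
            using R block(1) t by blast
          then show ?thesis using blk[OF block(1), of t] block(2,3) by simp
        qed
      qed
    qed
  qed
qed

end

section \<open>The conditional probability of lying on one side of the hyperplane\<close>

lemma persist_nonneg: "persist_p k r \<ge> 0" "persist_q k r \<ge> 0"
  by (simp_all add: persist_p_def persist_q_def)

lemma sets_bridge_event:
  "{z \<in> space (gaussians {1..n-1}). \<forall>j\<in>{1..n-1}. (\<Sum>i=1..j. bridge n (z(n := c)) i) \<le> (\<rho> :: real)}
    \<in> sets (PiM {1..n-1} (\<lambda>_. gauss :: real measure))"
proof (intro sets.sets_Collect_finite_All borel_measurable_le borel_measurable_sum borel_measurable_bridge)
  fix k j i assume "k \<in> {1..n}" "j \<in> {1..n-1}" "i \<in> {1..j}"
  then show "(\<lambda>z. (z(n := c)) k) \<in> borel_measurable (PiM {1..n-1} (\<lambda>_. gauss :: real measure))"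
    by (cases "k = n") auto
qed auto

lemma sets_walk_event:
  fixes n :: nat
  shows
  "{z \<in> space (gaussians {1..n}). \<forall>j\<in>{1..n}. (\<Sum>i=1..j. z i) \<le> (\<rho> :: real)}
    \<in> sets (PiM {1..n} (\<lambda>_. gauss :: real measure))"
proof (intro sets.sets_Collect_finite_All borel_measurable_le borel_measurable_sum)
  fix j i assume "j \<in> {1..n}" "i \<in> {1..j}"
  then have "i \<in> {1..n}" by auto
  then show "(\<lambda>z. z i) \<in> borel_measurable (PiM {1..n} (\<lambda>_. gauss :: real measure))" by measurable
qed auto

context config begin

definition walk_points :: "(nat \<times> nat \<Rightarrow> real^'d::finite) \<Rightarrow> (nat \<times> nat \<Rightarrow> real^'d)" where
  "walk_points \<omega> = (\<lambda>(l, i)\<in>J. walk \<omega> l i)"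

definition points :: "(nat \<times> nat \<Rightarrow> 'b::real_vector) \<Rightarrow> (nat \<times> nat \<Rightarrow> 'b)" where
  "points W = (\<lambda>(l, i)\<in>J. point W l i)"

text \<open>With \<open>W\<close> fixed, the last input of every scalar bridge is pinned to
  \<open>level r q / sqrt (gap q)\<close>, as in \<open>persist_q_bridge\<close>. The other inputs
  are read from \<open>z\<close> at indices outside \<open>J\<close>; after projection to
  \<open>u\<close> they are standard normal, and different blocks and tails use different indices,
  hence are independent.\<close>

lemma measure_conditional:
  fixes u :: "real^'d::finite" and W :: "nat \<times> nat \<Rightarrow> real^'d"
  defines "I \<equiv> walk_index m n"
  defines "P \<equiv> PiM (I - J) (\<lambda>_. gauss :: (real^'d) measure)"
  assumes T: "\<And>x q t. q \<in> J \<Longrightarrow> t \<in> {1..gap q} \<Longrightarrow> T x (block q t) = bridge (gap q) (\<lambda>t. x (block q t)) t"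
    and T': "\<And>x i. i \<in> I \<Longrightarrow> i \<notin> (\<Union>q\<in>J. block q ` {1..gap q}) \<Longrightarrow> T x i = x i"
    and u: "norm u = 1" "\<And>l i. (l, i) \<in> J \<Longrightarrow> u \<bullet> point W l i = r"
  shows "measure P {z \<in> space P. \<forall>(l, i)\<in>I. u \<bullet> walk (T (merge J (I - J) (W, z))) l i \<le> r} = persist r"
proof -
  let ?x = "\<lambda>z. merge J (I - J) (W, z)"
  \<comment> \<open>Blocks are tagged \<open>Inl\<close>, tails \<open>Inr\<close>; \<open>N\<close>
    counts the free inputs, one less than the gap for a block.\<close>
  define B where "B = J <+> {1..m}"
  define N where "N = case_sum (\<lambda>q. gap q - 1) (\<lambda>l. n l - final l)"
  define e where "e = case_sum block (\<lambda>l t. (l, final l + t))"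
  define E where "E = case_sum
     (\<lambda>q. {z \<in> space (gaussians {1..gap q - 1}). \<forall>j\<in>{1..gap q - 1}.
         (\<Sum>i=1..j. bridge (gap q) (z(gap q := level r q / sqrt (gap q))) i) \<le> level r q})
     (\<lambda>l. {z \<in> space (gaussians {1..n l - final l}). \<forall>j\<in>{1..n l - final l}. (\<Sum>i=1..j. z i) \<le> (if A l = {} then r else 0)})"
  have "{z \<in> space P. \<forall>(l, i)\<in>I. u \<bullet> walk (T (?x z)) l i \<le> r}
    = {z \<in> space P. \<forall>q\<in>B. (\<lambda>t\<in>{1..N q}. u \<bullet> z (e q t)) \<in> E q}"
  proof (rule Collect_cong, rule conj_cong[OF refl])
    fix z assume "z \<in> space P"
    have pt: "u \<bullet> point (?x z) l i = r" if "(l, i) \<in> J" for l i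
    proof -
      have "point (?x z) l i = point W l i"
        by (rule point_cong) (use that in \<open>auto simp: J_def merge_def\<close>)
      then show ?thesis using u(2)[OF that] by simp
    qed
    have "(\<forall>(l, i)\<in>I. u \<bullet> walk (T (?x z)) l i \<le> r) \<longleftrightarrow>
      (\<forall>q\<in>J. \<forall>j\<in>{1..gap q - 1}. (\<Sum>s=1..j. bridge (gap q) (\<lambda>t. u \<bullet> ?x z (block q t)) s) \<le> level r q) \<and>
      (\<forall>l\<in>{1..m}. \<forall>j\<in>{1..n l - final l}. (\<Sum>s=1..j. u \<bullet> ?x z (l, final l + s)) \<le> (if A l = {} then r else 0))"
      unfolding I_def by (rule walk_bound_iff[OF T T'[unfolded I_def] pt[unfolded I_def]])
    also have "\<dots> \<longleftrightarrow> (\<forall>q\<in>J. (\<lambda>t\<in>{1..N (Inl q)}. u \<bullet> z (e (Inl q) t)) \<in> E (Inl q)) \<and>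
      (\<forall>l\<in>{1..m}. (\<lambda>t\<in>{1..N (Inr l)}. u \<bullet> z (e (Inr l) t)) \<in> E (Inr l))"
    proof (rule conj_cong; rule ball_cong[OF refl])
      fix q assume q: "q \<in> J"
      obtain l i where li: "q = (l, i)" by (cases q)
      have l: "l \<in> {1..m}" using q by (simp add: J_def li)
      let ?y = "(\<lambda>t\<in>{1..gap q - 1}. u \<bullet> z (block q t))(gap q := level r q / sqrt (gap q))"
      have W: "u \<bullet> W q = level r q / sqrt (gap q)"
      proof -
        have "u \<bullet> point W l i = u \<bullet> point W l (prev l i) + sqrt (gap q) * (u \<bullet> W q)"
          using point_prev[of l i W] q by (simp add: li inner_add_right)
        moreover have "u \<bullet> point W l (prev l i) + level r (l, i) = r"
          by (rule point_level(1)[OF l]) (rule u(2))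
        ultimately have "sqrt (gap q) * (u \<bullet> W q) = level r q"
          using u(2)[of l i] q by (simp add: li)
        then show ?thesis using gap_pos[OF q] by (simp add: field_simps)
      qed
      have "(\<lambda>t. u \<bullet> ?x z (block q t)) t = ?y t" if "t \<in> {1..gap q}" for t
      proof (cases "t = gap q")
        case True
        then show ?thesis using W block_gap[OF q] q by (simp add: merge_def)
      next
        case False
        then have t: "t \<in> {1..gap q - 1}" using that by auto
        have "?x z (block q t) = z (block q t)"
          using block_notin_J[OF q t] by (auto simp: merge_def I_def)
        then show ?thesis using False t by simp
      qed
      then have br: "bridge (gap q) (\<lambda>t. u \<bullet> ?x z (block q t)) s = bridge (gap q) ?y s" if "s \<in> {1..gap q}" for s
        using that by (intro bridge_cong)
      have "(\<Sum>s=1..j. bridge (gap q) (\<lambda>t. u \<bullet> ?x z (block q t)) s) = (\<Sum>s=1..j. bridge (gap q) ?y s)"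
        if "j \<in> {1..gap q - 1}" for j
      proof (intro sum.cong refl)
        fix s assume "s \<in> {1..j}"
        then have "s \<in> {1..gap q}" using \<open>j \<in> {1..gap q - 1}\<close> by auto
        then show "bridge (gap q) (\<lambda>t. u \<bullet> ?x z (block q t)) s = bridge (gap q) ?y s"
          by (rule br)
      qed
      then show "(\<forall>j\<in>{1..gap q - 1}. (\<Sum>s=1..j. bridge (gap q) (\<lambda>t. u \<bullet> ?x z (block q t)) s) \<le> level r q)
        \<longleftrightarrow> (\<lambda>t\<in>{1..N (Inl q)}. u \<bullet> z (e (Inl q) t)) \<in> E (Inl q)"
        by (simp add: E_def N_def e_def space_PiM del: One_nat_def)
    next
      fix l assume l: "l \<in> {1..m}"
      have "(\<Sum>s=1..j. u \<bullet> ?x z (l, final l + s)) = (\<Sum>s=1..j. (\<lambda>t\<in>{1..n l - final l}. u \<bullet> z (l, final l + t)) s)"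
        if "j \<in> {1..n l - final l}" for j
      proof (rule sum.cong[OF refl])
        fix s assume "s \<in> {1..j}"
        then have s: "s \<in> {1..n l - final l}" using that by auto
        have "?x z (l, final l + s) = z (l, final l + s)"
          using tail_notin_J[OF l s] by (auto simp: merge_def I_def)
        then show "u \<bullet> ?x z (l, final l + s) = (\<lambda>t\<in>{1..n l - final l}. u \<bullet> z (l, final l + t)) s" using s by simp
      qed
      then show "(\<forall>j\<in>{1..n l - final l}. (\<Sum>s=1..j. u \<bullet> ?x z (l, final l + s)) \<le> (if A l = {} then r else 0))
        \<longleftrightarrow> (\<lambda>t\<in>{1..N (Inr l)}. u \<bullet> z (e (Inr l) t)) \<in> E (Inr l)"
        by (simp add: E_def N_def e_def space_PiM del: One_nat_def)
    qed
    also have "\<dots> \<longleftrightarrow> (\<forall>q\<in>B. (\<lambda>t\<in>{1..N q}. u \<bullet> z (e q t)) \<in> E q)"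
      by (simp add: B_def Plus_def ball_Un)
    finally show "(\<forall>(l, i)\<in>I. u \<bullet> walk (T (?x z)) l i \<le> r) \<longleftrightarrow> (\<forall>q\<in>B. (\<lambda>t\<in>{1..N q}. u \<bullet> z (e q t)) \<in> E q)" .
  qed
  moreover have "measure P {z \<in> space P. \<forall>q\<in>B. (\<lambda>t\<in>{1..N q}. u \<bullet> z (e q t)) \<in> E q}
    = (\<Prod>q\<in>B. measure (gaussians {1..N q}) (E q))"
    unfolding P_def
  proof (rule measure_PiM_gauss_inner_blocks[OF _ _ u(1)])
    show "finite (I - J)" by (simp add: I_def finite_walk_index)
    show "finite B" by (simp add: B_def finite_J)
    show "inj_on (e q) {1..N q}" for q
      by (cases q) (auto simp: e_def inj_block, auto simp: inj_on_def)
    show "e q ` {1..N q} \<subseteq> I - J" if "q \<in> B" for q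
      using that block_notin_J tail_notin_J by (auto simp: B_def e_def N_def I_def simp del: One_nat_def)
    show "E q \<in> sets (gaussians {1..N q})" for q
      using sets_bridge_event sets_walk_event by (cases q) (simp_all add: E_def N_def del: One_nat_def)
    show "disjoint_family_on (\<lambda>q. e q ` {1..N q}) B"
      unfolding disjoint_family_on_def
    proof (intro ballI impI)
      fix q \<gamma> assume "q \<in> B" "\<gamma> \<in> B" "q \<noteq> \<gamma>"
      have sub: "block q ` {1..gap q - 1} \<subseteq> block q ` {1..gap q}" for q by (rule image_mono) auto
      have ll: "block q ` {1..gap q - 1} \<inter> block \<gamma> ` {1..gap \<gamma> - 1} = {}" if "q \<in> J" "\<gamma> \<in> J" "q \<noteq> \<gamma>" for q \<gamma>
        using disjoint_family_onD[OF disjoint_blocks that] sub[of q] sub[of \<gamma>] by blast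
      have lr: "block q ` {1..gap q - 1} \<inter> (\<lambda>t. (l, final l + t)) ` {1..n l - final l} = {}" if "q \<in> J" "l \<in> {1..m}" for q l
      proof -
        have "(l, final l + t) \<notin> block q ` {1..gap q - 1}" if t: "t \<in> {1..n l - final l}" for t
        proof -
          have "t \<ge> 1" using t by simp
          then show ?thesis using tail_notin_block[OF \<open>l \<in> {1..m}\<close>, of t] sub[of q] \<open>q \<in> J\<close> by blast
        qed
        then show ?thesis by (intro Int_emptyI) (auto simp only:)
      qed
      have BJ: "b \<in> J" if "Inl b \<in> B" for b using that by (auto simp: B_def)
      have Bl: "l \<in> {1..m}" if "Inr l \<in> B" for l using that by (auto simp: B_def)
      have rr: "(\<lambda>t. (l, final l + t)) ` {1..n l - final l} \<inter> (\<lambda>t. (l', final l' + t)) ` {1..n l' - final l'} = {}"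
        if "l \<noteq> l'" for l l'
        using that by auto
      show "e q ` {1..N q} \<inter> e \<gamma> ` {1..N \<gamma>} = {}"
      proof (cases q)
        case q: (Inl b)
        show ?thesis
        proof (cases \<gamma>)
          case (Inl b')
          then show ?thesis using ll[of b b'] BJ[of b] BJ[of b'] q \<open>q \<in> B\<close> \<open>\<gamma> \<in> B\<close> \<open>q \<noteq> \<gamma>\<close> by (simp add: e_def N_def del: One_nat_def)
        next
          case (Inr l)
          then show ?thesis using lr[of b l] BJ[of b] Bl[of l] q \<open>q \<in> B\<close> \<open>\<gamma> \<in> B\<close> by (simp add: e_def N_def del: One_nat_def)
        qed
      next
        case q: (Inr l)
        show ?thesis
        proof (cases \<gamma>)
          case (Inl b)
          then show ?thesis using lr[of b l] BJ[of b] Bl[of l] q \<open>q \<in> B\<close> \<open>\<gamma> \<in> B\<close> by (simp add: e_def N_def Int_commute del: One_nat_def)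
        next
          case (Inr l')
          then show ?thesis using rr[of l l'] q \<open>q \<noteq> \<gamma>\<close> by (simp add: e_def N_def del: One_nat_def)
        qed
      qed
    qed
  qed
  moreover have "(\<Prod>q\<in>B. measure (gaussians {1..N q}) (E q)) = persist r"
  proof -
    have "(\<Prod>q\<in>B. measure (gaussians {1..N q}) (E q)) =
      (\<Prod>q\<in>J. measure (gaussians {1..N (Inl q)}) (E (Inl q))) *
      (\<Prod>l\<in>{1..m}. measure (gaussians {1..N (Inr l)}) (E (Inr l)))"
      unfolding B_def by (simp only: prod.Plus[OF finite_J finite_atLeastAtMost] o_def)
    also have "(\<Prod>q\<in>J. measure (gaussians {1..N (Inl q)}) (E (Inl q))) = (\<Prod>q\<in>J. persist_q (gap q) (level r q))"
      by (rule prod.cong[OF refl]) (simp add: persist_q_bridge[OF gap_pos] E_def N_def del: One_nat_def)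
    also have "(\<Prod>l\<in>{1..m}. measure (gaussians {1..N (Inr l)}) (E (Inr l))) = (\<Prod>l=1..m. persist_p (n l - final l) (if A l = {} then r else 0))"
      by (rule prod.cong[OF refl]) (simp add: persist_p_def std_normal_measure_eq E_def N_def del: One_nat_def)
    finally show ?thesis by (simp only: persist_def)
  qed
  ultimately show ?thesis by simp
qed

lemma measurable_walk_points:
  "walk_points \<in> PiM (walk_index m n) (\<lambda>_. gauss :: (real^'d::finite) measure) \<rightarrow>\<^sub>M gaussians J"
  unfolding walk_points_def[abs_def]
proof (rule measurable_restrict)
  fix q assume q: "q \<in> J"
  obtain l i where li: "q = (l, i)" by (cases q)
  then have "(l, i) \<in> walk_index m n" using q J_sub by auto
  then have "(\<lambda>\<omega>. walk \<omega> l i) \<in> borel_measurable (PiM (walk_index m n) (\<lambda>_. gauss :: (real^'d) measure))"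
    by (intro borel_measurable_walk) (auto simp: walk_index_def)
  then show "(\<lambda>\<omega>. case q of (l, i) \<Rightarrow> walk \<omega> l i) \<in> PiM (walk_index m n) (\<lambda>_. gauss :: (real^'d) measure) \<rightarrow>\<^sub>M gauss"
    by (simp add: li measurable_cong_sets[OF refl sets_gauss])
qed

lemma sets_one_side:
  fixes c :: "(nat \<times> nat \<Rightarrow> real^'d::finite) \<Rightarrow> real^'d"
  defines "M \<equiv> PiM (walk_index m n) (\<lambda>_. gauss :: (real^'d) measure)" and "PJ \<equiv> PiM J (\<lambda>_. gauss :: (real^'d) measure)"
  assumes c[measurable]: "c \<in> borel_measurable PJ" and \<tau>[measurable]: "\<tau> \<in> borel_measurable PJ"
  shows "{\<omega> \<in> space M. \<forall>(l, i)\<in>walk_index m n. c (walk_points \<omega>) \<bullet> walk \<omega> l i \<le> \<tau> (walk_points \<omega>)} \<in> sets M"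
proof (rule sets.sets_Collect_finite_All[OF _ finite_walk_index])
  have [measurable]: "walk_points \<in> M \<rightarrow>\<^sub>M PJ" unfolding M_def PJ_def by (rule measurable_walk_points)
  fix q assume q: "q \<in> walk_index m n"
  obtain l i where li: "q = (l, i)" by (cases q)
  have [measurable]: "(\<lambda>\<omega>. walk \<omega> l i) \<in> borel_measurable M"
    unfolding M_def using q by (intro borel_measurable_walk) (auto simp: li walk_index_def)
  show "{\<omega> \<in> space M. case q of (l, i) \<Rightarrow> c (walk_points \<omega>) \<bullet> walk \<omega> l i \<le> \<tau> (walk_points \<omega>)} \<in> sets M"
    unfolding li by simp measurable
qed

text \<open>After the measure preserving change \<open>T\<close>, the configuration points depend
  only on the coordinates in \<open>J\<close>, and the rest enters through \<open>z\<close>. Fubini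
  then reduces to \<open>measure_conditional\<close>, with \<open>u\<close> the normalised
  \<open>c\<close>. Where \<open>c\<close> vanishes and has no direction, \<open>N\<close> is
  0.\<close>

lemma nn_integral_one_side:
  fixes c :: "(nat \<times> nat \<Rightarrow> real^'d::finite) \<Rightarrow> real^'d"
  defines "M \<equiv> PiM (walk_index m n) (\<lambda>_. gauss :: (real^'d) measure)" and "PJ \<equiv> PiM J (\<lambda>_. gauss :: (real^'d) measure)"
  assumes N: "N \<in> borel_measurable PJ" and c: "c \<in> borel_measurable PJ" and \<tau>: "\<tau> \<in> borel_measurable PJ"
    and N0: "\<And>y. c y = 0 \<Longrightarrow> N y = 0" and c\<tau>: "\<And>y q. q \<in> J \<Longrightarrow> c y \<bullet> y q = \<tau> y"
  shows "(\<integral>\<^sup>+\<omega>. N (walk_points \<omega>) * of_bool (\<forall>(l, i)\<in>walk_index m n. c (walk_points \<omega>) \<bullet> walk \<omega> l i \<le> \<tau> (walk_points \<omega>)) \<partial>M)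
    = (\<integral>\<^sup>+W. N (points W) * ennreal (persist (\<tau> (points W) / norm (c (points W)))) \<partial>PJ)"
proof -
  let ?I = "walk_index m n"
  interpret product_sigma_finite "\<lambda>_::nat \<times> nat. gauss :: (real^'d) measure" ..
  interpret PZ: prob_space "PiM (?I - J) (\<lambda>_. gauss :: (real^'d) measure)" by (rule prob_space_PiM_gauss)
  let ?PZ = "PiM (?I - J) (\<lambda>_. gauss :: (real^'d) measure)"
  define S where "S = {\<omega> \<in> space M. \<forall>(l, i)\<in>?I. c (walk_points \<omega>) \<bullet> walk \<omega> l i \<le> \<tau> (walk_points \<omega>)}"
  define G where "G \<omega> = N (walk_points \<omega>) * indicator S \<omega>" for \<omega>
  have [measurable]: "walk_points \<in> M \<rightarrow>\<^sub>M PJ" unfolding M_def PJ_def by (rule measurable_walk_points)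
  note [measurable] = N c \<tau>
  have Sm[measurable]: "S \<in> sets M"
    unfolding S_def M_def by (rule sets_one_side[OF c[unfolded PJ_def] \<tau>[unfolded PJ_def]])
  have Gm[measurable]: "G \<in> borel_measurable M" unfolding G_def[abs_def] by measurable
  show ?thesis
  proof (rule PiM_gauss_bridge_blocks[OF finite_walk_index finite_J gap_pos inj_block block_sub disjoint_blocks, where 'b="real^'d"])
    fix T :: "(nat \<times> nat \<Rightarrow> real^'d) \<Rightarrow> (nat \<times> nat \<Rightarrow> real^'d)"
    assume Tm: "T \<in> gaussians ?I \<rightarrow>\<^sub>M gaussians ?I"
      and Td: "distr (gaussians ?I) (gaussians ?I) T = gaussians ?I"
      and T: "\<And>x q t. q \<in> J \<Longrightarrow> t \<in> {1..gap q} \<Longrightarrow> T x (block q t) = bridge (gap q) (\<lambda>t. x (block q t)) t"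
      and T': "\<And>x i. i \<in> ?I \<Longrightarrow> i \<notin> (\<Union>q\<in>J. block q ` {1..gap q}) \<Longrightarrow> T x i = x i"
    note Tm' = Tm[folded M_def] and Td' = Td[folded M_def]
    have GT: "(\<lambda>x. G (T x)) \<in> borel_measurable (gaussians (J \<union> (?I - J)))"
      using measurable_compose[OF Tm' Gm] J_sub by (simp add: M_def Un_absorb1)
    have "(\<integral>\<^sup>+\<omega>. G \<omega> \<partial>M) = (\<integral>\<^sup>+x. G (T x) \<partial>M)"
      by (subst Td'[symmetric], rule nn_integral_distr[OF Tm']) (use Td' Gm in simp)
    also have "\<dots> = (\<integral>\<^sup>+x. G (T x) \<partial>gaussians (J \<union> (?I - J)))"
      using J_sub by (simp add: M_def Un_absorb1)
    also have "\<dots> = (\<integral>\<^sup>+W. \<integral>\<^sup>+z. G (T (merge J (?I - J) (W, z))) \<partial>?PZ \<partial>PJ)"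
      unfolding PJ_def by (rule product_nn_integral_fold[OF _ finite_J _ GT]) (auto simp: finite_walk_index)
    also have "\<dots> = (\<integral>\<^sup>+W. N (points W) * ennreal (persist (\<tau> (points W) / norm (c (points W)))) \<partial>PJ)"
    proof (rule nn_integral_cong)
      fix W assume W: "W \<in> space PJ"
      have wpT: "walk_points (T (merge J (?I - J) (W, z))) = points W" for z
      proof -
        have "walk (T (merge J (?I - J) (W, z))) l i = point W l i" if li: "(l, i) \<in> J" for l i
        proof -
          have l: "l \<in> {1..m}" "i \<in> insert 0 (A l)" using li by (auto simp: J_def)
          have "walk (T (merge J (?I - J) (W, z))) l i = point (merge J (?I - J) (W, z)) l i"
            by (rule walk_eq_point[OF T l])
          also have "\<dots> = point W l i" by (rule point_cong[OF l(1)]) (simp add: merge_def)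
          finally show ?thesis .
        qed
        then show ?thesis by (auto simp: walk_points_def points_def fun_eq_iff)
      qed
      have sp: "T (merge J (?I - J) (W, z)) \<in> space M" if "z \<in> space ?PZ" for z
      proof -
        have "merge J (?I - J) (W, z) \<in> space M"
          using J_sub by (auto simp: M_def space_PiM PiE_def extensional_def merge_def)
        then show ?thesis by (rule measurable_space[OF Tm'])
      qed
      show "(\<integral>\<^sup>+z. G (T (merge J (?I - J) (W, z))) \<partial>?PZ) = N (points W) * ennreal (persist (\<tau> (points W) / norm (c (points W))))"
      proof (cases "c (points W) = 0")
        case True
        then show ?thesis using N0[of "points W"] by (simp add: G_def wpT)
      next
        case False
        define y where "y = points W"
        define u where "u = c y /\<^sub>R norm (c y)"
        define r where "r = \<tau> y / norm (c y)"
        have cy: "norm (c y) > 0" using False by (simp add: y_def)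
        have u: "norm u = 1" using cy by (simp add: u_def)
        have iff: "u \<bullet> v \<le> r \<longleftrightarrow> c y \<bullet> v \<le> \<tau> y" for v
          using cy by (simp add: u_def r_def field_simps)
        have ul: "u \<bullet> point W l i = r" if "(l, i) \<in> J" for l i
        proof -
          have "c y \<bullet> point W l i = \<tau> y" using c\<tau>[OF that, of y] that by (simp add: y_def points_def)
          then show ?thesis by (simp add: u_def r_def divide_inverse mult.commute)
        qed
        let ?E = "{z \<in> space ?PZ. \<forall>(l, i)\<in>?I. u \<bullet> walk (T (merge J (?I - J) (W, z))) l i \<le> r}"
        have meas: "measure ?PZ ?E = persist r"
          by (rule measure_conditional[where T=T, OF T T' u ul])
        have "(\<integral>\<^sup>+z. G (T (merge J (?I - J) (W, z))) \<partial>?PZ) = (\<integral>\<^sup>+z. N y * indicator ?E z \<partial>?PZ)"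
          by (rule nn_integral_cong) (use sp in \<open>auto simp: G_def S_def wpT y_def[symmetric] iff indicator_def\<close>)
        also have "\<dots> = N y * emeasure ?PZ ?E"
        proof (rule nn_integral_cmult_indicator)
          have mm: "(\<lambda>z. T (merge J (?I - J) (W, z))) \<in> ?PZ \<rightarrow>\<^sub>M M"
          proof (rule measurable_compose[OF _ Tm'])
            have "(\<lambda>z. (W, z)) \<in> ?PZ \<rightarrow>\<^sub>M PJ \<Otimes>\<^sub>M ?PZ" using W by simp
            then have "(\<lambda>z. merge J (?I - J) (W, z)) \<in> ?PZ \<rightarrow>\<^sub>M gaussians (J \<union> (?I - J))"
              unfolding PJ_def by (rule measurable_compose[OF _ measurable_merge])
            then show "(\<lambda>z. merge J (?I - J) (W, z)) \<in> ?PZ \<rightarrow>\<^sub>M M"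
              using J_sub by (simp add: M_def Un_absorb1)
          qed
          have "?E = (\<lambda>z. T (merge J (?I - J) (W, z))) -` S \<inter> space ?PZ"
            using sp by (auto simp: S_def wpT y_def[symmetric] iff)
          then show "?E \<in> sets ?PZ" using measurable_sets[OF mm Sm] by simp
        qed
        also have "emeasure ?PZ ?E = ennreal (persist r)" using meas by (simp add: PZ.emeasure_eq_measure)
        finally show ?thesis by (simp add: y_def r_def)
      qed
    qed
    finally have "(\<integral>\<^sup>+\<omega>. G \<omega> \<partial>M) = (\<integral>\<^sup>+W. N (points W) * ennreal (persist (\<tau> (points W) / norm (c (points W)))) \<partial>PJ)" .
    moreover have "(\<integral>\<^sup>+\<omega>. G \<omega> \<partial>M) = (\<integral>\<^sup>+\<omega>. N (walk_points \<omega>) * of_bool (\<forall>(l, i)\<in>?I. c (walk_points \<omega>) \<bullet> walk \<omega> l i \<le> \<tau> (walk_points \<omega>)) \<partial>M)"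
      by (rule nn_integral_cong) (auto simp: G_def S_def indicator_def)
    ultimately show ?thesis by simp
  qed
qed

end

section \<open>Closed forms of the constants of a configuration\<close>

lemma last_sorted_list_of_set: "finite B \<Longrightarrow> B \<noteq> {} \<Longrightarrow> List.last (sorted_list_of_set B) = Max B"
proof (induction B rule: finite_linorder_max_induct)
  case (insert b B)
  have "sorted_list_of_set (insert b B) = sorted_list_of_set B @ [b]"
    using insert by (subst sorted_list_of_set_insert) (auto intro!: sorted_insort_is_snoc less_imp_le)
  moreover have "Max (insert b B) = b" using insert by (intro Max_eqI) (auto intro: less_imp_le)
  ultimately show ?case by simp
qed simp

text \<open>Translates differences of consecutive list entries into differences from predecessors,
  the form of \<open>gap\<close>. The minimum is excluded because its predecessor would be the start
  of the walk.\<close>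

lemma gapprod_eq:
  assumes "finite B"
  shows "gapprod B = (\<Prod>i\<in>B - {Min B}. real (i - Max (insert 0 {j \<in> B. j < i})))"
  using assms
proof (induction B rule: finite_linorder_max_induct)
  case empty then show ?case by (simp add: gapprod_def)
next
  case (insert b B)
  show ?case
  proof (cases "B = {}")
    case True then show ?thesis by (simp add: gapprod_def)
  next
    case False
    define xs where "xs = sorted_list_of_set B"
    have xs: "xs \<noteq> []" "set xs = B" "List.last xs = Max B"
      using False insert.hyps last_sorted_list_of_set by (auto simp: xs_def)
    have snoc: "sorted_list_of_set (insert b B) = xs @ [b]"
      using insert unfolding xs_def by (subst sorted_list_of_set_insert) (auto intro!: sorted_insort_is_snoc less_imp_le)
    have mn: "Min B \<in> B" "Min B < b" "b \<notin> B" using insert.hyps False Min_in[of B] by auto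
    then have mn': "Min (insert b B) = Min B" using Min_insert[OF insert.hyps(1) False, of b] by (metis min_absorb2 less_imp_le)
    have len: "{..<length xs} = insert (length xs - 1) {..<length xs - 1}" using xs(1) by (cases xs) auto
    have "gapprod (insert b B) = (\<Prod>j<length xs. real ((xs @ [b]) ! Suc j - (xs @ [b]) ! j))"
      unfolding gapprod_def snoc by (simp add: Let_def)
    also have "\<dots> = real (b - List.last xs) * (\<Prod>j<length xs - 1. real ((xs @ [b]) ! Suc j - (xs @ [b]) ! j))"
      unfolding len using xs(1) by (subst prod.insert) (auto simp: nth_append last_conv_nth)
    also have "(\<Prod>j<length xs - 1. real ((xs @ [b]) ! Suc j - (xs @ [b]) ! j)) = gapprod B"
      unfolding gapprod_def xs_def[symmetric] Let_def by (rule prod.cong) (auto simp: nth_append)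
    also have "\<dots> = (\<Prod>i\<in>B - {Min B}. real (i - Max (insert 0 {j \<in> insert b B. j < i})))"
      unfolding insert.IH
    proof (rule prod.cong[OF refl])
      fix i assume "i \<in> B - {Min B}"
      then have "{j \<in> insert b B. j < i} = {j \<in> B. j < i}" using insert.hyps by (auto dest: less_asym)
      then show "real (i - Max (insert 0 {j \<in> B. j < i})) = real (i - Max (insert 0 {j \<in> insert b B. j < i}))" by simp
    qed
    also have "real (b - List.last xs) = real (b - Max (insert 0 {j \<in> insert b B. j < b}))"
    proof -
      have "{j \<in> insert b B. j < b} = B" using insert.hyps by auto
      moreover have "Max (insert 0 B) = Max B" using insert.hyps(1) False by (subst Max_insert) auto
      ultimately show ?thesis by (simp add: xs(3))
    qed
    also have "real (b - Max (insert 0 {j \<in> insert b B. j < b})) * (\<Prod>i\<in>B - {Min B}. real (i - Max (insert 0 {j \<in> insert b B. j < i})))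
      = (\<Prod>i\<in>insert b (B - {Min B}). real (i - Max (insert 0 {j \<in> insert b B. j < i})))"
      using insert.hyps mn by (subst prod.insert) auto
    also have "insert b (B - {Min B}) = insert b B - {Min (insert b B)}" using mn unfolding mn' by auto
    finally show ?thesis .
  qed
qed

lemma gapprod_pos: "finite B \<Longrightarrow> 0 \<notin> B \<Longrightarrow> gapprod B > 0"
proof -
  assume B: "finite B" "0 \<notin> B"
  have "Max (insert 0 {j \<in> B. j < i}) < i" if "i \<in> B" for i
    using B that by (subst Max_less_iff) (auto intro: gr0I)
  then show ?thesis unfolding gapprod_eq[OF B(1)] by (intro prod_pos) auto
qed

context config begin

lemma prod_J: "(\<Prod>q\<in>J. g q) = (\<Prod>l=1..m. \<Prod>i\<in>A l. g (l, i))"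
proof -
  have "J = Sigma {1..m} A" by (auto simp: J_def)
  moreover have "(\<Prod>l=1..m. \<Prod>i\<in>A l. g (l, i)) = (\<Prod>(l, i)\<in>Sigma {1..m} A. g (l, i))"
    by (rule prod.Sigma) (auto intro: finite_A)
  ultimately show ?thesis by simp
qed

lemma sum_J: "(\<Sum>q\<in>J. g q) = (\<Sum>l=1..m. \<Sum>i\<in>A l. g (l, i))"
proof -
  have "J = Sigma {1..m} A" by (auto simp: J_def)
  moreover have "(\<Sum>l=1..m. \<Sum>i\<in>A l. g (l, i)) = (\<Sum>(l, i)\<in>Sigma {1..m} A. g (l, i))"
    by (rule sum.Sigma) (auto intro: finite_A)
  ultimately show ?thesis by simp
qed

lemma active_sub: "active m A \<subseteq> {1..m}" "finite (active m A)"
  by (auto simp: active_def)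

lemma activeD:
  assumes "l \<in> active m A"
  shows "l \<in> {1..m}" "finite (A l)" "A l \<noteq> {}" "Min (A l) \<in> A l" "Min (A l) \<ge> 1" "0 \<notin> A l"
proof -
  show l: "l \<in> {1..m}" and ne: "A l \<noteq> {}" using assms by (auto simp: active_def)
  show "finite (A l)" by (rule finite_A[OF l])
  then show "Min (A l) \<in> A l" using ne by simp
  then show "Min (A l) \<ge> 1" using A_pos[OF l] by blast
  show "0 \<notin> A l" using A_pos[OF l, of 0] by auto
qed

lemma prev_eq_0_iff:
  assumes "(l, i) \<in> J"
  shows "prev l i = 0 \<longleftrightarrow> i = Min (A l)"
proof -
  have l: "l \<in> active m A" and i: "i \<in> A l" using assms by (auto simp: J_def active_def)
  note a = activeD[OF l]
  show ?thesis
  proof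
    assume "i = Min (A l)"
    then have "{j \<in> A l. j < i} = {}" using a by auto
    then show "prev l i = 0" unfolding prev_def by (simp only:) simp
  next
    assume p: "prev l i = 0"
    show "i = Min (A l)"
    proof (rule ccontr)
      assume "i \<noteq> Min (A l)"
      then have "Min (A l) < i" using a i by (simp add: le_neq_trans)
      then show False using prev_ge[OF a(1,4)] a(5) p by fastforce
    qed
  qed
qed

lemma gap_Min: "l \<in> active m A \<Longrightarrow> gap (l, Min (A l)) = Min (A l)"
  using prev_eq_0_iff[of l "Min (A l)"] activeD[of l] by (simp add: gap_def J_def)

lemma prod_gap: "l \<in> active m A \<Longrightarrow> (\<Prod>i\<in>A l - {Min (A l)}. real (gap (l, i))) = gapprod (A l)"
  using activeD(2)[of l] by (simp add: gapprod_eq gap_def prev_def)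

lemma prod_A:
  assumes l: "l \<in> {1..m}"
  shows "(\<Prod>i\<in>A l. g i) = (if l \<in> active m A then g (Min (A l)) * (\<Prod>i\<in>A l - {Min (A l)}. g i) else 1)"
  using l activeD[of l] by (auto simp: prod.remove active_def)

lemma prod_active: "(\<Prod>l=1..m. if l \<in> active m A then g l else h l) = (\<Prod>l\<in>active m A. g l) * (\<Prod>l\<in>{1..m} - active m A. h l)"
  by (subst prod.If_cases) (use active_sub in \<open>auto intro!: arg_cong2[where f="(*)"] prod.cong\<close>)

text \<open>The determinant of the triangular matrix that expresses the configuration points through
  the Gaussian vectors.\<close>

definition scale :: real where "scale = (\<Prod>q\<in>J. sqrt (real (gap q)))"

lemma scale_eq: "scale = (\<Prod>l\<in>active m A. sqrt (real (Min (A l))) * sqrt (gapprod (A l)))"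
proof -
  have s: "(\<Prod>i\<in>X. sqrt (g i)) = sqrt (\<Prod>i\<in>X. g i)" for X and g :: "nat \<Rightarrow> real"
    by (induction X rule: infinite_finite_induct) (simp_all add: real_sqrt_mult)
  have "scale = (\<Prod>l=1..m. if l \<in> active m A then sqrt (real (Min (A l))) * sqrt (gapprod (A l)) else 1)"
    unfolding scale_def prod_J
  proof (rule prod.cong[OF refl])
    fix l assume l: "l \<in> {1..m}"
    show "(\<Prod>i\<in>A l. sqrt (real (gap (l, i)))) = (if l \<in> active m A then sqrt (real (Min (A l))) * sqrt (gapprod (A l)) else 1)"
      unfolding prod_A[OF l] s using prod_gap[of l] gap_Min[of l] by (simp add: real_sqrt_mult)
  qed
  then show ?thesis unfolding prod_active by simp
qed

lemma scale_pos: "scale > 0"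
  unfolding scale_def by (intro prod_pos) (use gap_pos in force)

text \<open>Only the first block of a walk has a nonzero level, and its gap is the smallest
  configuration index; this is the origin of s.\<close>

lemma sum_slope: "(\<Sum>q\<in>J. (level 1 q / sqrt (real (gap q)))\<^sup>2) = sfac m A"
proof -
  have "(\<Sum>i\<in>A l. (level 1 (l, i) / sqrt (real (gap (l, i))))\<^sup>2) = (if l \<in> active m A then 1 / real (Min (A l)) else 0)"
    if l: "l \<in> {1..m}" for l
  proof (cases "l \<in> active m A")
    case True
    note a = activeD[OF True]
    have "(\<Sum>i\<in>A l. (level 1 (l, i) / sqrt (real (gap (l, i))))\<^sup>2) = (\<Sum>i\<in>{Min (A l)}. (level 1 (l, i) / sqrt (real (gap (l, i))))\<^sup>2)"
      by (rule sum.mono_neutral_right) (use a prev_eq_0_iff[of l] in \<open>auto simp: level_def J_def\<close>)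
    also have "\<dots> = 1 / real (Min (A l))"
      using prev_eq_0_iff[of l "Min (A l)"] a gap_Min[OF True] by (simp add: level_def J_def power_divide)
    finally show ?thesis using True by simp
  qed (use l in \<open>auto simp: active_def\<close>)
  then have "(\<Sum>q\<in>J. (level 1 q / sqrt (real (gap q)))\<^sup>2) = (\<Sum>l=1..m. if l \<in> active m A then 1 / real (Min (A l)) else 0)"
    unfolding sum_J by (intro sum.cong) auto
  also have "\<dots> = sfac m A"
    unfolding sfac_def using active_sub by (subst sum.If_cases) (auto simp: Int_absorb1)
  finally show ?thesis .
qed

text \<open>The first blocks and the walks without configuration points keep the level
  \<open>r\<close>. All other blocks and tails start on the hyperplane and run at level 0, where the
  values \<open>1 / gap\<close> and \<open>cfac\<close> are known.\<close>

lemma persist_eq: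
  "persist r = (\<Prod>l\<in>{1..m} - active m A. persist_p (n l) r) * (\<Prod>l\<in>active m A. persist_q (Min (A l)) r) *
     (\<Prod>l\<in>active m A. cfac (n l - Max (A l)) / gapprod (A l))"
proof -
  have "(\<Prod>q\<in>J. persist_q (gap q) (level r q)) = (\<Prod>l=1..m. if l \<in> active m A then persist_q (Min (A l)) r / gapprod (A l) else 1)"
    unfolding prod_J
  proof (rule prod.cong[OF refl])
    fix l assume l: "l \<in> {1..m}"
    show "(\<Prod>i\<in>A l. persist_q (gap (l, i)) (level r (l, i))) = (if l \<in> active m A then persist_q (Min (A l)) r / gapprod (A l) else 1)"
    proof (cases "l \<in> active m A")
      case True
      have "persist_q (gap (l, i)) (level r (l, i)) = inverse (real (gap (l, i)))" if "i \<in> A l - {Min (A l)}" for i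
      proof -
        have J: "(l, i) \<in> J" using that l by (simp add: J_def)
        then have "level r (l, i) = 0" using prev_eq_0_iff[OF J] that by (simp add: level_def)
        then show ?thesis using persist_q_0[of "gap (l, i)"] gap_pos[OF J] by (simp add: inverse_eq_divide)
      qed
      then have "(\<Prod>i\<in>A l - {Min (A l)}. persist_q (gap (l, i)) (level r (l, i))) = inverse (gapprod (A l))"
        using prod_gap[OF True] prod_inversef[of "\<lambda>i. real (gap (l, i))" "A l - {Min (A l)}"] by (simp add: o_def)
      moreover have "level r (l, Min (A l)) = r"
        using prev_eq_0_iff[of l "Min (A l)"] activeD[OF True] by (simp add: level_def J_def)
      ultimately show ?thesis unfolding prod_A[OF l] using True gap_Min[OF True] by (simp add: divide_inverse)
    qed (simp add: prod_A[OF l])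
  qed
  moreover have "(\<Prod>l=1..m. persist_p (n l - final l) (if A l = {} then r else 0)) =
    (\<Prod>l=1..m. if l \<in> active m A then cfac (n l - Max (A l)) else persist_p (n l) r)"
  proof (rule prod.cong[OF refl])
    fix l assume l: "l \<in> {1..m}"
    show "persist_p (n l - final l) (if A l = {} then r else 0) = (if l \<in> active m A then cfac (n l - Max (A l)) else persist_p (n l) r)"
    proof (cases "l \<in> active m A")
      case True
      then have "final l = Max (A l)" using activeD[OF True] by (simp add: final_def Max_insert)
      then show ?thesis using True activeD[OF True] by (simp add: persist_p_0)
    next
      case False
      then have "A l = {}" using l by (auto simp: active_def)
      then show ?thesis using False by (simp add: final_def)
    qed
  qed
  ultimately show ?thesis
    unfolding persist_def by (simp only: prod_active) (simp add: prod_dividef)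
qed

end

text \<open>Rows are changed one at a time from the highest rank downwards, so the rows whose
  combination is added are still the original ones at that moment.\<close>

lemma det_add_lower_rows:
  fixes w \<alpha> :: "'d::finite \<Rightarrow> real^'d" and rank :: "'d \<Rightarrow> nat"
  assumes inj: "inj rank" and \<alpha>: "\<And>k. \<alpha> k \<in> vec.span {w j |j. rank j < rank k}"
  shows "det (\<chi> k. w k + \<alpha> k) = det (\<chi> k. w k)"
proof -
  define row' where "row' t k = (if rank k \<ge> t then w k + \<alpha> k else w k)" for t k
  have "det (\<chi> k. row' t k) = det (\<chi> k. row' (Suc t) k)" for t
  proof (cases "t \<in> range rank")
    case False
    then have "rank k \<noteq> t" for k by auto
    then have "row' t k = row' (Suc t) k" for k by (auto simp: row'_def not_less_eq_eq order.order_iff_strict)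
    then show ?thesis by simp
  next
    case True
    then obtain k0 where k0: "rank k0 = t" by auto
    have other: "row' t k = row' (Suc t) k" if "k \<noteq> k0" for k
    proof -
      have "rank k \<noteq> t" using inj_eq[OF inj, of k k0] that k0 by auto
      then show ?thesis by (auto simp: row'_def)
    qed
    let ?A = "\<chi> k. row' (Suc t) k"
    have "{w j |j. rank j < rank k0} \<subseteq> {row j ?A |j. j \<noteq> k0}"
    proof
      fix x assume "x \<in> {w j |j. rank j < rank k0}"
      then obtain j where j: "x = w j" "rank j < t" using k0 by auto
      then have "x = row j ?A" "j \<noteq> k0" using k0 by (auto simp: row'_def row_def vec_eq_iff)
      then show "x \<in> {row j ?A |j. j \<noteq> k0}" by blast
    qed
    then have "\<alpha> k0 \<in> vec.span {row j ?A |j. j \<noteq> k0}" using \<alpha>[of k0] vec.span_mono by blast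
    then have "det (\<chi> k. if k = k0 then row k0 ?A + \<alpha> k0 else row k ?A) = det ?A" by (rule det_row_span)
    moreover have "(\<chi> k. if k = k0 then row k0 ?A + \<alpha> k0 else row k ?A) = (\<chi> k. row' t k)"
    proof (intro arg_cong[where f=vec_lambda] ext)
      fix k
      have "row k ?A = row' (Suc t) k" for k by (simp add: row_def vec_eq_iff)
      then show "(if k = k0 then row k0 ?A + \<alpha> k0 else row k ?A) = row' t k"
        using other[of k] k0 by (auto simp: row'_def)
    qed
    ultimately show ?thesis by simp
  qed
  then have "det (\<chi> k. row' 0 k) = det (\<chi> k. row' t k)" for t by (induction t) simp_all
  from this[of "Suc (Max (range rank))"] have "det (\<chi> k. row' 0 k) = det (\<chi> k. row' (Suc (Max (range rank))) k)" .
  moreover have "row' (Suc (Max (range rank))) k = w k" for k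
  proof -
    have "rank k \<le> Max (range rank)" by (rule Max_ge) auto
    then have "\<not> Suc (Max (range rank)) \<le> rank k" by linarith
    then show ?thesis by (simp only: row'_def if_False)
  qed
  ultimately show ?thesis by (simp add: row'_def)
qed

lemma det_minus_row:
  fixes Y :: "'d::finite \<Rightarrow> real^'d"
  shows "det (\<chi> k. if k = k0 then Y k0 else Y k - Y k0) = det (\<chi> k. Y k)"
proof -
  obtain r :: "'d \<Rightarrow> nat" where r: "inj r"
    using finite_imp_inj_to_nat_seg[of "UNIV :: 'd set"] by auto
  define rank where "rank k = (if k = k0 then 0 else Suc (r k))" for k
  have "det (\<chi> k. Y k + (if k = k0 then 0 else - Y k0)) = det (\<chi> k. Y k)"
  proof (rule det_add_lower_rows)
    show "inj rank" using r by (auto simp: inj_def rank_def)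
    show "(if k = k0 then 0 else - Y k0) \<in> vec.span {Y j |j. rank j < rank k}" for k
    proof (cases "k = k0")
      case False
      then have "Y k0 \<in> {Y j |j. rank j < rank k}" by (auto simp: rank_def)
      then show ?thesis using False by (simp add: vec.span_neg vec.span_base)
    qed (simp add: vec.span_zero)
  qed
  moreover have "(\<chi> k. Y k + (if k = k0 then 0 else - Y k0)) = (\<chi> k. if k = k0 then Y k0 else Y k - Y k0)"
    by (auto simp: vec_eq_iff)
  ultimately show ?thesis by simp
qed

text \<open>Gives the offset of the hyperplane through the points: the differences are orthogonal to
  the normal, so one height serves for all \<open>k\<close>, and at \<open>k0\<close> it is a
  determinant by \<open>det_minus_row\<close>.\<close>

lemma inner_crossp_differences:
  fixes Y :: "'d::finite \<Rightarrow> real^'d"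
  shows "crossp k0 (\<lambda>k. Y k - Y k0) \<bullet> Y k = det (\<chi> k. Y k)"
proof -
  have "crossp k0 (\<lambda>k. Y k - Y k0) \<bullet> Y k0 = det (\<chi> k. Y k)"
    unfolding inner_crossp by (rule det_minus_row)
  moreover have "crossp k0 (\<lambda>k. Y k - Y k0) \<bullet> (Y k - Y k0) = 0"
    using inner_crossp_row[of k k0 "\<lambda>k. Y k - Y k0"] by (cases "k = k0") auto
  ultimately show ?thesis by (simp add: inner_diff_right)
qed

context config begin

lemma rank_exists:
  fixes f :: "'k \<Rightarrow> nat \<times> nat"
  assumes "inj_on f K" "f ` K \<subseteq> J"
  obtains rank :: "nat \<times> nat \<Rightarrow> nat" where "inj_on (rank \<circ> f) K"
    "\<And>l i j. (l, i) \<in> J \<Longrightarrow> (l, j) \<in> J \<Longrightarrow> j < i \<Longrightarrow> rank (l, j) < rank (l, i)"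
proof -
  \<comment> \<open>Time is the leading digit and the walk, at most \<open>m\<close>, the last one;
    so the code is injective on \<open>J\<close> and increases along each walk.\<close>
  define rank where "rank = (\<lambda>(l, i). i * (m + 1) + l :: nat)"
  have "inj_on rank J"
  proof (rule inj_onI)
    fix x y assume "x \<in> J" "y \<in> J" and eq: "rank x = rank y"
    obtain l i l' i' where xy: "x = (l, i)" "y = (l', i')" by (cases x, cases y)
    then have "l < m + 1" "l' < m + 1" using \<open>x \<in> J\<close> \<open>y \<in> J\<close> by (auto simp: J_def)
    then have "rank x mod (m + 1) = l" "rank y mod (m + 1) = l'" "rank x div (m + 1) = i" "rank y div (m + 1) = i'"
      by (simp_all only: rank_def xy case_prod_conv mod_mult_self3 mod_less div_mult_self3 div_less)
    then show "x = y" using eq xy by simp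
  qed
  then have "inj_on (rank \<circ> f) K" using assms by (intro comp_inj_on) (auto intro: inj_on_subset)
  moreover have "rank (l, j) < rank (l, i)" if "j < i" for l i j
    using mult_less_mono1[OF that, of "m + 1"] by (simp only: rank_def case_prod_conv) linarith
  ultimately show ?thesis by (rule that)
qed

text \<open>Subtracting from each point its predecessor on the same walk is a unitriangular row operation.\<close>
lemma det_points:
  fixes f :: "'d::finite \<Rightarrow> nat \<times> nat" and W :: "nat \<times> nat \<Rightarrow> real^'d"
  assumes f: "inj_on f K" "f ` K = J" and K: "K = UNIV \<or> K = UNIV - {k0}"
  shows "det (\<chi> k. if k \<in> K then points W (f k) else x) = scale * det (\<chi> k. if k \<in> K then W (f k) else x)"
proof -
  have fJ: "f k \<in> J" if "k \<in> K" for k using f that by auto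
  obtain rk :: "nat \<times> nat \<Rightarrow> nat" where rk: "inj_on (rk \<circ> f) K"
    "\<And>l i j. (l, i) \<in> J \<Longrightarrow> (l, j) \<in> J \<Longrightarrow> j < i \<Longrightarrow> rk (l, j) < rk (l, i)"
    using rank_exists[of f K] f by auto
  define rank where "rank k = (if k \<in> K then Suc (rk (f k)) else 0)" for k
  define w where "w k = (if k \<in> K then points W (f k) else x)" for k
  define \<alpha> where "\<alpha> k = (if k \<in> K then (case f k of (l, i) \<Rightarrow> - point W l (prev l i)) else 0)" for k
  have K': "k = k'" if "k \<notin> K" "k' \<notin> K" for k k' using K that by auto
  have "det (\<chi> k. w k + \<alpha> k) = det (\<chi> k. w k)"
  proof (rule det_add_lower_rows)
    show "inj rank"
      using rk(1) K' by (auto simp: inj_def inj_on_def rank_def)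
    show "\<alpha> k \<in> vec.span {w j |j. rank j < rank k}" for k
    proof (cases "k \<in> K")
      case True
      obtain l i where li: "f k = (l, i)" by (cases "f k")
      then have J: "(l, i) \<in> J" and l: "l \<in> {1..m}" using fJ[OF True] by (auto simp: J_def)
      show ?thesis
      proof (cases "prev l i = 0")
        case pr0: True
        then show ?thesis using True li point_0[OF l, of W] by (simp add: \<alpha>_def vec.span_zero)
      next
        case False
        then have p: "(l, prev l i) \<in> J" "prev l i < i" using prev_cases[OF l, of i] l by (auto simp: J_def)
        then obtain j where j: "j \<in> K" "f j = (l, prev l i)" using f(2) by (metis imageE)
        then have "w j = point W l (prev l i)" "rank j < rank k"
          using p True li rk(2)[OF J p] by (auto simp: w_def points_def rank_def)
        then have "point W l (prev l i) \<in> {w j |j. rank j < rank k}" by (intro CollectI exI[of _ j]) simp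
        then show ?thesis using True li by (simp add: \<alpha>_def vec.span_neg vec.span_base)
      qed
    qed (simp add: \<alpha>_def vec.span_zero)
  qed
  moreover have "w k + \<alpha> k = (if k \<in> K then sqrt (real (gap (f k))) else 1) *s (if k \<in> K then W (f k) else x)" for k
  proof (cases "k \<in> K")
    case True
    obtain l i where li: "f k = (l, i)" by (cases "f k")
    then show ?thesis using True fJ[OF True] point_prev[of l i W]
      by (simp add: w_def \<alpha>_def points_def vec_eq_iff)
  qed (simp add: w_def \<alpha>_def)
  ultimately have "det (\<chi> k. w k) = (\<Prod>k\<in>UNIV. if k \<in> K then sqrt (real (gap (f k))) else 1) * det (\<chi> k. if k \<in> K then W (f k) else x)"
    by (simp only: det_rows_mul)
  also have "(\<Prod>k\<in>UNIV. if k \<in> K then sqrt (real (gap (f k))) else 1) = (\<Prod>k\<in>K. sqrt (real (gap (f k))))"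
    by (simp add: prod.If_cases)
  also have "\<dots> = scale" unfolding scale_def using f by (simp add: prod.reindex[symmetric] flip: f(2)) (simp add: prod.reindex)
  finally show ?thesis by (simp add: w_def)
qed

end

section \<open>Measurability and integration of the persistence factors\<close>

lemma persist_p_eq: "persist_p n r = measure (PiM {1..n} (\<lambda>_. gauss :: real measure))
    {z \<in> space (gaussians {1..n}). \<forall>j\<in>{1..n}. (\<Sum>i=1..j. z i) \<le> r}"
  by (simp add: persist_p_def std_normal_measure_eq)

lemma persist_p_le_1: "persist_p n r \<le> 1"
  unfolding persist_p_eq by (rule prob_space.prob_le_1[OF prob_space_PiM_gauss])

lemma persist_q_le_1: "n \<ge> 1 \<Longrightarrow> persist_q n r \<le> 1"
  unfolding persist_q_bridge by (rule prob_space.prob_le_1[OF prob_space_PiM_gauss])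

lemma borel_measurable_measure_section:
  assumes M: "prob_space M" and E: "{x \<in> space (borel \<Otimes>\<^sub>M M). P (fst x) (snd x)} \<in> sets (borel \<Otimes>\<^sub>M M)"
  shows "(\<lambda>r :: real. measure M {z \<in> space M. P r z}) \<in> borel_measurable borel"
proof -
  interpret prob_space M by fact
  have "(\<lambda>r. emeasure M (Pair r -` {x \<in> space (borel \<Otimes>\<^sub>M M). P (fst x) (snd x)})) \<in> borel_measurable borel"
    by (rule measurable_emeasure_Pair[OF E])
  moreover have "Pair r -` {x \<in> space (borel \<Otimes>\<^sub>M M). P (fst x) (snd x)} = {z \<in> space M. P r z}" for r
    by (auto simp: space_pair_measure)
  ultimately have "(\<lambda>r. emeasure M {z \<in> space M. P r z}) \<in> borel_measurable borel" by simp
  then show ?thesis unfolding measure_def by measurable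
qed

lemma borel_measurable_persist_p: "persist_p n \<in> borel_measurable borel"
  unfolding persist_p_eq[abs_def]
proof (rule borel_measurable_measure_section[OF prob_space_PiM_gauss])
  let ?P = "PiM {1..n} (\<lambda>_. gauss :: real measure)"
  show "{x \<in> space (borel \<Otimes>\<^sub>M ?P). \<forall>j\<in>{1..n}. (\<Sum>i=1..j. snd x i) \<le> (fst x :: real)} \<in> sets (borel \<Otimes>\<^sub>M ?P)"
  proof (intro sets.sets_Collect_finite_All borel_measurable_le borel_measurable_sum)
    fix j i assume "j \<in> {1..n}" "i \<in> {1..j}"
    then have "i \<in> {1..n}" by auto
    then have "(\<lambda>z. z i) \<in> borel_measurable ?P" by measurable
    then show "(\<lambda>x. snd x i) \<in> borel_measurable ((borel :: real measure) \<Otimes>\<^sub>M ?P)" by (rule measurable_compose[OF measurable_snd])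
  qed auto
qed

lemma borel_measurable_persist_q:
  assumes "n \<ge> 1"
  shows "persist_q n \<in> borel_measurable borel"
  unfolding persist_q_bridge[OF assms, abs_def]
proof (rule borel_measurable_measure_section[OF prob_space_PiM_gauss])
  let ?P = "PiM {1..n-1} (\<lambda>_. gauss :: real measure)"
  show "{x \<in> space (borel \<Otimes>\<^sub>M ?P). \<forall>j\<in>{1..n-1}. (\<Sum>i=1..j. bridge n ((snd x)(n := fst x / sqrt n)) i) \<le> (fst x :: real)} \<in> sets (borel \<Otimes>\<^sub>M ?P)"
  proof (intro sets.sets_Collect_finite_All borel_measurable_le borel_measurable_sum borel_measurable_bridge)
    fix k j i assume "k \<in> {1..n}" "j \<in> {1..n-1}" "i \<in> {1..j}"
    show "(\<lambda>x. ((snd x)(n := fst x / sqrt n)) k) \<in> borel_measurable ((borel :: real measure) \<Otimes>\<^sub>M ?P)"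
    proof (cases "k = n")
      case False
      then have "k \<in> {1..n-1}" using \<open>k \<in> {1..n}\<close> by auto
      then have "(\<lambda>z. z k) \<in> borel_measurable ?P" by measurable
      then have "(\<lambda>x. snd x k) \<in> borel_measurable ((borel :: real measure) \<Otimes>\<^sub>M ?P)" by (rule measurable_compose[OF measurable_snd])
      then show ?thesis using False by simp
    qed simp
  qed auto
qed

lemma integrable_gaussian:
  assumes "s > 0"
  shows "integrable lborel (\<lambda>r :: real. exp (- s * r\<^sup>2 / 2))"
proof -
  define \<sigma> where "\<sigma> = 1 / sqrt s"
  have \<sigma>: "\<sigma> > 0" "\<sigma>\<^sup>2 = 1 / s" using assms by (auto simp: \<sigma>_def power_divide)
  have "integrable lborel (\<lambda>r. sqrt (2 * pi * \<sigma>\<^sup>2) * normal_density 0 \<sigma> r)"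
    using \<sigma>(1) by (intro integrable_mult_right integrable_normal_density)
  moreover have "sqrt (2 * pi * \<sigma>\<^sup>2) * normal_density 0 \<sigma> r = exp (- s * r\<^sup>2 / 2)" for r
    using assms by (simp add: normal_density_def \<sigma>(2))
  ultimately show ?thesis by simp
qed

lemma cfac_nonneg: "cfac k \<ge> 0" by (simp add: cfac_def)

context config begin

lemma borel_measurable_persist: "persist \<in> borel_measurable borel"
proof -
  have "(\<lambda>r. \<Prod>l\<in>{1..m} - active m A. persist_p (n l) r) \<in> borel_measurable borel"
    by (intro borel_measurable_prod borel_measurable_persist_p)
  moreover have "(\<lambda>r. \<Prod>l\<in>active m A. persist_q (Min (A l)) r) \<in> borel_measurable borel"
    by (intro borel_measurable_prod borel_measurable_persist_q activeD)
  ultimately show ?thesis unfolding persist_eq[abs_def] by measurable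
qed

lemma sfac_pos: "active m A \<noteq> {} \<Longrightarrow> sfac m A > 0"
  unfolding sfac_def using activeD active_sub by (intro sum_pos) force+

text \<open>Here the nonnegative integral becomes the real one of the statement; the integrand is
  dominated by a Gaussian because the persistence probabilities are at most 1.\<close>

lemma nn_integral_persist:
  assumes ne: "active m A \<noteq> {}" and R: "R \<in> sets borel"
  shows "(\<integral>\<^sup>+r. ennreal (exp (- sfac m A * r\<^sup>2 / 2)) * (indicator R r * ennreal (persist r)) \<partial>lborel)
    = ennreal ((\<Prod>l\<in>active m A. cfac (n l - Max (A l)) / gapprod (A l)) * (LINT r:R|lborel. Jint_fun m n A r))"
proof -
  let ?C = "\<Prod>l\<in>active m A. cfac (n l - Max (A l)) / gapprod (A l)"
  have C: "?C \<ge> 0"     by (intro prod_nonneg divide_nonneg_nonneg cfac_nonneg less_imp_le[OF gapprod_pos] activeD)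
  let ?p = "\<lambda>r. \<Prod>l\<in>{1..m} - active m A. persist_p (n l) r" and ?q = "\<lambda>r. \<Prod>l\<in>active m A. persist_q (Min (A l)) r"
  have p: "0 \<le> ?p r" "?p r \<le> 1" for r by (auto intro!: prod_nonneg prod_le_1 simp: persist_nonneg persist_p_le_1)
  have "?q r \<le> 1" for r by (intro prod_le_1 conjI persist_nonneg persist_q_le_1 activeD)
  then have q: "0 \<le> ?q r" "?q r \<le> 1" for r by (simp_all add: prod_nonneg persist_nonneg)
  have pq: "0 \<le> ?p r * ?q r" "?p r * ?q r \<le> 1" for r using p q by (auto intro: mult_le_one)
  have J: "Jint_fun m n A r = exp (- sfac m A * r\<^sup>2 / 2) * (?p r * ?q r)" for r by (simp add: Jint_fun_def)
  have pm: "?p \<in> borel_measurable borel" by (intro borel_measurable_prod borel_measurable_persist_p)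
  have qm: "?q \<in> borel_measurable borel" by (intro borel_measurable_prod borel_measurable_persist_q activeD)
  have Jm[measurable]: "Jint_fun m n A \<in> borel_measurable borel" unfolding J[abs_def] using pm qm by measurable
  have J0: "0 \<le> Jint_fun m n A r" "Jint_fun m n A r \<le> exp (- sfac m A * r\<^sup>2 / 2)" for r
    unfolding J using pq[of r] by (auto intro: mult_left_le)
  have int: "integrable lborel (\<lambda>r. indicator R r *\<^sub>R Jint_fun m n A r)"
  proof (rule Bochner_Integration.integrable_bound[OF integrable_gaussian[OF sfac_pos[OF ne]]])
    show "(\<lambda>r. indicator R r *\<^sub>R Jint_fun m n A r) \<in> borel_measurable lborel" using R by measurable
    show "AE r in lborel. norm (indicator R r *\<^sub>R Jint_fun m n A r) \<le> norm (exp (- sfac m A * r\<^sup>2 / 2))"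
      using J0 by (auto simp: indicator_def)
  qed
  have "(\<integral>\<^sup>+r. ennreal (exp (- sfac m A * r\<^sup>2 / 2)) * (indicator R r * ennreal (persist r)) \<partial>lborel)
    = (\<integral>\<^sup>+r. ennreal ?C * ennreal (indicator R r *\<^sub>R Jint_fun m n A r) \<partial>lborel)"
  proof (rule nn_integral_cong)
    fix r :: real
    have "exp (- sfac m A * r\<^sup>2 / 2) * persist r = ?C * Jint_fun m n A r" by (simp add: persist_eq J)
    moreover have "persist r \<ge> 0" unfolding persist_eq by (rule mult_nonneg_nonneg[OF pq(1) C])
    ultimately show "ennreal (exp (- sfac m A * r\<^sup>2 / 2)) * (indicator R r * ennreal (persist r)) = ennreal ?C * ennreal (indicator R r *\<^sub>R Jint_fun m n A r)"
      using C J0(1)[of r] by (auto simp: indicator_def ennreal_mult[symmetric])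
  qed
  also have "\<dots> = ennreal ?C * (\<integral>\<^sup>+r. ennreal (indicator R r *\<^sub>R Jint_fun m n A r) \<partial>lborel)"
    by (rule nn_integral_cmult) (use R in measurable)
  also have "(\<integral>\<^sup>+r. ennreal (indicator R r *\<^sub>R Jint_fun m n A r) \<partial>lborel) = ennreal (LINT r:R|lborel. Jint_fun m n A r)"
    unfolding set_lebesgue_integral_def using J0(1) by (intro nn_integral_eq_integral[OF int]) (auto simp: indicator_def)
  also have "ennreal ?C * ennreal (LINT r:R|lborel. Jint_fun m n A r) = ennreal (?C * (LINT r:R|lborel. Jint_fun m n A r))"
    using C by (rule ennreal_mult'[symmetric])
  finally show ?thesis .
qed

lemma measurable_points: "points \<in> PiM J (\<lambda>_. gauss :: (real^'d::finite) measure) \<rightarrow>\<^sub>M gaussians J"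
  unfolding points_def[abs_def]
proof (rule measurable_restrict)
  fix \<beta> assume \<beta>: "\<beta> \<in> J"
  obtain l i where li: "\<beta> = (l, i)" by (cases \<beta>)
  have l: "l \<in> {1..m}" using \<beta> by (simp add: li J_def)
  have "(\<lambda>W. point W l i) \<in> borel_measurable (PiM J (\<lambda>_. gauss :: (real^'d) measure))"
    unfolding point_def
  proof (intro borel_measurable_sum borel_measurable_scaleR)
    fix j assume "j \<in> {j. j \<in> A l \<and> j \<le> i}"
    then have "(l, j) \<in> J" using l by (simp add: J_def)
    then show "(\<lambda>W. W (l, j)) \<in> borel_measurable (PiM J (\<lambda>_. gauss :: (real^'d) measure))" by measurable
  qed simp
  then show "(\<lambda>W. case \<beta> of (l, i) \<Rightarrow> point W l i) \<in> PiM J (\<lambda>_. gauss :: (real^'d) measure) \<rightarrow>\<^sub>M gauss"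
    by (simp add: li measurable_cong_sets[OF refl sets_gauss])
qed

text \<open>Area of the simplex times the indicators of the two sides. The set \<open>R\<close>
  carries the extra condition on the origin: \<open>UNIV\<close> for the hull of the walks alone,
  \<open>{0<..}\<close> when 0 is added as a further vertex. For the normal \<open>c\<close> and
  offset \<open>\<tau>\<close> of a configuration this function is measurable and almost surely
  equals the facet area, so it can replace the latter under the integral.\<close>

definition sides :: "real set \<Rightarrow> ((nat \<times> nat \<Rightarrow> real^'d::finite) \<Rightarrow> real^'d) \<Rightarrow> ((nat \<times> nat \<Rightarrow> real^'d) \<Rightarrow> real) \<Rightarrow> (nat \<times> nat \<Rightarrow> real^'d) \<Rightarrow> ennreal" where
  "sides R c \<tau> \<omega> = (let y = walk_points \<omega>; v = c y; t = \<tau> y; r = t / norm v in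
     ennreal (norm v / fact (CARD('d) - 1)) *
      (indicator R r * of_bool (\<forall>(l, i)\<in>walk_index m n. v \<bullet> walk \<omega> l i \<le> t) +
       indicator R (- r) * of_bool (\<forall>(l, i)\<in>walk_index m n. t \<le> v \<bullet> walk \<omega> l i)))"

text \<open>The second side is the first one for \<open>- c\<close> and \<open>- \<tau>\<close>, so
  \<open>nn_integral_one_side\<close> serves twice.\<close>

lemma
  fixes c :: "(nat \<times> nat \<Rightarrow> real^'d::finite) \<Rightarrow> real^'d"
  defines "M \<equiv> PiM (walk_index m n) (\<lambda>_. gauss :: (real^'d) measure)" and "PJ \<equiv> PiM J (\<lambda>_. gauss :: (real^'d) measure)"
  assumes c: "c \<in> borel_measurable PJ" and \<tau>: "\<tau> \<in> borel_measurable PJ" and R[measurable]: "R \<in> sets borel"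
    and c\<tau>: "\<And>y \<beta>. \<beta> \<in> J \<Longrightarrow> c y \<bullet> y \<beta> = \<tau> y"
  shows borel_measurable_sides: "sides R c \<tau> \<in> borel_measurable M" (is ?m)
    and nn_integral_sides: "(\<integral>\<^sup>+\<omega>. sides R c \<tau> \<omega> \<partial>M) = (\<integral>\<^sup>+W. (let v = c (points W); r = \<tau> (points W) / norm v in
      ennreal (norm v / fact (CARD('d) - 1)) * (indicator R r * ennreal (persist r) + indicator R (- r) * ennreal (persist (- r)))) \<partial>PJ)" (is ?i)
proof -
  define w where "w = (walk_points :: (nat \<times> nat \<Rightarrow> real^'d) \<Rightarrow> _)"
  note [measurable] = c \<tau> borel_measurable_persist
  have [measurable]: "points \<in> PJ \<rightarrow>\<^sub>M PJ" unfolding PJ_def by (rule measurable_points)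
  have wp[measurable]: "w \<in> M \<rightarrow>\<^sub>M PJ" unfolding M_def PJ_def w_def by (rule measurable_walk_points)
  define Np where "Np y = ennreal (norm (c y) / fact (CARD('d) - 1)) * indicator R (\<tau> y / norm (c y))" for y
  define Nm where "Nm y = ennreal (norm (c y) / fact (CARD('d) - 1)) * indicator R (- (\<tau> y / norm (c y)))" for y
  have Np[measurable]: "Np \<in> borel_measurable PJ" unfolding Np_def[abs_def] by measurable
  have Nm[measurable]: "Nm \<in> borel_measurable PJ" unfolding Nm_def[abs_def] by measurable
  let ?Sp = "\<lambda>\<omega>. \<forall>(l, i)\<in>walk_index m n. c (w \<omega>) \<bullet> walk \<omega> l i \<le> \<tau> (w \<omega>)"
  let ?Sm = "\<lambda>\<omega>. \<forall>(l, i)\<in>walk_index m n. - c (w \<omega>) \<bullet> walk \<omega> l i \<le> - \<tau> (w \<omega>)"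
  have cm: "(\<lambda>y. - c y) \<in> borel_measurable PJ" "(\<lambda>y. - \<tau> y) \<in> borel_measurable PJ" by measurable
  have Sp: "{\<omega> \<in> space M. ?Sp \<omega>} \<in> sets M"
    using sets_one_side[OF c[unfolded PJ_def] \<tau>[unfolded PJ_def]] by (simp add: M_def w_def)
  have Sm: "{\<omega> \<in> space M. ?Sm \<omega>} \<in> sets M"
    using sets_one_side[OF cm[unfolded PJ_def]] by (simp add: M_def w_def)
  have ind: "(\<lambda>\<omega>. of_bool (Q \<omega>) :: ennreal) \<in> borel_measurable M" if "{\<omega> \<in> space M. Q \<omega>} \<in> sets M" for Q
  proof -
    have "(indicator {\<omega> \<in> space M. Q \<omega>} :: _ \<Rightarrow> ennreal) \<in> borel_measurable M" using that by simp
    then show ?thesis by (rule measurable_cong[THEN iffD1, rotated]) (simp add: indicator_def)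
  qed
  have eq: "sides R c \<tau> \<omega> = Np (w \<omega>) * of_bool (?Sp \<omega>) + Nm (w \<omega>) * of_bool (?Sm \<omega>)" for \<omega>
    by (simp add: sides_def Let_def w_def Np_def Nm_def distrib_left mult.assoc)
  have p: "(\<lambda>\<omega>. Np (w \<omega>) * of_bool (?Sp \<omega>)) \<in> borel_measurable M"
    by (intro borel_measurable_times_ennreal ind[OF Sp] measurable_compose[OF wp Np])
  have m: "(\<lambda>\<omega>. Nm (w \<omega>) * of_bool (?Sm \<omega>)) \<in> borel_measurable M"
    by (intro borel_measurable_times_ennreal ind[OF Sm] measurable_compose[OF wp Nm])
  show ?m unfolding eq[abs_def] by (rule borel_measurable_add[OF p m])
  have "(\<integral>\<^sup>+\<omega>. sides R c \<tau> \<omega> \<partial>M) = (\<integral>\<^sup>+\<omega>. Np (w \<omega>) * of_bool (?Sp \<omega>) \<partial>M) + (\<integral>\<^sup>+\<omega>. Nm (w \<omega>) * of_bool (?Sm \<omega>) \<partial>M)"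
    unfolding eq by (rule nn_integral_add[OF p m])
  also have "(\<integral>\<^sup>+\<omega>. Np (w \<omega>) * of_bool (?Sp \<omega>) \<partial>M) = (\<integral>\<^sup>+W. Np (points W) * ennreal (persist (\<tau> (points W) / norm (c (points W)))) \<partial>PJ)"
    unfolding M_def PJ_def w_def
    by (rule nn_integral_one_side[OF Np[unfolded PJ_def] c[unfolded PJ_def] \<tau>[unfolded PJ_def] _ c\<tau>]) (simp add: Np_def)
  also have "(\<integral>\<^sup>+\<omega>. Nm (w \<omega>) * of_bool (?Sm \<omega>) \<partial>M) = (\<integral>\<^sup>+W. Nm (points W) * ennreal (persist (- \<tau> (points W) / norm (- c (points W)))) \<partial>PJ)"
    unfolding M_def PJ_def w_def
    by (rule nn_integral_one_side[OF Nm[unfolded PJ_def] cm[unfolded PJ_def]]) (simp_all add: Nm_def c\<tau>)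
  also have "(\<integral>\<^sup>+W. Np (points W) * ennreal (persist (\<tau> (points W) / norm (c (points W)))) \<partial>PJ) +
      (\<integral>\<^sup>+W. Nm (points W) * ennreal (persist (- \<tau> (points W) / norm (- c (points W)))) \<partial>PJ)
    = (\<integral>\<^sup>+W. Np (points W) * ennreal (persist (\<tau> (points W) / norm (c (points W)))) +
        Nm (points W) * ennreal (persist (- \<tau> (points W) / norm (- c (points W)))) \<partial>PJ)"
    by (rule nn_integral_add[symmetric]) measurable
  finally show ?i by (simp add: Np_def Nm_def Let_def distrib_left mult.assoc)
qed

end

section \<open>The expectation for a single configuration\<close>

lemma gcoef_nonneg: "k \<ge> 1 \<Longrightarrow> gcoef k \<ge> 0"
  by (simp add: gcoef_def Gamma_real_pos less_imp_le)

context config begin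

lemma active_nonempty: "J \<noteq> {} \<Longrightarrow> active m A \<noteq> {}"
  by (auto simp: J_def active_def)

lemma nn_integral_PiM_J:
  fixes f :: "'k \<Rightarrow> nat \<times> nat"
  assumes f: "bij_betw f K J" and \<Psi>: "\<Psi> \<in> borel_measurable (PiM J (\<lambda>_. gauss :: 'b::euclidean_space measure))"
  shows "(\<integral>\<^sup>+W. \<Psi> W \<partial>PiM J (\<lambda>_. gauss :: 'b measure)) = (\<integral>\<^sup>+g. \<Psi> (\<lambda>q\<in>J. g (the_inv_into K f q)) \<partial>gaussians K)"
    "(\<lambda>g. \<lambda>q\<in>J. g (the_inv_into K f q)) \<in> PiM K (\<lambda>_. gauss :: 'b measure) \<rightarrow>\<^sub>M gaussians J"
proof -
  have b: "inj_on (the_inv_into K f) J" "the_inv_into K f ` J \<subseteq> K"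
    using bij_betw_the_inv_into[OF f] by (auto simp: bij_betw_def)
  show m: "(\<lambda>g. \<lambda>q\<in>J. g (the_inv_into K f q)) \<in> PiM K (\<lambda>_. gauss :: 'b measure) \<rightarrow>\<^sub>M gaussians J"
    by (rule measurable_reindex[OF b(2)])
  show "(\<integral>\<^sup>+W. \<Psi> W \<partial>PiM J (\<lambda>_. gauss :: 'b measure)) = (\<integral>\<^sup>+g. \<Psi> (\<lambda>q\<in>J. g (the_inv_into K f q)) \<partial>gaussians K)"
    by (subst PiM_gauss_reindex[OF b, symmetric], rule nn_integral_distr[OF m]) (use \<Psi> in \<open>simp only: measurable_distr_eq1\<close>)
qed

lemma borel_measurable_component:
  "q \<in> X \<Longrightarrow> (\<lambda>y. y q) \<in> borel_measurable (PiM X (\<lambda>_. gauss :: 'b::euclidean_space measure))"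
  by measurable

text \<open>\<open>f\<close> enumerates the configuration indices by \<open>'d\<close>, and
  \<open>nn_integral_hyperplane\<close> is applied to the Gaussian vectors with
  \<open>a = scale\<close> and \<open>b k\<close> the unit level of a block divided by the root of
  its gap. The sum of squares of \<open>b\<close> is then \<open>sfac\<close>, and (d - 1)!
  cancels.\<close>

lemma nn_integral_facet_sides:
  fixes f :: "'d::finite \<Rightarrow> nat \<times> nat" and k0 :: 'd and R :: "real set"
  defines "c \<equiv> \<lambda>y. crossp k0 (\<lambda>k. y (f k) - y (f k0) :: real^'d)" and "\<tau> \<equiv> \<lambda>y. det (\<chi> k. (y (f k) :: real^'d))"
    and "M \<equiv> PiM (walk_index m n) (\<lambda>_. gauss :: (real^'d) measure)"
  assumes d2: "CARD('d) \<ge> 2" and f: "bij_betw f UNIV J" and R[measurable]: "R \<in> sets borel"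
  shows "sides R c \<tau> \<in> borel_measurable M" "(\<integral>\<^sup>+\<omega>. sides R c \<tau> \<omega> \<partial>M) = ennreal (summand_facet CARD('d) m n R A)"
proof -
  let ?PJ = "PiM J (\<lambda>_. gauss :: (real^'d) measure)"
  let ?PU = "PiM UNIV (\<lambda>_. gauss :: (real^'d) measure) :: ('d \<Rightarrow> real^'d) measure"
  let ?d = "CARD('d)"
  have fJ: "f k \<in> J" for k using f by (auto simp: bij_betw_def)
  have fs: "f ` UNIV = J" "inj f" using f by (auto simp: bij_betw_def)
  have cm[measurable]: "c \<in> borel_measurable ?PJ"
    unfolding c_def by (intro borel_measurable_crossp borel_measurable_diff borel_measurable_component fJ)
  have \<tau>m[measurable]: "\<tau> \<in> borel_measurable ?PJ"
    unfolding \<tau>_def by (intro borel_measurable_det borel_measurable_component fJ)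
  note [measurable] = borel_measurable_persist measurable_points
  have c\<tau>: "c y \<bullet> y q = \<tau> y" if q: "q \<in> J" for y q
  proof -
    obtain k where "q = f k" using q fs(1) by auto
    then show ?thesis unfolding c_def \<tau>_def using inner_crossp_differences[of k0 "\<lambda>k. y (f k)" k] by simp
  qed
  define h where "h r = indicator R r * ennreal (persist r)" for r
  have hm[measurable]: "h \<in> borel_measurable borel" unfolding h_def[abs_def] by measurable
  define \<Psi> where "\<Psi> W = ennreal (norm (c (points W)) / fact (?d - 1)) *
      (h (\<tau> (points W) / norm (c (points W))) + h (- (\<tau> (points W) / norm (c (points W)))))" for W
  have \<Psi>m: "\<Psi> \<in> borel_measurable ?PJ" unfolding \<Psi>_def[abs_def] by measurable
  define L where "L g = (\<lambda>q\<in>J. g (the_inv_into UNIV f q))" for g :: "'d \<Rightarrow> real^'d"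
  have Lm[measurable]: "L \<in> ?PU \<rightarrow>\<^sub>M ?PJ" unfolding L_def[abs_def] by (rule nn_integral_PiM_J(2)[OF f \<Psi>m])
  have Lf: "L g (f k) = g k" for g k using fJ fs by (simp add: L_def the_inv_into_f_f)
  define c' where "c' g = c (points (L g))" for g
  define \<tau>' where "\<tau>' g = \<tau> (points (L g))" for g
  have c'm: "c' \<in> borel_measurable ?PU" and \<tau>'m: "\<tau>' \<in> borel_measurable ?PU"
    unfolding c'_def[abs_def] \<tau>'_def[abs_def] by measurable
  define b where "b k = level 1 (f k) / sqrt (real (gap (f k)))" for k
  \<comment> \<open>All configuration points have the same height, so a Gaussian vector is
    orthogonal to the normal unless its block starts at the origin.\<close>
  have cg: "c' g \<bullet> g k = \<tau>' g * b k" for g k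
  proof -
    obtain l i where li: "f k = (l, i)" by (cases "f k")
    then have J: "(l, i) \<in> J" and l: "l \<in> {1..m}" using fJ[of k] by (auto simp: J_def)
    have cp: "c' g \<bullet> point (L g) l j = \<tau>' g" if "(l, j) \<in> J" for l j
      using c\<tau>[OF that, of "points (L g)"] that by (simp add: c'_def \<tau>'_def points_def)
    have "c' g \<bullet> point (L g) l (prev l i) + level (\<tau>' g) (l, i) = \<tau>' g"
      by (rule point_level(1)[OF l]) (rule cp)
    then have "sqrt (real (gap (l, i))) * (c' g \<bullet> g k) = level (\<tau>' g) (l, i)"
      using cp[OF J] Lf[of g k] by (simp add: point_prev[OF J] inner_add_right li)
    then have "c' g \<bullet> g k = level (\<tau>' g) (l, i) / sqrt (real (gap (l, i)))"
      using gap_pos[OF J] by (simp add: field_simps)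
    then show ?thesis by (simp add: b_def li level_def)
  qed
  have \<tau>a: "\<bar>\<tau>' g\<bar> = scale * \<bar>det (\<chi> k. g k)\<bar>" for g
    using det_points[OF fs(2,1), of undefined "L g" 0] scale_pos Lf by (simp add: \<tau>'_def \<tau>_def abs_mult)
  have bs: "sfac m A = (\<Sum>k\<in>UNIV. (b k)\<^sup>2)"
    unfolding sum_slope[symmetric] b_def by (rule sum.reindex_bij_betw[OF f, symmetric])
  have ne: "active m A \<noteq> {}" using active_nonempty fJ by blast
  show "sides R c \<tau> \<in> borel_measurable M" unfolding M_def by (rule borel_measurable_sides[OF cm \<tau>m R c\<tau>])
  have "(\<integral>\<^sup>+\<omega>. sides R c \<tau> \<omega> \<partial>M) = (\<integral>\<^sup>+W. \<Psi> W \<partial>?PJ)"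
    unfolding \<Psi>_def h_def M_def by (rule nn_integral_sides[OF cm \<tau>m R, unfolded Let_def]) (rule c\<tau>)
  also have "\<dots> = (\<integral>\<^sup>+g. \<Psi> (L g) \<partial>?PU)"
    unfolding L_def by (rule nn_integral_PiM_J(1)[OF f \<Psi>m])
  also have "\<dots> = (\<integral>\<^sup>+g. ennreal (1 / fact (?d - 1)) * (ennreal (norm (c' g)) * (h (\<tau>' g / norm (c' g)) + h (- (\<tau>' g / norm (c' g))))) \<partial>?PU)"
  proof (rule nn_integral_cong)
    fix g
    have "ennreal (norm (c' g) / fact (?d - 1)) = ennreal (1 / fact (?d - 1)) * ennreal (norm (c' g))"
      by (simp flip: ennreal_mult')
    then show "\<Psi> (L g) = ennreal (1 / fact (?d - 1)) * (ennreal (norm (c' g)) * (h (\<tau>' g / norm (c' g)) + h (- (\<tau>' g / norm (c' g)))))"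
      by (simp only: \<Psi>_def c'_def[symmetric] \<tau>'_def[symmetric] mult.assoc)
  qed
  also have "\<dots> = ennreal (1 / fact (?d - 1)) * (\<integral>\<^sup>+g. ennreal (norm (c' g)) * (h (\<tau>' g / norm (c' g)) + h (- (\<tau>' g / norm (c' g)))) \<partial>?PU)"
    by (rule nn_integral_cmult) (use c'm \<tau>'m in measurable)
  also have "(\<integral>\<^sup>+g. ennreal (norm (c' g)) * (h (\<tau>' g / norm (c' g)) + h (- (\<tau>' g / norm (c' g)))) \<partial>?PU)
    = ennreal (scale * sfac m A * fact (?d - 1) * gcoef ?d) * (\<integral>\<^sup>+r. ennreal (exp (- sfac m A * r\<^sup>2 / 2)) * h r \<partial>lborel)"
    by (rule nn_integral_hyperplane[OF d2 c'm \<tau>'m cg \<tau>a scale_pos _ bs sfac_pos[OF ne] hm]) (auto simp: b_def level_def split: prod.split)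
  also have "(\<integral>\<^sup>+r. ennreal (exp (- sfac m A * r\<^sup>2 / 2)) * h r \<partial>lborel)
    = ennreal ((\<Prod>l\<in>active m A. cfac (n l - Max (A l)) / gapprod (A l)) * (LINT r:R|lborel. Jint_fun m n A r))"
    unfolding h_def by (rule nn_integral_persist[OF ne R])
  also have "ennreal (1 / fact (?d - 1)) * (ennreal (scale * sfac m A * fact (?d - 1) * gcoef ?d) *
      ennreal ((\<Prod>l\<in>active m A. cfac (n l - Max (A l)) / gapprod (A l)) * (LINT r:R|lborel. Jint_fun m n A r)))
    = ennreal (summand_facet ?d m n R A)"
  proof -
    have "scale * sfac m A * fact (?d - 1) * gcoef ?d \<ge> 0"
      using scale_pos sfac_pos[OF ne] gcoef_nonneg[of ?d] d2 by simp
    then have "ennreal (1 / fact (?d - 1)) * (ennreal (scale * sfac m A * fact (?d - 1) * gcoef ?d) *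
        ennreal ((\<Prod>l\<in>active m A. cfac (n l - Max (A l)) / gapprod (A l)) * (LINT r:R|lborel. Jint_fun m n A r)))
      = ennreal (1 / fact (?d - 1) * (scale * sfac m A * fact (?d - 1) * gcoef ?d *
        ((\<Prod>l\<in>active m A. cfac (n l - Max (A l)) / gapprod (A l)) * (LINT r:R|lborel. Jint_fun m n A r))))"
      by (simp only: ennreal_mult' zero_le_divide_1_iff fact_ge_zero)
    also have "1 / fact (?d - 1) * (scale * sfac m A * fact (?d - 1) * gcoef ?d *
        ((\<Prod>l\<in>active m A. cfac (n l - Max (A l)) / gapprod (A l)) * (LINT r:R|lborel. Jint_fun m n A r)))
      = sfac m A * gcoef ?d * (scale * (\<Prod>l\<in>active m A. cfac (n l - Max (A l)) / gapprod (A l))) * (LINT r:R|lborel. Jint_fun m n A r)"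
      by simp
    \<comment> \<open>Each gap after the first keeps the power -1/2: \<open>scale\<close> brings its
      square root, the bridge at level 0 its inverse.\<close>
    also have "scale * (\<Prod>l\<in>active m A. cfac (n l - Max (A l)) / gapprod (A l))
      = (\<Prod>l\<in>active m A. sqrt (real (Min (A l))) / sqrt (gapprod (A l)) * cfac (n l - Max (A l)))"
      unfolding scale_eq prod.distrib[symmetric]
    proof (rule prod.cong[OF refl])
      fix l assume l: "l \<in> active m A"
      have g: "gapprod (A l) > 0" using gapprod_pos activeD[OF l] by blast
      have "sqrt (gapprod (A l)) / gapprod (A l) = 1 / sqrt (gapprod (A l))"
        using g real_sqrt_mult_self[of "gapprod (A l)"] by (simp add: field_simps)
      then show "sqrt (real (Min (A l))) * sqrt (gapprod (A l)) * (cfac (n l - Max (A l)) / gapprod (A l))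
        = sqrt (real (Min (A l))) / sqrt (gapprod (A l)) * cfac (n l - Max (A l))"
        by (metis (no_types, opaque_lifting) mult.assoc mult.commute mult_1 times_divide_eq_left times_divide_eq_right)
    qed
    finally show ?thesis by (simp add: summand_facet_def)
  qed
  finally show "(\<integral>\<^sup>+\<omega>. sides R c \<tau> \<omega> \<partial>M) = ennreal (summand_facet ?d m n R A)" .
qed

text \<open>Both sides are compared through their inner products with an arbitrary vector x, which
  are determinants with x as row \<open>k0\<close>, so that \<open>det_points\<close>
  applies.\<close>

lemma crossp_points:
  fixes f :: "'d::finite \<Rightarrow> nat \<times> nat" and W :: "nat \<times> nat \<Rightarrow> real^'d"
  assumes f: "bij_betw f (UNIV - {k0}) J"
  shows "crossp k0 (\<lambda>k. points W (f k)) = scale *\<^sub>R crossp k0 (\<lambda>k. W (f k))"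
proof -
  have fs: "inj_on f (UNIV - {k0})" "f ` (UNIV - {k0}) = J" using f by (auto simp: bij_betw_def)
  have e: "(if k \<in> UNIV - {k0} then a else x) = (if k = k0 then x else a)" for k and a x :: "real^'d" by auto
  have "crossp k0 (\<lambda>k. points W (f k)) \<bullet> x = (scale *\<^sub>R crossp k0 (\<lambda>k. W (f k))) \<bullet> x" for x
    unfolding inner_scaleR_left inner_crossp using det_points[OF fs disjI2[OF refl], of W x] unfolding e .
  then show ?thesis by (rule iffD1[OF vector_eq_rdot, OF allI])
qed

text \<open>The offset is 0, so both sides have the constant conditional probability
  \<open>persist 0\<close>; there remains the mean length of the cross product of d - 1 Gaussian
  vectors. The constant \<open>sqrt (2 * pi)\<close> is \<open>2 * sqrt (pi / 2)\<close>, the 2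
  counting the sides.\<close>

lemma nn_integral_zero_facet_sides:
  fixes f :: "'d::finite \<Rightarrow> nat \<times> nat" and k0 :: 'd
  defines "c \<equiv> \<lambda>y. crossp k0 (\<lambda>k. y (f k) :: real^'d)" and "M \<equiv> PiM (walk_index m n) (\<lambda>_. gauss :: (real^'d) measure)"
  assumes d2: "CARD('d) \<ge> 2" and f: "bij_betw f (UNIV - {k0}) J"
  shows "sides UNIV c (\<lambda>_. 0) \<in> borel_measurable M" "(\<integral>\<^sup>+\<omega>. sides UNIV c (\<lambda>_. 0) \<omega> \<partial>M) = ennreal (summand_zero CARD('d) m n A)"
proof -
  let ?PJ = "PiM J (\<lambda>_. gauss :: (real^'d) measure)"
  let ?PK = "PiM (UNIV - {k0}) (\<lambda>_. gauss :: (real^'d) measure)"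
  let ?d = "CARD('d)"
  have fs: "inj_on f (UNIV - {k0})" "f ` (UNIV - {k0}) = J" using f by (auto simp: bij_betw_def)
  then have fJ: "f k \<in> J" if "k \<noteq> k0" for k using that by blast
  have cm[measurable]: "c \<in> borel_measurable ?PJ"
    unfolding c_def by (intro borel_measurable_crossp borel_measurable_component fJ)
  note [measurable] = measurable_points
  have c0: "c y \<bullet> y q = 0" if q: "q \<in> J" for y q
  proof -
    obtain k where "k \<in> UNIV - {k0}" "q = f k" using q fs(2) by auto
    then show ?thesis unfolding c_def using inner_crossp_row[of k k0 "\<lambda>k. y (f k)"] by simp
  qed
  have p0: "persist 0 \<ge> 0"
    unfolding persist_def by (intro mult_nonneg_nonneg prod_nonneg ballI persist_nonneg)
  define \<Psi> where "\<Psi> W = ennreal (norm (c (points W)) / fact (?d - 1)) * (ennreal (persist 0) + ennreal (persist 0))" for W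
  have \<Psi>m: "\<Psi> \<in> borel_measurable ?PJ" unfolding \<Psi>_def[abs_def] by measurable
  define L where "L g = (\<lambda>q\<in>J. g (the_inv_into (UNIV - {k0}) f q))" for g :: "'d \<Rightarrow> real^'d"
  have Lf: "L g (f k) = g k" if "k \<noteq> k0" for g k using fJ[OF that] that the_inv_into_f_f[OF fs(1), of k] by (simp add: L_def)
  note sides = cm borel_measurable_const[of 0] sets.top[of borel, unfolded space_borel]
  show "sides UNIV c (\<lambda>_. 0) \<in> borel_measurable M" unfolding M_def by (rule borel_measurable_sides[OF sides]) (rule c0)
  have "(\<integral>\<^sup>+\<omega>. sides UNIV c (\<lambda>_. 0) \<omega> \<partial>M) = (\<integral>\<^sup>+W. \<Psi> W \<partial>?PJ)"
    using nn_integral_sides[OF sides, unfolded Let_def] c0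
    unfolding \<Psi>_def M_def by (simp only: indicator_simps(1)[OF UNIV_I] mult_1_left div_0 minus_zero)
  also have "\<dots> = (\<integral>\<^sup>+g. \<Psi> (L g) \<partial>?PK)"
    unfolding L_def by (rule nn_integral_PiM_J(1)[OF f \<Psi>m])
  also have "\<dots> = (\<integral>\<^sup>+g. ennreal (scale * (2 * persist 0) / fact (?d - 1)) * ennreal (norm (crossp k0 g)) \<partial>?PK)"
  proof (rule nn_integral_cong)
    fix g :: "'d \<Rightarrow> real^'d"
    have "c (points (L g)) = scale *\<^sub>R crossp k0 g"
      unfolding c_def crossp_points[OF f] using Lf by (intro arg_cong[where f="(*\<^sub>R) scale"] crossp_cong) simp
    then have "norm (c (points (L g))) = scale * norm (crossp k0 g)" using scale_pos by simp
    then show "\<Psi> (L g) = ennreal (scale * (2 * persist 0) / fact (?d - 1)) * ennreal (norm (crossp k0 g))"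
      unfolding \<Psi>_def ennreal_plus[OF p0 p0, symmetric] using p0 scale_pos by (simp add: ennreal_mult''[symmetric] mult_ac)
  qed
  also have "\<dots> = ennreal (scale * (2 * persist 0) / fact (?d - 1)) * (\<integral>\<^sup>+g. ennreal (norm (crossp k0 g)) \<partial>?PK)"
  proof (rule nn_integral_cmult)
    have "(\<lambda>g. crossp k0 g) \<in> borel_measurable ?PK"
      by (intro borel_measurable_crossp borel_measurable_component) simp
    then show "(\<lambda>g. ennreal (norm (crossp k0 g))) \<in> borel_measurable ?PK" by measurable
  qed
  also have "(\<integral>\<^sup>+g. ennreal (norm (crossp k0 g)) \<partial>?PK) = ennreal (fact (?d - 1) * sqrt (pi / 2) * gcoef ?d)"
    by (rule nn_integral_norm_crossp[OF d2])
  also have "ennreal (scale * (2 * persist 0) / fact (?d - 1)) * ennreal (fact (?d - 1) * sqrt (pi / 2) * gcoef ?d) = ennreal (summand_zero ?d m n A)"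
  proof -
    have "scale * (2 * persist 0) / fact (?d - 1) \<ge> 0" using scale_pos p0 by simp
    then have "ennreal (scale * (2 * persist 0) / fact (?d - 1)) * ennreal (fact (?d - 1) * sqrt (pi / 2) * gcoef ?d)
      = ennreal (scale * (2 * persist 0) / fact (?d - 1) * (fact (?d - 1) * sqrt (pi / 2) * gcoef ?d))"
      by (rule ennreal_mult'[symmetric])
    also have "scale * (2 * persist 0) / fact (?d - 1) * (fact (?d - 1) * sqrt (pi / 2) * gcoef ?d) = (2 * sqrt (pi / 2)) * gcoef ?d * (scale * persist 0)"
      by simp
    also have "2 * sqrt (pi / 2) = sqrt (2 * pi)"
    proof -
      have "2 * sqrt (pi / 2) = sqrt (2\<^sup>2) * sqrt (pi / 2)" by simp
      also have "\<dots> = sqrt (2 * pi)" by (simp only: real_sqrt_mult[symmetric]) simp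
      finally show ?thesis .
    qed
    also have "scale * persist 0 = (\<Prod>l=1..m. elfac n A l)"
    proof -
      have "(\<Prod>l=1..m. elfac n A l) = (\<Prod>l=1..m. if l \<in> active m A then cfac (n l - Max (A l)) / sqrt (real (Min (A l)) * gapprod (A l)) else cfac (n l))"
        by (rule prod.cong) (auto simp: elfac_def active_def)
      also have "\<dots> = (\<Prod>l\<in>active m A. cfac (n l - Max (A l)) / sqrt (real (Min (A l)) * gapprod (A l))) * (\<Prod>l\<in>{1..m} - active m A. cfac (n l))"
        by (rule prod_active)
      also have "(\<Prod>l\<in>active m A. cfac (n l - Max (A l)) / sqrt (real (Min (A l)) * gapprod (A l)))
        = scale * (\<Prod>l\<in>active m A. persist_q (Min (A l)) 0) * (\<Prod>l\<in>active m A. cfac (n l - Max (A l)) / gapprod (A l))"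
        unfolding scale_eq prod.distrib[symmetric]
      proof (rule prod.cong[OF refl])
        fix l assume l: "l \<in> active m A"
        have g: "gapprod (A l) > 0" using gapprod_pos activeD[OF l] by blast
        have mn: "real (Min (A l)) > 0" using activeD(5)[OF l] by linarith
        have "sqrt x / x = 1 / sqrt x" if "x > 0" for x using that real_sqrt_mult_self[of x] by (simp add: field_simps)
        from this[OF g] this[OF mn]
        have "cfac (n l - Max (A l)) / (sqrt (real (Min (A l))) * sqrt (gapprod (A l)))
          = (sqrt (real (Min (A l))) / real (Min (A l))) * (sqrt (gapprod (A l)) / gapprod (A l)) * cfac (n l - Max (A l))" by simp
        then show "cfac (n l - Max (A l)) / sqrt (real (Min (A l)) * gapprod (A l))
          = sqrt (real (Min (A l))) * sqrt (gapprod (A l)) * persist_q (Min (A l)) 0 * (cfac (n l - Max (A l)) / gapprod (A l))"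
          using persist_q_0[OF activeD(5)[OF l]] by (simp add: real_sqrt_mult)
      qed
      finally show ?thesis by (simp add: persist_eq persist_p_0)
    qed
    finally show ?thesis by (simp add: summand_zero_def)
  qed
  finally show "(\<integral>\<^sup>+\<omega>. sides UNIV c (\<lambda>_. 0) \<omega> \<partial>M) = ennreal (summand_zero ?d m n A)" .
qed

end

subsection \<open>General position of random walks\<close>

text \<open>The index (0, 0) stands for the origin, since \<open>walk \<omega> 0 0 = 0\<close>.\<close>
definition walk_index0 :: "nat \<Rightarrow> (nat \<Rightarrow> nat) \<Rightarrow> (nat \<times> nat) set" where
  "walk_index0 m n = insert (0, 0) (walk_index m n)"

lemma finite_walk_index0: "finite (walk_index0 m n)"
  by (simp add: walk_index0_def finite_walk_index)

lemma walk_eq_sum: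
  assumes "(l, i) \<in> walk_index0 m n"
  shows "walk \<omega> l i = (\<Sum>p\<in>walk_index m n. of_bool (fst p = l \<and> snd p \<le> i) *\<^sub>R \<omega> p)"
proof -
  have "(\<Sum>p\<in>walk_index m n. of_bool (fst p = l \<and> snd p \<le> i) *\<^sub>R \<omega> p) = (\<Sum>p\<in>Pair l ` {1..i}. \<omega> p)"
    by (rule sum.mono_neutral_cong_right[OF finite_walk_index])
       (use assms in \<open>auto simp: walk_index0_def walk_index_def\<close>)
  also have "\<dots> = walk \<omega> l i" by (simp add: walk_def sum.reindex inj_on_def)
  finally show ?thesis ..
qed

text \<open>Each row is a signed sum of steps, and \<open>AE_det_nonzero\<close> needs a private
  step for every row. A point beyond \<open>b\<close> on its walk, or on another walk, has its own
  last step. A point before \<open>b\<close> on the walk of \<open>b\<close>, or the origin, has the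
  next step towards \<open>b\<close>, which enters with the sign of \<open>b\<close>.\<close>

lemma AE_walk_differences_det:
  fixes \<psi> :: "'d::finite \<Rightarrow> nat \<times> nat"
  assumes \<psi>: "inj \<psi>" "range \<psi> \<subseteq> walk_index0 m n" and b: "b \<in> walk_index0 m n - range \<psi>"
  shows "AE \<omega> in PiM (walk_index m n) (\<lambda>_. gauss :: (real^'d) measure).
    det (\<chi> k. case_prod (walk \<omega>) (\<psi> k) - case_prod (walk \<omega>) b) \<noteq> 0"
proof -
  let ?I = "walk_index m n"
  obtain lb ib where b_eq: "b = (lb, ib)" by (cases b)
  define L where "L k = fst (\<psi> k)" for k
  define P where "P k = snd (\<psi> k)" for k
  have \<psi>_eq: "\<psi> k = (L k, P k)" for k by (simp add: L_def P_def)
  have mem: "(L k, P k) \<in> walk_index0 m n" for k using \<psi>(2) by (auto simp flip: \<psi>_eq)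
  have bmem: "(lb, ib) \<in> walk_index0 m n" using b by (simp add: b_eq)
  have zero: "L k = 0" if "P k = 0" for k using mem[of k] that by (auto simp: walk_index0_def walk_index_def)
  have pos: "(L k, P k) \<in> ?I" if "P k > 0" for k using mem[of k] that by (auto simp: walk_index0_def)
  have ne_b: "(L k, P k) \<noteq> (lb, ib)" for k
  proof -
    have "\<psi> k \<noteq> b" using b by auto
    then show ?thesis by (simp add: \<psi>_eq b_eq)
  qed
  have \<psi>_inj: "k = k'" if "L k = L k'" "P k = P k'" for k k' using injD[OF \<psi>(1), of k k'] that by (simp add: \<psi>_eq)
  define \<alpha> :: "'d \<Rightarrow> nat \<times> nat \<Rightarrow> real" where
    "\<alpha> k p = of_bool (fst p = L k \<and> snd p \<le> P k) - of_bool (fst p = lb \<and> snd p \<le> ib)" for k p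
  \<comment> \<open>The path to the point is an initial piece of the path to \<open>b\<close>; the
    origin counts as such for every walk.\<close>
  define low where "low k \<longleftrightarrow> P k = 0 \<or> L k = lb \<and> P k < ib" for k
  define priv where "priv k = (if low k then (lb, P k + 1) else (L k, P k))" for k
  define B where "B = Suc ib"
  \<comment> \<open>Low points come first, those nearest to \<open>b\<close> before the farther
    ones; then the others, ordered by time and walk. A private step is then absent from all rows of
    smaller rank.\<close>
  define rank where "rank k = (if low k then ib - P k else B + (P k * Suc m + L k))" for k
  have ib_pos: "ib > 0" if "low k" for k
  proof (rule ccontr)
    assume "\<not> ib > 0"
    then have "P k = 0" "ib = 0" using that by (auto simp: low_def)
    moreover have "lb = 0" using bmem \<open>ib = 0\<close> by (auto simp: walk_index0_def walk_index_def)
    ultimately show False using ne_b[of k] zero[of k] by simp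
  qed
  have lowP: "P k < ib" if "low k" for k using that ib_pos[OF that] by (auto simp: low_def)
  have Lm: "L k \<le> m" for k using mem[of k] by (auto simp: walk_index0_def walk_index_def)
  have low_inj: "k = k'" if "low k" "low k'" "P k = P k'" for k k'
    using that zero[of k] zero[of k'] \<psi>_inj[of k k'] by (cases "P k = 0") (auto simp: low_def)
  have cmp: "P k' < P k \<or> P k' = P k \<and> L k' < L k" if "P k' * Suc m + L k' < P k * Suc m + L k" for k k'
  proof (rule ccontr)
    assume "\<not> ?thesis"
    then consider "P k < P k'" | "P k' = P k" "L k \<le> L k'" by linarith
    then show False
    proof cases
      case 1
      then have "Suc (P k) * Suc m \<le> P k' * Suc m" by (intro mult_le_mono1) simp
      then show False using that Lm[of k] by simp
    qed (use that in simp)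
  qed
  have rank_inj: "inj rank"
  proof (rule injI)
    fix k k' assume eq: "rank k = rank k'"
    consider "low k" "low k'" | "\<not> low k" "\<not> low k'" | "low k \<noteq> low k'" by blast
    then show "k = k'"
    proof cases
      case 1
      then have "P k = P k'" using eq lowP[of k] lowP[of k'] by (simp add: rank_def)
      then show ?thesis using low_inj 1 by blast
    next
      case 2
      then have e: "P k * Suc m + L k = P k' * Suc m + L k'" using eq by (simp add: rank_def)
      have "(P k * Suc m + L k) mod Suc m = L k" "(P k' * Suc m + L k') mod Suc m = L k'"
        using Lm[of k] Lm[of k'] by (simp_all only: mod_mult_self3 mod_less less_Suc_eq_le)
      then have "L k = L k'" using e by simp
      moreover from this have "P k * Suc m = P k' * Suc m" using e by linarith
      then have "P k = P k'" by (metis mult_cancel2 nat.distinct(1))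
      ultimately show ?thesis by (rule \<psi>_inj)
    next
      case 3
      then show ?thesis using eq by (cases "low k") (simp_all add: rank_def B_def)
    qed
  qed
  have "AE \<omega> in PiM ?I (\<lambda>_. gauss :: (real^'d) measure). det (\<chi> k. \<Sum>p\<in>?I. \<alpha> k p *\<^sub>R \<omega> p) \<noteq> 0"
  proof (rule AE_det_nonzero[OF rank_inj])
    show "finite ?I" by (rule finite_walk_index)
    show "priv k \<in> ?I" for k
    proof (cases "low k")
      case True
      then show ?thesis using bmem lowP[OF True] by (auto simp: priv_def walk_index0_def walk_index_def)
    next
      case False
      then show ?thesis using pos[of k] by (auto simp: priv_def low_def)
    qed
    show "\<alpha> k (priv k) \<noteq> 0" for k
    proof (cases "low k")
      case True
      then show ?thesis using lowP[OF True] by (auto simp: priv_def \<alpha>_def)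
    next
      case False
      then show ?thesis using ne_b[of k] by (auto simp: priv_def \<alpha>_def low_def)
    qed
    show "\<alpha> k' (priv k) = 0" if "rank k' < rank k" for k k'
    proof (cases "low k")
      case True
      then have "low k'" "P k < P k'" using that lowP[OF True] lowP[of k'] by (auto simp: rank_def B_def split: if_splits)
      then have "\<not> (lb = L k' \<and> P k + 1 \<le> P k') \<or> P k' > P k" "L k' = lb"
        using lowP[OF True] by (auto simp: low_def)
      then show ?thesis using \<open>P k < P k'\<close> lowP[OF True] by (auto simp: \<alpha>_def priv_def True)
    next
      case False
      show ?thesis
      proof (cases "low k'")
        case low': True
        have "\<not> (L k = L k' \<and> P k \<le> P k') \<and> \<not> (L k = lb \<and> P k \<le> ib)" 
          using False low' ne_b[of k] lowP[OF low'] zero[of k'] by (auto simp: low_def)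
        then show ?thesis using False by (auto simp: \<alpha>_def priv_def)
      next
        case False': False
        then have "P k' < P k \<or> P k' = P k \<and> L k' < L k" using that False by (intro cmp) (simp add: rank_def)
        moreover have "\<not> (L k = lb \<and> P k \<le> ib)" using False ne_b[of k] by (auto simp: low_def)
        ultimately show ?thesis using False by (auto simp: \<alpha>_def priv_def)
      qed
    qed
  qed
  moreover have "(\<Sum>p\<in>?I. \<alpha> k p *\<^sub>R \<omega> p) = case_prod (walk \<omega>) (\<psi> k) - case_prod (walk \<omega>) b" for k and \<omega> :: "nat \<times> nat \<Rightarrow> real^'d"
    unfolding \<psi>_eq b_eq case_prod_conv walk_eq_sum[OF mem] walk_eq_sum[OF bmem]
    by (simp add: \<alpha>_def scaleR_diff_left sum_subtractf)
  ultimately show ?thesis by simp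
qed

text \<open>A single almost sure event that yields all general position statements below. Since the
  origin is among the indices, hyperplanes through 0 and those avoiding it are covered
  alike.\<close>

definition generic :: "nat \<Rightarrow> (nat \<Rightarrow> nat) \<Rightarrow> (nat \<times> nat \<Rightarrow> real^'d::finite) \<Rightarrow> bool" where
  "generic m n \<omega> \<longleftrightarrow> (\<forall>\<psi> :: 'd \<Rightarrow> nat \<times> nat. \<forall>b. inj \<psi> \<and> range \<psi> \<subseteq> walk_index0 m n \<and> b \<in> walk_index0 m n - range \<psi> \<longrightarrow>
     det (\<chi> k. case_prod (walk \<omega>) (\<psi> k) - case_prod (walk \<omega>) b) \<noteq> 0)"

lemma AE_generic: "AE \<omega> in PiM (walk_index m n) (\<lambda>_. gauss :: (real^'d::finite) measure). generic m n \<omega>"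
proof -
  let ?X = "(PiE UNIV (\<lambda>_. walk_index0 m n) :: ('d \<Rightarrow> nat \<times> nat) set) \<times> walk_index0 m n"
  have "finite ?X" by (intro finite_cartesian_product finite_PiE finite_walk_index0) simp_all
  then have "AE \<omega> in PiM (walk_index m n) (\<lambda>_. gauss :: (real^'d) measure). \<forall>x\<in>?X. inj (fst x) \<and> snd x \<notin> range (fst x) \<longrightarrow>
    det (\<chi> k. case_prod (walk \<omega>) (fst x k) - case_prod (walk \<omega>) (snd x)) \<noteq> 0"
  proof (rule eventually_ball_finite, intro ballI)
    fix x assume x: "x \<in> ?X"
    show "AE \<omega> in PiM (walk_index m n) (\<lambda>_. gauss :: (real^'d) measure). inj (fst x) \<and> snd x \<notin> range (fst x) \<longrightarrow>
      det (\<chi> k. case_prod (walk \<omega>) (fst x k) - case_prod (walk \<omega>) (snd x)) \<noteq> 0"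
    proof (cases "inj (fst x) \<and> snd x \<notin> range (fst x)")
      case True
      then have "AE \<omega> in PiM (walk_index m n) (\<lambda>_. gauss :: (real^'d) measure).
        det (\<chi> k. case_prod (walk \<omega>) (fst x k) - case_prod (walk \<omega>) (snd x)) \<noteq> 0"
        using x by (intro AE_walk_differences_det) auto
      then show ?thesis by eventually_elim simp
    next
      case False
      then show ?thesis by (intro AE_I2) blast
    qed
  qed
  then show ?thesis
  proof eventually_elim
    case (elim \<omega>)
    show ?case unfolding generic_def
    proof (intro allI impI)
      fix \<psi> :: "'d \<Rightarrow> nat \<times> nat" and b
      assume a: "inj \<psi> \<and> range \<psi> \<subseteq> walk_index0 m n \<and> b \<in> walk_index0 m n - range \<psi>"
      then have "(\<psi>, b) \<in> ?X" by (auto simp: PiE_def extensional_def)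
      from bspec[OF elim this] a show "det (\<chi> k. case_prod (walk \<omega>) (\<psi> k) - case_prod (walk \<omega>) b) \<noteq> 0" by simp
    qed
  qed
qed

text \<open>\<open>x\<close> takes the place of the index \<open>\<phi> k0\<close> in the family,
  and that index becomes the base; the determinant of the differences is then the inner product of
  the normal with the difference of the two points.\<close>

lemma generic_crossp:
  fixes \<phi> :: "'d::finite \<Rightarrow> nat \<times> nat" and \<omega> :: "nat \<times> nat \<Rightarrow> real^'d"
  defines "Y \<equiv> \<lambda>k. case_prod (walk \<omega>) (\<phi> k)"
  assumes g: "generic m n \<omega>" and \<phi>: "inj \<phi>" "range \<phi> \<subseteq> walk_index0 m n" and x: "x \<in> walk_index0 m n - range \<phi>"
  shows "crossp k0 (\<lambda>k. Y k - Y k0) \<bullet> case_prod (walk \<omega>) x \<noteq> crossp k0 (\<lambda>k. Y k - Y k0) \<bullet> Y k0"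
proof -
  define \<psi> where "\<psi> = \<phi>(k0 := x)"
  have "inj \<psi>" unfolding \<psi>_def by (rule inj_on_fun_updI[OF \<phi>(1)]) (use x in auto)
  moreover have "range \<psi> \<subseteq> walk_index0 m n" using \<phi>(2) x by (auto simp: \<psi>_def)
  moreover have "\<phi> k0 \<in> walk_index0 m n - range \<psi>"
  proof -
    have "\<psi> k \<noteq> \<phi> k0" for k
    proof (cases "k = k0")
      case True
      then show ?thesis using x by (auto simp: \<psi>_def)
    next
      case False
      then show ?thesis using inj_eq[OF \<phi>(1), of k k0] by (simp add: \<psi>_def)
    qed
    then show ?thesis using \<phi>(2) by force
  qed
  ultimately have "det (\<chi> k. case_prod (walk \<omega>) (\<psi> k) - Y k0) \<noteq> 0" using g unfolding generic_def Y_def by blast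
  moreover have "(\<chi> k. case_prod (walk \<omega>) (\<psi> k) - Y k0) = (\<chi> k. if k = k0 then case_prod (walk \<omega>) x - Y k0 else Y k - Y k0)"
    by (auto simp: vec_eq_iff \<psi>_def Y_def)
  ultimately have "crossp k0 (\<lambda>k. Y k - Y k0) \<bullet> (case_prod (walk \<omega>) x - Y k0) \<noteq> 0" unfolding inner_crossp by simp
  then show ?thesis by (simp add: inner_diff_right)
qed

text \<open>If two indices had the same point, one of them could be completed to d indices avoiding
  the other, whose point would then lie on the hyperplane through them.\<close>

lemma generic_inj_on:
  fixes \<omega> :: "nat \<times> nat \<Rightarrow> real^'d::finite"
  assumes g: "generic m n \<omega>" and card: "CARD('d) + 1 \<le> card (walk_index0 m n)"
  shows "inj_on (case_prod (walk \<omega>)) (walk_index0 m n)"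
proof (rule inj_onI, rule ccontr)
  fix a b assume a: "a \<in> walk_index0 m n" and b: "b \<in> walk_index0 m n" and eq: "case_prod (walk \<omega>) a = case_prod (walk \<omega>) b" and ne: "a \<noteq> b"
  obtain k0 :: 'd where True by blast
  have "card (walk_index0 m n - {a, b}) = card (walk_index0 m n) - 2"
    using a b ne finite_walk_index0 by (subst card_Diff_subset) auto
  then have "card (UNIV - {k0} :: 'd set) \<le> card (walk_index0 m n - {a, b})" using card by simp
  then obtain h where h: "inj_on h (UNIV - {k0} :: 'd set)" "h ` (UNIV - {k0}) \<subseteq> walk_index0 m n - {a, b}"
    using card_le_inj[of "UNIV - {k0} :: 'd set" "walk_index0 m n - {a, b}"] finite_walk_index0[of m n] by auto
  define \<phi> where "\<phi> = h(k0 := a)"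
  have h': "h k \<in> walk_index0 m n" "h k \<noteq> a" "h k \<noteq> b" if "k \<noteq> k0" for k using h(2) that by auto
  have "inj \<phi>"
  proof (rule injI)
    fix k k' assume "\<phi> k = \<phi> k'"
    then show "k = k'" using h'(2)[of k] h'(2)[of k'] inj_onD[OF h(1), of k k'] by (auto simp: \<phi>_def split: if_splits)
  qed
  moreover have "range \<phi> \<subseteq> walk_index0 m n" using h'(1) a by (auto simp: \<phi>_def)
  moreover have "b \<in> walk_index0 m n - range \<phi>" using h'(3) b ne by (auto simp: \<phi>_def)
  ultimately show False using generic_crossp[OF g, of \<phi> b k0] eq by (simp add: \<phi>_def)
qed

lemma generic_crossp_nonzero:
  fixes \<phi> :: "'d::finite \<Rightarrow> nat \<times> nat" and \<omega> :: "nat \<times> nat \<Rightarrow> real^'d"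
  assumes g: "generic m n \<omega>" and card: "CARD('d) + 1 \<le> card (walk_index0 m n)"
    and \<phi>: "inj \<phi>" "range \<phi> \<subseteq> walk_index0 m n"
  shows "crossp k0 (\<lambda>k. case_prod (walk \<omega>) (\<phi> k) - case_prod (walk \<omega>) (\<phi> k0)) \<noteq> 0"
proof -
  have "card (range \<phi>) = CARD('d)" by (rule card_image[OF \<phi>(1)])
  then have "walk_index0 m n - range \<phi> \<noteq> {}"
    using card card_mono[of "range \<phi>" "walk_index0 m n"] by auto
  then obtain x where "x \<in> walk_index0 m n - range \<phi>" by blast
  from generic_crossp[OF g \<phi> this, of k0] show ?thesis by auto
qed

lemma generic_general_position:
  fixes \<omega> :: "nat \<times> nat \<Rightarrow> real^'d::finite"
  assumes g: "generic m n \<omega>" and card: "CARD('d) + 1 \<le> card (walk_index0 m n)" and S: "S \<subseteq> walk_index0 m n"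
  shows "general_position k0 (case_prod (walk \<omega>) ` S)"
  unfolding general_position_def
proof (intro allI impI)
  fix Y :: "'d \<Rightarrow> real^'d" assume Y: "inj Y \<and> range Y \<subseteq> case_prod (walk \<omega>) ` S"
  then have "Y k \<in> case_prod (walk \<omega>) ` S" for k by blast
  then have "\<forall>k. \<exists>p. p \<in> S \<and> Y k = case_prod (walk \<omega>) p" by (simp only: image_iff Bex_def) simp
  then obtain \<phi> where "\<forall>k. \<phi> k \<in> S \<and> Y k = case_prod (walk \<omega>) (\<phi> k)" by (rule choice[THEN exE])
  then have \<phi>S: "\<phi> k \<in> S" and Y\<phi>: "Y k = case_prod (walk \<omega>) (\<phi> k)" for k by auto
  have \<phi>: "inj \<phi>" using Y Y\<phi> by (auto simp: inj_def)
  have \<phi>r: "range \<phi> \<subseteq> walk_index0 m n" using \<phi>S S by auto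
  show "crossp k0 (\<lambda>k. Y k - Y k0) \<noteq> 0 \<and> (\<forall>x\<in>case_prod (walk \<omega>) ` S - range Y. crossp k0 (\<lambda>k. Y k - Y k0) \<bullet> x \<noteq> crossp k0 (\<lambda>k. Y k - Y k0) \<bullet> Y k0)"
    unfolding Y\<phi>
  proof (intro conjI ballI generic_crossp_nonzero[OF g card \<phi> \<phi>r])
    fix x assume x: "x \<in> case_prod (walk \<omega>) ` S - range (\<lambda>k. case_prod (walk \<omega>) (\<phi> k))"
    then obtain p where p: "p \<in> S" "x = case_prod (walk \<omega>) p" by auto
    then have "p \<in> walk_index0 m n - range \<phi>" using x S by auto
    from generic_crossp[OF g \<phi> \<phi>r this, of k0]
    show "crossp k0 (\<lambda>k. case_prod (walk \<omega>) (\<phi> k) - case_prod (walk \<omega>) (\<phi> k0)) \<bullet> x \<noteq>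
      crossp k0 (\<lambda>k. case_prod (walk \<omega>) (\<phi> k) - case_prod (walk \<omega>) (\<phi> k0)) \<bullet> case_prod (walk \<omega>) (\<phi> k0)"
      unfolding p(2) .
  qed
qed

text \<open>A point off the hyperplane prevents both alternatives from holding, so the sum of their
  indicators is the indicator of being a facet.\<close>

lemma facet_volume_eq:
  fixes Y :: "'d::finite \<Rightarrow> real^'d" and k0 :: 'd
  defines "c \<equiv> crossp k0 (\<lambda>k. Y k - Y k0)"
  assumes d2: "CARD('d) \<ge> 2" and T: "finite T" "range Y \<subseteq> T" "T \<noteq> range Y" and c: "c \<noteq> 0"
    and other: "\<And>x. x \<in> T - range Y \<Longrightarrow> c \<bullet> x \<noteq> c \<bullet> Y k0"
  shows "facet_area (range Y) (convex hull T)
    = ennreal (norm c / fact (CARD('d) - 1)) * (of_bool (\<forall>x\<in>T. c \<bullet> x \<le> c \<bullet> Y k0) + of_bool (\<forall>x\<in>T. c \<bullet> Y k0 \<le> c \<bullet> x))"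
proof -
  have iff: "convex hull (range Y) facet_of convex hull T \<longleftrightarrow>
    (\<forall>x\<in>T. c \<bullet> x \<le> c \<bullet> Y k0) \<or> (\<forall>x\<in>T. c \<bullet> Y k0 \<le> c \<bullet> x)"
    unfolding c_def by (rule facet_of_simplex_iff[OF T(1,2)]) (use c other T(3) in \<open>auto simp: c_def\<close>)
  have "\<not> ((\<forall>x\<in>T. c \<bullet> x \<le> c \<bullet> Y k0) \<and> (\<forall>x\<in>T. c \<bullet> Y k0 \<le> c \<bullet> x))"
  proof -
    obtain x where "x \<in> T - range Y" using T by blast
    then show ?thesis using other[of x] by force
  qed
  then show ?thesis
    unfolding iff using hausdorff_measure_simplex[OF d2, of k0 Y] c by (auto simp: c_def)
qed

subsection \<open>Expected facet areas\<close>

lemma config_index_bij: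
  "bij_betw (\<lambda>A. {(l, i). l \<in> {1..m} \<and> i \<in> A l}) (configs m n k) {X. X \<subseteq> walk_index m n \<and> card X = k}"
proof (rule bij_betw_byWitness[where f'="\<lambda>X l. {i. (l, i) \<in> X}"])
  have card: "card {(l, i). l \<in> {1..m} \<and> i \<in> A l} = (\<Sum>l=1..m. card (A l))" if "\<forall>l\<in>{1..m}. A l \<subseteq> {1..n l}" for A
  proof -
    have "{(l, i). l \<in> {1..m} \<and> i \<in> A l} = Sigma {1..m} A" by auto
    moreover have "\<forall>l\<in>{1..m}. finite (A l)" using that finite_subset by blast
    ultimately show ?thesis by (simp add: card_SigmaI)
  qed
  show "\<forall>A\<in>configs m n k. (\<lambda>l. {i. (l, i) \<in> {(l, i). l \<in> {1..m} \<and> i \<in> A l}}) = A"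
    by (force simp: configs_def fun_eq_iff)
  show "\<forall>X\<in>{X. X \<subseteq> walk_index m n \<and> card X = k}. {(l, i). l \<in> {1..m} \<and> i \<in> {i. (l, i) \<in> X}} = X"
    by (auto simp: walk_index_def)
  show "(\<lambda>A. {(l, i). l \<in> {1..m} \<and> i \<in> A l}) ` configs m n k \<subseteq> {X. X \<subseteq> walk_index m n \<and> card X = k}"
  proof (rule image_subsetI)
    fix A assume "A \<in> configs m n k"
    then have A: "\<forall>l\<in>{1..m}. A l \<subseteq> {1..n l}" "(\<Sum>l=1..m. card (A l)) = k" by (simp_all add: configs_def)
    then show "{(l, i). l \<in> {1..m} \<and> i \<in> A l} \<in> {X. X \<subseteq> walk_index m n \<and> card X = k}"
      using card[OF A(1)] by (force simp: walk_index_def)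
  qed
  show "(\<lambda>X l. {i. (l, i) \<in> X}) ` {X. X \<subseteq> walk_index m n \<and> card X = k} \<subseteq> configs m n k"
  proof (rule image_subsetI)
    fix X assume X: "X \<in> {X. X \<subseteq> walk_index m n \<and> card X = k}"
    then have sub: "\<forall>l\<in>{1..m}. {i. (l, i) \<in> X} \<subseteq> {1..n l}" by (auto simp: walk_index_def)
    have "{(l, i). l \<in> {1..m} \<and> i \<in> {i. (l, i) \<in> X}} = X" using X by (auto simp: walk_index_def)
    then have "(\<Sum>l=1..m. card {i. (l, i) \<in> X}) = k" using card[OF sub] X by simp
    then show "(\<lambda>l. {i. (l, i) \<in> X}) \<in> configs m n k"
      using sub X by (auto simp: configs_def walk_index_def)
  qed
qed

lemma image_subsets_bij:
  assumes "inj_on p I"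
  shows "bij_betw (\<lambda>X. p ` X) {X. X \<subseteq> I \<and> card X = k} {S. S \<subseteq> p ` I \<and> card S = k}"
proof (rule bij_betw_imageI)
  show "inj_on (\<lambda>X. p ` X) {X. X \<subseteq> I \<and> card X = k}"
    by (rule inj_onI) (use inj_on_image_eq_iff[OF assms] in auto)
  have c: "card (p ` X) = card X" if "X \<subseteq> I" for X
    by (rule card_image) (rule inj_on_subset[OF assms that])
  show "(\<lambda>X. p ` X) ` {X. X \<subseteq> I \<and> card X = k} = {S. S \<subseteq> p ` I \<and> card S = k}"
  proof (intro equalityI subsetI)
    fix S assume "S \<in> {S. S \<subseteq> p ` I \<and> card S = k}"
    then obtain X where "X \<subseteq> I" "S = p ` X" "card S = k" by (auto simp: subset_image_iff)
    then show "S \<in> (\<lambda>X. p ` X) ` {X. X \<subseteq> I \<and> card X = k}" using c[of X] by auto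
  qed (use c in auto)
qed

lemma insert_subsets_bij:
  assumes z: "z \<notin> T" and T: "finite T" and k: "k \<ge> 1"
    and F: "bij_betw F K {S. S \<subseteq> T \<and> card S = k}" and G: "bij_betw G L {S. S \<subseteq> T \<and> card S = k - 1}"
  shows "bij_betw (case_sum F (\<lambda>A. insert z (G A))) (K <+> L) {S. S \<subseteq> insert z T \<and> card S = k}"
proof (rule bij_betw_imageI)
  have Fi: "F A \<subseteq> T" "card (F A) = k" if "A \<in> K" for A using F that by (auto simp: bij_betw_def)
  have Gi: "G A \<subseteq> T" "card (G A) = k - 1" if "A \<in> L" for A using G that by (auto simp: bij_betw_def)
  have zF: "z \<notin> F A" if "A \<in> K" for A using Fi[OF that] z by auto
  have zG: "z \<notin> G A" if "A \<in> L" for A using Gi[OF that] z by auto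
  have Gfin: "finite (G A)" if "A \<in> L" for A using Gi[OF that] T finite_subset by blast
  show "inj_on (case_sum F (\<lambda>A. insert z (G A))) (K <+> L)"
  proof (rule inj_onI)
    fix a b assume ab: "a \<in> K <+> L" "b \<in> K <+> L" "case_sum F (\<lambda>A. insert z (G A)) a = case_sum F (\<lambda>A. insert z (G A)) b"
    have FF: "A = B" if "A \<in> K" "B \<in> K" "F A = F B" for A B using F that by (auto simp: bij_betw_def dest: inj_onD)
    have GG: "A = B" if "A \<in> L" "B \<in> L" "insert z (G A) = insert z (G B)" for A B
    proof -
      have "G A = G B" using insert_ident[of z "G A" "G B"] zG that by simp
      then show ?thesis using G that by (auto simp: bij_betw_def dest: inj_onD)
    qed
    show "a = b" using ab FF GG zF by (elim PlusE) (auto, (metis insertI1)+)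
  qed
  show "case_sum F (\<lambda>A. insert z (G A)) ` (K <+> L) = {S. S \<subseteq> insert z T \<and> card S = k}"
  proof (intro equalityI subsetI)
    fix S assume "S \<in> case_sum F (\<lambda>A. insert z (G A)) ` (K <+> L)"
    then consider A where "A \<in> K" "S = F A" | A where "A \<in> L" "S = insert z (G A)" by (auto elim!: PlusE)
    then show "S \<in> {S. S \<subseteq> insert z T \<and> card S = k}"
    proof cases
      case (1 A) then show ?thesis using Fi[of A] by auto
    next
      case (2 A) then show ?thesis using Gi[of A] Gfin[of A] zG[of A] k by auto
    qed
  next
    fix S assume S: "S \<in> {S. S \<subseteq> insert z T \<and> card S = k}"
    show "S \<in> case_sum F (\<lambda>A. insert z (G A)) ` (K <+> L)"
    proof (cases "z \<in> S")
      case True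
      then have "S - {z} \<in> {S. S \<subseteq> T \<and> card S = k - 1}" using S T by auto
      then have "S - {z} \<in> G ` L" using G by (simp add: bij_betw_def)
      then obtain A where A: "A \<in> L" "S - {z} = G A" by auto
      then have "S = case_sum F (\<lambda>A. insert z (G A)) (Inr A)" using True by auto
      then show ?thesis using A(1) by (intro image_eqI[of _ _ "Inr A"]) auto
    next
      case False
      then have "S \<in> {S. S \<subseteq> T \<and> card S = k}" using S by auto
      then have "S \<in> F ` K" using F by (simp add: bij_betw_def)
      then obtain A where A: "A \<in> K" "S = F A" by auto
      then show ?thesis by (intro image_eqI[of _ _ "Inl A"]) auto
    qed
  qed
qed

lemma generic_facet_volume:
  fixes \<phi> :: "'d::finite \<Rightarrow> nat \<times> nat" and \<omega> :: "nat \<times> nat \<Rightarrow> real^'d" and k0 :: 'd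
  defines "p \<equiv> case_prod (walk \<omega>)"
  defines "c \<equiv> crossp k0 (\<lambda>k. p (\<phi> k) - p (\<phi> k0))"
  assumes d2: "CARD('d) \<ge> 2" and g: "generic m n \<omega>" and S: "S \<subseteq> walk_index0 m n" and card: "CARD('d) + 1 \<le> card S"
    and \<phi>: "inj \<phi>" "range \<phi> \<subseteq> S"
  shows "facet_area (p ` range \<phi>) (convex hull (p ` S))
    = ennreal (norm c / fact (CARD('d) - 1)) * (of_bool (\<forall>q\<in>S. c \<bullet> p q \<le> c \<bullet> p (\<phi> k0)) + of_bool (\<forall>q\<in>S. c \<bullet> p (\<phi> k0) \<le> c \<bullet> p q))"
proof -
  have finS: "finite S" using S finite_walk_index0 finite_subset by blast
  have card0: "CARD('d) + 1 \<le> card (walk_index0 m n)" using card card_mono[OF finite_walk_index0 S] by linarith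
  have \<phi>0: "range \<phi> \<subseteq> walk_index0 m n" using \<phi>(2) S by auto
  define Y where "Y k = p (\<phi> k)" for k
  have rY: "p ` range \<phi> = range Y" by (auto simp: Y_def)
  have injp: "inj_on p (walk_index0 m n)" unfolding p_def by (rule generic_inj_on[OF g card0])
  have ne: "S \<noteq> range \<phi>" using card card_image[OF \<phi>(1)] by auto
  have c_Y: "c = crossp k0 (\<lambda>k. Y k - Y k0)" by (simp add: c_def Y_def)
  have "facet_area (range Y) (convex hull (p ` S))
    = ennreal (norm c / fact (CARD('d) - 1)) * (of_bool (\<forall>x\<in>p ` S. c \<bullet> x \<le> c \<bullet> Y k0) + of_bool (\<forall>x\<in>p ` S. c \<bullet> Y k0 \<le> c \<bullet> x))"
    unfolding c_Y
  proof (rule facet_volume_eq[OF d2])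
    show "finite (p ` S)" using finS by simp
    show "range Y \<subseteq> p ` S" using \<phi>(2) by (auto simp: Y_def)
    show "p ` S \<noteq> range Y" using ne inj_on_image_eq_iff[OF injp S \<phi>0] by (simp add: rY)
    show "crossp k0 (\<lambda>k. Y k - Y k0) \<noteq> 0"
      unfolding Y_def p_def by (rule generic_crossp_nonzero[OF g card0 \<phi>(1) \<phi>0])
    fix x assume x: "x \<in> p ` S - range Y"
    then obtain q where q: "q \<in> S" "x = p q" by auto
    then have "q \<in> walk_index0 m n - range \<phi>" using x S by (auto simp: Y_def)
    from generic_crossp[OF g \<phi>(1) \<phi>0 this, of k0]
    show "crossp k0 (\<lambda>k. Y k - Y k0) \<bullet> x \<noteq> crossp k0 (\<lambda>k. Y k - Y k0) \<bullet> Y k0"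
      by (simp add: Y_def p_def q(2))
  qed
  then show ?thesis unfolding rY by (simp add: Y_def)
qed

lemma walk_image_eq:
  "{walk \<omega> l i |l i. l \<in> {1..m} \<and> i \<in> {1..n l}} = case_prod (walk \<omega>) ` walk_index m n"
  by (auto simp: walk_index_def image_iff)

lemma Qpoly_eq: "Qpoly m n \<omega> = convex hull (case_prod (walk \<omega>) ` walk_index m n)"
  by (simp only: Qpoly_def walk_image_eq)

lemma Qpoly0_eq: "Qpoly0 m n \<omega> = convex hull (case_prod (walk \<omega>) ` walk_index0 m n)"
  by (simp only: Qpoly0_def walk_image_eq walk_index0_def image_insert case_prod_conv walk_0)

lemma config_points_image:
  "config_points m \<omega> A = case_prod (walk \<omega>) ` {(l, i). l \<in> {1..m} \<and> i \<in> A l}"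
  by (auto simp: config_points_def image_iff)

context config begin

lemma config_points_eq: "config_points m \<omega> A = case_prod (walk \<omega>) ` J"
  by (simp only: config_points_image J_def)

lemma walk_points_J: "\<beta> \<in> J \<Longrightarrow> walk_points \<omega> \<beta> = case_prod (walk \<omega>) \<beta>"
  by (simp add: walk_points_def)

text \<open>The existential \<open>G\<close> is a measurable version of the facet area. The two
  cases for \<open>S\<close> differ in the inequality that the origin adds on each side, and this is
  what \<open>R\<close> encodes.\<close>

lemma facet_expectation:
  fixes S :: "(nat \<times> nat) set" and R :: "real set"
  defines "M \<equiv> PiM (walk_index m n) (\<lambda>_. gauss :: (real^'d::finite) measure)"
  assumes d2: "CARD('d) \<ge> 2" and J: "card J = CARD('d)" and card: "CARD('d) + 1 \<le> card S"
    and SR: "S = walk_index m n \<and> R = UNIV \<or> S = walk_index0 m n \<and> R = {0<..}"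
  shows "\<exists>G\<in>borel_measurable M. (AE \<omega> in M. facet_area (config_points m \<omega> A) (convex hull (case_prod (walk \<omega>) ` S)) = G \<omega>)
    \<and> (\<integral>\<^sup>+\<omega>. G \<omega> \<partial>M) = ennreal (summand_facet CARD('d) m n R A)"
proof -
  let ?I = "walk_index m n"
  obtain k0 :: 'd where True by blast
  obtain f :: "'d \<Rightarrow> nat \<times> nat" where f: "bij_betw f UNIV J"
    using finite_same_card_bij[of "UNIV :: 'd set" J] J finite_J by auto
  then have f': "inj f" "range f = J" by (auto simp: bij_betw_def)
  then have fJ: "f k \<in> J" for k by auto
  have R: "R \<in> sets borel" using SR by auto
  define c where "c y = crossp k0 (\<lambda>k. y (f k) - y (f k0) :: real^'d)" for y
  define \<tau> where "\<tau> y = det (\<chi> k. (y (f k) :: real^'d))" for y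
  show ?thesis
  proof (intro bexI[of _ "sides R c \<tau>"] conjI)
    show "sides R c \<tau> \<in> borel_measurable M" "(\<integral>\<^sup>+\<omega>. sides R c \<tau> \<omega> \<partial>M) = ennreal (summand_facet CARD('d) m n R A)"
      unfolding M_def c_def[abs_def] \<tau>_def[abs_def] by (rule nn_integral_facet_sides[OF d2 f R])+
    show "AE \<omega> in M. facet_area (config_points m \<omega> A) (convex hull (case_prod (walk \<omega>) ` S)) = sides R c \<tau> \<omega>"
      using AE_generic[where 'd='d, of m n, folded M_def]
    proof eventually_elim
      fix \<omega> :: "nat \<times> nat \<Rightarrow> real^'d" assume g: "generic m n \<omega>"
      define p where "p = case_prod (walk \<omega>)"
      define c' where "c' = crossp k0 (\<lambda>k. p (f k) - p (f k0))"
      define t where "t = c' \<bullet> p (f k0)"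
      have c'_eq: "c (walk_points \<omega>) = c'" using fJ by (simp add: c_def c'_def p_def walk_points_J)
      have t_eq: "\<tau> (walk_points \<omega>) = t"
        unfolding t_def c'_def inner_crossp_differences[of k0 "\<lambda>k. p (f k)" k0] using fJ by (simp add: \<tau>_def p_def walk_points_J)
      have S0: "S \<subseteq> walk_index0 m n" "J \<subseteq> S" using SR J_sub by (auto simp: walk_index0_def)
      have vol: "facet_area (config_points m \<omega> A) (convex hull (p ` S))
        = ennreal (norm c' / fact (CARD('d) - 1)) * (of_bool (\<forall>q\<in>S. c' \<bullet> p q \<le> t) + of_bool (\<forall>q\<in>S. t \<le> c' \<bullet> p q))"
        unfolding config_points_eq f'(2)[symmetric] t_def c'_def p_def
        by (rule generic_facet_volume[OF d2 g S0(1) card f'(1)]) (use S0(2) f'(2) in simp)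
      have ballI: "(\<forall>(l, i)\<in>?I. Q (walk \<omega> l i)) \<longleftrightarrow> (\<forall>q\<in>?I. Q (p q))" for Q by (auto simp: p_def)
      have up: "of_bool (\<forall>q\<in>S. c' \<bullet> p q \<le> t) = (indicator R (t / norm c') * of_bool (\<forall>q\<in>?I. c' \<bullet> p q \<le> t) :: ennreal)"
        and down: "of_bool (\<forall>q\<in>S. t \<le> c' \<bullet> p q) = (indicator R (- (t / norm c')) * of_bool (\<forall>q\<in>?I. t \<le> c' \<bullet> p q) :: ennreal)"
      proof -
        consider "S = ?I" "R = UNIV" | "S = walk_index0 m n" "R = {0<..}" using SR by auto
        then have "of_bool (\<forall>q\<in>S. c' \<bullet> p q \<le> t) = (indicator R (t / norm c') * of_bool (\<forall>q\<in>?I. c' \<bullet> p q \<le> t) :: ennreal) \<and>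
          of_bool (\<forall>q\<in>S. t \<le> c' \<bullet> p q) = (indicator R (- (t / norm c')) * of_bool (\<forall>q\<in>?I. t \<le> c' \<bullet> p q) :: ennreal)"
        proof cases
          case 1
          then show ?thesis by simp
        next
          case 2
          have f0: "range f \<subseteq> walk_index0 m n" using f'(2) J_sub by (auto simp: walk_index0_def)
          have "(0, 0) \<in> walk_index0 m n - range f" using f'(2) J_sub by (auto simp: walk_index0_def walk_index_def)
          \<comment> \<open>Genericity at the origin excludes offset 0, so its condition
            \<open>0 \<le> t\<close> is the strict \<open>0 < t\<close> encoded in
            \<open>R\<close>.\<close>
          from generic_crossp[OF g f'(1) f0 this, of k0] have t0: "t \<noteq> 0"
            by (simp add: t_def c'_def p_def walk_0)
          have p0: "p (0, 0) = 0" by (simp add: p_def walk_0)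
          have c'0: "norm c' > 0" using t0 by (auto simp: t_def)
          have "(\<forall>q\<in>S. c' \<bullet> p q \<le> t) \<longleftrightarrow> 0 < t \<and> (\<forall>q\<in>?I. c' \<bullet> p q \<le> t)"
            using t0 p0 by (auto simp: 2 walk_index0_def)
          moreover have "(\<forall>q\<in>S. t \<le> c' \<bullet> p q) \<longleftrightarrow> t < 0 \<and> (\<forall>q\<in>?I. t \<le> c' \<bullet> p q)"
            using t0 p0 by (auto simp: 2 walk_index0_def)
          moreover have "0 < t / norm c' \<longleftrightarrow> 0 < t" "0 < - (t / norm c') \<longleftrightarrow> t < 0"
            using c'0 by (auto simp: zero_less_divide_iff divide_less_0_iff)
          ultimately show ?thesis by (simp add: 2(2) indicator_def)
        qed
        then show "of_bool (\<forall>q\<in>S. c' \<bullet> p q \<le> t) = (indicator R (t / norm c') * of_bool (\<forall>q\<in>?I. c' \<bullet> p q \<le> t) :: ennreal)"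
          "of_bool (\<forall>q\<in>S. t \<le> c' \<bullet> p q) = (indicator R (- (t / norm c')) * of_bool (\<forall>q\<in>?I. t \<le> c' \<bullet> p q) :: ennreal)" by auto
      qed
      have G: "sides R c \<tau> \<omega> = ennreal (norm c' / fact (CARD('d) - 1)) * (indicator R (t / norm c') * of_bool (\<forall>q\<in>?I. c' \<bullet> p q \<le> t)
          + indicator R (- (t / norm c')) * of_bool (\<forall>q\<in>?I. t \<le> c' \<bullet> p q))"
        unfolding sides_def Let_def c'_eq t_eq
          ballI[of "\<lambda>x. c' \<bullet> x \<le> t"] ballI[of "\<lambda>x. t \<le> c' \<bullet> x"] ..
      show "facet_area (config_points m \<omega> A) (convex hull (case_prod (walk \<omega>) ` S)) = sides R c \<tau> \<omega>"
        using vol unfolding up down G[symmetric] unfolding p_def .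
    qed
  qed
qed

lemma zero_facet_expectation:
  defines "M \<equiv> PiM (walk_index m n) (\<lambda>_. gauss :: (real^'d::finite) measure)"
  assumes d2: "CARD('d) \<ge> 2" and J: "card J = CARD('d) - 1" and card: "CARD('d) + 1 \<le> card (walk_index0 m n)"
  shows "\<exists>G\<in>borel_measurable M. (AE \<omega> in M. facet_area (insert 0 (config_points m \<omega> A)) (convex hull (case_prod (walk \<omega>) ` walk_index0 m n)) = G \<omega>)
    \<and> (\<integral>\<^sup>+\<omega>. G \<omega> \<partial>M) = ennreal (summand_zero CARD('d) m n A)"
proof -
  let ?I = "walk_index m n"
  obtain k0 :: 'd where True by blast
  obtain f :: "'d \<Rightarrow> nat \<times> nat" where f: "bij_betw f (UNIV - {k0}) J"
    using finite_same_card_bij[of "UNIV - {k0} :: 'd set" J] J finite_J by auto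
  then have f': "inj_on f (UNIV - {k0})" "f ` (UNIV - {k0}) = J" by (auto simp: bij_betw_def)
  then have fJ: "f k \<in> J" if "k \<noteq> k0" for k using that by auto
  define c where "c y = crossp k0 (\<lambda>k. y (f k) :: real^'d)" for y
  show ?thesis
  proof (intro bexI[of _ "sides UNIV c (\<lambda>_. 0)"] conjI)
    show "sides UNIV c (\<lambda>_. 0) \<in> borel_measurable M" "(\<integral>\<^sup>+\<omega>. sides UNIV c (\<lambda>_. 0) \<omega> \<partial>M) = ennreal (summand_zero CARD('d) m n A)"
      unfolding M_def c_def[abs_def] by (rule nn_integral_zero_facet_sides[OF d2 f])+
    show "AE \<omega> in M. facet_area (insert 0 (config_points m \<omega> A)) (convex hull (case_prod (walk \<omega>) ` walk_index0 m n)) = sides UNIV c (\<lambda>_. 0) \<omega>"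
      using AE_generic[where 'd='d, of m n, folded M_def]
    proof eventually_elim
      fix \<omega> :: "nat \<times> nat \<Rightarrow> real^'d" assume g: "generic m n \<omega>"
      define p where "p = case_prod (walk \<omega>)"
      \<comment> \<open>The origin is put at \<open>k0\<close>, so the differences from it are the
        configuration points themselves.\<close>
      define \<phi> where "\<phi> = f(k0 := (0, 0))"
      have notJ: "(0, 0) \<notin> J" using J_sub by (auto simp: walk_index_def)
      have \<phi>: "inj \<phi>"
      proof (rule injI)
        fix k k' assume "\<phi> k = \<phi> k'"
        then show "k = k'" using notJ fJ[of k] fJ[of k'] inj_onD[OF f'(1), of k k'] by (auto simp: \<phi>_def split: if_splits)
      qed
      have r: "range \<phi> = insert (0, 0) J" using f'(2) by (auto simp: \<phi>_def)
      have p0: "p (0, 0) = 0" by (simp add: p_def walk_0)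
      have pr: "p ` range \<phi> = insert 0 (config_points m \<omega> A)" unfolding r by (simp add: p0 config_points_eq p_def[symmetric])
      define c' where "c' = crossp k0 (\<lambda>k. p (\<phi> k) - p (\<phi> k0))"
      have pk0: "p (\<phi> k0) = 0" by (simp add: \<phi>_def p0)
      have c'_eq: "c (walk_points \<omega>) = c'"
        unfolding c_def c'_def pk0 by (rule crossp_cong) (use fJ in \<open>simp add: \<phi>_def p_def walk_points_J\<close>)
      have vol: "facet_area (p ` range \<phi>) (convex hull (p ` walk_index0 m n))
        = ennreal (norm c' / fact (CARD('d) - 1)) * (of_bool (\<forall>q\<in>walk_index0 m n. c' \<bullet> p q \<le> c' \<bullet> p (\<phi> k0)) + of_bool (\<forall>q\<in>walk_index0 m n. c' \<bullet> p (\<phi> k0) \<le> c' \<bullet> p q))"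
        unfolding c'_def p_def
        by (rule generic_facet_volume[OF d2 g order_refl card \<phi>]) (use r J_sub in \<open>auto simp: walk_index0_def\<close>)
      have ballI: "(\<forall>(l, i)\<in>?I. Q (walk \<omega> l i)) \<longleftrightarrow> (\<forall>q\<in>?I. Q (p q))" for Q by (auto simp: p_def)
      have "sides UNIV c (\<lambda>_. 0) \<omega> = ennreal (norm c' / fact (CARD('d) - 1)) * (of_bool (\<forall>q\<in>?I. c' \<bullet> p q \<le> 0) + of_bool (\<forall>q\<in>?I. 0 \<le> c' \<bullet> p q))"
        unfolding sides_def Let_def c'_eq ballI[of "\<lambda>x. c' \<bullet> x \<le> 0"] ballI[of "\<lambda>x. 0 \<le> c' \<bullet> x"]
        by (simp only: indicator_simps(1)[OF UNIV_I] mult_1_left)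
      also have "\<dots> = ennreal (norm c' / fact (CARD('d) - 1)) * (of_bool (\<forall>q\<in>walk_index0 m n. c' \<bullet> p q \<le> c' \<bullet> p (\<phi> k0)) + of_bool (\<forall>q\<in>walk_index0 m n. c' \<bullet> p (\<phi> k0) \<le> c' \<bullet> p q))"
        unfolding pk0 by (simp add: walk_index0_def p0)
      finally show "facet_area (insert 0 (config_points m \<omega> A)) (convex hull (case_prod (walk \<omega>) ` walk_index0 m n)) = sides UNIV c (\<lambda>_. 0) \<omega>"
        unfolding vol[symmetric] pr unfolding p_def ..
    qed
  qed
qed

lemma summand_facet_nonneg: "k \<ge> 1 \<Longrightarrow> summand_facet k m n R A \<ge> 0"
  unfolding summand_facet_def sfac_def set_lebesgue_integral_def
proof (intro mult_nonneg_nonneg gcoef_nonneg prod_nonneg sum_nonneg ballI cfac_nonneg Bochner_Integration.integral_nonneg)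
  fix r :: real
  have "Jint_fun m n A r \<ge> 0"
    unfolding Jint_fun_def by (intro mult_nonneg_nonneg prod_nonneg ballI persist_nonneg) simp
  then show "indicator R r *\<^sub>R Jint_fun m n A r \<ge> 0" by simp
next
  fix l assume "l \<in> active m A"
  then show "sqrt (real (Min (A l))) / sqrt (gapprod (A l)) \<ge> 0" using gapprod_pos activeD by (simp add: less_imp_le)
qed simp_all

lemma summand_zero_nonneg: "k \<ge> 1 \<Longrightarrow> summand_zero k m n A \<ge> 0"
  unfolding summand_zero_def
proof (intro mult_nonneg_nonneg gcoef_nonneg prod_nonneg ballI)
  fix l assume l: "l \<in> {1..m}"
  show "elfac n A l \<ge> 0"
  proof (cases "A l = {}")
    case False
    then have "gapprod (A l) > 0" using l activeD[of l] by (intro gapprod_pos) (auto simp: active_def)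
    then show ?thesis by (simp add: elfac_def cfac_nonneg)
  qed (simp add: elfac_def cfac_nonneg)
qed simp_all

end

text \<open>Additivity is applied to the measurable versions and carried back by almost sure
  equality.\<close>

lemma nn_integral_AE_sum:
  fixes F :: "'k \<Rightarrow> 'a \<Rightarrow> ennreal" and v :: "'k \<Rightarrow> real"
  assumes G: "\<And>A. A \<in> K \<Longrightarrow> \<exists>G\<in>borel_measurable M. (AE \<omega> in M. F A \<omega> = G \<omega>) \<and> (\<integral>\<^sup>+\<omega>. G \<omega> \<partial>M) = ennreal (v A)"
    and v: "\<And>A. A \<in> K \<Longrightarrow> v A \<ge> 0" and K: "finite K"
    and X: "AE \<omega> in M. X \<omega> = (\<Sum>A\<in>K. F A \<omega>)"
  shows "(\<integral>\<^sup>+\<omega>. X \<omega> \<partial>M) = ennreal (\<Sum>A\<in>K. v A)"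
proof -
  have "\<forall>A\<in>K. \<exists>G. G \<in> borel_measurable M \<and> (AE \<omega> in M. F A \<omega> = G \<omega>) \<and> (\<integral>\<^sup>+\<omega>. G \<omega> \<partial>M) = ennreal (v A)"
    using G by blast
  from bchoice[OF this] obtain H where H: "\<And>A. A \<in> K \<Longrightarrow> H A \<in> borel_measurable M" "\<And>A. A \<in> K \<Longrightarrow> AE \<omega> in M. F A \<omega> = H A \<omega>"
    "\<And>A. A \<in> K \<Longrightarrow> (\<integral>\<^sup>+\<omega>. H A \<omega> \<partial>M) = ennreal (v A)" by blast
  have "AE \<omega> in M. \<forall>A\<in>K. F A \<omega> = H A \<omega>" using K H(2) by (intro eventually_ball_finite) auto
  with X have "AE \<omega> in M. X \<omega> = (\<Sum>A\<in>K. H A \<omega>)" by eventually_elim simp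
  then have "(\<integral>\<^sup>+\<omega>. X \<omega> \<partial>M) = (\<integral>\<^sup>+\<omega>. (\<Sum>A\<in>K. H A \<omega>) \<partial>M)" by (rule nn_integral_cong_AE)
  also have "\<dots> = (\<Sum>A\<in>K. ennreal (v A))" using H(1,3) by (simp add: nn_integral_sum)
  finally show ?thesis using v by simp
qed

section \<open>Summation over all configurations\<close>

lemma finite_configs: "finite (configs m n k)"
proof -
  have "finite {X. X \<subseteq> walk_index m n \<and> card X = k}" using finite_walk_index by simp
  then show ?thesis using bij_betw_finite[OF config_index_bij[of m n k]] by simp
qed

lemma config_of_configs:
  assumes "A \<in> configs m n k"
  shows "config m n A" "card (config.J m A) = k"
proof -
  show c: "config m n A" using assms by unfold_locales (simp add: configs_def)
  have "{(l, i). l \<in> {1..m} \<and> i \<in> A l} \<in> {X. X \<subseteq> walk_index m n \<and> card X = k}"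
    by (rule bij_betw_apply[OF config_index_bij assms])
  then show "card (config.J m A) = k" by (simp add: config.J_def[OF c])
qed

lemma card_walk_index: "card (walk_index m n) = (\<Sum>l=1..m. n l)"
proof -
  have "walk_index m n = Sigma {1..m} (\<lambda>l. {1..n l})" by (auto simp: walk_index_def)
  then show ?thesis by simp
qed

lemma card_walk_index0: "card (walk_index0 m n) = card (walk_index m n) + 1"
proof -
  have "(0, 0) \<notin> walk_index m n" by (auto simp: walk_index_def)
  then show ?thesis by (simp add: walk_index0_def finite_walk_index)
qed

lemma config_points_bij:
  fixes \<omega> :: "nat \<times> nat \<Rightarrow> real^'d::finite"
  assumes g: "generic m n \<omega>" and card: "CARD('d) + 1 \<le> card (walk_index0 m n)"
  shows "bij_betw (config_points m \<omega>) (configs m n k) {S. S \<subseteq> case_prod (walk \<omega>) ` walk_index m n \<and> card S = k}"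
proof -
  have "inj_on (case_prod (walk \<omega>)) (walk_index m n)"
    using generic_inj_on[OF g card] by (rule inj_on_subset) (auto simp: walk_index0_def)
  from bij_betw_trans[OF config_index_bij image_subsets_bij[OF this]] show ?thesis
    by (simp add: o_def config_points_image[abs_def])
qed

lemma frontier_Qpoly:
  fixes \<omega> :: "nat \<times> nat \<Rightarrow> real^'d::finite"
  assumes d2: "CARD('d) \<ge> 2" and g: "generic m n \<omega>" and card: "CARD('d) + 1 \<le> card (walk_index m n)"
  shows "hausdorff_measure (real CARD('d) - 1) (frontier (Qpoly m n \<omega>)) = (\<Sum>A\<in>configs m n CARD('d).
    facet_area (config_points m \<omega> A) (Qpoly m n \<omega>))"
  unfolding Qpoly_eq
proof (rule hausdorff_measure_frontier[OF d2])
  have card0: "CARD('d) + 1 \<le> card (walk_index0 m n)" using card card_walk_index0[of m n] by simp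
  have sub: "walk_index m n \<subseteq> walk_index0 m n" by (auto simp: walk_index0_def)
  show "finite (case_prod (walk \<omega>) ` walk_index m n)" by (simp add: finite_walk_index)
  have "card (case_prod (walk \<omega>) ` walk_index m n) = card (walk_index m n)"
    by (rule card_image[OF inj_on_subset[OF generic_inj_on[OF g card0] sub]])
  then show "CARD('d) + 1 \<le> card (case_prod (walk \<omega>) ` walk_index m n)" using card by simp
  \<comment> \<open>Genericity gives general position for every choice of \<open>k0\<close>, so an
    arbitrary one is taken.\<close>
  show "general_position undefined (case_prod (walk \<omega>) ` walk_index m n)"
    by (rule generic_general_position[OF g card0 sub])
  show "bij_betw (config_points m \<omega>) (configs m n CARD('d)) {S. S \<subseteq> case_prod (walk \<omega>) ` walk_index m n \<and> card S = CARD('d)}"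
    by (rule config_points_bij[OF g card0])
qed

text \<open>A vertex set of d points either avoids the origin and is a configuration of size d, or
  contains it and leaves a configuration of size d - 1; the disjoint sum of the index sets records
  this.\<close>

lemma frontier_Qpoly0:
  fixes \<omega> :: "nat \<times> nat \<Rightarrow> real^'d::finite"
  assumes d2: "CARD('d) \<ge> 2" and g: "generic m n \<omega>" and card: "CARD('d) + 1 \<le> card (walk_index0 m n)"
  shows "hausdorff_measure (real CARD('d) - 1) (frontier (Qpoly0 m n \<omega>)) = (\<Sum>A\<in>configs m n CARD('d) <+> configs m n (CARD('d) - 1).
    let S = case_sum (config_points m \<omega>) (\<lambda>A. insert 0 (config_points m \<omega> A)) A in
    facet_area S (Qpoly0 m n \<omega>))"
  unfolding Qpoly0_eq Let_def
proof (rule hausdorff_measure_frontier[OF d2])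
  show "finite (case_prod (walk \<omega>) ` walk_index0 m n)" by (simp add: finite_walk_index0)
  have inj: "inj_on (case_prod (walk \<omega>)) (walk_index0 m n)" by (rule generic_inj_on[OF g card])
  show "CARD('d) + 1 \<le> card (case_prod (walk \<omega>) ` walk_index0 m n)" using card card_image[OF inj] by simp
  show "general_position undefined (case_prod (walk \<omega>) ` walk_index0 m n)"
    by (rule generic_general_position[OF g card order_refl])
  have T: "case_prod (walk \<omega>) ` walk_index0 m n = insert 0 (case_prod (walk \<omega>) ` walk_index m n)"
    by (simp add: walk_index0_def walk_0)
  have "(0, 0) \<notin> walk_index m n" by (auto simp: walk_index_def)
  then have "case_prod (walk \<omega>) (0, 0) \<notin> case_prod (walk \<omega>) ` walk_index m n"
    using inj by (subst inj_on_image_mem_iff[where B="walk_index0 m n"]) (auto simp: walk_index0_def)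
  then have z: "0 \<notin> case_prod (walk \<omega>) ` walk_index m n" by (simp add: walk_0)
  show "bij_betw (case_sum (config_points m \<omega>) (\<lambda>A. insert 0 (config_points m \<omega> A))) (configs m n CARD('d) <+> configs m n (CARD('d) - 1))
    {S. S \<subseteq> case_prod (walk \<omega>) ` walk_index0 m n \<and> card S = CARD('d)}"
    unfolding T using d2 finite_walk_index
    by (intro insert_subsets_bij[OF z _ _ config_points_bij[OF g card] config_points_bij[OF g card]]) auto
qed

text \<open>The bounds on \<open>N\<close> provide d + 1 points, the origin being one of them for
  \<open>Qpoly0\<close>; the hull is then almost surely full-dimensional and its frontier is the
  union of its facets.\<close>

theorem theorem4:
  fixes m :: nat and n :: "nat \<Rightarrow> nat"
  assumes d2: "CARD('d::finite) \<ge> 2"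
    and m1: "m \<ge> 1"
    and n1: "\<forall>l\<in>{1..m}. n l \<ge> 1"
  defines "M \<equiv> (walk_space m n :: ((nat \<times> nat) \<Rightarrow> real ^ 'd) measure)"
    and "d \<equiv> CARD('d)"
    and "N \<equiv> (\<Sum>l=1..m. n l)"
  shows
    "(d + 1 \<le> N \<longrightarrow>
        (\<integral>\<^sup>+ \<omega>. hausdorff_measure (real d - 1) (frontier (Qpoly m n \<omega>)) \<partial>M)
          = ennreal (\<Sum>A\<in>configs m n d. summand_facet d m n UNIV A)
      \<and> (\<forall>A\<in>configs m n d.
          (\<integral>\<^sup>+ \<omega>. (if convex hull (config_points m \<omega> A) facet_of Qpoly m n \<omega>
                    then hausdorff_measure (real d - 1) (convex hull (config_points m \<omega> A)) else 0) \<partial>M)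
          = ennreal (summand_facet d m n UNIV A)))
   \<and> (d \<le> N \<longrightarrow>
        (\<integral>\<^sup>+ \<omega>. hausdorff_measure (real d - 1) (frontier (Qpoly0 m n \<omega>)) \<partial>M)
          = ennreal ((\<Sum>A\<in>configs m n d. summand_facet d m n {0<..} A)
                     + (\<Sum>A\<in>configs m n (d - 1). summand_zero d m n A))
      \<and> (\<forall>A\<in>configs m n d.
          (\<integral>\<^sup>+ \<omega>. (if convex hull (config_points m \<omega> A) facet_of Qpoly0 m n \<omega>
                    then hausdorff_measure (real d - 1) (convex hull (config_points m \<omega> A)) else 0) \<partial>M)
          = ennreal (summand_facet d m n {0<..} A))
      \<and> (\<forall>A\<in>configs m n (d - 1).
          (\<integral>\<^sup>+ \<omega>. (if convex hull (insert 0 (config_points m \<omega> A)) facet_of Qpoly0 m n \<omega>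
                    then hausdorff_measure (real d - 1) (convex hull (insert 0 (config_points m \<omega> A))) else 0) \<partial>M)
          = ennreal (summand_zero d m n A)))"
proof -
  have M: "M = gaussians (walk_index m n)" by (simp add: M_def walk_space_def std_gauss_eq)
  have NI: "N = card (walk_index m n)" by (simp only: N_def card_walk_index)
  have d: "d \<ge> 1" using d2 by (simp add: d_def)
  let ?V = "\<lambda>Q S. if convex hull S facet_of Q then hausdorff_measure (real d - 1) (convex hull S) else 0"
  have exp1: "(\<integral>\<^sup>+\<omega>. F \<omega> \<partial>M) = ennreal v" if "\<exists>G\<in>borel_measurable M. (AE \<omega> in M. F \<omega> = G \<omega>) \<and> (\<integral>\<^sup>+\<omega>. G \<omega> \<partial>M) = ennreal v"
    for F v using that nn_integral_cong_AE[of F _ M] by metis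
  have gen: "AE \<omega> in M. generic m n \<omega>" unfolding M by (rule AE_generic)
  have facet: "\<exists>G\<in>borel_measurable M. (AE \<omega> in M. ?V (Qpoly m n \<omega>) (config_points m \<omega> A) = G \<omega>) \<and> (\<integral>\<^sup>+\<omega>. G \<omega> \<partial>M) = ennreal (summand_facet d m n UNIV A)"
    "summand_facet d m n UNIV A \<ge> 0" if A: "A \<in> configs m n d" and N: "d + 1 \<le> N" for A
  proof -
    interpret config m n A by (rule config_of_configs(1)[OF A])
    show "summand_facet d m n UNIV A \<ge> 0" by (rule summand_facet_nonneg[OF d])
    show "\<exists>G\<in>borel_measurable M. (AE \<omega> in M. ?V (Qpoly m n \<omega>) (config_points m \<omega> A) = G \<omega>) \<and> (\<integral>\<^sup>+\<omega>. G \<omega> \<partial>M) = ennreal (summand_facet d m n UNIV A)"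
      unfolding M Qpoly_eq d_def
      by (rule facet_expectation[OF d2]) (use config_of_configs(2)[OF A] N in \<open>simp_all add: d_def NI\<close>)
  qed
  have facet0: "\<exists>G\<in>borel_measurable M. (AE \<omega> in M. ?V (Qpoly0 m n \<omega>) (config_points m \<omega> A) = G \<omega>) \<and> (\<integral>\<^sup>+\<omega>. G \<omega> \<partial>M) = ennreal (summand_facet d m n {0<..} A)"
    "summand_facet d m n {0<..} A \<ge> 0" if A: "A \<in> configs m n d" and N: "d \<le> N" for A
  proof -
    interpret config m n A by (rule config_of_configs(1)[OF A])
    show "summand_facet d m n {0<..} A \<ge> 0" by (rule summand_facet_nonneg[OF d])
    show "\<exists>G\<in>borel_measurable M. (AE \<omega> in M. ?V (Qpoly0 m n \<omega>) (config_points m \<omega> A) = G \<omega>) \<and> (\<integral>\<^sup>+\<omega>. G \<omega> \<partial>M) = ennreal (summand_facet d m n {0<..} A)"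
      unfolding M Qpoly0_eq d_def
      by (rule facet_expectation[OF d2]) (use config_of_configs(2)[OF A] N in \<open>simp_all add: d_def NI card_walk_index0\<close>)
  qed
  have zero: "\<exists>G\<in>borel_measurable M. (AE \<omega> in M. ?V (Qpoly0 m n \<omega>) (insert 0 (config_points m \<omega> A)) = G \<omega>) \<and> (\<integral>\<^sup>+\<omega>. G \<omega> \<partial>M) = ennreal (summand_zero d m n A)"
    "summand_zero d m n A \<ge> 0" if A: "A \<in> configs m n (d - 1)" and N: "d \<le> N" for A
  proof -
    interpret config m n A by (rule config_of_configs(1)[OF A])
    show "summand_zero d m n A \<ge> 0" by (rule summand_zero_nonneg[OF d])
    show "\<exists>G\<in>borel_measurable M. (AE \<omega> in M. ?V (Qpoly0 m n \<omega>) (insert 0 (config_points m \<omega> A)) = G \<omega>) \<and> (\<integral>\<^sup>+\<omega>. G \<omega> \<partial>M) = ennreal (summand_zero d m n A)"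
      unfolding M Qpoly0_eq d_def
      by (rule zero_facet_expectation[OF d2]) (use config_of_configs(2)[OF A] N in \<open>simp_all add: d_def NI card_walk_index0\<close>)
  qed
  have total: "(\<integral>\<^sup>+ \<omega>. hausdorff_measure (real d - 1) (frontier (Qpoly m n \<omega>)) \<partial>M) = ennreal (\<Sum>A\<in>configs m n d. summand_facet d m n UNIV A)"
    if N: "d + 1 \<le> N"
  proof (rule nn_integral_AE_sum[where F="\<lambda>A \<omega>. ?V (Qpoly m n \<omega>) (config_points m \<omega> A)"])
    show "AE \<omega> in M. hausdorff_measure (real d - 1) (frontier (Qpoly m n \<omega>)) = (\<Sum>A\<in>configs m n d. ?V (Qpoly m n \<omega>) (config_points m \<omega> A))"
      using gen by eventually_elim (use N in \<open>simp only: d_def NI frontier_Qpoly[OF d2]\<close>)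
  qed (use facet N in \<open>auto intro: finite_configs\<close>)
  have total0: "(\<integral>\<^sup>+ \<omega>. hausdorff_measure (real d - 1) (frontier (Qpoly0 m n \<omega>)) \<partial>M)
    = ennreal ((\<Sum>A\<in>configs m n d. summand_facet d m n {0<..} A) + (\<Sum>A\<in>configs m n (d - 1). summand_zero d m n A))"
    if N: "d \<le> N"
  proof -
    let ?S = "\<lambda>\<omega>. case_sum (config_points m \<omega>) (\<lambda>A. insert 0 (config_points m \<omega> A))"
    let ?v = "case_sum (summand_facet d m n {0<..}) (summand_zero d m n)"
    have "(\<integral>\<^sup>+ \<omega>. hausdorff_measure (real d - 1) (frontier (Qpoly0 m n \<omega>)) \<partial>M) = ennreal (\<Sum>A\<in>configs m n d <+> configs m n (d - 1). ?v A)"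
    proof (rule nn_integral_AE_sum[where F="\<lambda>A \<omega>. ?V (Qpoly0 m n \<omega>) (?S \<omega> A)"])
      have c: "CARD('d) + 1 \<le> card (walk_index0 m n)" using N by (simp add: d_def NI card_walk_index0)
      show "AE \<omega> in M. hausdorff_measure (real d - 1) (frontier (Qpoly0 m n \<omega>)) = (\<Sum>A\<in>configs m n d <+> configs m n (d - 1). ?V (Qpoly0 m n \<omega>) (?S \<omega> A))"
        using gen by eventually_elim (simp only: d_def frontier_Qpoly0[OF d2 _ c] Let_def)
      show "finite (configs m n d <+> configs m n (d - 1))" by (simp add: finite_configs)
      fix A assume A: "A \<in> configs m n d <+> configs m n (d - 1)"
      show "?v A \<ge> 0" using A facet0(2) zero(2) N by auto
      show "\<exists>G\<in>borel_measurable M. (AE \<omega> in M. ?V (Qpoly0 m n \<omega>) (?S \<omega> A) = G \<omega>) \<and> (\<integral>\<^sup>+\<omega>. G \<omega> \<partial>M) = ennreal (?v A)"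
        using A
      proof (rule PlusE)
        fix B assume "B \<in> configs m n d" "A = Inl B"
        then show ?thesis using facet0(1)[of B] N by (simp only: sum.case)
      next
        fix B assume "B \<in> configs m n (d - 1)" "A = Inr B"
        then show ?thesis using zero(1)[of B] N by (simp only: sum.case)
      qed
    qed
    also have "(\<Sum>A\<in>configs m n d <+> configs m n (d - 1). ?v A) =
      (\<Sum>A\<in>configs m n d. summand_facet d m n {0<..} A) + (\<Sum>A\<in>configs m n (d - 1). summand_zero d m n A)"
      by (simp only: sum.Plus[OF finite_configs finite_configs] o_def sum.case)
    finally show ?thesis .
  qed
  show ?thesis
    by (intro conjI impI ballI total total0 exp1 facet(1) facet0(1) zero(1))
qed

end
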